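(* Assume there are $0<\delta\le1$, $\rho>\max\{(\delta^2+4\delta)/(2+2\delta),\,1\}$ and a constant $C$ such that $\mathbb{E}(|Y_1|^{2+\delta})<\infty$ and $\alpha_Y(k)\le Ck^{-\rho(2+\delta)(1+\delta)/\delta^2}$ for all $k\in\mathbb{N}$. Denote $\ell_n=n^s$ and $\tilde\ell_n=n^q$. (1) Let $\mu$ be a constant mean function and let $\mathbb{E}(|Y_1|^{4+2\delta})<\infty$. Assume $s>0.5$, $q<s$ and $$q>(1-s)\cdot\max\left\{\delta^{-1}\frac{\rho+1}{\rho-1},\ 1+\frac{\delta^2}{\rho(1+\delta)(2+\delta)}\right\}.$$ Then $\sqrt{b_n}\,(\hat\kappa(n)-\kappa_Y)\to0$ in probability as $n\to\infty$. (2) Let $\mu$ be a piecewise Lipschitz-continuous mean function. Assume $q<2/3$ and let either $\mathbb{E}(|Y_1|^{4+2\delta})<\infty$ or $\rho>\frac{\delta(8+\delta)}{(2+\delta)(1+\delta)}$. Then $\hat\kappa(n)-\kappa_Y\to0$ in probability as $n\to\infty$.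
   Context: $(Y_i)_{i\in\mathbb{N}}$ is a strictly stationary real-valued process with $\mathbb{E}(Y_1)=0$, $\mathrm{Var}(Y_1)=1$. For $\sigma$-fields $\mathcal{A},\mathcal{B}$ let $\alpha(\mathcal{A},\mathcal{B})=\sup\{|\mathbb{P}(A)\mathbb{P}(B)-\mathbb{P}(A\cap B)|:A\in\mathcal{A},B\in\mathcal{B}\}$ and $\alpha_Y(k)=\sup_{m\in\mathbb{N}}\alpha(\sigma(Y_1,\dots,Y_m),\sigma(Y_{k+m},Y_{k+m+1},\dots))$; $(Y_i)$ is $\alpha$-mixing, i.e. $\alpha_Y(k)\to0$. The long run variance $\kappa_Y^2=\mathrm{Var}(Y_1)+2\sum_{k=1}^\infty\mathrm{Cov}(Y_1,Y_{k+1})$ (finite under the moment and mixing assumptions made) satisfies $\kappa_Y^2>0$, and $\kappa_Y>0$ is its square root. A function on $[0,1]$ is piecewise Lipschitz-continuous if it is the sum of a Lipschitz-continuous function and a piecewise constant function with a fixed finite number of jumps. Observations: $X_i=X_{i,n}=\mu(i/n)+\sigma(i/n)Y_i$, $i=1,\dots,n$, where $\mu:[0,1]\to\mathbb{R}$ is càdlàg and $\sigma:[0,1]\to(0,\infty)$ is càdlàg and piecewise Lipschitz-continuous with $\sigma(x)\ge\sigma_0$ for all $x\in[0,1]$ and some $\sigma_0>0$. Blocks: $\ell_n=n^s$, $b_n=n^{1-s}$ with $s\in(0.5,1)$, both assumed to be integers; local means $\hat\mu_j=\frac1{\ell_n}\sum_{i=(j-1)\ell_n+1}^{j\ell_n}X_i$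 and local variances $\hat\sigma_{j,n}^2=\frac1{\ell_n}\sum_{i=(j-1)\ell_n+1}^{j\ell_n}(X_i-\hat\mu_j)^2$, $1\le j\le b_n$. Long run variance estimator: let $\tilde\ell_n=n^q$, $\tilde b_n=n^{1-q}$ with $q\in(0,1)$, both assumed to be integers, let $c_0\in[1,\tilde b_n)$ be a fixed constant and $$\hat\kappa_{\tilde X}(n)=\sqrt{\tfrac{2c_0}{1+2c_0}}\,\frac1{\tilde b_n}\sqrt{\tfrac\pi2}\sum_{j=1}^{\tilde b_n}\frac1{\sqrt{\tilde\ell_n}}\left|\sum_{i=(j-1)\tilde\ell_n+1}^{j\tilde\ell_n}X_i-\frac1{2c_0}\left(\sum_{i=(j-1-c_0)\tilde\ell_n+1}^{(j-1)\tilde\ell_n}X_i+\sum_{i=j\tilde\ell_n+1}^{(j+c_0)\tilde\ell_n}X_i\right)\right|,$$ where $X_i:=0$ for $i\notin\{1,\dots,n\}$ and in the affected (boundary) blocks the weight $\frac1{2c_0}$ is adjusted accordingly (replaced by $\tilde\ell_n$ divided by the number of indices $i\in\{1,\dots,n\}$ in the two surrounding sums). Finally $$\hat\kappa(n)=\frac{\hat\kappa_{\tilde X}(n)}{\frac1{b_n}\sum_{j=1}^{b_n}\hat\sigma_{j,n}} .$$ *)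

theory Defs
  imports "HOL-Probability.Probability"
begin

(* Indices in the natural numbers 1, 2, 3, ...: for a process Y :: nat => 'a => real
   the value Y 0 is never used. *)

definition strictly_stationary :: "'a measure \<Rightarrow> (nat \<Rightarrow> 'a \<Rightarrow> real) \<Rightarrow> bool" where
  "strictly_stationary M Y \<longleftrightarrow>
     (\<forall>i\<ge>1. Y i \<in> borel_measurable M) \<and>
     (\<forall>I h. finite I \<and> I \<subseteq> {1..} \<longrightarrow>
        distr M (\<Pi>\<^sub>M i\<in>I. borel) (\<lambda>\<omega>. \<lambda>i\<in>I. Y (i + h) \<omega>) =
        distr M (\<Pi>\<^sub>M i\<in>I. borel) (\<lambda>\<omega>. \<lambda>i\<in>I. Y i \<omega>))"

definition covariance :: "'a measure \<Rightarrow> ('a \<Rightarrow> real) \<Rightarrow> ('a \<Rightarrow> real) \<Rightarrow> real" where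
  "covariance M U V =
     (\<integral>\<omega>. (U \<omega> - (\<integral>\<omega>'. U \<omega>' \<partial>M)) * (V \<omega> - (\<integral>\<omega>'. V \<omega>' \<partial>M)) \<partial>M)"

definition long_run_variance :: "'a measure \<Rightarrow> (nat \<Rightarrow> 'a \<Rightarrow> real) \<Rightarrow> real" where
  "long_run_variance M Y =
     prob_space.variance M (Y 1) + 2 * (\<Sum>k. covariance M (Y 1) (Y (Suc k + 1)))"

definition sigma_gen :: "'a measure \<Rightarrow> (nat \<Rightarrow> 'a \<Rightarrow> real) \<Rightarrow> nat set \<Rightarrow> 'a set set" where
  "sigma_gen M Y I =
     sigma_sets (space M) (\<Union>i\<in>I. {Y i -` B \<inter> space M | B. B \<in> sets borel})"

definition alpha_coeff :: "'a measure \<Rightarrow> 'a set set \<Rightarrow> 'a set set \<Rightarrow> real" where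
  "alpha_coeff M \<A> \<B> =
     (SUP (A, B)\<in>\<A> \<times> \<B>. \<bar>measure M A * measure M B - measure M (A \<inter> B)\<bar>)"

definition alpha_mix :: "'a measure \<Rightarrow> (nat \<Rightarrow> 'a \<Rightarrow> real) \<Rightarrow> nat \<Rightarrow> real" where
  "alpha_mix M Y k =
     (SUP m\<in>{1..}. alpha_coeff M (sigma_gen M Y {1..m}) (sigma_gen M Y {k + m..}))"

(* F is a filter on the sample size n; see admissible below. *)
definition tendsto_in_prob ::
    "'a measure \<Rightarrow> (nat \<Rightarrow> 'a \<Rightarrow> real) \<Rightarrow> real \<Rightarrow> nat filter \<Rightarrow> bool" where
  "tendsto_in_prob M Z c F \<longleftrightarrow>
     (\<forall>\<epsilon>>0. ((\<lambda>n. measure M {\<omega> \<in> space M. \<bar>Z n \<omega> - c\<bar> > \<epsilon>}) \<longlongrightarrow> 0) F)"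


definition cadlag01 :: "(real \<Rightarrow> real) \<Rightarrow> bool" where
  "cadlag01 f \<longleftrightarrow>
     (\<forall>x\<in>{0..<1}. (f \<longlongrightarrow> f x) (at_right x)) \<and>
     (\<forall>x\<in>{0<..1}. \<exists>l. (f \<longlongrightarrow> l) (at_left x))"

(* f is constant on each of the finitely many open subintervals between consecutive points
   of J; its values at the points of J are arbitrary. *)
definition piecewise_constant01 :: "(real \<Rightarrow> real) \<Rightarrow> bool" where
  "piecewise_constant01 f \<longleftrightarrow>
     (\<exists>J. finite J \<and>
        (\<forall>x\<in>{0..1}. \<forall>y\<in>{0..1}. x \<le> y \<and> {x..y} \<inter> J = {} \<longrightarrow> f x = f y))"

definition piecewise_lipschitz01 :: "(real \<Rightarrow> real) \<Rightarrow> bool" where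
  "piecewise_lipschitz01 f \<longleftrightarrow>
     (\<exists>g h L. L-lipschitz_on {0..1} g \<and> piecewise_constant01 h \<and>
        (\<forall>x\<in>{0..1}. f x = g x + h x))"


(* The power n^a for those n for which it is an integer; only such n matter below. *)
definition npow :: "nat \<Rightarrow> real \<Rightarrow> nat" where
  "npow n a = nat \<lfloor>real n powr a\<rfloor>"

(* The sample sizes for which the block lengths n^s, n^q and the numbers of blocks n^(1-s),
   n^(1-q) are integers, c0 is less than n^(1-q), and the summation limits
   (j - 1 - c0) n^q and (j + c0) n^q are integers. For no s and q in (0, 1) does
   every n qualify, so limits n -> infinity are taken along this set; it is infinite for
   rational s, q and an integer c0 (admissible_infinite). *)
definition admissible :: "real \<Rightarrow> real \<Rightarrow> real \<Rightarrow> nat set" where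
  "admissible s q c0 =
     {n. n \<ge> 1 \<and> real n powr s \<in> \<nat> \<and> real n powr (1 - s) \<in> \<nat> \<and>
         real n powr q \<in> \<nat> \<and> real n powr (1 - q) \<in> \<nat> \<and>
         c0 < real n powr (1 - q) \<and> c0 * real n powr q \<in> \<nat>}"

abbreviation admissible_at_top :: "real \<Rightarrow> real \<Rightarrow> real \<Rightarrow> nat filter" where
  "admissible_at_top s q c0 \<equiv> inf sequentially (principal (admissible s q c0))"

definition block :: "nat \<Rightarrow> nat \<Rightarrow> nat set" where
  "block l j = {(j - 1) * l + 1..j * l}"

definition local_mean :: "nat \<Rightarrow> (nat \<Rightarrow> real) \<Rightarrow> nat \<Rightarrow> real" where
  "local_mean l x j = 1 / real l * (\<Sum>i\<in>block l j. x i)"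

definition local_variance :: "nat \<Rightarrow> (nat \<Rightarrow> real) \<Rightarrow> nat \<Rightarrow> real" where
  "local_variance l x j = 1 / real l * (\<Sum>i\<in>block l j. (x i - local_mean l x j)\<^sup>2)"

(* The observed indices in the c0 blocks of length l before and the c0 blocks after block j;
   as x i := 0 for i outside {1..n}, the other indices do not contribute to the sums. *)
definition surrounding :: "nat \<Rightarrow> real \<Rightarrow> nat \<Rightarrow> nat \<Rightarrow> nat set" where
  "surrounding n c0 l j =
     {i \<in> {1..n}. (real j - 1 - c0) * real l + 1 \<le> real i \<and> real i \<le> (real j - 1) * real l} \<union>
     {i \<in> {1..n}. real j * real l + 1 \<le> real i \<and> real i \<le> (real j + c0) * real l}"

(* The second case is that of the boundary blocks. *)
definition surrounding_weight :: "nat \<Rightarrow> real \<Rightarrow> nat \<Rightarrow> nat \<Rightarrow> real" where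
  "surrounding_weight n c0 l j =
     (if 0 \<le> (real j - 1 - c0) * real l \<and> (real j + c0) * real l \<le> real n
      then 1 / (2 * c0)
      else real l / real (card (surrounding n c0 l j)))"

(* l and b are the block length n^q and the number n^(1-q) of blocks. *)
definition kappa_hat_X :: "nat \<Rightarrow> real \<Rightarrow> nat \<Rightarrow> nat \<Rightarrow> (nat \<Rightarrow> real) \<Rightarrow> real" where
  "kappa_hat_X n c0 l b x =
     sqrt (2 * c0 / (1 + 2 * c0)) * (1 / real b) * sqrt (pi / 2) *
     (\<Sum>j=1..b. 1 / sqrt (real l) *
        \<bar>(\<Sum>i\<in>block l j. x i) -
          surrounding_weight n c0 l j * (\<Sum>i\<in>surrounding n c0 l j. x i)\<bar>)"

definition kappa_hat :: "real \<Rightarrow> real \<Rightarrow> real \<Rightarrow> nat \<Rightarrow> (nat \<Rightarrow> real) \<Rightarrow> real" where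
  "kappa_hat s q c0 n x =
     kappa_hat_X n c0 (npow n q) (npow n (1 - q)) x /
     (1 / real (npow n (1 - s)) *
        (\<Sum>j=1..npow n (1 - s). sqrt (local_variance (npow n s) x j)))"

definition observation ::
    "(real \<Rightarrow> real) \<Rightarrow> (real \<Rightarrow> real) \<Rightarrow> (nat \<Rightarrow> 'a \<Rightarrow> real) \<Rightarrow> nat \<Rightarrow> 'a \<Rightarrow> nat \<Rightarrow> real" where
  "observation \<mu> \<sigma> Y n \<omega> i = \<mu> (real i / real n) + \<sigma> (real i / real n) * Y i \<omega>"


lemma powr_rat:
  assumes r: "0 < r" "r = real a / real b" and b: "b > 0" and d: "d > 0" and m: "m \<ge> 1"
  shows "real (m ^ (b * d)) powr r \<in> \<nat>" and "real m \<le> real (m ^ (b * d)) powr r"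
proof -
  have "real (m ^ (b * d)) = real m powr real (b * d)"
    using m by (subst powr_realpow) auto
  then have "real (m ^ (b * d)) powr r = real m powr (real (b * d) * r)"
    by (simp only: powr_powr)
  also have "real (b * d) * r = real (a * d)"
    using r b by (simp add: field_simps)
  also have "real m powr real (a * d) = real (m ^ (a * d))"
    using m by (subst powr_realpow) auto
  finally have eq: "real (m ^ (b * d)) powr r = real (m ^ (a * d))" .
  show "real (m ^ (b * d)) powr r \<in> \<nat>"
    unfolding eq by (rule of_nat_in_Nats)
  have "a > 0"
    using r by (cases a) auto
  then have "m \<le> m ^ (a * d)"
    using m d by (intro self_le_power) auto
  then show "real m \<le> real (m ^ (b * d)) powr r"
    unfolding eq by (simp only: of_nat_le_iff)
qed

lemma admissible_infinite:
  assumes "s \<in> \<rat>" "q \<in> \<rat>" "0 < s" "s < 1" "0 < q" "q < 1" "c0 \<in> \<nat>"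
  shows "infinite (admissible s q c0)"
  unfolding infinite_nat_iff_unbounded_le
proof
  fix K :: nat
  have rat: "\<exists>a b::nat. b > 0 \<and> x = real a / real b" if "x \<in> \<rat>" "x > 0" for x :: real
    using Rats_abs_nat_div_natE[OF that(1)] that(2) by (metis abs_of_pos gr0I)
  obtain a b where s: "b > 0" "s = real a / real b"
    using rat assms by blast
  obtain c d where q: "d > 0" "q = real c / real d"
    using rat assms by blast
  have "real a < real b"
    using s(1) \<open>s < 1\<close> unfolding s(2) by (simp add: divide_less_eq)
  moreover have "real c < real d"
    using q(1) \<open>q < 1\<close> unfolding q(2) by (simp add: divide_less_eq)
  ultimately have "a \<le> b" "c \<le> d"
    by auto
  then have s': "1 - s = real (b - a) / real b" and q': "1 - q = real (d - c) / real d"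
    using s q by (auto simp: field_simps of_nat_diff)
  obtain k where k: "c0 = real k"
    using assms(7) by (auto elim: Nats_cases)
  define m where "m = max K (Suc k)"
  define n where "n = m ^ (b * d)"
  have m: "m \<ge> 1" "K \<le> m" "c0 < real m"
    by (auto simp: m_def k)
  have "real n powr s \<in> \<nat>" "real n powr (1 - s) \<in> \<nat>"
    using powr_rat(1)[OF _ s(2,1) q(1) m(1)] powr_rat(1)[OF _ s' s(1) q(1) m(1)] assms
    by (auto simp: n_def)
  moreover have "real n powr q \<in> \<nat>" "real n powr (1 - q) \<in> \<nat>" "real m \<le> real n powr (1 - q)"
    using powr_rat[OF _ q(2,1) s(1) m(1)] powr_rat[OF _ q' q(1) s(1) m(1)] assms
    by (auto simp: n_def mult.commute)
  moreover have "m \<le> n"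
    unfolding n_def using m s q by (intro self_le_power) auto
  ultimately show "\<exists>n\<ge>K. n \<in> admissible s q c0"
    using m assms(7) by (intro exI[of _ n]) (auto simp: admissible_def intro: Nats_mult)
qed

end

theory Submission
  imports Defs "HOL-Real_Asymp.Real_Asymp"
begin

text \<open>The first absolute moment of a window sum of length \<open>N\<close> is compared with that of a normal
  variable by Lindeberg's replacement method: \<open>E |x + sqrt s * N|\<close> is an explicit function of \<open>x\<close> and
  \<open>s\<close> that solves the heat equation, and when the summands are replaced one at a time the first and
  second order terms are controlled by covariance inequalities across gaps. The remaining variance
  \<open>s\<close> keeps the derivatives small, so the total error is of order \<open>ln N\<close>, that is \<open>ln N / sqrt N\<close>
  after normalisation. When only \<open>2 + \<delta>\<close> moments are available, truncation gives the same
  conclusion without a rate.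

  Along the grid \<open>\<mu>\<close> and \<open>\<sigma>\<close> have bounded variation, so the sum over all blocks of their
  oscillations stays bounded, jumps included. Hence the numerator of the estimator is close in
  mean to \<open>\<kappa>\<close> times the Riemann sum of \<open>\<sigma>\<close>, and the denominator to that same Riemann sum. The
  two are compared with each other directly, so no convergence rate of the Riemann sum to the
  integral enters.\<close>

section \<open>Covariances of strongly mixing variables\<close>

text \<open>Replacing one summand of a dependent sum does not make the first order term vanish: the
  summand is correlated with the derivative at the past, and expanding that derivative once more
  along the window produces the lagged covariances of the long run variance. The remainders are
  covariances of three factors. These cost \<open>3 / p\<close> in the exponent of Davydov's
  inequality, and their double sum over two gaps converges when the decay
  \<open>\<theta> * (1 - 3 / p)\<close> exceeds 2. Moments of order \<open>4 + 2 * \<delta>\<close>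
  give this directly; for a bounded truncation \<open>p = 6\<close> works because
  \<open>\<theta> > 6\<close>. The window estimate concerns expectations only. The average of
  absolute window sums over the blocks is compared with its mean separately; there only second
  moments are at hand, so the sums are clipped before mixing is used. With \<open>sqrt b_n\<close>
  in front, the window error vanishes for \<open>q > 1 - s\<close>. A varying mean adds
  \<open>sqrt (n powr q) / n powr (1 - q)\<close>, the origin of the bound
  \<open>2 / 3\<close>.\<close>

lemma integrable_dominated:
  fixes f g :: "'a \<Rightarrow> real"
  assumes "f \<in> borel_measurable M" "integrable M g" "\<And>\<omega>. \<omega> \<in> space M \<Longrightarrow> \<bar>f \<omega>\<bar> \<le> g \<omega>"
  shows "integrable M f"
proof (rule Bochner_Integration.integrable_bound[OF assms(2,1)], rule AE_I2)
  fix \<omega> assume "\<omega> \<in> space M"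
  then show "norm (f \<omega>) \<le> norm (g \<omega>)" using assms(3)[of \<omega>] by simp
qed

lemma (in prob_space) integrable_unit:
  fixes f :: "'a \<Rightarrow> real"
  assumes "f \<in> borel_measurable M" "\<And>\<omega>. \<omega> \<in> space M \<Longrightarrow> 0 \<le> f \<omega>" "\<And>\<omega>. \<omega> \<in> space M \<Longrightarrow> f \<omega> \<le> 1"
  shows "integrable M f"
  using assms by (intro integrable_const_bound[where B=1]) (auto intro!: AE_I2 simp: abs_le_iff order_trans[of _ "0::real"])

text \<open>A function with values in [0, 1] is within \<open>1 / N\<close> of the average of its
  \<open>N\<close> level indicators. The covariance of two such staircases is the average of
  \<open>N * N\<close> event covariances, so the event bound \<open>x\<close> passes to functions
  without loss of a constant.\<close>

lemma (in prob_space) cov_unit_le: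
  assumes U: "U \<in> borel_measurable F" and V: "V \<in> borel_measurable G"
    and F: "subalgebra M F" and G: "subalgebra M G"
    and x: "\<And>A B. A \<in> sets F \<Longrightarrow> B \<in> sets G \<Longrightarrow> \<bar>prob (A \<inter> B) - prob A * prob B\<bar> \<le> x"
    and U01: "\<And>\<omega>. \<omega> \<in> space M \<Longrightarrow> 0 \<le> U \<omega> \<and> U \<omega> \<le> 1"
    and V01: "\<And>\<omega>. \<omega> \<in> space M \<Longrightarrow> 0 \<le> V \<omega> \<and> V \<omega> \<le> 1"
  shows "\<bar>expectation (\<lambda>\<omega>. U \<omega> * V \<omega>) - expectation U * expectation V\<bar> \<le> x"
proof (rule field_le_epsilon)
  fix e :: real assume "e > 0"
  \<comment> \<open>Replacing both functions changes the mean of the product and the product of the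
    means by at most \<open>2 / N\<close> each, hence the 4.\<close>
  then obtain N :: nat where N: "real N > 4 / e" "N > 0"
    by (metis gr0I of_nat_0 reals_Archimedean2 divide_pos_pos zero_less_numeral order_less_asym of_nat_0_less_iff order_less_trans)
  have U': "U \<in> borel_measurable M" and V': "V \<in> borel_measurable M"
    using U V F G measurable_from_subalg by blast+
  define A where "A k = {\<omega> \<in> space M. real k \<le> real N * U \<omega>}" for k :: nat
  define B where "B k = {\<omega> \<in> space M. real k \<le> real N * V \<omega>}" for k :: nat
  have A: "A k \<in> sets F" for k
  proof -
    have "{\<omega> \<in> space F. real k \<le> real N * U \<omega>} \<in> sets F" using U by measurable
    then show ?thesis using F by (simp add: A_def subalgebra_def)
  qed
  have B: "B k \<in> sets G" for k
  proof -
    have "{\<omega> \<in> space G. real k \<le> real N * V \<omega>} \<in> sets G" using V by measurable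
    then show ?thesis using G by (simp add: B_def subalgebra_def)
  qed
  have AM[measurable]: "A k \<in> sets M" "B k \<in> sets M" for k
    using A B F G by (auto simp: subalgebra_def)
  define Us where "Us \<omega> = (\<Sum>k=1..N. indicator (A k) \<omega>) / real N" for \<omega>
  define Vs where "Vs \<omega> = (\<Sum>k=1..N. indicator (B k) \<omega>) / real N" for \<omega>
  have key: "\<bar>(\<Sum>k=1..N. indicator {\<omega> \<in> space M. real k \<le> real N * W \<omega>} \<omega>) / real N - W \<omega>\<bar> \<le> 1 / real N
      \<and> 0 \<le> (\<Sum>k=1..N. indicator {\<omega> \<in> space M. real k \<le> real N * W \<omega>} \<omega>) / real N
      \<and> (\<Sum>k=1..N. indicator {\<omega> \<in> space M. real k \<le> real N * W \<omega>} \<omega>) / real N \<le> 1"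
    if w: "\<omega> \<in> space M" "0 \<le> W \<omega>" "W \<omega> \<le> 1" for W :: "'a \<Rightarrow> real" and \<omega>
  proof -
    \<comment> \<open>The levels \<open>k\<close> with \<open>k \<le> N * W\<close> are exactly
      \<open>1..m\<close>, so the staircase is \<open>m / N\<close>, the value rounded down to the
      grid.\<close>
    define m where "m = nat \<lfloor>real N * W \<omega>\<rfloor>"
    have m: "real m \<le> real N * W \<omega>" "real N * W \<omega> < real m + 1"
      using w by (auto simp: m_def)
    have "real m \<le> real N" using m(1) w mult_left_le[of "W \<omega>" "real N"] by linarith
    then have mN: "m \<le> N" by simp
    have "(\<Sum>k=1..N. indicator {\<omega> \<in> space M. real k \<le> real N * W \<omega>} \<omega>) = (\<Sum>k=1..N. if k \<le> m then 1 else (0::real))"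
    proof (rule sum.cong, simp)
      fix k assume "k \<in> {1..N}"
      have "real k \<le> real N * W \<omega> \<longleftrightarrow> k \<le> m"
      proof
        assume "real k \<le> real N * W \<omega>" then have "real k < real m + 1" using m by linarith
        then show "k \<le> m" by linarith
      next
        assume "k \<le> m" then show "real k \<le> real N * W \<omega>" using m by linarith
      qed
      then show "indicator {\<omega> \<in> space M. real k \<le> real N * W \<omega>} \<omega> = (if k \<le> m then 1 else (0::real))"
        using w by (simp add: indicator_def)
    qed
    also have "\<dots> = real (card {k \<in> {1..N}. k \<le> m})"
      by (simp add: sum.If_cases Int_def)
    also have "{k \<in> {1..N}. k \<le> m} = {1..m}" using mN by auto
    finally have s: "(\<Sum>k=1..N. indicator {\<omega> \<in> space M. real k \<le> real N * W \<omega>} \<omega>) = real m" by simp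
    have "W \<omega> - real m / real N = (real N * W \<omega> - real m) / real N" using N by (simp add: field_simps)
    moreover have "0 \<le> (real N * W \<omega> - real m) / real N" "(real N * W \<omega> - real m) / real N \<le> 1 / real N"
      using m N by (auto intro!: divide_right_mono divide_nonneg_nonneg)
    ultimately have "0 \<le> W \<omega> - real m / real N" "W \<omega> - real m / real N \<le> 1 / real N" by metis+
    then have "\<bar>real m / real N - W \<omega>\<bar> \<le> 1 / real N" unfolding abs_le_iff by linarith
    moreover have "real m / real N \<le> 1" using mN N by simp
    ultimately show ?thesis unfolding s by simp
  qed
  have Us: "\<bar>Us \<omega> - U \<omega>\<bar> \<le> 1 / real N" "0 \<le> Us \<omega>" "Us \<omega> \<le> 1" if "\<omega> \<in> space M" for \<omega>
    using key[of \<omega> U] U01 that by (auto simp: Us_def A_def)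
  have Vs: "\<bar>Vs \<omega> - V \<omega>\<bar> \<le> 1 / real N" "0 \<le> Vs \<omega>" "Vs \<omega> \<le> 1" if "\<omega> \<in> space M" for \<omega>
    using key[of \<omega> V] V01 that by (auto simp: Vs_def B_def)
  have [measurable]: "Us \<in> borel_measurable M" "Vs \<in> borel_measurable M"
    unfolding Us_def Vs_def by measurable
  note [measurable] = U' V'
  have iU: "integrable M U" "integrable M V" "integrable M Us" "integrable M Vs"
    using U01 V01 Us Vs by (auto intro!: integrable_unit)
  have iUV: "integrable M (\<lambda>\<omega>. U \<omega> * V \<omega>)" "integrable M (\<lambda>\<omega>. Us \<omega> * Vs \<omega>)"
    using U01 V01 Us Vs by (auto intro!: integrable_unit mult_le_one)
  have E1: "\<bar>expectation U - expectation Us\<bar> \<le> 1 / real N"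
  proof -
    have "\<bar>expectation U - expectation Us\<bar> = \<bar>expectation (\<lambda>\<omega>. U \<omega> - Us \<omega>)\<bar>" using iU by simp
    also have "\<dots> \<le> expectation (\<lambda>\<omega>. \<bar>U \<omega> - Us \<omega>\<bar>)" by (rule integral_abs_bound)
    also have "\<dots> \<le> expectation (\<lambda>\<omega>. 1 / real N)"
      using iU Us by (intro integral_mono) (auto simp: abs_minus_commute)
    finally show ?thesis by (simp add: prob_space)
  qed
  have E2: "\<bar>expectation V - expectation Vs\<bar> \<le> 1 / real N"
  proof -
    have "\<bar>expectation V - expectation Vs\<bar> = \<bar>expectation (\<lambda>\<omega>. V \<omega> - Vs \<omega>)\<bar>" using iU by simp
    also have "\<dots> \<le> expectation (\<lambda>\<omega>. \<bar>V \<omega> - Vs \<omega>\<bar>)" by (rule integral_abs_bound)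
    also have "\<dots> \<le> expectation (\<lambda>\<omega>. 1 / real N)"
      using iU Vs by (intro integral_mono) (auto simp: abs_minus_commute)
    finally show ?thesis by (simp add: prob_space)
  qed
  have pr: "\<bar>a * b - c * d\<bar> \<le> 2 / real N"
    if "\<bar>a - c\<bar> \<le> 1 / real N" "\<bar>b - d\<bar> \<le> 1 / real N" "0 \<le> b" "b \<le> 1" "0 \<le> c" "c \<le> 1" for a b c d :: real
  proof -
    have "a * b - c * d = (a - c) * b + c * (b - d)" by (simp add: algebra_simps)
    also have "\<bar>\<dots>\<bar> \<le> \<bar>a - c\<bar> * \<bar>b\<bar> + \<bar>c\<bar> * \<bar>b - d\<bar>" by (metis abs_mult abs_triangle_ineq)
    also have "\<dots> \<le> 1 / real N * 1 + 1 * (1 / real N)"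
      using that by (intro add_mono mult_mono) auto
    finally show ?thesis by simp
  qed
  have E3: "\<bar>expectation (\<lambda>\<omega>. U \<omega> * V \<omega>) - expectation (\<lambda>\<omega>. Us \<omega> * Vs \<omega>)\<bar> \<le> 2 / real N"
  proof -
    have "\<bar>expectation (\<lambda>\<omega>. U \<omega> * V \<omega>) - expectation (\<lambda>\<omega>. Us \<omega> * Vs \<omega>)\<bar> = \<bar>expectation (\<lambda>\<omega>. U \<omega> * V \<omega> - Us \<omega> * Vs \<omega>)\<bar>" using iUV by simp
    also have "\<dots> \<le> expectation (\<lambda>\<omega>. \<bar>U \<omega> * V \<omega> - Us \<omega> * Vs \<omega>\<bar>)" by (rule integral_abs_bound)
    also have "\<dots> \<le> expectation (\<lambda>\<omega>. 2 / real N)"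
      using iUV Us Vs U01 V01 by (intro integral_mono pr) (auto simp: abs_minus_commute)
    finally show ?thesis by (simp add: prob_space)
  qed
  have E4: "\<bar>expectation U * expectation V - expectation Us * expectation Vs\<bar> \<le> 2 / real N"
  proof (rule pr[OF E1 E2])
    show "0 \<le> expectation V" using V01 by (intro integral_nonneg_AE) auto
    show "0 \<le> expectation Us" using Us by (intro integral_nonneg_AE) auto
    have "expectation V \<le> expectation (\<lambda>_. 1)" using iU V01 by (intro integral_mono) auto
    then show "expectation V \<le> 1" by (simp add: prob_space)
    have "expectation Us \<le> expectation (\<lambda>_. 1)" using iU Us by (intro integral_mono) auto
    then show "expectation Us \<le> 1" by (simp add: prob_space)
  qed
  have ind: "integrable M (indicat_real S)" "expectation (indicat_real S) = prob S" if "S \<in> sets M" for S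
    using that by (auto intro!: integrable_unit)
  have eU: "expectation Us = (\<Sum>k=1..N. prob (A k)) / real N"
    unfolding Us_def using ind by (simp add: Bochner_Integration.integral_sum)
  have eV: "expectation Vs = (\<Sum>k=1..N. prob (B k)) / real N"
    unfolding Vs_def using ind by (simp add: Bochner_Integration.integral_sum)
  have eUV: "expectation (\<lambda>\<omega>. Us \<omega> * Vs \<omega>) = (\<Sum>k=1..N. \<Sum>j=1..N. prob (A k \<inter> B j)) / (real N * real N)"
  proof -
    have "Us \<omega> * Vs \<omega> = (\<Sum>k=1..N. \<Sum>j=1..N. indicator (A k \<inter> B j) \<omega>) / (real N * real N)" for \<omega>
      unfolding Us_def Vs_def by (simp add: sum_product indicator_inter_arith)
    then show ?thesis using ind by (simp add: Bochner_Integration.integral_sum)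
  qed
  have "expectation (\<lambda>\<omega>. Us \<omega> * Vs \<omega>) - expectation Us * expectation Vs
      = (\<Sum>k=1..N. \<Sum>j=1..N. prob (A k \<inter> B j) - prob (A k) * prob (B j)) / (real N * real N)"
    unfolding eU eV eUV by (simp add: sum_product sum_subtractf diff_divide_distrib)
  also have "\<bar>\<dots>\<bar> \<le> (\<Sum>k=1..N. \<Sum>j=1..N. x) / (real N * real N)"
    unfolding abs_divide using A B x
    by (intro divide_mono order_trans[OF sum_abs] sum_mono) (use N in auto)
  also have "\<dots> = x" using N by simp
  finally have E5: "\<bar>expectation (\<lambda>\<omega>. Us \<omega> * Vs \<omega>) - expectation Us * expectation Vs\<bar> \<le> x" .
  have "4 / real N < e" using N \<open>e > 0\<close> by (simp add: field_simps)
  then show "\<bar>expectation (\<lambda>\<omega>. U \<omega> * V \<omega>) - expectation U * expectation V\<bar> \<le> x + e"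
    using E3 E4 E5 by linarith
qed

text \<open>Covariances ignore shifts; mapping [-a, a] and [-b, b] onto [0, 1] divides by
  \<open>2 * a\<close> and \<open>2 * b\<close>, which is the factor 4.\<close>

lemma (in prob_space) cov_bounded_le:
  assumes U: "U \<in> borel_measurable F" and V: "V \<in> borel_measurable G"
    and F: "subalgebra M F" and G: "subalgebra M G"
    and x: "\<And>A B. A \<in> sets F \<Longrightarrow> B \<in> sets G \<Longrightarrow> \<bar>prob (A \<inter> B) - prob A * prob B\<bar> \<le> x"
    and Ua: "\<And>\<omega>. \<omega> \<in> space M \<Longrightarrow> \<bar>U \<omega>\<bar> \<le> a" and Vb: "\<And>\<omega>. \<omega> \<in> space M \<Longrightarrow> \<bar>V \<omega>\<bar> \<le> b"
    and ab: "a > 0" "b > 0"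
  shows "\<bar>expectation (\<lambda>\<omega>. U \<omega> * V \<omega>) - expectation U * expectation V\<bar> \<le> 4 * a * b * x"
proof -
  define U' where "U' \<omega> = (U \<omega> + a) / (2 * a)" for \<omega>
  define V' where "V' \<omega> = (V \<omega> + b) / (2 * b)" for \<omega>
  have [measurable]: "U \<in> borel_measurable M" "V \<in> borel_measurable M"
    using U V F G measurable_from_subalg by blast+
  have "\<bar>expectation (\<lambda>\<omega>. U' \<omega> * V' \<omega>) - expectation U' * expectation V'\<bar> \<le> x"
  proof (rule cov_unit_le[OF _ _ F G x])
    show "U' \<in> borel_measurable F" unfolding U'_def using U by measurable
    show "V' \<in> borel_measurable G" unfolding V'_def using V by measurable
    show "0 \<le> U' \<omega> \<and> U' \<omega> \<le> 1" if "\<omega> \<in> space M" for \<omega>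
      using Ua[OF that] ab unfolding U'_def by (auto simp: field_simps abs_le_iff)
    show "0 \<le> V' \<omega> \<and> V' \<omega> \<le> 1" if "\<omega> \<in> space M" for \<omega>
      using Vb[OF that] ab unfolding V'_def by (auto simp: field_simps abs_le_iff)
  qed auto
  moreover have i: "integrable M U" "integrable M V"
    using Ua Vb integrable_const_bound[of U a] integrable_const_bound[of V b] by (simp_all add: AE_I2)
  have i2: "integrable M (\<lambda>\<omega>. U \<omega> * V \<omega>)"
    using Ua Vb ab by (intro integrable_const_bound[where B="a*b"]) (auto simp: abs_mult intro!: AE_I2 mult_mono)
  have "expectation U' = (expectation U + a) / (2 * a)" "expectation V' = (expectation V + b) / (2 * b)"
    unfolding U'_def V'_def using i by (simp_all add: prob_space)
  moreover have "expectation (\<lambda>\<omega>. U' \<omega> * V' \<omega>) = (expectation (\<lambda>\<omega>. U \<omega> * V \<omega>) + a * expectation V + b * expectation U + a * b) / (4 * a * b)"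
  proof -
    have "expectation (\<lambda>\<omega>. U' \<omega> * V' \<omega>) = expectation (\<lambda>\<omega>. (U \<omega> * V \<omega> + a * V \<omega> + b * U \<omega> + a * b) / (4 * a * b))"
      unfolding U'_def V'_def using ab by (intro Bochner_Integration.integral_cong) (auto simp: field_simps)
    then show ?thesis using i i2 by (simp add: prob_space)
  qed
  ultimately have "\<bar>(expectation (\<lambda>\<omega>. U \<omega> * V \<omega>) + a * expectation V + b * expectation U + a * b) / (4 * a * b)
      - (expectation U + a) / (2 * a) * ((expectation V + b) / (2 * b))\<bar> \<le> x" by simp
  also have "(expectation (\<lambda>\<omega>. U \<omega> * V \<omega>) + a * expectation V + b * expectation U + a * b) / (4 * a * b)
      - (expectation U + a) / (2 * a) * ((expectation V + b) / (2 * b)) =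
      (expectation (\<lambda>\<omega>. U \<omega> * V \<omega>) - expectation U * expectation V) / (4 * a * b)"
    using ab by (simp add: field_simps)
  finally show ?thesis using ab by (simp add: abs_mult field_simps)
qed

text \<open>Let \<open>m\<close> be the larger of the two powers. Both factors are bounded by powers
  of \<open>m\<close> with total exponent \<open>t = 1/p + 1/r\<close>, so the product is at most
  \<open>m * m powr (t - 1)\<close>, and \<open>m > 1 / x\<close> as soon as one factor exceeds its
  threshold. This is the pointwise form of a Markov estimate at the thresholds where
  \<open>Davydov_inequality\<close> clips.\<close>

lemma powr_product_tail:
  fixes u v x p r :: real
  assumes "p > 0" "r > 0" "1/p + 1/r < 1" "0 < x" "u \<ge> 0" "v \<ge> 0"
    and "u > x powr (-1/p) \<or> v > x powr (-1/r)"
  shows "u * v \<le> (u powr p + v powr r) * x powr (1 - 1/p - 1/r)"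
proof -
  define m where "m = max (u powr p) (v powr r)"
  define t where "t = 1/p + 1/r"
  have u: "u \<le> m powr (1/p)"
  proof -
    have "u = (u powr p) powr (1/p)" using assms by (simp add: powr_powr)
    also have "\<dots> \<le> m powr (1/p)" using assms by (intro powr_mono2) (auto simp: m_def)
    finally show ?thesis .
  qed
  have v: "v \<le> m powr (1/r)"
  proof -
    have "v = (v powr r) powr (1/r)" using assms by (simp add: powr_powr)
    also have "\<dots> \<le> m powr (1/r)" using assms by (intro powr_mono2) (auto simp: m_def)
    finally show ?thesis .
  qed
  have m: "m > 1 / x"
    using assms(7)
  proof
    assume "u > x powr (-1/p)"
    then have "u powr p > (x powr (-1/p)) powr p" using assms by (intro powr_less_mono2) auto
    moreover have "(x powr (-1/p)) powr p = 1 / x" using assms by (simp only: powr_powr) (simp add: powr_minus_divide)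
    ultimately show ?thesis by (simp add: m_def)
  next
    assume "v > x powr (-1/r)"
    then have "v powr r > (x powr (-1/r)) powr r" using assms by (intro powr_less_mono2) auto
    moreover have "(x powr (-1/r)) powr r = 1 / x" using assms by (simp only: powr_powr) (simp add: powr_minus_divide)
    ultimately show ?thesis by (simp add: m_def)
  qed
  have m0: "m > 0" using m assms by (meson divide_pos_pos less_trans zero_less_one)
  have "u * v \<le> m powr (1/p) * m powr (1/r)" using u v assms by (intro mult_mono) auto
  also have "\<dots> = m * m powr (-(1 - t))" using m0 by (simp add: powr_add[symmetric] t_def powr_mult_base)
  also have "m powr (-(1-t)) \<le> (1/x) powr (-(1-t))"
    using m assms by (intro powr_mono2') (auto simp: t_def)
  also have "(1/x) powr (-(1-t)) = x powr (1 - t)"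
  proof -
    have "1 / x = x powr (-1)" using assms by (simp add: powr_minus_divide)
    then have "(1/x) powr (-(1-t)) = x powr ((-1) * (-(1-t)))" by (simp only: powr_powr)
    then show ?thesis by simp
  qed
  finally have "u * v \<le> m * x powr (1-t)" using m0 by simp
  also have "\<dots> \<le> (u powr p + v powr r) * x powr (1 - t)"
    by (intro mult_right_mono) (auto simp: m_def)
  finally show ?thesis by (simp add: t_def algebra_simps)
qed

text \<open>The one-variable companion. The exponent \<open>t\<close> may exceed \<open>1/p\<close>:
  as \<open>x \<le> 1\<close> this only weakens the bound, and it lets all clipping errors be stated
  with the same power of \<open>x\<close>.\<close>

lemma powr_tail:
  fixes u x p t :: real
  assumes "p > 0" "1/p \<le> t" "0 < x" "x \<le> 1" "u > x powr (-1/p)" "t \<le> 1"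
  shows "u \<le> u powr p * x powr (1 - t)"
proof -
  have u0: "u > 0" using assms by (smt (verit) powr_gt_zero)
  have "p * t \<ge> 1" using assms by (simp add: field_simps)
  have "x powr (1/p) * u \<ge> 1"
  proof -
    have "x powr (1/p) * x powr (-1/p) = 1" using assms by (simp add: powr_add[symmetric])
    then show ?thesis using assms by (metis less_eq_real_def mult_left_mono powr_ge_zero)
  qed
  have "1 \<le> u powr (p-1) * x powr (1-t)"
  proof -
    have p1: "p \<ge> 1" using assms by (smt (verit) divide_le_eq_1_pos)
    have "u powr (p-1) \<ge> (x powr (-1/p)) powr (p-1)"
      using p1 assms by (intro powr_mono2) auto
    then have "u powr (p-1) * x powr (1-t) \<ge> x powr ((-1/p) * (p-1)) * x powr (1-t)"
      by (intro mult_right_mono) (auto simp: powr_powr)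
    also have "x powr ((-1/p) * (p-1)) * x powr (1-t) = x powr (1/p - t)"
      using assms by (simp add: powr_add[symmetric] field_simps)
    also have "x powr (1/p - t) \<ge> 1" using assms
      by (smt (verit) powr_minus_divide powr_le1 le_divide_eq_1_pos powr_gt_zero)
    finally show ?thesis .
  qed
  then have "u * 1 \<le> u * (u powr (p-1) * x powr (1-t))" using u0 by (intro mult_left_mono) auto
  also have "\<dots> = u powr p * x powr (1-t)" using u0 by (simp add: powr_mult_base mult.assoc[symmetric])
  finally show ?thesis by simp
qed
lemma abs_le_one_plus_powr:
  assumes "(1::real) \<le> p" "u \<ge> 0" shows "u \<le> 1 + u powr p"
proof (cases "u \<le> 1")
  case True then show ?thesis by (smt (verit) powr_ge_zero)
next
  case False
  then have "u powr 1 \<le> u powr p" using assms by (intro powr_mono) auto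
  then show ?thesis using False by simp
qed

lemma (in prob_space) integrable_powr_less:
  fixes U :: "'a \<Rightarrow> real"
  assumes [measurable]: "U \<in> borel_measurable M" and "integrable M (\<lambda>\<omega>. \<bar>U \<omega>\<bar> powr p)" "1 \<le> p"
  shows "integrable M U"
proof (rule integrable_dominated)
  show "integrable M (\<lambda>\<omega>. 1 + \<bar>U \<omega>\<bar> powr p)" using assms(2) by simp
  show "\<bar>U \<omega>\<bar> \<le> 1 + \<bar>U \<omega>\<bar> powr p" for \<omega>
    using abs_le_one_plus_powr[OF assms(3)] by simp
qed (rule assms)

text \<open>At the levels \<open>a = x powr (-1/p)\<close> and \<open>b = x powr (-1/r)\<close> the
  bounded estimate \<open>4 * a * b * x\<close> and the tail contributions have the same order
  \<open>y\<close>. A common moment bound \<open>K\<close> replaces the usual product of norms; only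
  the power of \<open>x\<close> matters later. Integrability of the product belongs to the
  conclusion, since the moments of the factors have to provide it.\<close>

lemma (in prob_space) Davydov_inequality:
  assumes U: "U \<in> borel_measurable F" and V: "V \<in> borel_measurable G"
    and F: "subalgebra M F" and G: "subalgebra M G"
    and x: "\<And>A B. A \<in> sets F \<Longrightarrow> B \<in> sets G \<Longrightarrow> \<bar>prob (A \<inter> B) - prob A * prob B\<bar> \<le> x"
    and x01: "0 < x" "x \<le> 1"
    and iU: "integrable M (\<lambda>\<omega>. \<bar>U \<omega>\<bar> powr p)" and iV: "integrable M (\<lambda>\<omega>. \<bar>V \<omega>\<bar> powr r)"
    and KU: "expectation (\<lambda>\<omega>. \<bar>U \<omega>\<bar> powr p) \<le> K" and KV: "expectation (\<lambda>\<omega>. \<bar>V \<omega>\<bar> powr r) \<le> K"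
    and pr: "p \<ge> 1" "r \<ge> 1" "1/p + 1/r < 1"
  shows "\<bar>expectation (\<lambda>\<omega>. U \<omega> * V \<omega>) - expectation U * expectation V\<bar> \<le> 4 * (1 + K)\<^sup>2 * x powr (1 - 1/p - 1/r)"
    and "integrable M (\<lambda>\<omega>. U \<omega> * V \<omega>)"
proof -
  define y where "y = x powr (1 - 1/p - 1/r)"
  have y01: "0 < y" "y \<le> 1" using x01 pr by (auto simp: y_def intro!: powr_le1)
  have K0: "K \<ge> 0" by (rule order_trans[OF Bochner_Integration.integral_nonneg KU]) simp
  define a where "a = x powr (-1/p)"
  define b where "b = x powr (-1/r)"
  have ab: "a > 0" "b > 0" using x01 by (auto simp: a_def b_def)
  have abx: "a * b * x = y"
  proof -
    have "a * b * x = x powr (-1/p) * x powr (-1/r) * x powr 1" using x01 by (simp add: a_def b_def)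
    also have "\<dots> = y" unfolding powr_add[symmetric] y_def by (simp add: algebra_simps)
    finally show ?thesis .
  qed
  have [measurable]: "U \<in> borel_measurable M" "V \<in> borel_measurable M"
    using U V F G measurable_from_subalg by blast+
  define Uc where "Uc \<omega> = max (-a) (min a (U \<omega>))" for \<omega>
  define Vc where "Vc \<omega> = max (-b) (min b (V \<omega>))" for \<omega>
  have [measurable]: "Uc \<in> borel_measurable M" "Vc \<in> borel_measurable M"
    unfolding Uc_def Vc_def by measurable
  have bnd: "\<bar>Uc \<omega>\<bar> \<le> a" "\<bar>Vc \<omega>\<bar> \<le> b" for \<omega> using ab by (auto simp: Uc_def Vc_def)
  have c: "\<bar>expectation (\<lambda>\<omega>. Uc \<omega> * Vc \<omega>) - expectation Uc * expectation Vc\<bar> \<le> 4 * y"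
  proof -
    have "\<bar>expectation (\<lambda>\<omega>. Uc \<omega> * Vc \<omega>) - expectation Uc * expectation Vc\<bar> \<le> 4 * a * b * x"
    proof (rule cov_bounded_le[OF _ _ F G x])
      show "Uc \<in> borel_measurable F" unfolding Uc_def using U by measurable
      show "Vc \<in> borel_measurable G" unfolding Vc_def using V by measurable
    qed (use bnd ab in auto)
    then show ?thesis using abx by (simp add: mult.assoc)
  qed
  have d1: "\<bar>U \<omega> * V \<omega> - Uc \<omega> * Vc \<omega>\<bar> \<le> (\<bar>U \<omega>\<bar> powr p + \<bar>V \<omega>\<bar> powr r) * y" for \<omega>
  proof (cases "\<bar>U \<omega>\<bar> > a \<or> \<bar>V \<omega>\<bar> > b")
    case True
    \<comment> \<open>Clipping multiplies by a factor in [0, 1], so the clipped product is a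
      multiple in [0, 1] of the full one and their difference is at most the full product.\<close>
    have sg: "\<exists>l. 0 \<le> l \<and> l \<le> 1 \<and> max (-a) (min a u) = l * u" if "a > 0" for a u :: real
    proof (cases "\<bar>u\<bar> \<le> a")
      case True then show ?thesis by (intro exI[of _ 1]) auto
    next
      case False then show ?thesis using that by (intro exI[of _ "a / \<bar>u\<bar>"]) (auto simp: abs_if max_def min_def)
    qed
    obtain l k where lk: "0 \<le> l" "l \<le> 1" "Uc \<omega> = l * U \<omega>" "0 \<le> k" "k \<le> 1" "Vc \<omega> = k * V \<omega>"
      using sg[OF ab(1), of "U \<omega>"] sg[OF ab(2), of "V \<omega>"] unfolding Uc_def Vc_def by auto
    have "l * k \<le> 1" "0 \<le> l * k" using lk by (auto intro: mult_le_one)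
    then have "0 \<le> 1 - l * k" "1 - l * k \<le> 1" by auto
    have "U \<omega> * V \<omega> - Uc \<omega> * Vc \<omega> = (1 - l * k) * (U \<omega> * V \<omega>)" unfolding lk by (simp add: algebra_simps)
    then have "\<bar>U \<omega> * V \<omega> - Uc \<omega> * Vc \<omega>\<bar> = (1 - l * k) * \<bar>U \<omega> * V \<omega>\<bar>"
      using \<open>0 \<le> 1 - l * k\<close> by (simp add: abs_mult)
    also have "\<dots> \<le> 1 * \<bar>U \<omega> * V \<omega>\<bar>" using \<open>1 - l * k \<le> 1\<close> by (intro mult_right_mono) auto
    also have "\<dots> = \<bar>U \<omega>\<bar> * \<bar>V \<omega>\<bar>" by (simp add: abs_mult)
    also have "\<dots> \<le> (\<bar>U \<omega>\<bar> powr p + \<bar>V \<omega>\<bar> powr r) * y"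
      unfolding y_def using True pr x01 by (intro powr_product_tail) (auto simp: a_def b_def)
    finally show ?thesis .
  next
    case False
    then have "Uc \<omega> = U \<omega>" "Vc \<omega> = V \<omega>" by (auto simp: Uc_def Vc_def)
    then show ?thesis using y01 by simp
  qed
  have d2: "\<bar>U \<omega> - Uc \<omega>\<bar> \<le> \<bar>U \<omega>\<bar> powr p * y" for \<omega>
  proof (cases "\<bar>U \<omega>\<bar> > a")
    case True
    have "\<bar>U \<omega> - Uc \<omega>\<bar> \<le> \<bar>U \<omega>\<bar>" using ab by (auto simp: Uc_def)
    also have "\<dots> \<le> \<bar>U \<omega>\<bar> powr p * x powr (1 - (1/p + 1/r))"
      using True pr x01 by (intro powr_tail) (auto simp: a_def)
    finally show ?thesis by (simp add: y_def algebra_simps)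
  next
    case False then have "Uc \<omega> = U \<omega>" by (auto simp: Uc_def)
    then show ?thesis using y01 by simp
  qed
  have d3: "\<bar>V \<omega> - Vc \<omega>\<bar> \<le> \<bar>V \<omega>\<bar> powr r * y" for \<omega>
  proof (cases "\<bar>V \<omega>\<bar> > b")
    case True
    have "\<bar>V \<omega> - Vc \<omega>\<bar> \<le> \<bar>V \<omega>\<bar>" using ab by (auto simp: Vc_def)
    also have "\<dots> \<le> \<bar>V \<omega>\<bar> powr r * x powr (1 - (1/p + 1/r))"
      using True pr x01 by (intro powr_tail) (auto simp: b_def)
    finally show ?thesis by (simp add: y_def algebra_simps)
  next
    case False then have "Vc \<omega> = V \<omega>" by (auto simp: Vc_def)
    then show ?thesis using y01 by simp
  qed
  have i: "integrable M U" "integrable M V"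
    by (rule integrable_powr_less[OF _ iU pr(1)], measurable) (rule integrable_powr_less[OF _ iV pr(2)], measurable)
  have ic: "integrable M Uc" "integrable M Vc"
    using bnd integrable_const_bound[of Uc a] integrable_const_bound[of Vc b] by simp_all
  have iUcVc: "integrable M (\<lambda>\<omega>. Uc \<omega> * Vc \<omega>)"
    using bnd ab by (intro integrable_const_bound[where B="a*b"]) (auto simp: abs_mult intro!: AE_I2 mult_mono)
  have idiff: "integrable M (\<lambda>\<omega>. U \<omega> * V \<omega> - Uc \<omega> * Vc \<omega>)"
    by (rule integrable_dominated[OF _ integrable_mult_left[OF Bochner_Integration.integrable_add[OF iU iV]] d1]) measurable
  have "integrable M (\<lambda>\<omega>. (U \<omega> * V \<omega> - Uc \<omega> * Vc \<omega>) + Uc \<omega> * Vc \<omega>)"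
    using idiff iUcVc by (rule Bochner_Integration.integrable_add)
  then show iUV: "integrable M (\<lambda>\<omega>. U \<omega> * V \<omega>)" by simp
  have e1: "\<bar>expectation (\<lambda>\<omega>. U \<omega> * V \<omega>) - expectation (\<lambda>\<omega>. Uc \<omega> * Vc \<omega>)\<bar> \<le> 2 * K * y"
  proof -
    have "\<bar>expectation (\<lambda>\<omega>. U \<omega> * V \<omega>) - expectation (\<lambda>\<omega>. Uc \<omega> * Vc \<omega>)\<bar> = \<bar>expectation (\<lambda>\<omega>. U \<omega> * V \<omega> - Uc \<omega> * Vc \<omega>)\<bar>"
      using iUV iUcVc by simp
    also have "\<dots> \<le> expectation (\<lambda>\<omega>. \<bar>U \<omega> * V \<omega> - Uc \<omega> * Vc \<omega>\<bar>)" by (rule integral_abs_bound)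
    also have "\<dots> \<le> expectation (\<lambda>\<omega>. (\<bar>U \<omega>\<bar> powr p + \<bar>V \<omega>\<bar> powr r) * y)"
      using idiff iU iV d1 by (intro integral_mono) auto
    also have "\<dots> \<le> (K + K) * y" using iU iV KU KV y01 by (simp add: mult_right_mono add_mono)
    finally show ?thesis by simp
  qed
  have e2: "\<bar>expectation U - expectation Uc\<bar> \<le> K * y"
  proof -
    have "\<bar>expectation U - expectation Uc\<bar> = \<bar>expectation (\<lambda>\<omega>. U \<omega> - Uc \<omega>)\<bar>" using i ic by simp
    also have "\<dots> \<le> expectation (\<lambda>\<omega>. \<bar>U \<omega> - Uc \<omega>\<bar>)" by (rule integral_abs_bound)
    also have "\<dots> \<le> expectation (\<lambda>\<omega>. \<bar>U \<omega>\<bar> powr p * y)"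
      using i ic iU d2 by (intro integral_mono) auto
    also have "\<dots> \<le> K * y" using iU KU y01 by (simp add: mult_right_mono)
    finally show ?thesis .
  qed
  have e3: "\<bar>expectation V - expectation Vc\<bar> \<le> K * y"
  proof -
    have "\<bar>expectation V - expectation Vc\<bar> = \<bar>expectation (\<lambda>\<omega>. V \<omega> - Vc \<omega>)\<bar>" using i ic by simp
    also have "\<dots> \<le> expectation (\<lambda>\<omega>. \<bar>V \<omega> - Vc \<omega>\<bar>)" by (rule integral_abs_bound)
    also have "\<dots> \<le> expectation (\<lambda>\<omega>. \<bar>V \<omega>\<bar> powr r * y)"
      using i ic iV d3 by (intro integral_mono) auto
    also have "\<dots> \<le> K * y" using iV KV y01 by (simp add: mult_right_mono)
    finally show ?thesis .
  qed
  have EV: "\<bar>expectation V\<bar> \<le> 1 + K"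
  proof -
    have "\<bar>expectation V\<bar> \<le> expectation (\<lambda>\<omega>. \<bar>V \<omega>\<bar>)" by (rule integral_abs_bound)
    also have "\<dots> \<le> expectation (\<lambda>\<omega>. 1 + \<bar>V \<omega>\<bar> powr r)"
      using i iV pr by (intro integral_mono abs_le_one_plus_powr) auto
    also have "\<dots> \<le> 1 + K" using iV KV by (simp add: prob_space)
    finally show ?thesis .
  qed
  have EU: "\<bar>expectation Uc\<bar> \<le> 1 + K"
  proof -
    have "\<bar>expectation Uc\<bar> \<le> expectation (\<lambda>\<omega>. \<bar>Uc \<omega>\<bar>)" by (rule integral_abs_bound)
    also have "\<dots> \<le> expectation (\<lambda>\<omega>. 1 + \<bar>U \<omega>\<bar> powr p)"
    proof (intro integral_mono)
      fix \<omega>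
      have "\<bar>Uc \<omega>\<bar> \<le> \<bar>U \<omega>\<bar>" using ab by (auto simp: Uc_def)
      then show "\<bar>Uc \<omega>\<bar> \<le> 1 + \<bar>U \<omega>\<bar> powr p"
        using abs_le_one_plus_powr[OF pr(1), of "\<bar>U \<omega>\<bar>"] by linarith
    qed (use ic iU in auto)
    also have "\<dots> \<le> 1 + K" using iU KU by (simp add: prob_space)
    finally show ?thesis .
  qed
  have e4: "\<bar>expectation U * expectation V - expectation Uc * expectation Vc\<bar> \<le> 2 * K * (1 + K) * y"
  proof -
    have "expectation U * expectation V - expectation Uc * expectation Vc =
      (expectation U - expectation Uc) * expectation V + expectation Uc * (expectation V - expectation Vc)" by (simp add: algebra_simps)
    also have "\<bar>\<dots>\<bar> \<le> \<bar>expectation U - expectation Uc\<bar> * \<bar>expectation V\<bar> + \<bar>expectation Uc\<bar> * \<bar>expectation V - expectation Vc\<bar>"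
      by (metis abs_mult abs_triangle_ineq)
    also have "\<dots> \<le> (K * y) * (1 + K) + (1 + K) * (K * y)"
      using e2 e3 EU EV K0 y01 by (intro add_mono mult_mono) auto
    finally show ?thesis by (simp add: algebra_simps)
  qed
  have "\<bar>expectation (\<lambda>\<omega>. U \<omega> * V \<omega>) - expectation U * expectation V\<bar> \<le> 4 * y + 2 * K * y + 2 * K * (1 + K) * y"
    using c e1 e4 by linarith
  also have "\<dots> = (4 + 4 * K + 2 * K\<^sup>2) * y" by (simp add: algebra_simps power2_eq_square)
  also have "\<dots> \<le> (4 * (1 + K)\<^sup>2) * y"
    using K0 y01 by (intro mult_right_mono) (auto simp: power2_eq_square algebra_simps)
  finally show "\<bar>expectation (\<lambda>\<omega>. U \<omega> * V \<omega>) - expectation U * expectation V\<bar> \<le> 4 * (1 + K)\<^sup>2 * x powr (1 - 1/p - 1/r)"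
    by (simp add: y_def)
qed

section \<open>The heat flow of the absolute value\<close>

text \<open>\<open>P\<close> is the error function up to the factor \<open>sqrt pi / 2\<close>. The
  bound on \<open>x * (sqrt pi / 2 - P x)\<close> is the Mills ratio estimate; it keeps the smoothed
  absolute value at bounded distance from the absolute value for large arguments.\<close>

lemma gauss_antiderivative:
  obtains P :: "real \<Rightarrow> real" where "\<And>x. (P has_real_derivative exp (- x\<^sup>2)) (at x)" "P 0 = 0"
    "\<And>x. \<bar>P x\<bar> \<le> sqrt pi / 2" "\<And>x. x > 0 \<Longrightarrow> x * (sqrt pi / 2 - P x) \<le> 1 / 2"
    "\<And>x. P (- x) = - P x"
proof -
  have "\<exists>F. \<forall>x. -\<infinity> < ereal x \<longrightarrow> ereal x < \<infinity> \<longrightarrow> (F has_vector_derivative exp (- x\<^sup>2)) (at x)"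
    by (rule einterval_antiderivative) (auto intro!: continuous_intros)
  then obtain F where F: "\<And>x::real. (F has_real_derivative exp (- x\<^sup>2)) (at x)"
    by (auto simp: has_real_derivative_iff_has_vector_derivative)
  define P where "P x = F x - F 0" for x
  have P: "(P has_real_derivative exp (- x\<^sup>2)) (at x)" for x
    unfolding P_def by (auto intro!: derivative_eq_intros F)
  have odd: "P (- x) = - P x" for x
  proof -
    have "((\<lambda>x. P x + P (- x)) has_real_derivative 0) (at y)" for y
      by (auto intro!: derivative_eq_intros P DERIV_chain'[OF _ P])
    then have "P x + P (- x) = P 0 + P (- 0)" 
      by (metis (no_types, lifting) DERIV_isconst_all)
    then show ?thesis by (simp add: P_def)
  qed
  have mono: "P x \<le> P y" if "x \<le> y" for x y
    by (rule DERIV_nonneg_imp_nondecreasing[OF that]) (auto intro!: exI P)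
  have lim: "(P \<longlongrightarrow> sqrt pi / 2) at_top"
  proof -
    let ?f = "\<lambda>x::real. indicator {0..} x *\<^sub>R exp (- x\<^sup>2)"
    have "((\<lambda>y. \<integral> x. indicator {..y} x *\<^sub>R ?f x \<partial>lborel) \<longlongrightarrow> (\<integral> x. ?f x \<partial>lborel)) at_top"
      using gaussian_moment_0 by (intro tendsto_integral_at_top) (auto simp: has_bochner_integral_iff)
    moreover have "(\<integral> x. ?f x \<partial>lborel) = sqrt pi / 2"
      using gaussian_moment_0 by (auto simp: has_bochner_integral_iff)
    moreover have "eventually (\<lambda>y. (\<integral> x. indicator {..y} x *\<^sub>R ?f x \<partial>lborel) = P y) at_top"
    proof (rule eventually_mono[OF eventually_ge_at_top[of 0]])
      fix y :: real assume y: "0 \<le> y"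
      have "has_bochner_integral lborel (\<lambda>x. indicator {0..y} x *\<^sub>R exp (- x\<^sup>2)) (P y - P 0)"
        using y by (intro has_bochner_integral_FTC_Icc)
          (auto simp: has_real_derivative_iff_has_vector_derivative[symmetric] intro!: continuous_intros DERIV_subset[OF P])
      moreover have "(\<lambda>x. indicator {..y} x *\<^sub>R ?f x) = (\<lambda>x. indicator {0..y} x *\<^sub>R exp (- x\<^sup>2))"
        by (auto simp: indicator_def fun_eq_iff)
      ultimately show "(\<integral> x. indicator {..y} x *\<^sub>R ?f x \<partial>lborel) = P y"
        by (simp add: has_bochner_integral_iff P_def)
    qed
    ultimately show ?thesis by (simp only:) (rule Lim_transform_eventually)
  qed
  have up: "P x \<le> sqrt pi / 2" for x
    using mono tendsto_lowerbound[OF lim, of "P x"] eventually_mono[OF eventually_ge_at_top[of x], of "\<lambda>y. P x \<le> P y"] by auto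
  have tail: "x * (sqrt pi / 2 - P x) \<le> 1 / 2" if x: "x > 0" for x
  proof -
    \<comment> \<open>Adding the Mills term makes the function decreasing with the same limit, hence
      it lies above \<open>sqrt pi / 2\<close>.\<close>
    define L where "L w = P w + exp (- w\<^sup>2) / (2 * w)" for w
    have L: "L y \<le> L x" if "x \<le> y" for y
    proof (rule DERIV_nonpos_imp_nonincreasing[OF that])
      fix z assume z: "x \<le> z"
      have "(L has_real_derivative - exp (- z\<^sup>2) / (2 * z\<^sup>2)) (at z)"
        unfolding L_def using z x
        by (auto intro!: derivative_eq_intros P simp: power2_eq_square field_simps)
      then show "\<exists>y. (L has_real_derivative y) (at z) \<and> y \<le> 0" by (intro exI conjI) auto
    qed
    have "((\<lambda>w::real. exp (- w\<^sup>2) / (2 * w)) \<longlongrightarrow> 0) at_top"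
    proof (rule Lim_null_comparison)
      show "eventually (\<lambda>w::real. norm (exp (- w\<^sup>2) / (2 * w)) \<le> 1 / w) at_top"
        using eventually_gt_at_top[of 0] 
      proof eventually_elim
        case (elim w)
        have "exp (- w\<^sup>2) \<le> 1" by simp
        then have "exp (- w\<^sup>2) \<le> 2" by linarith
        then show ?case using elim by (simp add: field_simps)
      qed
      show "((\<lambda>w::real. 1 / w) \<longlongrightarrow> 0) at_top" by (rule tendsto_divide_0[OF tendsto_const filterlim_at_top_imp_at_infinity[OF filterlim_ident]])
    qed
    from tendsto_add[OF lim this] have "(L \<longlongrightarrow> sqrt pi / 2) at_top" by (simp add: L_def[abs_def])
    then have "sqrt pi / 2 \<le> L x"
      by (rule tendsto_upperbound) (use L in \<open>auto simp: eventually_at_top_linorder\<close>)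
    then have "x * (sqrt pi / 2 - P x) \<le> x * (exp (- x\<^sup>2) / (2 * x))"
      using x by (intro mult_left_mono) (auto simp: L_def)
    also have "\<dots> \<le> 1 / 2" using x by simp
    finally show ?thesis .
  qed
  have "\<bar>P x\<bar> \<le> sqrt pi / 2" for x
    using up[of x] up[of "- x"] odd[of x] by (auto simp: abs_le_iff)
  then show ?thesis by (intro that[of P] P tail odd) (auto simp: P_def)
qed

text \<open>\<open>u s x\<close> is the expectation of the absolute value of \<open>x + sqrt s * N\<close> for a standard
  normal \<open>N\<close>; it solves the heat equation with initial value the absolute value.\<close>

lemma heat_function:
  obtains u g k :: "real \<Rightarrow> real \<Rightarrow> real" where
    "\<And>s x. s > 0 \<Longrightarrow> (u s has_real_derivative g s x) (at x)"
    "\<And>s x. s > 0 \<Longrightarrow> (g s has_real_derivative k s x) (at x)"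
    "\<And>s x. s > 0 \<Longrightarrow> ((\<lambda>s. u s x) has_real_derivative k s x / 2) (at s)"
    "\<And>s x. k s x = 2 / sqrt pi / sqrt (2 * s) * exp (- (x / sqrt (2 * s))\<^sup>2)"
    "\<And>x. \<bar>u 1 x - \<bar>x\<bar>\<bar> \<le> 2" "\<And>s. s > 0 \<Longrightarrow> u s 0 = sqrt (2 / pi) * sqrt s"
    "\<And>s. g s 0 = 0" "\<And>s x. \<bar>g s x\<bar> \<le> 1"
proof -
  obtain P :: "real \<Rightarrow> real" where P: "\<And>x. (P has_real_derivative exp (- x\<^sup>2)) (at x)" "P 0 = 0"
    "\<And>x. \<bar>P x\<bar> \<le> sqrt pi / 2" "\<And>x. x > 0 \<Longrightarrow> x * (sqrt pi / 2 - P x) \<le> 1 / 2" "\<And>x. P (- x) = - P x"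
    using gauss_antiderivative by blast
  \<comment> \<open>The mean of a folded normal variable, written in \<open>r = sqrt (2 * s)\<close>
    so that the root enters only through the chain rule at the end.\<close>
  define U where "U r x = 2 / sqrt pi * (x * P (x / r) + r / 2 * exp (- (x / r)\<^sup>2))" for r x
  define u where "u s x = U (sqrt (2 * s)) x" for s x
  define g where "g s x = 2 / sqrt pi * P (x / sqrt (2 * s))" for s x
  define k where "k s x = 2 / sqrt pi / sqrt (2 * s) * exp (- (x / sqrt (2 * s))\<^sup>2)" for s x
  have U1: "(U r has_real_derivative 2 / sqrt pi * P (x / r)) (at x)" if "r > 0" for r x
    unfolding U_def using that
    by (auto intro!: derivative_eq_intros DERIV_chain'[OF _ P(1)] simp: power2_eq_square field_simps)
  have Ur: "((\<lambda>r. U r x) has_real_derivative exp (- (x / r)\<^sup>2) / sqrt pi) (at r)" if "r > 0" for r x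
    unfolding U_def using that
    by (auto intro!: derivative_eq_intros DERIV_chain'[OF _ P(1)] simp: power2_eq_square field_simps)
  have sq: "((\<lambda>s. sqrt (2 * s)) has_real_derivative 1 / sqrt (2 * s)) (at s)" if "s > 0" for s :: real
    using that by (auto intro!: derivative_eq_intros simp: field_simps)
  have a: "(u s has_real_derivative g s x) (at x)" if "s > 0" for s x
    using U1[of "sqrt (2 * s)" x] that by (simp add: u_def[abs_def] g_def)
  have b: "(g s has_real_derivative k s x) (at x)" if "s > 0" for s x
  proof -
    have "((\<lambda>x. P (x / r)) has_real_derivative exp (- (x / r)\<^sup>2) * (1 / r)) (at x)" if "r > 0" for r
      using that by (intro DERIV_chain2[OF P(1)]) (auto intro!: derivative_eq_intros)
    from DERIV_cmult[OF this, of "sqrt (2 * s)" "2 / sqrt pi"] that show ?thesis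
      by (simp add: g_def[abs_def] k_def mult_ac)
  qed
  have c: "((\<lambda>s. u s x) has_real_derivative k s x / 2) (at s)" if "s > 0" for s x
  proof -
    have "((\<lambda>s. U (sqrt (2 * s)) x) has_real_derivative (exp (- (x / sqrt (2 * s))\<^sup>2) / sqrt pi) * (1 / sqrt (2 * s))) (at s)"
      using DERIV_chain2[OF Ur sq[OF that], of x] that by simp
    then show ?thesis by (simp add: u_def k_def mult_ac)
  qed
  have e0: "u s 0 = sqrt (2 / pi) * sqrt s" if "s > 0" for s
    using that by (simp add: u_def U_def real_sqrt_mult real_sqrt_divide)
  have pos: "\<bar>u 1 x - x\<bar> \<le> 2" if "x > 0" for x
  proof -
    define w where "w = x / sqrt 2"
    have w: "w > 0" "x = sqrt 2 * w" using that by (auto simp: w_def)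
    have sp: "sqrt pi > 1" using pi_gt3 by (auto simp: real_less_rsqrt)
    have "u 1 x - x = 2 / sqrt pi * sqrt 2 * (exp (- w\<^sup>2) / 2 - w * (sqrt pi / 2 - P w))"
      using sp unfolding u_def U_def w(2) by (simp add: field_simps)
    moreover have "0 \<le> w * (sqrt pi / 2 - P w)" using P(3)[of w] w by auto
    moreover have "w * (sqrt pi / 2 - P w) \<le> 1/2" using P(4) w by auto
    moreover have "exp (- w\<^sup>2) \<le> 1" by simp
    moreover have "exp (- w\<^sup>2) \<ge> 0" by simp
    ultimately have eq: "u 1 x - x = 2 / sqrt pi * sqrt 2 * (exp (- w\<^sup>2) / 2 - w * (sqrt pi / 2 - P w))"
      and b: "\<bar>exp (- w\<^sup>2) / 2 - w * (sqrt pi / 2 - P w)\<bar> \<le> 1 / 2" unfolding abs_le_iff by linarith+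
    have "\<bar>u 1 x - x\<bar> \<le> \<bar>2 / sqrt pi * sqrt 2\<bar> * (1/2)"
      unfolding eq abs_mult[of "2 / sqrt pi * sqrt 2"] using b by (rule mult_left_mono) simp
    also have "\<dots> = sqrt 2 / sqrt pi" by simp
    also have "\<dots> \<le> sqrt 2" using sp by (simp add: field_simps)
    also have "\<dots> \<le> 2" by (simp add: real_le_lsqrt)
    finally show ?thesis .
  qed
  have d: "\<bar>u 1 x - \<bar>x\<bar>\<bar> \<le> 2" for x
  proof (cases "x = 0")
    case True 
    have "sqrt (2 / pi) \<le> 1" "sqrt (2 / pi) \<ge> 0" using pi_gt3 by auto
    moreover have "u 1 x = sqrt (2 / pi)" using e0[of 1] True by simp
    ultimately show ?thesis using True by linarith
  next
    case False
    have "u 1 (- x) = u 1 x" by (simp add: u_def U_def P(5))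
    then show ?thesis using pos[of x] pos[of "- x"] False by (cases "x > 0") auto
  qed
  have f: "\<bar>g s x\<bar> \<le> 1" for s x
    using P(3)[of "x / sqrt (2 * s)"] by (simp add: g_def abs_mult field_simps)
  show ?thesis
    using that[of u g k, OF a b c k_def d e0 _ f] by (simp add: g_def P(2))
qed

text \<open>By scaling, every space derivative costs \<open>v powr (-1/2)\<close> and every time
  derivative costs \<open>1 / v\<close>. So the third space derivative is of order
  \<open>1 / v\<close>, and the second time derivative, of order \<open>v powr (-3/2)\<close>, is
  below that for \<open>v \<ge> 1\<close>. All remainders are expressed in the single factor
  \<open>1 / v\<close> because \<open>v\<close> will be the remaining variance, and the sum of
  \<open>1 / v\<close> over the replacement steps is harmonic.\<close>

lemma heat_kernel_bounds:
  obtains u g k :: "real \<Rightarrow> real \<Rightarrow> real" where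
    "\<And>v. v \<ge> 1 \<Longrightarrow> u v \<in> borel_measurable borel"
    "\<And>v. v \<ge> 1 \<Longrightarrow> g v \<in> borel_measurable borel"
    "\<And>v. v \<ge> 1 \<Longrightarrow> k v \<in> borel_measurable borel"
    "\<And>v x. v \<ge> 1 \<Longrightarrow> \<bar>u v x - u v 0\<bar> \<le> \<bar>x\<bar>"
    "\<And>v x. v \<ge> 1 \<Longrightarrow> \<bar>g v x\<bar> \<le> 1"
    "\<And>v. v \<ge> 1 \<Longrightarrow> g v 0 = 0"
    "\<And>v x. v \<ge> 1 \<Longrightarrow> \<bar>k v x\<bar> \<le> 1"
    "\<And>v x y. v \<ge> 1 \<Longrightarrow> \<bar>k v y - k v x\<bar> \<le> \<bar>y - x\<bar> / v"
    "\<And>v x y. v \<ge> 1 \<Longrightarrow> \<bar>g v y - g v x - (y - x) * k v x\<bar> \<le> (y - x)\<^sup>2 / v"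
    "\<And>v x y. v \<ge> 1 \<Longrightarrow> \<bar>u v y - u v x - (y - x) * g v x - (y - x)\<^sup>2 / 2 * k v x\<bar> \<le> \<bar>y - x\<bar> ^ 3 / v"
    "\<And>v h x. v \<ge> 1 \<Longrightarrow> h \<ge> 0 \<Longrightarrow> \<bar>u (v + h) x - u v x - h / 2 * k v x\<bar> \<le> h\<^sup>2 / v"
    "\<And>x. \<bar>u 1 x - \<bar>x\<bar>\<bar> \<le> 2"
    "\<And>v. v \<ge> 1 \<Longrightarrow> u v 0 = sqrt (2 / pi) * sqrt v"
proof -
  obtain u g k :: "real \<Rightarrow> real \<Rightarrow> real" where
    a: "\<And>s x. s > 0 \<Longrightarrow> (u s has_real_derivative g s x) (at x)" and
    b: "\<And>s x. s > 0 \<Longrightarrow> (g s has_real_derivative k s x) (at x)" and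
    c: "\<And>s x. s > 0 \<Longrightarrow> ((\<lambda>s. u s x) has_real_derivative k s x / 2) (at s)" and
    k: "\<And>s x. k s x = 2 / sqrt pi / sqrt (2 * s) * exp (- (x / sqrt (2 * s))\<^sup>2)" and
    d: "\<And>x. \<bar>u 1 x - \<bar>x\<bar>\<bar> \<le> 2" and e: "\<And>s. s > 0 \<Longrightarrow> u s 0 = sqrt (2 / pi) * sqrt s"
    and g0: "\<And>s. g s 0 = 0" and g1: "\<And>s x. \<bar>g s x\<bar> \<le> 1"
    using heat_function by blast
  have sp: "sqrt pi \<ge> 1" using pi_gt3 by (auto simp: real_le_rsqrt)
  define k1 where "k1 s x = - (2 * x / (2 * s)) * k s x" for s x
  have k1: "(k s has_real_derivative k1 s x) (at x)" if "s > 0" for s x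
  proof -
    have "((\<lambda>x. 2 / sqrt pi / sqrt (2 * s) * exp (- (x / sqrt (2 * s))\<^sup>2)) has_real_derivative 
      2 / sqrt pi / sqrt (2 * s) * (exp (- (x / sqrt (2 * s))\<^sup>2) * (- (2 * x / (2 * s))))) (at x)"
      using that by (auto intro!: derivative_eq_intros simp: power2_eq_square field_simps)
    then show ?thesis by (simp add: k[abs_def] k1_def mult.commute mult.left_commute)
  qed
  have expb: "\<bar>w\<bar> * exp (- w\<^sup>2) \<le> 1/2" "(2 * w\<^sup>2 + 1) * exp (- w\<^sup>2) \<le> 2" for w :: real
  proof -
    have "1 + w\<^sup>2 \<le> exp (w\<^sup>2)" by (rule exp_ge_add_one_self)
    moreover have "2 * \<bar>w\<bar> \<le> 1 + w\<^sup>2" using zero_le_power2[of "\<bar>w\<bar> - 1"] by (simp add: power2_eq_square algebra_simps)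
    ultimately have "\<bar>w\<bar> \<le> exp (w\<^sup>2) / 2" by linarith
    then show "\<bar>w\<bar> * exp (- w\<^sup>2) \<le> 1/2" by (simp add: exp_minus field_simps)
    have "2 * w\<^sup>2 + 1 \<le> 2 * exp (w\<^sup>2)" using \<open>1 + w\<^sup>2 \<le> exp (w\<^sup>2)\<close> by linarith
    then show "(2 * w\<^sup>2 + 1) * exp (- w\<^sup>2) \<le> 2" by (simp add: exp_minus field_simps)
  qed
  have k0: "\<bar>k v x\<bar> \<le> 1" if "v \<ge> 1" for v x
  proof -
    have "sqrt pi * sqrt (2 * v) = sqrt (2 * pi * v)" by (simp add: real_sqrt_mult[symmetric] mult_ac)
    also have "\<dots> \<ge> 2" using that pi_gt3 mult_mono[of 3 pi 1 v] by (intro real_le_rsqrt) auto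
    finally have 1: "2 / (sqrt pi * sqrt (2 * v)) \<le> 1" using sp that by (simp add: field_simps)
    have "\<bar>k v x\<bar> = 2 / (sqrt pi * sqrt (2 * v)) * exp (- (x / sqrt (2 * v))\<^sup>2)" using that sp by (simp add: k abs_mult)
    also have "\<dots> \<le> 1 * 1" using 1 that sp by (intro mult_mono) auto
    finally show ?thesis by simp
  qed
  have k1b: "\<bar>k1 v x\<bar> \<le> 1 / v" if "v \<ge> 1" for v x
  proof -
    define w where "w = x / sqrt (2 * v)"
    have x: "x = w * sqrt (2 * v)" using that by (simp add: w_def)
    have "\<bar>k1 v x\<bar> = \<bar>w * sqrt (2 * v) / v * (2 / sqrt pi / sqrt (2 * v) * exp (- w\<^sup>2))\<bar>"
      unfolding k1_def k w_def[symmetric] by (simp add: x abs_mult)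
    also have "w * sqrt (2 * v) / v * (2 / sqrt pi / sqrt (2 * v) * exp (- w\<^sup>2)) = 2 / sqrt pi / v * (w * exp (- w\<^sup>2))"
      using that by (simp add: field_simps)
    also have "\<bar>\<dots>\<bar> = 2 / sqrt pi / v * (\<bar>w\<bar> * exp (- w\<^sup>2))" using that sp by (simp add: abs_mult)
    also have "\<dots> \<le> 2 / sqrt pi / v * (1 / 2)" using expb that by (intro mult_left_mono) auto
    also have "\<dots> \<le> 1 / v" using that sp by (simp add: field_simps)
    finally show ?thesis .
  qed
  \<comment> \<open>The second derivative of \<open>u\<close> in time. Its bound is needed for all
    \<open>s \<ge> v\<close>, since the intermediate point of the Taylor formula lies between
    \<open>v\<close> and \<open>v + h\<close>.\<close>
  define k2 where "k2 s x = 1 / sqrt pi * (1 / sqrt (2 * s)) ^ 3 * exp (- (x / sqrt (2 * s))\<^sup>2) * (2 * (x / sqrt (2 * s))\<^sup>2 - 1)" for s x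
  have k2: "((\<lambda>s. k s x / 2) has_real_derivative k2 s x) (at s)" if "s > 0" for s x
  proof -
    have sq: "((\<lambda>s. sqrt (2 * s)) has_real_derivative 1 / sqrt (2 * s)) (at s)"
      using that by (auto intro!: derivative_eq_intros simp: field_simps)
    have "((\<lambda>r. c / r * exp (- (x / r)\<^sup>2)) has_real_derivative
        c * (1 / r)^2 * exp (- (x / r)\<^sup>2) * (2 * (x / r)\<^sup>2 - 1)) (at r)" if "r > 0" for r c
      using that by (auto intro!: derivative_eq_intros simp: power2_eq_square field_simps)
    from DERIV_chain2[OF this[where c="1 / sqrt pi"] sq] that
    have "((\<lambda>s. 1 / sqrt pi / sqrt (2 * s) * exp (- (x / sqrt (2 * s))\<^sup>2)) has_real_derivative 
        1 / sqrt pi * (1 / sqrt (2 * s))^2 * exp (- (x / sqrt (2 * s))\<^sup>2) * (2 * (x / sqrt (2 * s))\<^sup>2 - 1) * (1 / sqrt (2 * s))) (at s)"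
      by simp
    then show ?thesis by (simp add: k k2_def power3_eq_cube power2_eq_square mult_ac)
  qed
  have k2b: "\<bar>k2 s x\<bar> \<le> 1 / v" if "v \<ge> 1" "s \<ge> v" for v s x
  proof -
    define w where "w = x / sqrt (2 * s)"
    have r: "sqrt (2 * s) \<ge> 1" using that by (auto simp: real_le_rsqrt)
    have "\<bar>2 * w\<^sup>2 - 1\<bar> \<le> 2 * w\<^sup>2 + 1" by (auto simp: abs_le_iff)
    then have "exp (- w\<^sup>2) * \<bar>2 * w\<^sup>2 - 1\<bar> \<le> exp (- w\<^sup>2) * (2 * w\<^sup>2 + 1)" by (intro mult_left_mono) auto
    also have "\<dots> \<le> 2" using expb[of w] by (simp add: mult.commute)
    finally have ee: "exp (- w\<^sup>2) * \<bar>2 * w\<^sup>2 - 1\<bar> \<le> 2" .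
    have "1 / sqrt (2 * s) ^ 3 = 1 / sqrt (2 * s) * (1 / (sqrt (2 * s))\<^sup>2)" by (simp add: power3_eq_cube power2_eq_square)
    also have "\<dots> \<le> 1 * (1 / (2 * s))" using r that by (intro mult_mono) auto
    also have "\<dots> \<le> 1 / (2 * v)" using that by (simp add: field_simps)
    finally have r3: "1 / sqrt (2 * s) ^ 3 \<le> 1 / (2 * v)" .
    have "\<bar>k2 s x\<bar> = 1 / sqrt pi * (1 / sqrt (2 * s) ^ 3) * (exp (- w\<^sup>2) * \<bar>2 * w\<^sup>2 - 1\<bar>)"
      unfolding k2_def w_def[symmetric] using sp that by (simp add: abs_mult power_one_over)
    also have "\<dots> \<le> 1 * (1 / (2 * v)) * 2" using r3 ee sp that by (intro mult_mono) auto
    finally show ?thesis by simp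
  qed
  have klip: "\<bar>k v y - k v x\<bar> \<le> \<bar>y - x\<bar> / v" if "v \<ge> 1" for v x y
  proof -
    have "norm (k v y - k v x) \<le> 1 / v * norm (y - x)"
      using k1[of v] k1b[OF that] that
      by (intro field_differentiable_bound[where S=UNIV and f'="k1 v"]) auto
    then show ?thesis by simp
  qed
  have glip: "\<bar>g v y - g v x - (y - x) * k v x\<bar> \<le> (y - x)\<^sup>2 / v" if "v \<ge> 1" for v x y
  proof (cases "x = y")
    case False
    define df where "df m = (if m = 0 then g v else if m = Suc 0 then k v else k1 v)" for m :: nat
    have "\<exists>t. (if y < x then y < t \<and> t < x else x < t \<and> t < y) \<and>
      g v y = (\<Sum>m<2. df m x / fact m * (y - x) ^ m) + df 2 t / fact 2 * (y - x) ^ 2"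
      using that False b[of v] k1[of v]
      by (intro Taylor[where a="min x y" and b="max x y"]) (auto simp: df_def less_2_cases_iff)
    then obtain t where "g v y = (\<Sum>m<2. df m x / fact m * (y - x) ^ m) + df 2 t / fact 2 * (y - x) ^ 2" by blast
    then have "g v y = g v x + k v x * (y - x) + k1 v t / 2 * (y - x)\<^sup>2" by (simp add: df_def numeral_2_eq_2)
    then have t: "g v y - g v x - (y - x) * k v x = k1 v t * ((y - x)\<^sup>2 / 2)" by simp
    have "\<bar>k1 v t * ((y - x)\<^sup>2 / 2)\<bar> \<le> 1 / v * ((y - x)\<^sup>2 / 2)"
      unfolding abs_mult using k1b[OF that, of t] that by (intro mult_mono) auto
    also have "\<dots> \<le> (y - x)\<^sup>2 / v" using that by (simp add: field_simps)
    finally show ?thesis unfolding t .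
  qed auto
  have ulip: "\<bar>u v y - u v x - (y - x) * g v x - (y - x)\<^sup>2 / 2 * k v x\<bar> \<le> \<bar>y - x\<bar> ^ 3 / v" if "v \<ge> 1" for v x y
  proof (cases "x = y")
    case False
    define df where "df m = (if m = 0 then u v else if m = Suc 0 then g v else if m = 2 then k v else k1 v)" for m :: nat
    have "\<exists>t. (if y < x then y < t \<and> t < x else x < t \<and> t < y) \<and>
      u v y = (\<Sum>m<3. df m x / fact m * (y - x) ^ m) + df 3 t / fact 3 * (y - x) ^ 3"
    proof (intro Taylor[where a="min x y" and b="max x y"] allI impI)
      fix m :: nat and t assume "m < 3 \<and> min x y \<le> t \<and> t \<le> max x y"
      then have "m = 0 \<or> m = Suc 0 \<or> m = 2" by auto
      then show "(df m has_real_derivative df (Suc m) t) (at t)"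
        using that a[of v] b[of v] k1[of v] by (auto simp: df_def)
    qed (use False in \<open>auto simp: df_def\<close>)
    then obtain t where "u v y = (\<Sum>m<3. df m x / fact m * (y - x) ^ m) + df 3 t / fact 3 * (y - x) ^ 3" by blast
    then have "u v y = u v x + g v x * (y - x) + k v x / 2 * (y - x)\<^sup>2 + k1 v t / 6 * (y - x)^3"
      by (simp add: df_def eval_nat_numeral)
    then have t: "u v y - u v x - (y - x) * g v x - (y - x)\<^sup>2 / 2 * k v x = k1 v t * ((y - x)^3 / 6)"
      by simp
    have "\<bar>k1 v t * ((y - x)^3 / 6)\<bar> \<le> 1 / v * (\<bar>y - x\<bar>^3 / 6)"
      unfolding abs_mult using k1b[OF that, of t] that by (intro mult_mono) (auto simp: power_abs)
    also have "\<dots> \<le> \<bar>y - x\<bar>^3 / v" using that by (simp add: field_simps)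
    finally show ?thesis unfolding t .
  qed auto
  have tlip: "\<bar>u (v + h) x - u v x - h / 2 * k v x\<bar> \<le> h\<^sup>2 / v" if "v \<ge> 1" "h \<ge> 0" for v h x
  proof (cases "h = 0")
    case False
    define df where "df m s = (if m = 0 then u s x else if m = Suc 0 then k s x / 2 else k2 s x)" for m :: nat and s
    have "\<exists>t. (if v + h < v then v + h < t \<and> t < v else v < t \<and> t < v + h) \<and>
      u (v+h) x = (\<Sum>m<2. df m v / fact m * (v + h - v) ^ m) + df 2 t / fact 2 * (v + h - v) ^ 2"
    proof (intro Taylor[where a=v and b="v + h"] allI impI)
      fix m :: nat and t assume "m < 2 \<and> v \<le> t \<and> t \<le> v + h"
      then have "m = 0 \<or> m = Suc 0" "t > 0" using that by auto
      then show "(df m has_real_derivative df (Suc m) t) (at t)"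
        using c[of t x] k2[of t x] by (auto simp: df_def[abs_def])
    qed (use False that in \<open>auto simp: df_def\<close>)
    then obtain t where t0: "if v + h < v then v + h < t \<and> t < v else v < t \<and> t < v + h" and tu: "u (v+h) x = (\<Sum>m<2. df m v / fact m * (v + h - v) ^ m) + df 2 t / fact 2 * (v + h - v) ^ 2" by blast
    have t: "v \<le> t" using t0 that by (auto split: if_splits)
    from tu have "u (v + h) x = u v x + k v x / 2 * h + k2 t x / 2 * h\<^sup>2" by (simp add: df_def numeral_2_eq_2)
    then have t': "u (v + h) x - u v x - h / 2 * k v x = k2 t x * (h\<^sup>2 / 2)" by simp
    have "\<bar>k2 t x * (h\<^sup>2 / 2)\<bar> \<le> 1 / v * (h\<^sup>2 / 2)"
      unfolding abs_mult using k2b[OF that(1) t, of x] that by (intro mult_mono) auto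
    also have "\<dots> \<le> h\<^sup>2 / v" using that by (simp add: field_simps)
    finally show ?thesis unfolding t' .
  qed auto
  have u0: "\<bar>u v x - u v 0\<bar> \<le> \<bar>x\<bar>" if "v \<ge> 1" for v x
  proof -
    have "norm (u v x - u v 0) \<le> 1 * norm (x - 0)"
      using a[of v] g1 that
      by (intro field_differentiable_bound[where S=UNIV and f'="g v"]) auto
    then show ?thesis by simp
  qed
  have dm: "f \<in> borel_measurable borel" if "\<And>x. (f has_real_derivative f' x) (at x)" for f f' :: "real \<Rightarrow> real"
    using DERIV_isCont[OF that] by (intro borel_measurable_continuous_onI continuous_at_imp_continuous_on) auto
  have m: "u v \<in> borel_measurable borel" "g v \<in> borel_measurable borel" "k v \<in> borel_measurable borel" if "v \<ge> 1" for v
    using a[of v] b[of v] k1[of v] that by (auto intro: dm)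
  have e': "u v 0 = sqrt (2 / pi) * sqrt v" if "v \<ge> 1" for v using e that by simp
  have g': "g v 0 = 0" "\<bar>g v x\<bar> \<le> 1" if "v \<ge> 1" for v x using g0 g1 by auto
  show ?thesis
    by (rule that[of u g k]) (fact m u0 g' k0 klip glip ulip tlip d e')+
qed

section \<open>Functionals of a mixing process\<close>

text \<open>The rate is kept with a constant of at least 1, so that raising it to the exponent in
  (0, 1) from Davydov's inequality does not increase it.\<close>

locale mixing_process = prob_space M for M :: "'a measure" +
  fixes Y :: "nat \<Rightarrow> 'a \<Rightarrow> real" and C \<theta> :: real
  assumes stationary: "strictly_stationary M Y"
    and C_ge_1: "C \<ge> 1" and \<theta>_pos: "\<theta> > 0"
    and alpha_le: "\<And>k. k \<ge> 1 \<Longrightarrow> alpha_mix M Y k \<le> C * real k powr (- \<theta>)"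
begin

text \<open>\<open>sigma_gen\<close> packaged as a measure space, so that measurability of functions
  of the past and of the future can be stated and composed.\<close>

definition gen :: "nat set \<Rightarrow> 'a measure" where
  "gen I = sigma (space M) (\<Union>i\<in>I. {Y i -` B \<inter> space M | B. B \<in> sets borel})"

lemma space_gen [simp]: "space (gen I) = space M"
  unfolding gen_def by (rule space_measure_of) auto

lemma sets_gen: "sets (gen I) = sigma_gen M Y I"
  unfolding gen_def sigma_gen_def by (rule sets_measure_of) auto

lemma Y_measurable [measurable]: "i \<ge> 1 \<Longrightarrow> Y i \<in> borel_measurable M"
  using stationary by (simp add: strictly_stationary_def)

lemma Y_gen: "i \<in> I \<Longrightarrow> Y i \<in> borel_measurable (gen I)"
proof (rule measurableI)
  fix B :: "real set" assume "i \<in> I" "B \<in> sets borel"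
  then show "Y i -` B \<inter> space (gen I) \<in> sets (gen I)"
    unfolding sets_gen sigma_gen_def by (auto intro!: sigma_sets.Basic)
qed auto

lemma sigma_gen_mono: "I \<subseteq> J \<Longrightarrow> sigma_gen M Y I \<subseteq> sigma_gen M Y J"
  unfolding sigma_gen_def by (intro sigma_sets_mono') blast

lemma gen_mono: "I \<subseteq> J \<Longrightarrow> U \<in> borel_measurable (gen I) \<Longrightarrow> U \<in> borel_measurable (gen J)"
  by (rule measurable_from_subalg[of "gen J" "gen I"]) (simp_all add: subalgebra_def sets_gen sigma_gen_mono)

lemma subalgebra_gen: "I \<subseteq> {1..} \<Longrightarrow> subalgebra M (gen I)"
proof -
  assume "I \<subseteq> {1..}"
  then have "(\<Union>i\<in>I. {Y i -` B \<inter> space M | B. B \<in> sets borel}) \<subseteq> sets M"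
    by (auto intro!: measurable_sets[OF Y_measurable])
  then show ?thesis
    unfolding subalgebra_def sets_gen sigma_gen_def by (simp add: sets.sigma_sets_subset)
qed

lemma gen_measurable: "I \<subseteq> {1..} \<Longrightarrow> U \<in> borel_measurable (gen I) \<Longrightarrow> U \<in> borel_measurable M"
  using measurable_from_subalg[OF subalgebra_gen] by blast

text \<open>\<open>alpha_mix\<close> is a nested supremum of reals, so an event is bounded by it
  only after both families are known to be bounded, here by 1. The minimum with 1 puts the bound in
  the range that \<open>Davydov_inequality\<close> requires.\<close>

lemma alpha_event_le:
  assumes A: "A \<in> sets (gen {1..m})" and B: "B \<in> sets (gen {m + k..})" and "m \<ge> 1" "k \<ge> 1"
  shows "\<bar>prob (A \<inter> B) - prob A * prob B\<bar> \<le> min 1 (C * real k powr (- \<theta>))"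
proof -
  have one: "\<bar>prob A * prob B - prob (A \<inter> B)\<bar> \<le> 1" for A B
  proof -
    have "0 \<le> prob A * prob B" "prob A * prob B \<le> 1" by (auto intro: mult_le_one)
    moreover have "0 \<le> prob (A \<inter> B)" "prob (A \<inter> B) \<le> 1" by auto
    ultimately show ?thesis by linarith
  qed
  have ne: "sigma_gen M Y I \<noteq> {}" for I
    unfolding sigma_gen_def using sigma_sets.Empty by blast
  have 1: "\<bar>prob A * prob B - prob (A \<inter> B)\<bar> \<le> alpha_coeff M (sigma_gen M Y {1..m}) (sigma_gen M Y {k + m..})"
    unfolding alpha_coeff_def using A B one
    by (intro cSUP_upper2[where x="(A, B)"] bdd_aboveI2[where M=1]) (auto simp: sets_gen add.commute)
  have "alpha_coeff M (sigma_gen M Y {1..j}) (sigma_gen M Y {k + j..}) \<le> 1" for j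
    unfolding alpha_coeff_def using one ne by (intro cSUP_least) auto
  then have 2: "alpha_coeff M (sigma_gen M Y {1..m}) (sigma_gen M Y {k + m..}) \<le> alpha_mix M Y k"
    unfolding alpha_mix_def using \<open>m \<ge> 1\<close> by (intro cSUP_upper2[where x=m] bdd_aboveI2[where M=1]) auto
  show ?thesis
    using 1 2 one[of A B] alpha_le[OF \<open>k \<ge> 1\<close>] by (simp add: abs_minus_commute)
qed

lemma cov_gap_bounded:
  assumes U: "U \<in> borel_measurable (gen {1..m})" and V: "V \<in> borel_measurable (gen {m + k..})"
    and mk: "m \<ge> 1" "k \<ge> 1"
    and "\<And>\<omega>. \<omega> \<in> space M \<Longrightarrow> \<bar>U \<omega>\<bar> \<le> a" "\<And>\<omega>. \<omega> \<in> space M \<Longrightarrow> \<bar>V \<omega>\<bar> \<le> b" "a > 0" "b > 0"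
  shows "\<bar>expectation (\<lambda>\<omega>. U \<omega> * V \<omega>) - expectation U * expectation V\<bar> \<le> 4 * a * b * (C * real k powr (- \<theta>))"
proof (rule cov_bounded_le[OF U V])
  show "\<bar>prob (A \<inter> B) - prob A * prob B\<bar> \<le> C * real k powr (- \<theta>)"
    if "A \<in> sets (gen {1..m})" "B \<in> sets (gen {m + k..})" for A B
    using alpha_event_le[OF that mk] by simp
  show "subalgebra M (gen {1..m})" "subalgebra M (gen {m + k..})"
    by (rule subalgebra_gen; use mk in force)+
qed (use assms in auto)

text \<open>The exponents of the two factors may differ: later a product of two variables, with
  moments of order \<open>p / 2\<close>, meets a single one of order \<open>p\<close>.\<close>

lemma cov_gap:
  assumes U: "U \<in> borel_measurable (gen {1..m})" and V: "V \<in> borel_measurable (gen {m + k..})"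
    and mk: "m \<ge> 1" "k \<ge> 1"
    and iU: "integrable M (\<lambda>\<omega>. \<bar>U \<omega>\<bar> powr p)" and iV: "integrable M (\<lambda>\<omega>. \<bar>V \<omega>\<bar> powr r)"
    and KU: "expectation (\<lambda>\<omega>. \<bar>U \<omega>\<bar> powr p) \<le> K" and KV: "expectation (\<lambda>\<omega>. \<bar>V \<omega>\<bar> powr r) \<le> K"
    and pr: "p \<ge> 1" "r \<ge> 1" "1/p + 1/r < 1"
  shows "\<bar>expectation (\<lambda>\<omega>. U \<omega> * V \<omega>) - expectation U * expectation V\<bar>
      \<le> 4 * (1 + K)\<^sup>2 * C * real k powr (- (\<theta> * (1 - 1/p - 1/r)))" (is "?L \<le> _")
    and "integrable M (\<lambda>\<omega>. U \<omega> * V \<omega>)"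
proof -
  define x where "x = min 1 (C * real k powr (- \<theta>))"
  define e where "e = 1 - 1/p - 1/r"
  have "0 < 1/p" "0 < 1/r" using pr by auto
  then have e: "0 < e" "e < 1" using pr unfolding e_def by linarith+
  have x: "0 < x" "x \<le> 1" using C_ge_1 mk by (auto simp: x_def)
  have s: "subalgebra M (gen {1..m})" "subalgebra M (gen {m + k..})"
    by (rule subalgebra_gen; use mk in force)+
  have ev: "\<bar>prob (A \<inter> B) - prob A * prob B\<bar> \<le> x"
    if "A \<in> sets (gen {1..m})" "B \<in> sets (gen {m + k..})" for A B
    unfolding x_def by (rule alpha_event_le[OF that mk])
  note D = Davydov_inequality[OF U V s ev x iU iV KU KV pr]
  have "?L \<le> 4 * (1 + K)\<^sup>2 * x powr e"
    unfolding e_def by (rule D(1))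
  also have "x powr e \<le> (C * real k powr (- \<theta>)) powr e"
    using x e by (intro powr_mono2) (auto simp: x_def)
  also have "\<dots> = C powr e * real k powr (- (\<theta> * e))"
    using C_ge_1 by (simp add: powr_mult powr_powr)
  also have "C powr e \<le> C powr 1" using C_ge_1 e by (intro powr_mono) auto
  finally show "?L \<le> 4 * (1 + K)\<^sup>2 * C * real k powr (- (\<theta> * (1 - 1/p - 1/r)))"
    using C_ge_1 by (simp add: e_def mult_left_mono mult_right_mono mult.assoc)
  show "integrable M (\<lambda>\<omega>. U \<omega> * V \<omega>)"
    by (rule D(2))
qed

text \<open>Every use of stationarity below concerns one or two coordinates. The index set
  \<open>{1, 1 + k}\<close> collapses to a singleton for \<open>k = 0\<close>, so moments of one
  variable are a special case.\<close>

lemma stationary_pair: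
  fixes F :: "real \<Rightarrow> real \<Rightarrow> real"
  assumes F [measurable]: "(\<lambda>(x, y). F x y) \<in> borel_measurable (borel \<Otimes>\<^sub>M borel)" and i: "i \<ge> 1"
  shows "expectation (\<lambda>\<omega>. F (Y i \<omega>) (Y (i + k) \<omega>)) = expectation (\<lambda>\<omega>. F (Y 1 \<omega>) (Y (1 + k) \<omega>))"
    and "integrable M (\<lambda>\<omega>. F (Y i \<omega>) (Y (i + k) \<omega>)) \<longleftrightarrow> integrable M (\<lambda>\<omega>. F (Y 1 \<omega>) (Y (1 + k) \<omega>))"
proof -
  define I where "I = {1, 1 + k}"
  define h where "h = i - 1"
  have I: "finite I" "I \<subseteq> {1..}" by (auto simp: I_def add.commute add.left_commute)
  have eq: "distr M (\<Pi>\<^sub>M i\<in>I. borel) (\<lambda>\<omega>. \<lambda>i\<in>I. Y (i + h) \<omega>) = distr M (\<Pi>\<^sub>M i\<in>I. borel) (\<lambda>\<omega>. \<lambda>i\<in>I. Y i \<omega>)"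
    using stationary I unfolding strictly_stationary_def by blast
  have mI: "(\<lambda>\<omega>. \<lambda>i\<in>I. Y (i + h) \<omega>) \<in> measurable M (\<Pi>\<^sub>M i\<in>I. borel)" for h
    by (rule measurable_restrict) (auto simp: I_def add.commute add.left_commute)
  have mI0: "(\<lambda>\<omega>. \<lambda>i\<in>I. Y i \<omega>) \<in> measurable M (\<Pi>\<^sub>M i\<in>I. borel)"
    using mI[of 0] by simp
  have G: "(\<lambda>x. F (x 1) (x (1 + k))) \<in> borel_measurable (\<Pi>\<^sub>M i\<in>I. borel)"
  proof -
    have [measurable]: "(\<lambda>x. x 1) \<in> borel_measurable (\<Pi>\<^sub>M i\<in>I. borel)" "(\<lambda>x. x (1 + k)) \<in> borel_measurable (\<Pi>\<^sub>M i\<in>I. (borel :: real measure))"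
      by (auto intro!: measurable_component_singleton simp: I_def)
    have "(\<lambda>x. (x 1, x (1 + k))) \<in> measurable (\<Pi>\<^sub>M i\<in>I. borel) (borel \<Otimes>\<^sub>M (borel :: real measure))"
      by measurable
    from measurable_compose[OF this F] show ?thesis by simp
  qed
  have s: "1 + h = i" "1 + k + h = i + k" using i by (auto simp: h_def)
  have "expectation (\<lambda>\<omega>. F (Y i \<omega>) (Y (i + k) \<omega>)) = (\<integral>x. F (x 1) (x (1 + k)) \<partial>distr M (\<Pi>\<^sub>M i\<in>I. borel) (\<lambda>\<omega>. \<lambda>i\<in>I. Y (i + h) \<omega>))"
    using s by (subst integral_distr[OF mI G]) (auto simp: I_def add.commute add.left_commute)
  also have "\<dots> = expectation (\<lambda>\<omega>. F (Y 1 \<omega>) (Y (1 + k) \<omega>))"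
    unfolding eq by (subst integral_distr[OF mI0 G]) (auto simp: I_def add.commute add.left_commute)
  finally show "expectation (\<lambda>\<omega>. F (Y i \<omega>) (Y (i + k) \<omega>)) = expectation (\<lambda>\<omega>. F (Y 1 \<omega>) (Y (1 + k) \<omega>))" .
  have "integrable M (\<lambda>\<omega>. F (Y i \<omega>) (Y (i + k) \<omega>)) \<longleftrightarrow> integrable (distr M (\<Pi>\<^sub>M i\<in>I. borel) (\<lambda>\<omega>. \<lambda>i\<in>I. Y (i + h) \<omega>)) (\<lambda>x. F (x 1) (x (1 + k)))"
    using s by (subst integrable_distr_eq[OF mI G]) (auto simp: I_def add.commute add.left_commute)
  also have "\<dots> \<longleftrightarrow> integrable M (\<lambda>\<omega>. F (Y 1 \<omega>) (Y (1 + k) \<omega>))"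
    unfolding eq by (subst integrable_distr_eq[OF mI0 G]) (auto simp: I_def add.commute add.left_commute)
  finally show "integrable M (\<lambda>\<omega>. F (Y i \<omega>) (Y (i + k) \<omega>)) \<longleftrightarrow> integrable M (\<lambda>\<omega>. F (Y 1 \<omega>) (Y (1 + k) \<omega>))" .
qed

lemma stationary_single:
  fixes f :: "real \<Rightarrow> real"
  assumes [measurable]: "f \<in> borel_measurable borel" and i: "i \<ge> 1"
  shows "expectation (\<lambda>\<omega>. f (Y i \<omega>)) = expectation (\<lambda>\<omega>. f (Y 1 \<omega>))"
    and "integrable M (\<lambda>\<omega>. f (Y i \<omega>)) \<longleftrightarrow> integrable M (\<lambda>\<omega>. f (Y 1 \<omega>))"
  using stationary_pair[of "\<lambda>x y. f x" i 0] i by simp_all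

text \<open>The envelope \<open>h\<close> carries the moment: one constant then serves all
  \<open>f\<close> and \<open>g\<close> below it, in particular all truncation levels at
  once.\<close>

lemma cov_pair:
  assumes f [measurable]: "f \<in> borel_measurable borel" and g [measurable]: "g \<in> borel_measurable borel"
    and "\<And>y. \<bar>f y\<bar> \<le> h y" "\<And>y. \<bar>g y\<bar> \<le> h y"
    and h [measurable]: "h \<in> borel_measurable borel"
    and ih: "integrable M (\<lambda>\<omega>. h (Y 1 \<omega>) powr p)" and K: "expectation (\<lambda>\<omega>. h (Y 1 \<omega>) powr p) \<le> K"
    and f0: "expectation (\<lambda>\<omega>. f (Y 1 \<omega>)) = 0" and "p > 2" "i \<ge> 1" "k \<ge> 1"
  shows "\<bar>expectation (\<lambda>\<omega>. f (Y i \<omega>) * g (Y (i + k) \<omega>))\<bar> \<le> 4 * (1 + K)\<^sup>2 * C * real k powr (- (\<theta> * (1 - 2/p)))"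
    and "integrable M (\<lambda>\<omega>. f (Y i \<omega>) * g (Y (i + k) \<omega>))"
proof -
  have m: "integrable M (\<lambda>\<omega>. \<bar>f (Y j \<omega>)\<bar> powr p) \<and> expectation (\<lambda>\<omega>. \<bar>f (Y j \<omega>)\<bar> powr p) \<le> K"
    if "j \<ge> 1" "\<And>y. \<bar>f y\<bar> \<le> h y" "f \<in> borel_measurable borel" for f j
  proof -
    note [measurable] = that(3)
    have 1: "integrable M (\<lambda>\<omega>. h (Y j \<omega>) powr p)"
      using ih stationary_single(2)[of "\<lambda>y. h y powr p", OF _ that(1)] by simp
    have 2: "\<bar>f y\<bar> powr p \<le> h y powr p" for y using \<open>p > 2\<close> by (intro powr_mono2 that) auto
    have 3: "integrable M (\<lambda>\<omega>. \<bar>f (Y j \<omega>)\<bar> powr p)"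
      by (rule integrable_dominated[OF _ 1]) (use 2 that in auto)
    have "expectation (\<lambda>\<omega>. \<bar>f (Y j \<omega>)\<bar> powr p) \<le> expectation (\<lambda>\<omega>. h (Y j \<omega>) powr p)"
      by (rule integral_mono[OF 3 1 2])
    also have "\<dots> \<le> K" using K stationary_single(1)[of "\<lambda>y. h y powr p", OF _ that(1)] by simp
    finally show ?thesis using 3 by simp
  qed
  have mf: "(\<lambda>\<omega>. f (Y i \<omega>)) \<in> borel_measurable (gen {1..i})" "(\<lambda>\<omega>. g (Y (i + k) \<omega>)) \<in> borel_measurable (gen {i + k..})"
    using \<open>i \<ge> 1\<close> by (auto intro!: measurable_compose[OF Y_gen])
  have fi: "expectation (\<lambda>\<omega>. f (Y i \<omega>)) = 0"
    using f0 stationary_single(1)[OF f \<open>i \<ge> 1\<close>] by simp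
  have t: "1 - 1/p - 1/p = 1 - 2/p" by simp
  have mm: "integrable M (\<lambda>\<omega>. \<bar>f (Y i \<omega>)\<bar> powr p)" "expectation (\<lambda>\<omega>. \<bar>f (Y i \<omega>)\<bar> powr p) \<le> K"
    "integrable M (\<lambda>\<omega>. \<bar>g (Y (i + k) \<omega>)\<bar> powr p)" "expectation (\<lambda>\<omega>. \<bar>g (Y (i + k) \<omega>)\<bar> powr p) \<le> K"
    using m[OF \<open>i \<ge> 1\<close> assms(3) f] m[OF _ assms(4) g, of "i + k"] \<open>i \<ge> 1\<close> by auto
  note c = cov_gap[OF mf \<open>i \<ge> 1\<close> \<open>k \<ge> 1\<close>, of p p K]
  show "\<bar>expectation (\<lambda>\<omega>. f (Y i \<omega>) * g (Y (i + k) \<omega>))\<bar> \<le> 4 * (1 + K)\<^sup>2 * C * real k powr (- (\<theta> * (1 - 2/p)))"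
  proof -
    have "\<bar>expectation (\<lambda>\<omega>. f (Y i \<omega>) * g (Y (i + k) \<omega>)) - expectation (\<lambda>\<omega>. f (Y i \<omega>)) * expectation (\<lambda>\<omega>. g (Y (i + k) \<omega>))\<bar>
      \<le> 4 * (1 + K)\<^sup>2 * C * real k powr (- (\<theta> * (1 - 1/p - 1/p)))"
      using mm(1) mm(3) mm(2) mm(4) by (rule c(1)) (use \<open>p > 2\<close> in auto)
    then show ?thesis unfolding t fi by simp
  qed
  show "integrable M (\<lambda>\<omega>. f (Y i \<omega>) * g (Y (i + k) \<omega>))"
    using mm(1) mm(3) mm(2) mm(4) by (rule c(2)) (use \<open>p > 2\<close> in auto)
qed

end

text \<open>Three factors of moment order \<open>p\<close> leave the exponent
  \<open>1 - 3 / p\<close> in Davydov's inequality. Asking the resulting decay to exceed 2 makes the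
  sum of \<open>k * k powr (- \<beta>)\<close> finite; both the count of gap pairs and the
  comparison of variances use this.\<close>

locale mixing_functional = mixing_process +
  fixes \<phi> :: "real \<Rightarrow> real" and p K :: real
  assumes \<phi>_measurable [measurable]: "\<phi> \<in> borel_measurable borel"
    and \<phi>_centered: "expectation (\<lambda>\<omega>. \<phi> (Y 1 \<omega>)) = 0"
    and p_gt_3: "p > 3" and rate: "\<theta> * (1 - 3 / p) > 2"
    and \<phi>_int: "integrable M (\<lambda>\<omega>. \<bar>\<phi> (Y 1 \<omega>)\<bar> powr p)"
    and \<phi>_moment: "expectation (\<lambda>\<omega>. \<bar>\<phi> (Y 1 \<omega>)\<bar> powr p) \<le> K"
begin

definition \<xi> :: "nat \<Rightarrow> 'a \<Rightarrow> real" where "\<xi> i \<omega> = \<phi> (Y i \<omega>)"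
definition \<beta> :: real where "\<beta> = \<theta> * (1 - 3 / p)"
text \<open>One constant above all moments up to order \<open>p\<close> and above every covariance
  constant that arises, including the case where a product of expectations is estimated
  separately.\<close>

definition D :: real where "D = 4 * (1 + 2 * K)\<^sup>2 * C * (2 + K)"
definition \<gamma> :: "nat \<Rightarrow> real" where "\<gamma> k = expectation (\<lambda>\<omega>. \<xi> 1 \<omega> * \<xi> (1 + k) \<omega>)"

lemma \<beta>_gt_2: "\<beta> > 2" using rate by (simp add: \<beta>_def)

lemma K_nonneg: "K \<ge> 0"
  by (rule order_trans[OF Bochner_Integration.integral_nonneg \<phi>_moment]) simp

lemma D_facts: "4 * (1 + 2 * K)\<^sup>2 * C \<le> D" "4 * (1 + K)\<^sup>2 * C \<le> D" "1 + K \<le> D" "1 \<le> D"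
  "4 * (1 + 2 * K)\<^sup>2 * C + (1 + K) * (4 * (1 + K)\<^sup>2 * C) \<le> D"
proof -
  define E where "E = 4 * (1 + 2 * K)\<^sup>2 * C"
  have e: "4 * (1 + K)\<^sup>2 * C \<le> E"
    unfolding E_def using K_nonneg C_ge_1 by (intro mult_right_mono mult_left_mono power_mono) auto
  have "1 * 1 * 1 \<le> 4 * (1 + 2 * K)\<^sup>2 * C"
    using K_nonneg C_ge_1 by (intro mult_mono) (auto intro: one_le_power)
  then have E1: "E \<ge> 1" by (simp add: E_def)
  have D: "D = E * (2 + K)" by (simp add: D_def E_def)
  have "(1 + K) * (4 * (1 + K)\<^sup>2 * C) \<le> (1 + K) * E" using e K_nonneg by (intro mult_left_mono) auto
  then show "4 * (1 + 2 * K)\<^sup>2 * C + (1 + K) * (4 * (1 + K)\<^sup>2 * C) \<le> D"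
    unfolding D E_def[symmetric] by (simp add: algebra_simps)
  have "E * 1 \<le> E * (2 + K)" using E1 K_nonneg by (intro mult_left_mono) auto
  then show 1: "4 * (1 + 2 * K)\<^sup>2 * C \<le> D" unfolding D E_def[symmetric] by simp
  then show "4 * (1 + K)\<^sup>2 * C \<le> D" using e unfolding E_def[symmetric] by simp
  show "1 \<le> D" using 1 E1 unfolding E_def[symmetric] by simp
  have "1 * (2 + K) \<le> E * (2 + K)" using E1 K_nonneg by (intro mult_right_mono) auto
  then show "1 + K \<le> D" unfolding D by simp
qed

lemma D_nonneg: "D \<ge> 0" using D_facts(4) by simp

lemma \<xi>_measurable [measurable]: "i \<ge> 1 \<Longrightarrow> \<xi> i \<in> borel_measurable M"
  unfolding \<xi>_def[abs_def] by measurable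

lemma \<xi>_gen: "i \<in> I \<Longrightarrow> \<xi> i \<in> borel_measurable (gen I)"
  unfolding \<xi>_def[abs_def] using measurable_compose[OF Y_gen \<phi>_measurable] by simp

lemma \<xi>_moment:
  assumes "i \<ge> 1"
  shows "integrable M (\<lambda>\<omega>. \<bar>\<xi> i \<omega>\<bar> powr p)" "expectation (\<lambda>\<omega>. \<bar>\<xi> i \<omega>\<bar> powr p) \<le> K"
  using stationary_single[of "\<lambda>y. \<bar>\<phi> y\<bar> powr p", OF _ assms] \<phi>_int \<phi>_moment by (simp_all add: \<xi>_def)

lemma \<xi>_centered: "i \<ge> 1 \<Longrightarrow> expectation (\<xi> i) = 0"
  unfolding \<xi>_def[abs_def] using stationary_single(1)[OF \<phi>_measurable, of i] \<phi>_centered by simp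

lemma \<xi>_power:
  assumes i: "i \<ge> 1" and q: "0 \<le> q" "q \<le> p"
  shows "integrable M (\<lambda>\<omega>. \<bar>\<xi> i \<omega>\<bar> powr q)" "expectation (\<lambda>\<omega>. \<bar>\<xi> i \<omega>\<bar> powr q) \<le> D"
proof -
  note [measurable] = \<xi>_measurable[OF i]
  have b: "\<bar>x\<bar> powr q \<le> 1 + \<bar>x\<bar> powr p" for x :: real
  proof (cases "\<bar>x\<bar> \<le> 1")
    case True then have "\<bar>x\<bar> powr q \<le> 1" using q by (intro powr_le1) auto
    then show ?thesis by (smt (verit) powr_ge_zero)
  next
    case False then have "\<bar>x\<bar> powr q \<le> \<bar>x\<bar> powr p" using q by (intro powr_mono) auto
    then show ?thesis by simp
  qed
  have i1: "integrable M (\<lambda>\<omega>. 1 + \<bar>\<xi> i \<omega>\<bar> powr p)" using \<xi>_moment[OF i] by simp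
  show i2: "integrable M (\<lambda>\<omega>. \<bar>\<xi> i \<omega>\<bar> powr q)"
    by (rule integrable_dominated[OF _ i1]) (use b in auto)
  have "expectation (\<lambda>\<omega>. \<bar>\<xi> i \<omega>\<bar> powr q) \<le> expectation (\<lambda>\<omega>. 1 + \<bar>\<xi> i \<omega>\<bar> powr p)"
    by (rule integral_mono[OF i2 i1 b])
  also have "\<dots> \<le> 1 + K" using \<xi>_moment[OF i] by (simp add: prob_space)
  finally show "expectation (\<lambda>\<omega>. \<bar>\<xi> i \<omega>\<bar> powr q) \<le> D" using D_facts by linarith
qed

lemma \<xi>_abs: assumes i: "i \<ge> 1"
  shows "integrable M (\<xi> i)" "integrable M (\<lambda>\<omega>. \<bar>\<xi> i \<omega>\<bar>)" "expectation (\<lambda>\<omega>. \<bar>\<xi> i \<omega>\<bar>) \<le> D"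
proof -
  show 1: "integrable M (\<lambda>\<omega>. \<bar>\<xi> i \<omega>\<bar>)" "expectation (\<lambda>\<omega>. \<bar>\<xi> i \<omega>\<bar>) \<le> D"
    using \<xi>_power[OF i, of 1] p_gt_3 by simp_all
  show "integrable M (\<xi> i)"
    by (rule integrable_dominated[OF _ 1(1)]) (use i in auto)
qed

lemma \<xi>_square: assumes i: "i \<ge> 1"
  shows "integrable M (\<lambda>\<omega>. (\<xi> i \<omega>)\<^sup>2)" "expectation (\<lambda>\<omega>. (\<xi> i \<omega>)\<^sup>2) \<le> D"
  using \<xi>_power[OF i, of 2] p_gt_3 by simp_all

lemma \<xi>_cube: assumes i: "i \<ge> 1"
  shows "integrable M (\<lambda>\<omega>. \<bar>\<xi> i \<omega>\<bar> ^ 3)" "expectation (\<lambda>\<omega>. \<bar>\<xi> i \<omega>\<bar> ^ 3) \<le> D"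
  using \<xi>_power[OF i, of 3] p_gt_3 by simp_all

lemma \<xi>_prod_integrable:
  assumes "i \<ge> 1" "j \<ge> 1" shows "integrable M (\<lambda>\<omega>. \<xi> i \<omega> * \<xi> j \<omega>)"
proof -
  have "integrable M (\<lambda>\<omega>. (\<xi> i \<omega>)\<^sup>2 + (\<xi> j \<omega>)\<^sup>2)" using \<xi>_square assms by simp
  then show ?thesis
  proof (rule integrable_dominated[rotated])
    fix \<omega>
    have "0 \<le> (\<bar>\<xi> i \<omega>\<bar> - \<bar>\<xi> j \<omega>\<bar>)\<^sup>2" by simp
    then have "2 * (\<bar>\<xi> i \<omega>\<bar> * \<bar>\<xi> j \<omega>\<bar>) \<le> (\<xi> i \<omega>)\<^sup>2 + (\<xi> j \<omega>)\<^sup>2" unfolding power2_diff by simp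
    moreover have "0 \<le> \<bar>\<xi> i \<omega>\<bar> * \<bar>\<xi> j \<omega>\<bar>" by simp
    ultimately show "\<bar>\<xi> i \<omega> * \<xi> j \<omega>\<bar> \<le> (\<xi> i \<omega>)\<^sup>2 + (\<xi> j \<omega>)\<^sup>2" unfolding abs_mult by linarith
  qed (use assms in auto)
qed

lemma \<gamma>_shift:
  assumes "i \<ge> 1" shows "expectation (\<lambda>\<omega>. \<xi> i \<omega> * \<xi> (i + k) \<omega>) = \<gamma> k"
  unfolding \<gamma>_def \<xi>_def using stationary_pair(1)[of "\<lambda>x y. \<phi> x * \<phi> y" i k] assms by simp

lemma gap_powr_le: "k \<ge> 1 \<Longrightarrow> b \<ge> \<beta> \<Longrightarrow> real k powr (- b) \<le> real k powr (- \<beta>)"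
  by (intro powr_mono) auto

text \<open>The three exponents of the moments involved never add up to more than \<open>3 / p\<close>, so all
  covariances across a gap \<open>k\<close> are at most of order \<open>k powr -\<beta>\<close>.\<close>

lemma cov_past_square:
  assumes R: "R \<in> borel_measurable (gen {1..m})" and mk: "m \<ge> 1" "k \<ge> 1"
    and le: "\<And>\<omega>. \<omega> \<in> space M \<Longrightarrow> \<bar>R \<omega>\<bar> \<le> (\<xi> m \<omega>)\<^sup>2"
  shows "\<bar>expectation (\<lambda>\<omega>. R \<omega> * \<xi> (m + k) \<omega>)\<bar> \<le> D * real k powr (- \<beta>)"
    and "integrable M (\<lambda>\<omega>. R \<omega> * \<xi> (m + k) \<omega>)"
proof -
  have [measurable]: "R \<in> borel_measurable M" by (rule gen_measurable[OF _ R]) auto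
  have b: "\<bar>R \<omega>\<bar> powr (p/2) \<le> \<bar>\<xi> m \<omega>\<bar> powr p" if "\<omega> \<in> space M" for \<omega>
  proof -
    have "\<bar>R \<omega>\<bar> powr (p/2) \<le> ((\<xi> m \<omega>)\<^sup>2) powr (p/2)" using le[OF that] p_gt_3 by (intro powr_mono2) auto
    also have "(\<xi> m \<omega>)\<^sup>2 = \<bar>\<xi> m \<omega>\<bar> powr 2" by simp
    also have "(\<bar>\<xi> m \<omega>\<bar> powr 2) powr (p/2) = \<bar>\<xi> m \<omega>\<bar> powr p" by (simp only: powr_powr) simp
    finally show ?thesis .
  qed
  have i: "integrable M (\<lambda>\<omega>. \<bar>R \<omega>\<bar> powr (p/2))"
    by (rule integrable_dominated[OF _ \<xi>_moment(1)[OF mk(1)]]) (use b in auto)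
  have e: "expectation (\<lambda>\<omega>. \<bar>R \<omega>\<bar> powr (p/2)) \<le> K"
    using integral_mono[OF i \<xi>_moment(1)[OF mk(1)] b] \<xi>_moment(2)[OF mk(1)] by simp
  have mk1: "m + k \<ge> 1" using mk by simp
  have g: "\<xi> (m + k) \<in> borel_measurable (gen {m + k..})" by (rule \<xi>_gen) simp
  have pr: "p/2 \<ge> 1" "p \<ge> 1" "1/(p/2) + 1/p < 1" using p_gt_3 by (auto simp: field_simps)
  have t: "1 - 1/(p/2) - 1/p = 1 - 3/p" by simp
  note c = cov_gap[OF R g mk i \<xi>_moment(1)[OF mk1] e \<xi>_moment(2)[OF mk1] pr, unfolded t]
  have "\<bar>expectation (\<lambda>\<omega>. R \<omega> * \<xi> (m + k) \<omega>)\<bar> \<le> 4 * (1 + K)\<^sup>2 * C * real k powr (- \<beta>)"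
    using c(1) \<xi>_centered[OF mk1] by (simp add: \<beta>_def)
  also have "\<dots> \<le> D * real k powr (- \<beta>)" using D_facts by (intro mult_right_mono) auto
  finally show "\<bar>expectation (\<lambda>\<omega>. R \<omega> * \<xi> (m + k) \<omega>)\<bar> \<le> D * real k powr (- \<beta>)" .
  show "integrable M (\<lambda>\<omega>. R \<omega> * \<xi> (m + k) \<omega>)" by (rule c(2))
qed

lemma \<gamma>_le: assumes "k \<ge> 1" shows "\<bar>\<gamma> k\<bar> \<le> 4 * (1 + K)\<^sup>2 * C * real k powr (- \<beta>)"
proof -
  have "\<bar>expectation (\<lambda>\<omega>. \<phi> (Y 1 \<omega>) * \<phi> (Y (1 + k) \<omega>))\<bar> \<le> 4 * (1 + K)\<^sup>2 * C * real k powr (- (\<theta> * (1 - 2/p)))"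
    by (rule cov_pair(1)[where h="\<lambda>y. \<bar>\<phi> y\<bar>"]) (use \<phi>_int \<phi>_moment \<phi>_centered p_gt_3 assms in auto)
  also have "\<dots> \<le> 4 * (1 + K)\<^sup>2 * C * real k powr (- \<beta>)"
  proof (intro mult_left_mono gap_powr_le assms)
    show "\<beta> \<le> \<theta> * (1 - 2/p)" unfolding \<beta>_def using \<theta>_pos p_gt_3 by (intro mult_left_mono) (auto simp: divide_right_mono)
  qed (use C_ge_1 in auto)
  finally show ?thesis by (simp add: \<gamma>_def \<xi>_def)
qed

lemma \<gamma>_le': "k \<ge> 1 \<Longrightarrow> \<bar>\<gamma> k\<bar> \<le> D * real k powr (- \<beta>)"
  using \<gamma>_le[of k] D_facts(2) by (meson mult_right_mono order_trans powr_ge_zero)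

text \<open>There are two gaps, \<open>m\<close> before the pair and \<open>k\<close> inside it, and
  the larger one is used. If it is \<open>m\<close>, the past is separated from the pair. If it is
  \<open>k\<close>, the last variable is split off: it is centred, so the mixed moment and
  \<open>\<gamma> k\<close> are small separately. Decay in the maximum of the gaps is what makes the
  double sum over them finite.\<close>

lemma cov_past_prod:
  assumes G: "G \<in> borel_measurable (gen {1..j})" and j: "j \<ge> 1" and m: "m \<ge> 1"
    and le: "\<And>\<omega>. \<omega> \<in> space M \<Longrightarrow> \<bar>G \<omega>\<bar> \<le> \<bar>\<xi> j \<omega>\<bar>"
  shows "\<bar>expectation (\<lambda>\<omega>. G \<omega> * (\<xi> (j + m) \<omega> * \<xi> (j + m + k) \<omega>)) - expectation G * \<gamma> k\<bar>
       \<le> D * real (max m k) powr (- \<beta>)"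
    and "integrable M (\<lambda>\<omega>. G \<omega> * (\<xi> (j + m) \<omega> * \<xi> (j + m + k) \<omega>))"
proof -
  let ?V = "\<lambda>\<omega>. \<xi> (j + m) \<omega> * \<xi> (j + m + k) \<omega>"
  have jm: "j + m \<ge> 1" "j + m + k \<ge> 1" using m by auto
  note [measurable] = \<xi>_measurable[OF jm(1)] \<xi>_measurable[OF jm(2)]
  have [measurable]: "G \<in> borel_measurable M" by (rule gen_measurable[OF _ G]) auto
  \<comment> \<open>The product is at most the square of the larger modulus, so half the moment
    order suffices for it.\<close>
  have pb: "\<bar>x * y\<bar> powr (p/2) \<le> \<bar>x\<bar> powr p + \<bar>y\<bar> powr p" for x y :: real
  proof -
    define z where "z = max \<bar>x\<bar> \<bar>y\<bar>"
    have "\<bar>x * y\<bar> \<le> z * z" unfolding abs_mult z_def by (intro mult_mono) auto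
    then have "\<bar>x * y\<bar> powr (p/2) \<le> (z * z) powr (p/2)" using p_gt_3 by (intro powr_mono2) auto
    also have "z * z = z powr 2" by (simp add: power2_eq_square z_def)
    also have "(z powr 2) powr (p/2) = z powr p" by (simp only: powr_powr) simp
    also have "\<dots> \<le> \<bar>x\<bar> powr p + \<bar>y\<bar> powr p" by (auto simp: z_def max_def)
    finally show ?thesis .
  qed
  have iV: "integrable M (\<lambda>\<omega>. \<bar>?V \<omega>\<bar> powr (p/2))" and eV: "expectation (\<lambda>\<omega>. \<bar>?V \<omega>\<bar> powr (p/2)) \<le> 2 * K"
  proof -
    have 1: "integrable M (\<lambda>\<omega>. \<bar>\<xi> (j + m) \<omega>\<bar> powr p + \<bar>\<xi> (j + m + k) \<omega>\<bar> powr p)" using \<xi>_moment jm by simp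
    show 2: "integrable M (\<lambda>\<omega>. \<bar>?V \<omega>\<bar> powr (p/2))"
      by (rule integrable_dominated[OF _ 1]) (use pb in auto)
    show "expectation (\<lambda>\<omega>. \<bar>?V \<omega>\<bar> powr (p/2)) \<le> 2 * K"
      using integral_mono[OF 2 1 pb] \<xi>_moment[OF jm(1)] \<xi>_moment[OF jm(2)] by simp
  qed
  have gp: "\<bar>G \<omega>\<bar> powr p \<le> \<bar>\<xi> j \<omega>\<bar> powr p" if "\<omega> \<in> space M" for \<omega>
    using le[OF that] p_gt_3 by (intro powr_mono2) auto
  have iG: "integrable M (\<lambda>\<omega>. \<bar>G \<omega>\<bar> powr p)"
    by (rule integrable_dominated[OF _ \<xi>_moment(1)[OF j]]) (use gp in auto)
  have eG: "expectation (\<lambda>\<omega>. \<bar>G \<omega>\<bar> powr p) \<le> K"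
    using integral_mono[OF iG \<xi>_moment(1)[OF j] gp] \<xi>_moment(2)[OF j] by simp
  have mV: "?V \<in> borel_measurable (gen {j + m..})"
    by (intro borel_measurable_times \<xi>_gen) auto
  have pr: "p \<ge> 1" "p/2 \<ge> 1" "1/p + 1/(p/2) < 1" "1/(p/2) + 1/p < 1" using p_gt_3 by (auto simp: field_simps)
  have t: "1 - 1/p - 1/(p/2) = 1 - 3/p" "1 - 1/(p/2) - 1/p = 1 - 3/p" by simp_all
  have K2: "K \<le> 2 * K" using K_nonneg by simp
  have eV0: "expectation ?V = \<gamma> k" using \<gamma>_shift[OF jm(1)] by simp
  note c1 = cov_gap[OF G mV j m iG iV order_trans[OF eG K2] eV pr(1,2,3), unfolded t eV0]
  show "integrable M (\<lambda>\<omega>. G \<omega> * ?V \<omega>)" using c1(2) .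
  show "\<bar>expectation (\<lambda>\<omega>. G \<omega> * ?V \<omega>) - expectation G * \<gamma> k\<bar> \<le> D * real (max m k) powr (- \<beta>)"
  proof (cases "k \<le> m")
    case True
    then have mx: "max m k = m" by simp
    show ?thesis using c1(1) D_facts(1) unfolding mx \<beta>_def[symmetric]
      by (meson mult_right_mono order_trans powr_ge_zero)
  next
    case False
    then have mx: "max m k = k" and k: "k \<ge> 1" by auto
    let ?U = "\<lambda>\<omega>. G \<omega> * \<xi> (j + m) \<omega>"
    have mU: "?U \<in> borel_measurable (gen {1..j + m})"
      by (intro borel_measurable_times gen_mono[OF _ G] \<xi>_gen) (use jm in auto)
    have mW: "\<xi> (j + m + k) \<in> borel_measurable (gen {j + m + k..})" by (rule \<xi>_gen) simp
    have ub: "\<bar>?U \<omega>\<bar> powr (p/2) \<le> \<bar>G \<omega>\<bar> powr p + \<bar>\<xi> (j + m) \<omega>\<bar> powr p" for \<omega> by (rule pb)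
    have 1: "integrable M (\<lambda>\<omega>. \<bar>G \<omega>\<bar> powr p + \<bar>\<xi> (j + m) \<omega>\<bar> powr p)" using \<xi>_moment jm iG by simp
    have iU: "integrable M (\<lambda>\<omega>. \<bar>?U \<omega>\<bar> powr (p/2))"
      by (rule integrable_dominated[OF _ 1]) (use ub in auto)
    have eU: "expectation (\<lambda>\<omega>. \<bar>?U \<omega>\<bar> powr (p/2)) \<le> 2 * K"
      using integral_mono[OF iU 1 ub] \<xi>_moment[OF jm(1)] iG eG by simp
    have "\<bar>expectation (\<lambda>\<omega>. ?U \<omega> * \<xi> (j + m + k) \<omega>)\<bar> \<le> 4 * (1 + 2 * K)\<^sup>2 * C * real k powr (- \<beta>)"
      using cov_gap(1)[OF mU mW jm(1) k iU \<xi>_moment(1)[OF jm(2)] eU order_trans[OF \<xi>_moment(2)[OF jm(2)] K2] pr(2,1,4), unfolded t]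
      by (simp add: \<xi>_centered[OF jm(2)] \<beta>_def)
    then have A: "\<bar>expectation (\<lambda>\<omega>. G \<omega> * ?V \<omega>)\<bar> \<le> 4 * (1 + 2 * K)\<^sup>2 * C * real k powr (- \<beta>)"
      by (simp add: mult.assoc)
    have "\<bar>expectation G\<bar> \<le> expectation (\<lambda>\<omega>. \<bar>G \<omega>\<bar>)" by (rule integral_abs_bound)
    also have "\<dots> \<le> expectation (\<lambda>\<omega>. 1 + \<bar>G \<omega>\<bar> powr p)"
      by (intro integral_mono abs_le_one_plus_powr integrable_abs integrable_powr_less[OF _ iG pr(1)]) (use iG pr in auto)
    also have "\<dots> \<le> 1 + K" using iG eG by (simp add: prob_space)
    finally have "\<bar>expectation G * \<gamma> k\<bar> \<le> (1 + K) * (4 * (1 + K)\<^sup>2 * C * real k powr (- \<beta>))"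
      unfolding abs_mult using \<gamma>_le[OF k] K_nonneg by (intro mult_mono) auto
    then have "\<bar>expectation (\<lambda>\<omega>. G \<omega> * ?V \<omega>) - expectation G * \<gamma> k\<bar>
        \<le> (4 * (1 + 2 * K)\<^sup>2 * C + (1 + K) * (4 * (1 + K)\<^sup>2 * C)) * real k powr (- \<beta>)"
      using A by (simp only: distrib_right)
    also have "\<dots> \<le> D * real k powr (- \<beta>)" using D_facts(5) by (intro mult_right_mono) auto
    finally show ?thesis unfolding mx .
  qed
qed

end

section \<open>Covariances inside a weighted window sum\<close>

lemma sum_telescope_pred:
  fixes f :: "nat \<Rightarrow> real"
  assumes "j \<ge> 1" shows "(\<Sum>t=1..<j. f t - f (t - 1)) = f (j - 1) - f 0"
  using assms
proof (induction j rule: dec_induct)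
  case (step n)
  then have "{1..<Suc n} = insert n {1..<n}" by auto
  then show ?case using step by simp
qed simp

text \<open>Exactly \<open>2 * M\<close> pairs have maximum \<open>M\<close>: the induction step
  adds one row and one column of equal entries.\<close>

lemma max_powr_sum_le:
  assumes "b > (2::real)"
  shows "(\<Sum>d<n. \<Sum>m=1..<n. real (max m d) powr (- b)) \<le> 2 * (\<Sum>M<n. real M powr (1 - b))"
proof (induction n)
  case (Suc n)
  show ?case
  proof (cases "n = 0")
    case False
    then have ins: "{1..<Suc n} = insert n {1..<n}" by auto
    have q: "real n * real n powr (- b) = real n powr (1 - b)"
      using False by (simp add: powr_mult_base)
    have "(\<Sum>d<Suc n. \<Sum>m=1..<Suc n. real (max m d) powr (- b))
        = (\<Sum>d<n. \<Sum>m=1..<Suc n. real (max m d) powr (- b)) + (\<Sum>m=1..<Suc n. real (max m n) powr (- b))"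
      by (rule sum.lessThan_Suc)
    also have "(\<Sum>d<n. \<Sum>m=1..<Suc n. real (max m d) powr (- b)) = (\<Sum>d<n. real n powr (- b) + (\<Sum>m=1..<n. real (max m d) powr (- b)))"
      unfolding ins by (intro sum.cong refl) (simp add: max_def)
    also have "\<dots> = real n powr (1 - b) + (\<Sum>d<n. \<Sum>m=1..<n. real (max m d) powr (- b))"
      by (simp add: sum.distrib q)
    also have "(\<Sum>m=1..<Suc n. real (max m n) powr (- b)) = (\<Sum>m=1..<Suc n. real n powr (- b))"
      by (intro sum.cong refl) (simp add: max_def)
    also have "\<dots> = real n powr (1 - b)" using q by (simp only: sum_constant card_atLeastLessThan) simp
    finally show ?thesis using Suc by simp
  qed simp
qed simp

lemma abs_diff_mult_trans:
  fixes x g y z p q :: real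
  assumes "\<bar>x - g * y\<bar> \<le> p" "\<bar>g\<bar> * \<bar>y - z\<bar> \<le> q" shows "\<bar>x - g * z\<bar> \<le> p + q"
proof -
  have "x - g * z = (x - g * y) + g * (y - z)" by (simp add: algebra_simps)
  then show ?thesis using assms abs_triangle_ineq[of "x - g * y" "g * (y - z)"] by (simp add: abs_mult)
qed

text \<open>\<open>r\<close> is the offset of the window in the process; the weights
  \<open>a\<close> will be the contrast coefficients of the estimator times the values of
  \<open>\<sigma>\<close>.\<close>

locale mixing_window = mixing_functional +
  fixes r :: nat and a :: "nat \<Rightarrow> real" and V :: real
  assumes V_ge_1: "V \<ge> 1" and a_le: "\<And>i. \<bar>a i\<bar> \<le> V"
begin

definition X :: "nat \<Rightarrow> 'a \<Rightarrow> real" where "X i \<omega> = a i * \<xi> (r + i) \<omega>"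
definition S :: "nat \<Rightarrow> 'a \<Rightarrow> real" where "S j \<omega> = (\<Sum>i=1..j. X i \<omega>)"

lemma X_gen: "i \<ge> 1 \<Longrightarrow> r + i \<in> I \<Longrightarrow> X i \<in> borel_measurable (gen I)"
  unfolding X_def[abs_def] using \<xi>_gen[of "r + i" I] by measurable

lemma X_measurable [measurable]: "i \<ge> 1 \<Longrightarrow> X i \<in> borel_measurable M"
  unfolding X_def[abs_def] by measurable

lemma S_gen: "S j \<in> borel_measurable (gen {1..r + j})"
  unfolding S_def[abs_def] by (intro borel_measurable_sum X_gen) auto

lemma S_measurable [measurable]: "S j \<in> borel_measurable M"
  by (rule gen_measurable[OF _ S_gen]) auto

lemma S_Suc: "j \<ge> 1 \<Longrightarrow> S j \<omega> = S (j - 1) \<omega> + X j \<omega>"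
  unfolding S_def by (cases j) auto

lemma S_0: "S 0 \<omega> = 0" by (simp add: S_def)

lemma X_abs:
  assumes "i \<ge> 1"
  shows "integrable M (X i)" "expectation (X i) = 0" "integrable M (\<lambda>\<omega>. \<bar>X i \<omega>\<bar>)" "expectation (\<lambda>\<omega>. \<bar>X i \<omega>\<bar>) \<le> V * D"
    "integrable M (\<lambda>\<omega>. \<bar>X i \<omega>\<bar> ^ 3)" "expectation (\<lambda>\<omega>. \<bar>X i \<omega>\<bar> ^ 3) \<le> V ^ 3 * D"
proof -
  have i: "r + i \<ge> 1" using assms by simp
  show 1: "integrable M (X i)" unfolding X_def[abs_def] using \<xi>_abs[OF i] by simp
  then show "integrable M (\<lambda>\<omega>. \<bar>X i \<omega>\<bar>)" by simp
  show "expectation (X i) = 0" unfolding X_def[abs_def] using \<xi>_centered[OF i] \<xi>_abs[OF i] by simp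
  have "expectation (\<lambda>\<omega>. \<bar>X i \<omega>\<bar>) = \<bar>a i\<bar> * expectation (\<lambda>\<omega>. \<bar>\<xi> (r + i) \<omega>\<bar>)"
    by (simp add: X_def abs_mult)
  also have "\<dots> \<le> V * D" using \<xi>_abs[OF i] a_le[of i] V_ge_1
    by (intro mult_mono) auto
  finally show "expectation (\<lambda>\<omega>. \<bar>X i \<omega>\<bar>) \<le> V * D" .
  show "integrable M (\<lambda>\<omega>. \<bar>X i \<omega>\<bar> ^ 3)" using \<xi>_cube[OF i] by (simp add: X_def abs_mult power_mult_distrib)
  have "expectation (\<lambda>\<omega>. \<bar>X i \<omega>\<bar> ^ 3) = \<bar>a i\<bar> ^ 3 * expectation (\<lambda>\<omega>. \<bar>\<xi> (r + i) \<omega>\<bar> ^ 3)"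
    by (simp add: X_def abs_mult power_mult_distrib)
  also have "\<dots> \<le> V ^ 3 * D" using \<xi>_cube[OF i] a_le[of i] V_ge_1
    by (intro mult_mono power_mono) auto
  finally show "expectation (\<lambda>\<omega>. \<bar>X i \<omega>\<bar> ^ 3) \<le> V ^ 3 * D" .
qed

lemma integrable_bdd:
  assumes [measurable]: "k \<in> borel_measurable borel" and "\<And>x. \<bar>k x\<bar> \<le> (1::real)"
  shows "integrable M (\<lambda>\<omega>. k (S j \<omega>))"
  by (rule integrable_dominated[where g="\<lambda>_. 1"]) (use assms in auto)

text \<open>Under independence the expectation would factor. Here \<open>k (S (j - 1))\<close> is
  written as a telescoping sum of increments, each at most \<open>V / v\<close> times one variable
  at gap \<open>j - t\<close> before the pair. Afterwards the argument is moved from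
  \<open>S (j - 1)\<close> to \<open>S (i - 1)\<close>, so that all \<open>j\<close> share the same
  factor; this costs \<open>i - j\<close> increments, paid for by the decay of
  \<open>\<gamma> (i - j)\<close>.\<close>

lemma prod_term:
  assumes j: "1 \<le> j" "j \<le> i" and k [measurable]: "k \<in> borel_measurable borel"
    and k1: "\<And>x. \<bar>k x\<bar> \<le> 1" and kl: "\<And>x y. \<bar>k y - k x\<bar> \<le> \<bar>y - x\<bar> / v" and v: "v \<ge> 1"
  shows "integrable M (\<lambda>\<omega>. X i \<omega> * X j \<omega> * k (S (j - 1) \<omega>))"
    and "\<bar>expectation (\<lambda>\<omega>. X i \<omega> * X j \<omega> * k (S (j - 1) \<omega>)) - a i * a j * \<gamma> (i - j) * expectation (\<lambda>\<omega>. k (S (i - 1) \<omega>))\<bar>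
      \<le> V ^ 3 * D\<^sup>2 / v * ((\<Sum>m=1..<i. real (max m (i - j)) powr (- \<beta>)) + real (i - j) powr (1 - \<beta>))"
proof -
  define d where "d = i - j"
  have i: "i = j + d" using j by (simp add: d_def)
  define W where "W \<omega> = \<xi> (r + j) \<omega> * \<xi> (r + i) \<omega>" for \<omega>
  have rj: "r + j \<ge> 1" "r + i \<ge> 1" using j by auto
  note [measurable] = \<xi>_measurable[OF rj(1)] \<xi>_measurable[OF rj(2)]
  have [measurable]: "W \<in> borel_measurable M" unfolding W_def by measurable
  have iW: "integrable M W" unfolding W_def[abs_def] by (rule \<xi>_prod_integrable[OF rj])
  have eW: "expectation W = \<gamma> d" unfolding W_def[abs_def] using \<gamma>_shift[OF rj(1), of d] by (simp add: i add.assoc)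
  have XW: "X i \<omega> * X j \<omega> * z = a i * a j * (z * W \<omega>)" for \<omega> z by (simp add: X_def W_def)
  define G where "G t \<omega> = k (S t \<omega>) - k (S (t - 1) \<omega>)" for t \<omega>
  have tele: "k (S (j - 1) \<omega>) = k 0 + (\<Sum>t=1..<j. G t \<omega>)" for \<omega>
    using sum_telescope_pred[OF j(1), of "\<lambda>t. k (S t \<omega>)"] by (simp add: G_def S_0)
  have iW': "integrable M (\<lambda>\<omega>. z \<omega> * W \<omega>)" if [measurable]: "z \<in> borel_measurable M" and "\<And>\<omega>. \<bar>z \<omega>\<bar> \<le> c" for z :: "'a \<Rightarrow> real" and c
  proof (rule integrable_dominated[where g="\<lambda>\<omega>. c * \<bar>W \<omega>\<bar>"])
    show "\<bar>z \<omega> * W \<omega>\<bar> \<le> c * \<bar>W \<omega>\<bar>" for \<omega>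
      unfolding abs_mult using that(2) by (rule mult_right_mono) simp
  qed (use iW in auto)
  have G_le: "\<bar>G t \<omega>\<bar> \<le> V / v * \<bar>\<xi> (r + t) \<omega>\<bar>" if "t \<ge> 1" for t \<omega>
  proof -
    have "\<bar>G t \<omega>\<bar> \<le> \<bar>S t \<omega> - S (t - 1) \<omega>\<bar> / v" unfolding G_def by (rule kl)
    also have "S t \<omega> - S (t - 1) \<omega> = X t \<omega>" using S_Suc[OF that] by simp
    also have "\<bar>X t \<omega>\<bar> / v \<le> V * \<bar>\<xi> (r + t) \<omega>\<bar> / v"
      using v a_le[of t] by (intro divide_right_mono) (auto simp: X_def abs_mult intro: mult_right_mono)
    finally show ?thesis by simp
  qed
  have G2: "\<bar>G t \<omega>\<bar> \<le> 2" for t \<omega> unfolding G_def using k1[of "S t \<omega>"] k1[of "S (t-1) \<omega>"] by linarith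
  have [measurable]: "G t \<in> borel_measurable M" for t unfolding G_def[abs_def] by measurable
  have Ggen: "G t \<in> borel_measurable (gen {1..r + t})" for t
  proof -
    have [measurable]: "S t \<in> borel_measurable (gen {1..r + t})" "S (t - 1) \<in> borel_measurable (gen {1..r + t})"
      by (rule S_gen) (rule gen_mono[OF _ S_gen], auto)
    show ?thesis unfolding G_def[abs_def] by measurable
  qed
  have iG: "integrable M (G t)" for t by (rule integrable_dominated[where g="\<lambda>_. 2"]) (use G2 in auto)
  have Gcov: "\<bar>expectation (\<lambda>\<omega>. G t \<omega> * W \<omega>) - expectation (G t) * \<gamma> d\<bar> \<le> V * D / v * real (max (j - t) d) powr (- \<beta>)"
    if t: "t \<in> {1..<j}" for t
  proof -
    have c: "V / v > 0" using V_ge_1 v by simp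
    \<comment> \<open>Rescaled so that it is dominated by a single variable, the form in which
      \<open>cov_past_prod\<close> is stated.\<close>
    define G' where "G' \<omega> = G t \<omega> / (V / v)" for \<omega>
    have G'l: "\<bar>G' \<omega>\<bar> \<le> \<bar>\<xi> (r + t) \<omega>\<bar>" for \<omega>
    proof -
      have "\<bar>G' \<omega>\<bar> = \<bar>G t \<omega>\<bar> / (V / v)" by (metis G'_def abs_divide abs_of_pos c)
      also have "\<dots> \<le> \<bar>\<xi> (r + t) \<omega>\<bar>" using G_le[of t \<omega>] t by (simp only: pos_divide_le_eq[OF c]) (simp add: mult.commute)
      finally show ?thesis .
    qed
    have mG': "G' \<in> borel_measurable (gen {1..r + t})" unfolding G'_def[abs_def] using Ggen[of t] by measurable
    have e: "r + t + (j - t) = r + j" "r + j + d = r + i" using t by (auto simp: i)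
    have rt: "r + t \<ge> 1" and jt: "j - t \<ge> 1" using t by auto
    have "\<bar>expectation (\<lambda>\<omega>. G' \<omega> * W \<omega>) - expectation G' * \<gamma> d\<bar> \<le> D * real (max (j - t) d) powr (- \<beta>)"
      using cov_past_prod(1)[OF mG' rt jt G'l, of d] unfolding e W_def by simp
    moreover have "expectation (\<lambda>\<omega>. G' \<omega> * W \<omega>) = expectation (\<lambda>\<omega>. G t \<omega> * W \<omega>) / (V / v)"
      unfolding G'_def times_divide_eq_left by (rule integral_divide_zero)
    moreover have "expectation G' = expectation (G t) / (V / v)"
      unfolding G'_def by (rule integral_divide_zero)
    ultimately have "\<bar>(expectation (\<lambda>\<omega>. G t \<omega> * W \<omega>) - expectation (G t) * \<gamma> d) / (V / v)\<bar> \<le> D * real (max (j - t) d) powr (- \<beta>)"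
      by (simp only: diff_divide_distrib times_divide_eq_left)
    then have "\<bar>expectation (\<lambda>\<omega>. G t \<omega> * W \<omega>) - expectation (G t) * \<gamma> d\<bar> \<le> (D * real (max (j - t) d) powr (- \<beta>)) * (V / v)"
      using c by (metis abs_divide abs_of_pos pos_divide_le_eq)
    then show ?thesis by (simp add: mult_ac)
  qed
  have iGW: "integrable M (\<lambda>\<omega>. G t \<omega> * W \<omega>)" for t by (rule iW'[OF _ G2]) measurable
  have ikW: "integrable M (\<lambda>\<omega>. k (S (j - 1) \<omega>) * W \<omega>)" by (rule iW'[OF _ k1]) measurable
  then show "integrable M (\<lambda>\<omega>. X i \<omega> * X j \<omega> * k (S (j - 1) \<omega>))" unfolding XW by simp
  have e1: "expectation (\<lambda>\<omega>. k (S (j - 1) \<omega>) * W \<omega>) = k 0 * \<gamma> d + (\<Sum>t=1..<j. expectation (\<lambda>\<omega>. G t \<omega> * W \<omega>))"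
  proof -
    have "expectation (\<lambda>\<omega>. k (S (j - 1) \<omega>) * W \<omega>) = expectation (\<lambda>\<omega>. k 0 * W \<omega> + (\<Sum>t=1..<j. G t \<omega> * W \<omega>))"
      by (intro Bochner_Integration.integral_cong refl) (simp only: tele distrib_right sum_distrib_right)
    also have "\<dots> = k 0 * \<gamma> d + (\<Sum>t=1..<j. expectation (\<lambda>\<omega>. G t \<omega> * W \<omega>))"
      using iW iGW eW by (simp add: Bochner_Integration.integral_sum)
    finally show ?thesis .
  qed
  have e2: "expectation (\<lambda>\<omega>. k (S (j - 1) \<omega>)) = k 0 + (\<Sum>t=1..<j. expectation (G t))"
    unfolding tele using iG by (simp add: Bochner_Integration.integral_sum prob_space)
  have A: "\<bar>expectation (\<lambda>\<omega>. k (S (j - 1) \<omega>) * W \<omega>) - \<gamma> d * expectation (\<lambda>\<omega>. k (S (j - 1) \<omega>))\<bar>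
      \<le> V * D / v * (\<Sum>m=1..<i. real (max m d) powr (- \<beta>))"
  proof -
    have "expectation (\<lambda>\<omega>. k (S (j - 1) \<omega>) * W \<omega>) - \<gamma> d * expectation (\<lambda>\<omega>. k (S (j - 1) \<omega>))
      = (\<Sum>t=1..<j. expectation (\<lambda>\<omega>. G t \<omega> * W \<omega>) - expectation (G t) * \<gamma> d)"
      unfolding e1 e2 by (simp add: algebra_simps sum_subtractf sum_distrib_left)
    also have "\<bar>\<dots>\<bar> \<le> (\<Sum>t=1..<j. V * D / v * real (max (j - t) d) powr (- \<beta>))"
      by (rule order_trans[OF sum_abs]) (intro sum_mono Gcov)
    also have "\<dots> = V * D / v * (\<Sum>t=1..<j. real (max (j - t) d) powr (- \<beta>))"
      by (simp add: sum_distrib_left)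
    also have "(\<Sum>t=1..<j. real (max (j - t) d) powr (- \<beta>)) = (\<Sum>m=1..<j. real (max m d) powr (- \<beta>))"
      by (rule sum.reindex_bij_witness[of _ "\<lambda>m. j - m" "\<lambda>t. j - t"]) auto
    also have "V * D / v * (\<Sum>m=1..<j. real (max m d) powr (- \<beta>)) \<le> V * D / v * (\<Sum>m=1..<i. real (max m d) powr (- \<beta>))"
      using V_ge_1 D_nonneg v j by (intro mult_left_mono sum_mono2) auto
    finally show ?thesis .
  qed
  \<comment> \<open>Passing from \<open>S (j - 1)\<close> to \<open>S (i - 1)\<close> adds
    \<open>d\<close> summands, and the factor \<open>d\<close> times the covariance decay gives
    \<open>d powr (1 - \<beta>)\<close>. For \<open>d = 0\<close> the two sums coincide.\<close>
  have B: "\<bar>\<gamma> d\<bar> * \<bar>expectation (\<lambda>\<omega>. k (S (j - 1) \<omega>)) - expectation (\<lambda>\<omega>. k (S (i - 1) \<omega>))\<bar> \<le> V * D\<^sup>2 / v * real d powr (1 - \<beta>)"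
  proof (cases "d = 0")
    case True then show ?thesis by (simp add: i)
  next
    case False
    have iX: "integrable M (\<lambda>\<omega>. \<Sum>t=j..<i. \<bar>X t \<omega>\<bar>)" using X_abs(3) j by (intro Bochner_Integration.integrable_sum) auto
    have "\<bar>expectation (\<lambda>\<omega>. k (S (j - 1) \<omega>)) - expectation (\<lambda>\<omega>. k (S (i - 1) \<omega>))\<bar>
        = \<bar>expectation (\<lambda>\<omega>. k (S (j - 1) \<omega>) - k (S (i - 1) \<omega>))\<bar>"
      using integrable_bdd[OF k k1] by simp
    also have "\<dots> \<le> expectation (\<lambda>\<omega>. \<bar>k (S (j - 1) \<omega>) - k (S (i - 1) \<omega>)\<bar>)" by (rule integral_abs_bound)
    also have "\<dots> \<le> expectation (\<lambda>\<omega>. (\<Sum>t=j..<i. \<bar>X t \<omega>\<bar>) / v)"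
    proof (rule integral_mono)
      fix \<omega>
      have "{1..i - 1} = {1..j - 1} \<union> {j..<i}" "{1..j-1} \<inter> {j..<i} = {}" using j by auto
      then have "S (i - 1) \<omega> = S (j - 1) \<omega> + (\<Sum>t=j..<i. X t \<omega>)"
        unfolding S_def by (simp add: sum.union_disjoint)
      then have "\<bar>S (j - 1) \<omega> - S (i - 1) \<omega>\<bar> \<le> (\<Sum>t=j..<i. \<bar>X t \<omega>\<bar>)" by (simp add: sum_abs)
      then show "\<bar>k (S (j - 1) \<omega>) - k (S (i - 1) \<omega>)\<bar> \<le> (\<Sum>t=j..<i. \<bar>X t \<omega>\<bar>) / v"
        using kl[of "S (j - 1) \<omega>" "S (i - 1) \<omega>"] v by (meson divide_right_mono order_trans zero_le_one)
    qed (use integrable_bdd[OF k k1] iX in auto)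
    also have "\<dots> = (\<Sum>t=j..<i. expectation (\<lambda>\<omega>. \<bar>X t \<omega>\<bar>)) / v"
      using X_abs(3) j by (simp add: Bochner_Integration.integral_sum)
    also have "\<dots> \<le> (\<Sum>t=j..<i. V * D) / v"
      using X_abs(4) j v by (intro divide_right_mono sum_mono) auto
    also have "\<dots> = real d * (V * D) / v" by (simp add: i)
    finally have "\<bar>\<gamma> d\<bar> * \<bar>expectation (\<lambda>\<omega>. k (S (j - 1) \<omega>)) - expectation (\<lambda>\<omega>. k (S (i - 1) \<omega>))\<bar> \<le> (D * real d powr (- \<beta>)) * (real d * (V * D) / v)"
      using \<gamma>_le'[of d] False D_nonneg by (intro mult_mono) auto
    also have "\<dots> = V * D\<^sup>2 / v * (real d * real d powr (- \<beta>))" by (simp add: power2_eq_square)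
    also have "real d * real d powr (- \<beta>) = real d powr (1 - \<beta>)" using False by (simp add: powr_mult_base)
    finally show ?thesis .
  qed
  have aa: "\<bar>a i * a j\<bar> \<le> V\<^sup>2" unfolding abs_mult power2_eq_square using a_le V_ge_1 by (intro mult_mono) auto
  have eq: "expectation (\<lambda>\<omega>. X i \<omega> * X j \<omega> * k (S (j - 1) \<omega>)) - a i * a j * \<gamma> d * expectation (\<lambda>\<omega>. k (S (i - 1) \<omega>))
      = a i * a j * (expectation (\<lambda>\<omega>. k (S (j - 1) \<omega>) * W \<omega>) - \<gamma> d * expectation (\<lambda>\<omega>. k (S (i - 1) \<omega>)))"
    unfolding XW integral_mult_right_zero by (simp add: algebra_simps)
  have "\<bar>expectation (\<lambda>\<omega>. X i \<omega> * X j \<omega> * k (S (j - 1) \<omega>)) - a i * a j * \<gamma> d * expectation (\<lambda>\<omega>. k (S (i - 1) \<omega>))\<bar>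
      \<le> V\<^sup>2 * \<bar>expectation (\<lambda>\<omega>. k (S (j - 1) \<omega>) * W \<omega>) - \<gamma> d * expectation (\<lambda>\<omega>. k (S (i - 1) \<omega>))\<bar>"
    unfolding eq abs_mult[of "a i * a j"] using aa by (rule mult_right_mono) simp
  also have "\<dots> \<le> V\<^sup>2 * (V * D / v * (\<Sum>m=1..<i. real (max m d) powr (- \<beta>)) + V * D\<^sup>2 / v * real d powr (1 - \<beta>))"
  proof (rule mult_left_mono)
    show "\<bar>expectation (\<lambda>\<omega>. k (S (j - 1) \<omega>) * W \<omega>) - \<gamma> d * expectation (\<lambda>\<omega>. k (S (i - 1) \<omega>))\<bar>
       \<le> V * D / v * (\<Sum>m=1..<i. real (max m d) powr (- \<beta>)) + V * D\<^sup>2 / v * real d powr (1 - \<beta>)"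
      by (rule abs_diff_mult_trans[OF A B])
  qed simp
  also have "\<dots> \<le> V\<^sup>2 * (V * D\<^sup>2 / v * (\<Sum>m=1..<i. real (max m d) powr (- \<beta>)) + V * D\<^sup>2 / v * real d powr (1 - \<beta>))"
  proof -
    have "D \<le> D\<^sup>2" using D_facts(4) by (simp add: power2_eq_square)
    then show ?thesis using V_ge_1 v
      by (intro mult_left_mono add_right_mono mult_right_mono divide_right_mono sum_nonneg) auto
  qed
  also have "\<dots> = V ^ 3 * D\<^sup>2 / v * ((\<Sum>m=1..<i. real (max m d) powr (- \<beta>)) + real d powr (1 - \<beta>))"
    by (simp add: algebra_simps power2_eq_square power3_eq_cube)
  finally show "\<bar>expectation (\<lambda>\<omega>. X i \<omega> * X j \<omega> * k (S (j - 1) \<omega>)) - a i * a j * \<gamma> (i - j) * expectation (\<lambda>\<omega>. k (S (i - 1) \<omega>))\<bar>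
      \<le> V ^ 3 * D\<^sup>2 / v * ((\<Sum>m=1..<i. real (max m (i - j)) powr (- \<beta>)) + real (i - j) powr (1 - \<beta>))"
    unfolding d_def .
qed

end

section \<open>Lindeberg replacement\<close>

lemma harm_le_ln: "n \<ge> 1 \<Longrightarrow> harm n \<le> 1 + ln (real n)"
proof -
  assume "n \<ge> 1"
  then obtain m where n: "n = Suc m" by (cases n) auto
  have "harm (Suc m) - ln (real (Suc m)) \<le> harm (Suc 0) - ln (real (Suc 0))"
    using decseqD[OF decseq_harm_diff_ln, of 0 m] by simp
  then show ?thesis by (simp add: n harm_def)
qed

context mixing_functional
begin

definition Z :: real where "Z = (\<Sum>n. real n powr (1 - \<beta>))"

lemma summable_Z: "summable (\<lambda>n. real n powr (1 - \<beta>))"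
  using \<beta>_gt_2 by (simp add: summable_real_powr_iff)

lemma sum_Z_le: "finite A \<Longrightarrow> (\<Sum>n\<in>A. real n powr (1 - \<beta>)) \<le> Z"
  unfolding Z_def by (intro sum_le_suminf summable_Z) auto

lemma Z_nonneg: "Z \<ge> 0"
  using sum_Z_le[of "{}"] by simp

lemma sum_powr_le_Z: "finite A \<Longrightarrow> (\<Sum>n\<in>A. real n powr (- \<beta>)) \<le> Z"
proof -
  assume "finite A"
  have "real n powr (- \<beta>) \<le> real n powr (1 - \<beta>)" for n
    by (cases "n = 0") (auto intro!: powr_mono)
  then have "(\<Sum>n\<in>A. real n powr (- \<beta>)) \<le> (\<Sum>n\<in>A. real n powr (1 - \<beta>))" by (intro sum_mono)
  then show ?thesis using sum_Z_le[OF \<open>finite A\<close>] by linarith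
qed

lemma summable_\<gamma>: "summable (\<lambda>k. \<bar>\<gamma> (Suc k)\<bar>)"
proof (rule summable_comparison_test')
  show "summable (\<lambda>k. D * real (Suc k) powr (- \<beta>))"
  proof (rule summable_mult)
    have "summable (\<lambda>k. real k powr (- \<beta>))" using \<beta>_gt_2 by (simp add: summable_real_powr_iff)
    then show "summable (\<lambda>k. real (Suc k) powr (- \<beta>))" by (subst summable_Suc_iff)
  qed
  show "norm \<bar>\<gamma> (Suc n)\<bar> \<le> D * real (Suc n) powr (- \<beta>)" for n using \<gamma>_le'[of "Suc n"] by simp
qed

text \<open>The long run variance of the process \<open>\<phi> (Y i)\<close>. For the identity it
  equals \<open>long_run_variance\<close>; for truncations it converges to it as the level
  grows.\<close>

definition \<kappa>2 :: real where "\<kappa>2 = \<gamma> 0 + 2 * (\<Sum>k. \<gamma> (Suc k))"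

end

section \<open>Second order terms of a replacement step\<close>

context mixing_window
begin

text \<open>With dependence the first order term \<open>X i * g (S (i - 1))\<close> may have a
  nonzero mean. Since \<open>g 0 = 0\<close>, the derivative telescopes along the window: the linear
  parts give the products with \<open>X j\<close> treated by \<open>prod_term\<close>, and the
  quadratic remainders lie at gap \<open>i - j\<close> before the centred \<open>X i\<close>.
  Together with the second order term the main part is half the increment of the variance of
  \<open>S\<close> at \<open>i\<close>, times the mean of \<open>k\<close>.\<close>

lemma step_term:
  assumes i: "i \<ge> 1" and k [measurable]: "k \<in> borel_measurable borel" and g [measurable]: "g \<in> borel_measurable borel"
    and k1: "\<And>x. \<bar>k x\<bar> \<le> 1" and kl: "\<And>x y. \<bar>k y - k x\<bar> \<le> \<bar>y - x\<bar> / v" and v: "v \<ge> 1"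
    and g1: "\<And>x. \<bar>g x\<bar> \<le> 1" and g0: "g 0 = 0"
    and gl: "\<And>x y. \<bar>g y - g x - (y - x) * k x\<bar> \<le> (y - x)\<^sup>2 / v"
  shows "integrable M (\<lambda>\<omega>. X i \<omega> * g (S (i - 1) \<omega>))"
    and "integrable M (\<lambda>\<omega>. X i \<omega> * X i \<omega> * k (S (i - 1) \<omega>))"
    and "\<bar>expectation (\<lambda>\<omega>. X i \<omega> * g (S (i - 1) \<omega>)) + expectation (\<lambda>\<omega>. X i \<omega> * X i \<omega> * k (S (i - 1) \<omega>)) / 2
       - (a i * a i * \<gamma> 0 + 2 * (\<Sum>j=1..<i. a i * a j * \<gamma> (i - j))) / 2 * expectation (\<lambda>\<omega>. k (S (i - 1) \<omega>))\<bar>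
      \<le> 5 * V ^ 3 * D\<^sup>2 * Z / v"
proof -
  define w where "w d = V ^ 3 * D\<^sup>2 / v * ((\<Sum>m=1..<i. real (max m d) powr (- \<beta>)) + real d powr (1 - \<beta>))" for d
  define E where "E = expectation (\<lambda>\<omega>. k (S (i - 1) \<omega>))"
  \<comment> \<open>Taylor remainder of the increment of \<open>g\<close>; being quadratic in
    \<open>X j\<close>, it fits \<open>cov_past_square\<close> after rescaling.\<close>
  define R where "R j \<omega> = g (S j \<omega>) - g (S (j - 1) \<omega>) - X j \<omega> * k (S (j - 1) \<omega>)" for j \<omega>
  have pt: "integrable M (\<lambda>\<omega>. X i \<omega> * X j \<omega> * k (S (j - 1) \<omega>))"
    "\<bar>expectation (\<lambda>\<omega>. X i \<omega> * X j \<omega> * k (S (j - 1) \<omega>)) - a i * a j * \<gamma> (i - j) * E\<bar> \<le> w (i - j)" if "1 \<le> j" "j \<le> i" for j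
    using prod_term[OF that k k1 kl v] by (simp_all add: w_def E_def)
  show i2: "integrable M (\<lambda>\<omega>. X i \<omega> * X i \<omega> * k (S (i - 1) \<omega>))" using pt(1)[of i] i by simp
  note [measurable] = X_measurable[OF i]
  show i1: "integrable M (\<lambda>\<omega>. X i \<omega> * g (S (i - 1) \<omega>))"
  proof (rule integrable_dominated[where g="\<lambda>\<omega>. \<bar>X i \<omega>\<bar>"])
    show "\<bar>X i \<omega> * g (S (i - 1) \<omega>)\<bar> \<le> \<bar>X i \<omega>\<bar>" for \<omega>
      unfolding abs_mult by (rule mult_left_le) (use g1 in auto)
  qed (use X_abs[OF i] in auto)
  have tele: "g (S (i - 1) \<omega>) = (\<Sum>j=1..<i. X j \<omega> * k (S (j - 1) \<omega>) + R j \<omega>)" for \<omega>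
    using sum_telescope_pred[OF i, of "\<lambda>t. g (S t \<omega>)"] by (simp add: R_def S_0 g0)
  have R_le: "\<bar>R j \<omega>\<bar> \<le> V\<^sup>2 / v * (\<xi> (r + j) \<omega>)\<^sup>2" if "j \<ge> 1" for j \<omega>
  proof -
    have "\<bar>R j \<omega>\<bar> \<le> (X j \<omega>)\<^sup>2 / v"
      using gl[of "S j \<omega>" "S (j - 1) \<omega>"] S_Suc[OF that, of \<omega>] by (simp add: R_def)
    also have "(X j \<omega>)\<^sup>2 \<le> V\<^sup>2 * (\<xi> (r + j) \<omega>)\<^sup>2"
      unfolding X_def power_mult_distrib using a_le[of j] V_ge_1 by (intro mult_right_mono power2_le_iff_abs_le[THEN iffD2]) auto
    finally show ?thesis using v by (simp add: divide_right_mono)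
  qed
  have Rgen: "R j \<in> borel_measurable (gen {1..r + j})" if "j \<ge> 1" for j
  proof -
    have [measurable]: "S j \<in> borel_measurable (gen {1..r + j})" by (rule S_gen)
    have [measurable]: "S (j - 1) \<in> borel_measurable (gen {1..r + j})" by (rule gen_mono[OF _ S_gen]) auto
    have [measurable]: "X j \<in> borel_measurable (gen {1..r + j})" using X_gen[of j "{1..r + j}"] that by simp
    show ?thesis unfolding R_def[abs_def] by measurable
  qed
  have XR: "integrable M (\<lambda>\<omega>. X i \<omega> * R j \<omega>)"
    "\<bar>expectation (\<lambda>\<omega>. X i \<omega> * R j \<omega>)\<bar> \<le> V ^ 3 * D / v * real (i - j) powr (- \<beta>)" if j: "j \<in> {1..<i}" for j
  proof -
    have c: "V\<^sup>2 / v > 0" using V_ge_1 v by simp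
    define R' where "R' \<omega> = R j \<omega> / (V\<^sup>2 / v)" for \<omega>
    have R'l: "\<bar>R' \<omega>\<bar> \<le> (\<xi> (r + j) \<omega>)\<^sup>2" for \<omega>
    proof -
      have "\<bar>R' \<omega>\<bar> = \<bar>R j \<omega>\<bar> / (V\<^sup>2 / v)" by (metis R'_def abs_divide abs_of_pos c)
      also have "\<dots> \<le> (\<xi> (r + j) \<omega>)\<^sup>2" using R_le[of j \<omega>] j by (simp only: pos_divide_le_eq[OF c]) (simp add: mult.commute)
      finally show ?thesis .
    qed
    have mR': "R' \<in> borel_measurable (gen {1..r + j})"
      unfolding R'_def[abs_def] using Rgen[of j] j by (intro borel_measurable_divide) auto
    have e: "r + j + (i - j) = r + i" using j by auto
    have rj: "r + j \<ge> 1" and ij: "i - j \<ge> 1" using j by auto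
    note cp = cov_past_square[OF mR' rj ij R'l, unfolded e]
    have XRe: "X i \<omega> * R j \<omega> = a i * (V\<^sup>2 / v) * (R' \<omega> * \<xi> (r + i) \<omega>)" for \<omega>
      using V_ge_1 v by (simp add: X_def R'_def)
    show "integrable M (\<lambda>\<omega>. X i \<omega> * R j \<omega>)" unfolding XRe using cp(2) by simp
    have "\<bar>expectation (\<lambda>\<omega>. X i \<omega> * R j \<omega>)\<bar> = \<bar>a i\<bar> * (V\<^sup>2 / v) * \<bar>expectation (\<lambda>\<omega>. R' \<omega> * \<xi> (r + i) \<omega>)\<bar>"
      unfolding XRe using v by (simp add: abs_mult)
    also have "\<dots> \<le> V * (V\<^sup>2 / v) * (D * real (i - j) powr (- \<beta>))"
      using cp(1) c a_le V_ge_1 v by (intro mult_mono mult_right_mono) auto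
    finally show "\<bar>expectation (\<lambda>\<omega>. X i \<omega> * R j \<omega>)\<bar> \<le> V ^ 3 * D / v * real (i - j) powr (- \<beta>)"
      by (simp add: power2_eq_square power3_eq_cube mult_ac)
  qed
  have e1: "expectation (\<lambda>\<omega>. X i \<omega> * g (S (i - 1) \<omega>)) = (\<Sum>j=1..<i. expectation (\<lambda>\<omega>. X i \<omega> * X j \<omega> * k (S (j - 1) \<omega>)) + expectation (\<lambda>\<omega>. X i \<omega> * R j \<omega>))"
  proof -
    have "expectation (\<lambda>\<omega>. X i \<omega> * g (S (i - 1) \<omega>)) = expectation (\<lambda>\<omega>. \<Sum>j=1..<i. X i \<omega> * X j \<omega> * k (S (j - 1) \<omega>) + X i \<omega> * R j \<omega>)"
      by (intro Bochner_Integration.integral_cong refl) (simp only: tele sum_distrib_left distrib_left mult.assoc)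
    also have "\<dots> = (\<Sum>j=1..<i. expectation (\<lambda>\<omega>. X i \<omega> * X j \<omega> * k (S (j - 1) \<omega>) + X i \<omega> * R j \<omega>))"
      using pt(1) XR(1) by (intro Bochner_Integration.integral_sum Bochner_Integration.integrable_add) auto
    also have "\<dots> = (\<Sum>j=1..<i. expectation (\<lambda>\<omega>. X i \<omega> * X j \<omega> * k (S (j - 1) \<omega>)) + expectation (\<lambda>\<omega>. X i \<omega> * R j \<omega>))"
      using pt(1) XR(1) by (intro sum.cong refl Bochner_Integration.integral_add) auto
    finally show ?thesis .
  qed
  define T where "T j = expectation (\<lambda>\<omega>. X i \<omega> * X j \<omega> * k (S (j - 1) \<omega>)) - a i * a j * \<gamma> (i - j) * E" for j
  define r' where "r' j = expectation (\<lambda>\<omega>. X i \<omega> * R j \<omega>)" for j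
  have eq: "expectation (\<lambda>\<omega>. X i \<omega> * g (S (i - 1) \<omega>)) + expectation (\<lambda>\<omega>. X i \<omega> * X i \<omega> * k (S (i - 1) \<omega>)) / 2
       - (a i * a i * \<gamma> 0 + 2 * (\<Sum>j=1..<i. a i * a j * \<gamma> (i - j))) / 2 * E
    = (\<Sum>j=1..<i. T j) + (\<Sum>j=1..<i. r' j) + T i / 2"
    unfolding e1 T_def r'_def sum.distrib sum_subtractf sum_distrib_right[symmetric] by (simp add: field_simps)
  have le1: "\<bar>(\<Sum>j=1..<i. T j) + (\<Sum>j=1..<i. r' j) + T i / 2\<bar> \<le> (\<Sum>j=1..<i. \<bar>T j\<bar>) + (\<Sum>j=1..<i. \<bar>r' j\<bar>) + \<bar>T i\<bar>"
  proof -
    have "\<bar>\<Sum>j=1..<i. T j\<bar> \<le> (\<Sum>j=1..<i. \<bar>T j\<bar>)" "\<bar>\<Sum>j=1..<i. r' j\<bar> \<le> (\<Sum>j=1..<i. \<bar>r' j\<bar>)" by (rule sum_abs)+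
    then show ?thesis by linarith
  qed
  have le2: "(\<Sum>j=1..<i. \<bar>T j\<bar>) + (\<Sum>j=1..<i. \<bar>r' j\<bar>) + \<bar>T i\<bar> \<le> 5 * V ^ 3 * D\<^sup>2 * Z / v"
  proof -
    \<comment> \<open>The diagonal term carries only the factor 1/2 but is counted in full, so that
      all lags from 0 to \<open>i - 1\<close> can be summed at once.\<close>
    have i': "{1..i} = insert i {1..<i}" "i \<notin> {1..<i}" using i by auto
    have "(\<Sum>j=1..<i. \<bar>T j\<bar>) + \<bar>T i\<bar> = (\<Sum>j=1..i. \<bar>T j\<bar>)" unfolding i'(1) using i'(2) by simp
    also have "\<dots> \<le> (\<Sum>j=1..i. w (i - j))" using pt(2) by (intro sum_mono) (auto simp: T_def)
    also have "\<dots> = (\<Sum>d<i. w d)"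
      by (rule sum.reindex_bij_witness[of _ "\<lambda>d. i - d" "\<lambda>j. i - j"]) (use i in auto)
    also have "\<dots> = V ^ 3 * D\<^sup>2 / v * ((\<Sum>d<i. \<Sum>m=1..<i. real (max m d) powr (- \<beta>)) + (\<Sum>d<i. real d powr (1 - \<beta>)))"
      unfolding w_def by (simp only: sum_distrib_left[symmetric] sum.distrib)
    also have "\<dots> \<le> V ^ 3 * D\<^sup>2 / v * (2 * Z + Z)"
      using max_powr_sum_le[OF \<beta>_gt_2, of i] sum_Z_le[of "{..<i}"] V_ge_1 v
      by (intro mult_left_mono add_mono) auto
    finally have A: "(\<Sum>j=1..<i. \<bar>T j\<bar>) + \<bar>T i\<bar> \<le> V ^ 3 * D\<^sup>2 / v * (3 * Z)" by simp
    have "(\<Sum>j=1..<i. \<bar>r' j\<bar>) \<le> (\<Sum>j=1..<i. V ^ 3 * D / v * real (i - j) powr (- \<beta>))"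
      using XR(2) by (intro sum_mono) (auto simp: r'_def)
    also have "\<dots> = V ^ 3 * D / v * (\<Sum>j=1..<i. real (i - j) powr (- \<beta>))" by (simp add: sum_distrib_left)
    also have "(\<Sum>j=1..<i. real (i - j) powr (- \<beta>)) = (\<Sum>d=1..<i. real d powr (- \<beta>))"
      by (rule sum.reindex_bij_witness[of _ "\<lambda>d. i - d" "\<lambda>j. i - j"]) auto
    also have "V ^ 3 * D / v * (\<Sum>d=1..<i. real d powr (- \<beta>)) \<le> V ^ 3 * D / v * Z"
      using sum_powr_le_Z[of "{1..<i}"] V_ge_1 v D_nonneg by (intro mult_left_mono) auto
    also have "\<dots> \<le> V ^ 3 * D\<^sup>2 / v * Z"
    proof -
      have "D \<le> D\<^sup>2" using D_facts(4) by (simp add: power2_eq_square)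
      then show ?thesis using V_ge_1 v Z_nonneg by (intro mult_right_mono divide_right_mono mult_left_mono) auto
    qed
    finally have B: "(\<Sum>j=1..<i. \<bar>r' j\<bar>) \<le> V ^ 3 * D\<^sup>2 / v * Z" .
    have "0 \<le> V ^ 3 * D\<^sup>2 / v * Z" using V_ge_1 v Z_nonneg by simp
    then have "(\<Sum>j=1..<i. \<bar>T j\<bar>) + (\<Sum>j=1..<i. \<bar>r' j\<bar>) + \<bar>T i\<bar> \<le> 5 * (V ^ 3 * D\<^sup>2 / v * Z)" using A B by linarith
    then show ?thesis by (simp add: mult_ac)
  qed
  show "\<bar>expectation (\<lambda>\<omega>. X i \<omega> * g (S (i - 1) \<omega>)) + expectation (\<lambda>\<omega>. X i \<omega> * X i \<omega> * k (S (i - 1) \<omega>)) / 2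
       - (a i * a i * \<gamma> 0 + 2 * (\<Sum>j=1..<i. a i * a j * \<gamma> (i - j))) / 2 * expectation (\<lambda>\<omega>. k (S (i - 1) \<omega>))\<bar>
      \<le> 5 * V ^ 3 * D\<^sup>2 * Z / v" 
    unfolding E_def[symmetric] eq by (rule order_trans[OF le1 le2])
qed

definition tv :: "nat \<Rightarrow> real" where "tv N = (\<Sum>i=1..<N. \<bar>a (Suc i) - a i\<bar>)"

text \<open>A difference over lag \<open>m\<close> consists of \<open>m\<close> unit increments. For
  each fixed position among them, the map from \<open>i\<close> to the increment is injective, so
  each position contributes at most one total variation.\<close>

lemma shift_variation_le: "m \<ge> 1 \<Longrightarrow> (\<Sum>i=m+1..N. \<bar>a i - a (i - m)\<bar>) \<le> real m * tv N"
proof -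
  assume m: "m \<ge> 1"
  have "(\<Sum>i=m+1..N. \<bar>a i - a (i - m)\<bar>) \<le> (\<Sum>i=m+1..N. \<Sum>s<m. \<bar>a (Suc (i - m + s)) - a (i - m + s)\<bar>)"
  proof (rule sum_mono)
    fix i assume "i \<in> {m+1..N}"
    then have "a i - a (i - m) = a (i - m + m) - a (i - m + 0)" by simp
    also have "\<dots> = (\<Sum>s<m. a (i - m + Suc s) - a (i - m + s))" by (rule sum_lessThan_telescope[symmetric])
    finally have "a i - a (i - m) = (\<Sum>s<m. a (Suc (i - m + s)) - a (i - m + s))" by simp
    then show "\<bar>a i - a (i - m)\<bar> \<le> (\<Sum>s<m. \<bar>a (Suc (i - m + s)) - a (i - m + s)\<bar>)" by (simp add: sum_abs)
  qed
  also have "\<dots> = (\<Sum>s<m. \<Sum>i=m+1..N. \<bar>a (Suc (i - m + s)) - a (i - m + s)\<bar>)" by (rule sum.swap)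
  also have "\<dots> \<le> (\<Sum>s<m. tv N)"
  proof (rule sum_mono)
    fix s assume s: "s \<in> {..<m}"
    have "(\<Sum>i=m+1..N. \<bar>a (Suc (i - m + s)) - a (i - m + s)\<bar>) = (\<Sum>t\<in>(\<lambda>i. i - m + s) ` {m+1..N}. \<bar>a (Suc t) - a t\<bar>)"
      by (subst sum.reindex) (auto simp: inj_on_def)
    also have "\<dots> \<le> tv N" unfolding tv_def using s by (intro sum_mono2) auto
    finally show "(\<Sum>i=m+1..N. \<bar>a (Suc (i - m + s)) - a (i - m + s)\<bar>) \<le> tv N" .
  qed
  finally show ?thesis by simp
qed

text \<open>Two things separate the variance increment from
  \<open>\<kappa>2 * (a i)\<^sup>2\<close>: the weights at lag \<open>m\<close> differ from
  \<open>a i\<close>, which summed over \<open>i\<close> costs \<open>m\<close> times the total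
  variation, and the covariance series is cut at lag \<open>i - 1\<close>. Either way lag
  \<open>m\<close> is weighted by \<open>m\<close>, and the sum of
  \<open>m * m powr (- \<beta>)\<close> is finite, so the total error grows with \<open>N\<close>
  only through \<open>tv N\<close>.\<close>

lemma variance_increment_sum:
  "(\<Sum>i=1..N. \<bar>a i * a i * \<gamma> 0 + 2 * (\<Sum>j=1..<i. a i * a j * \<gamma> (i - j)) - \<kappa>2 * (a i)\<^sup>2\<bar>)
     \<le> 2 * V\<^sup>2 * D * Z * (1 + tv N)"
proof -
  define q where "q m = D * real m powr (- \<beta>)" for m :: nat
  have tvn: "tv N \<ge> 0" unfolding tv_def by (intro sum_nonneg) auto
  have q: "\<bar>\<gamma> m\<bar> \<le> q m" if "m \<ge> 1" for m using \<gamma>_le'[OF that] by (simp add: q_def)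
  have q0: "q m \<ge> 0" for m using D_nonneg by (simp add: q_def)
  have sg: "summable (\<lambda>k. \<gamma> (Suc k))" using summable_\<gamma> by (rule summable_rabs_cancel)
  have sq: "summable (\<lambda>k. q (Suc k))" 
  proof -
    have "summable (\<lambda>k. real k powr (- \<beta>))" using \<beta>_gt_2 by (simp add: summable_real_powr_iff)
    then have "summable (\<lambda>k. real (Suc k) powr (- \<beta>))" by (subst summable_Suc_iff)
    then show ?thesis unfolding q_def by (rule summable_mult)
  qed
  have each: "\<bar>a i * a i * \<gamma> 0 + 2 * (\<Sum>j=1..<i. a i * a j * \<gamma> (i - j)) - \<kappa>2 * (a i)\<^sup>2\<bar>
     \<le> 2 * V * (\<Sum>m=1..<i. \<bar>a i - a (i - m)\<bar> * q m) + 2 * V\<^sup>2 * (\<Sum>k. q (Suc (k + (i - 1))))" if i: "i \<in> {1..N}" for i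
  proof -
    have r: "(\<Sum>j=1..<i. a i * a j * \<gamma> (i - j)) = (\<Sum>m=1..<i. a i * a (i - m) * \<gamma> m)"
      by (rule sum.reindex_bij_witness[of _ "\<lambda>d. i - d" "\<lambda>j. i - j"]) auto
    have split: "(\<Sum>k. \<gamma> (Suc k)) = (\<Sum>k. \<gamma> (Suc (k + (i - 1)))) + (\<Sum>m=1..<i. \<gamma> m)"
    proof -
      have "(\<Sum>k<i - 1. \<gamma> (Suc k)) = (\<Sum>m=1..<i. \<gamma> m)"
        by (rule sum.reindex_bij_witness[of _ "\<lambda>m. m - 1" Suc]) auto
      then show ?thesis using suminf_split_initial_segment[OF sg, of "i - 1"] by simp
    qed
    have "a i * a i * \<gamma> 0 + 2 * (\<Sum>j=1..<i. a i * a j * \<gamma> (i - j)) - \<kappa>2 * (a i)\<^sup>2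
        = 2 * ((\<Sum>m=1..<i. a i * a (i - m) * \<gamma> m) - (a i)\<^sup>2 * (\<Sum>m=1..<i. \<gamma> m)) - 2 * (a i)\<^sup>2 * (\<Sum>k. \<gamma> (Suc (k + (i - 1))))"
      unfolding r \<kappa>2_def split by (simp add: algebra_simps power2_eq_square)
    also have "(\<Sum>m=1..<i. a i * a (i - m) * \<gamma> m) - (a i)\<^sup>2 * (\<Sum>m=1..<i. \<gamma> m) = (\<Sum>m=1..<i. - a i * ((a i - a (i - m)) * \<gamma> m))"
      by (simp add: sum_distrib_left sum_subtractf[symmetric] algebra_simps power2_eq_square)
    finally have eq: "a i * a i * \<gamma> 0 + 2 * (\<Sum>j=1..<i. a i * a j * \<gamma> (i - j)) - \<kappa>2 * (a i)\<^sup>2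
      = 2 * (\<Sum>m=1..<i. - a i * ((a i - a (i - m)) * \<gamma> m)) - 2 * (a i)\<^sup>2 * (\<Sum>k. \<gamma> (Suc (k + (i - 1))))" .
    have A: "\<bar>\<Sum>m=1..<i. - a i * ((a i - a (i - m)) * \<gamma> m)\<bar> \<le> V * (\<Sum>m=1..<i. \<bar>a i - a (i - m)\<bar> * q m)"
      unfolding sum_distrib_left
    proof (rule order_trans[OF sum_abs], rule sum_mono)
      fix m assume "m \<in> {1..<i}"
      then show "\<bar>- a i * ((a i - a (i - m)) * \<gamma> m)\<bar> \<le> V * (\<bar>a i - a (i - m)\<bar> * q m)"
        unfolding abs_mult abs_minus_cancel using a_le V_ge_1 q[of m] by (intro mult_mono) auto
    qed
    have sgi: "summable (\<lambda>k. \<bar>\<gamma> (Suc (k + (i - 1)))\<bar>)" using summable_ignore_initial_segment[OF summable_\<gamma>, of "i - 1"] by simp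
    have sqi: "summable (\<lambda>k. q (Suc (k + (i - 1))))" using summable_ignore_initial_segment[OF sq, of "i - 1"] by simp
    have "\<bar>\<Sum>k. \<gamma> (Suc (k + (i - 1)))\<bar> \<le> (\<Sum>k. \<bar>\<gamma> (Suc (k + (i - 1)))\<bar>)" by (rule summable_rabs[OF sgi])
    also have "\<dots> \<le> (\<Sum>k. q (Suc (k + (i - 1))))" by (intro suminf_le q sgi sqi) auto
    finally have B: "\<bar>2 * (a i)\<^sup>2 * (\<Sum>k. \<gamma> (Suc (k + (i - 1))))\<bar> \<le> 2 * V\<^sup>2 * (\<Sum>k. q (Suc (k + (i - 1))))"
      unfolding abs_mult using a_le[of i] V_ge_1 by (intro mult_mono) (auto simp: power_mono abs_le_square_iff[symmetric])
    show ?thesis unfolding eq using A B by linarith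
  qed
  have S1: "(\<Sum>i=1..N. \<Sum>m=1..<i. \<bar>a i - a (i - m)\<bar> * q m) \<le> D * Z * tv N"
  proof -
    have "(\<Sum>i=1..N. \<Sum>m=1..<i. \<bar>a i - a (i - m)\<bar> * q m) = (\<Sum>m=1..<N. \<Sum>i=m+1..N. \<bar>a i - a (i - m)\<bar> * q m)"
      by (simp add: sum.Sigma) (rule sum.reindex_bij_witness[of _ "\<lambda>(m, i). (i, m)" "\<lambda>(i, m). (m, i)"], auto)
    also have "\<dots> = (\<Sum>m=1..<N. (\<Sum>i=m+1..N. \<bar>a i - a (i - m)\<bar>) * q m)" by (simp add: sum_distrib_right)
    also have "\<dots> \<le> (\<Sum>m=1..<N. real m * tv N * q m)"
      using shift_variation_le q0 by (intro sum_mono mult_right_mono) auto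
    also have "\<dots> = (\<Sum>m=1..<N. D * tv N * real m powr (1 - \<beta>))"
    proof (rule sum.cong[OF refl])
      fix m assume "m \<in> {1..<N}"
      then have "real m * real m powr (- \<beta>) = real m powr (1 - \<beta>)" by (simp add: powr_mult_base)
      then show "real m * tv N * q m = D * tv N * real m powr (1 - \<beta>)" by (simp add: q_def mult_ac)
    qed
    also have "\<dots> = D * tv N * (\<Sum>m=1..<N. real m powr (1 - \<beta>))" by (simp add: sum_distrib_left)
    also have "\<dots> \<le> D * tv N * Z" using D_nonneg tvn by (intro mult_left_mono sum_Z_le) auto
    finally show ?thesis by (simp add: mult_ac)
  qed
  have S2: "(\<Sum>i=1..N. \<Sum>k. q (Suc (k + (i - 1)))) \<le> D * Z"
  proof -
    \<comment> \<open>Lag \<open>m\<close> belongs only to the tails of the indices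
      \<open>i \<le> m\<close>, hence to at most \<open>m\<close> of them; exchanging the sums turns
      the decay \<open>m powr (- \<beta>)\<close> into \<open>m powr (1 - \<beta>)\<close>.\<close>
    have "(\<Sum>i=1..N. \<Sum>k. q (Suc (k + (i - 1)))) = (\<Sum>i=1..N. \<Sum>m. if m \<ge> i then q m else 0)"
    proof (rule sum.cong[OF refl])
      fix i assume i: "i \<in> {1..N}"
      have "summable (\<lambda>k. q (Suc (k + (i - 1))))" using summable_ignore_initial_segment[OF sq, of "i - 1"] by simp
      then have h: "(\<lambda>k. q (Suc (k + (i - 1)))) sums (\<Sum>k. q (Suc (k + (i - 1))))" by (rule summable_sums)
      define f where "f m = (if m \<ge> i then q m else 0)" for m
      have "f (k + i) = q (Suc (k + (i - 1)))" for k using i by (simp add: f_def)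
      then have "(\<lambda>k. f (k + i)) sums (\<Sum>k. q (Suc (k + (i - 1))))" using h by simp
      then have "f sums ((\<Sum>k. q (Suc (k + (i - 1)))) + sum f {..<i})" by (simp only: sums_iff_shift)
      moreover have "sum f {..<i} = 0" by (simp add: f_def)
      ultimately have "(\<lambda>m. if m \<ge> i then q m else 0) sums (\<Sum>k. q (Suc (k + (i - 1))))"
        by (simp add: f_def[abs_def])
      then show "(\<Sum>k. q (Suc (k + (i - 1)))) = (\<Sum>m. if m \<ge> i then q m else 0)" by (rule sums_unique)
    qed
    also have "\<dots> = (\<Sum>m. \<Sum>i=1..N. if m \<ge> i then q m else 0)"
    proof (rule suminf_sum[symmetric])
      fix i assume "i \<in> {1..N}"
      have "summable q" using sq by (subst (asm) summable_Suc_iff)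
      then show "summable (\<lambda>m. if m \<ge> i then q m else 0)"
        by (rule summable_comparison_test') (use q0 in auto)
    qed
    also have "\<dots> \<le> (\<Sum>m. D * real m powr (1 - \<beta>))"
    proof (rule suminf_le)
      have qm: "(\<Sum>i=1..N. if m \<ge> i then q m else 0) \<le> D * real m powr (1 - \<beta>)" for m
      proof -
        have "(\<Sum>i=1..N. if m \<ge> i then q m else 0) = real (card {i\<in>{1..N}. i \<le> m}) * q m"
          by (simp add: sum.If_cases Int_def)
        also have "\<dots> \<le> real m * q m"
        proof -
          have "card {i\<in>{1..N}. i \<le> m} \<le> card {1..m}" by (rule card_mono) auto
          then show ?thesis using q0 by (intro mult_right_mono) auto
        qed
        also have "\<dots> = D * real m powr (1 - \<beta>)"
        proof (cases "m = 0")
          case False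
          then have "real m * real m powr (- \<beta>) = real m powr (1 - \<beta>)" by (simp add: powr_mult_base)
          then show ?thesis by (simp add: q_def mult_ac)
        qed simp
        finally show ?thesis .
      qed
      then show "(\<Sum>i=1..N. if m \<ge> i then q m else 0) \<le> D * real m powr (1 - \<beta>)" for m .
      show s: "summable (\<lambda>m. D * real m powr (1 - \<beta>))" by (intro summable_mult summable_Z)
      show "summable (\<lambda>m. \<Sum>i=1..N. if m \<ge> i then q m else 0)"
      proof (rule summable_comparison_test'[OF s, of 0])
        fix m
        have "(\<Sum>i=1..N. if m \<ge> i then q m else 0) \<ge> 0" using q0 by (intro sum_nonneg) auto
        then show "norm (\<Sum>i=1..N. if m \<ge> i then q m else 0) \<le> D * real m powr (1 - \<beta>)" using qm[of m] by simp
      qed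
    qed
    also have "\<dots> = D * Z" unfolding Z_def by (rule suminf_mult[OF summable_Z])
    finally show ?thesis .
  qed
  have "(\<Sum>i=1..N. \<bar>a i * a i * \<gamma> 0 + 2 * (\<Sum>j=1..<i. a i * a j * \<gamma> (i - j)) - \<kappa>2 * (a i)\<^sup>2\<bar>)
    \<le> (\<Sum>i=1..N. 2 * V * (\<Sum>m=1..<i. \<bar>a i - a (i - m)\<bar> * q m) + 2 * V\<^sup>2 * (\<Sum>k. q (Suc (k + (i - 1)))))"
    by (intro sum_mono each)
  also have "\<dots> = 2 * V * (\<Sum>i=1..N. \<Sum>m=1..<i. \<bar>a i - a (i - m)\<bar> * q m) + 2 * V\<^sup>2 * (\<Sum>i=1..N. \<Sum>k. q (Suc (k + (i - 1))))"
    by (simp only: sum.distrib sum_distrib_left)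
  also have "\<dots> \<le> 2 * V * (D * Z * tv N) + 2 * V\<^sup>2 * (D * Z)"
    using S1 S2 V_ge_1 by (intro add_mono mult_left_mono) auto
  also have "\<dots> \<le> 2 * V\<^sup>2 * (D * Z * tv N) + 2 * V\<^sup>2 * (D * Z)"
    using V_ge_1 D_nonneg Z_nonneg tvn by (intro add_right_mono mult_right_mono mult_left_mono) (auto simp: power2_eq_square)
  finally show ?thesis by (simp add: algebra_simps)
qed

end

context mixing_functional
begin

text \<open>The numerator collects the third order, covariance and time step errors of one
  replacement; \<open>min 1 (\<kappa>2 * a0\<^sup>2)\<close> bounds from below how fast the
  remaining variance grows per summand; the next term comes from
  \<open>variance_increment_sum\<close>, and the 3 pays for the smoothing at both ends.\<close>

definition lindeberg_const :: "real \<Rightarrow> real \<Rightarrow> real" where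
  "lindeberg_const a0 V = (V ^ 3 * D + 5 * V ^ 3 * D\<^sup>2 * Z + \<kappa>2\<^sup>2 * V ^ 4) / min 1 (\<kappa>2 * a0\<^sup>2) + 2 * V\<^sup>2 * D * Z + 3"

end

context mixing_window
begin

text \<open>One summand is traded for variance \<open>h\<close>: \<open>u v\<close> after the step
  is compared with \<open>u (v + h)\<close> before it. Expanding in space and, by the heat equation,
  in time leaves the same factor \<open>k\<close> in both second order terms, with the variance
  increment as coefficient on one side and \<open>h\<close> on the other.\<close>

lemma lindeberg_step:
  fixes u g k :: "real \<Rightarrow> real \<Rightarrow> real"
  assumes i: "i \<ge> 1" and v: "v \<ge> 1" and h: "h \<ge> 0"
    and [measurable]: "u v \<in> borel_measurable borel" "u (v + h) \<in> borel_measurable borel" 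
      "g v \<in> borel_measurable borel" "k v \<in> borel_measurable borel"
    and u0: "\<And>x. \<bar>u v x - u v 0\<bar> \<le> \<bar>x\<bar>" "\<And>x. \<bar>u (v + h) x - u (v + h) 0\<bar> \<le> \<bar>x\<bar>"
    and g1: "\<And>x. \<bar>g v x\<bar> \<le> 1" and g0: "g v 0 = 0" and k1: "\<And>x. \<bar>k v x\<bar> \<le> 1"
    and kl: "\<And>x y. \<bar>k v y - k v x\<bar> \<le> \<bar>y - x\<bar> / v"
    and gl: "\<And>x y. \<bar>g v y - g v x - (y - x) * k v x\<bar> \<le> (y - x)\<^sup>2 / v"
    and ul: "\<And>x y. \<bar>u v y - u v x - (y - x) * g v x - (y - x)\<^sup>2 / 2 * k v x\<bar> \<le> \<bar>y - x\<bar> ^ 3 / v"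
    and ut: "\<And>x. \<bar>u (v + h) x - u v x - h / 2 * k v x\<bar> \<le> h\<^sup>2 / v"
  shows "\<bar>expectation (\<lambda>\<omega>. u v (S i \<omega>)) - expectation (\<lambda>\<omega>. u (v + h) (S (i - 1) \<omega>))\<bar>
    \<le> (V ^ 3 * D + 5 * V ^ 3 * D\<^sup>2 * Z + h\<^sup>2) / v
      + \<bar>a i * a i * \<gamma> 0 + 2 * (\<Sum>j=1..<i. a i * a j * \<gamma> (i - j)) - h\<bar>"
proof -
  note [measurable] = X_measurable[OF i]
  have iS: "integrable M (\<lambda>\<omega>. \<bar>S j \<omega>\<bar>)" for j
  proof -
    have "integrable M (S j)" unfolding S_def[abs_def] using X_abs(1) by (intro Bochner_Integration.integrable_sum) auto
    then show ?thesis by simp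
  qed
  have iu: "integrable M (\<lambda>\<omega>. f (S j \<omega>))" if [measurable]: "f \<in> borel_measurable borel" and "\<And>x. \<bar>f x - f 0\<bar> \<le> \<bar>x\<bar>" for f :: "real \<Rightarrow> real" and j
  proof (rule integrable_dominated[where g="\<lambda>\<omega>. \<bar>f 0\<bar> + \<bar>S j \<omega>\<bar>"])
    show "\<bar>f (S j \<omega>)\<bar> \<le> \<bar>f 0\<bar> + \<bar>S j \<omega>\<bar>" for \<omega> using that(2)[of "S j \<omega>"] by linarith
  qed (use iS in auto)
  have iu1: "integrable M (\<lambda>\<omega>. u v (S i \<omega>))" "integrable M (\<lambda>\<omega>. u (v + h) (S (i - 1) \<omega>))"
    by (rule iu[OF _ u0(1)], measurable) (rule iu[OF _ u0(2)], measurable)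
  note st = step_term[OF i _ _ k1 kl v g1 g0 gl]
  have iXg: "integrable M (\<lambda>\<omega>. X i \<omega> * g v (S (i - 1) \<omega>))" by (rule st(1)) measurable
  have iXk: "integrable M (\<lambda>\<omega>. X i \<omega> * X i \<omega> * k v (S (i - 1) \<omega>))" by (rule st(2)) measurable
  have ik: "integrable M (\<lambda>\<omega>. k v (S (i - 1) \<omega>))" by (rule integrable_bdd[OF _ k1]) measurable
  define Q where "Q \<omega> = X i \<omega> * g v (S (i - 1) \<omega>) + X i \<omega> * X i \<omega> * k v (S (i - 1) \<omega>) / 2 - h / 2 * k v (S (i - 1) \<omega>)" for \<omega>
  have iQ: "integrable M Q" unfolding Q_def[abs_def] using iXg iXk ik by simp
  define Ek where "Ek = expectation (\<lambda>\<omega>. k v (S (i - 1) \<omega>))"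
  define Bi where "Bi = a i * a i * \<gamma> 0 + 2 * (\<Sum>j=1..<i. a i * a j * \<gamma> (i - j))"
  define Eg where "Eg = expectation (\<lambda>\<omega>. X i \<omega> * g v (S (i - 1) \<omega>)) + expectation (\<lambda>\<omega>. X i \<omega> * X i \<omega> * k v (S (i - 1) \<omega>)) / 2"
  have eQ: "expectation Q = Eg - h / 2 * Ek"
    unfolding Q_def[abs_def] Eg_def Ek_def using iXg iXk ik by simp
  have pt: "\<bar>u v (S i \<omega>) - u (v + h) (S (i - 1) \<omega>) - Q \<omega>\<bar> \<le> \<bar>X i \<omega>\<bar> ^ 3 / v + h\<^sup>2 / v" for \<omega>
  proof -
    have s: "S i \<omega> - S (i - 1) \<omega> = X i \<omega>" using S_Suc[OF i, of \<omega>] by simp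
    have "\<bar>u v (S i \<omega>) - u v (S (i - 1) \<omega>) - X i \<omega> * g v (S (i - 1) \<omega>) - X i \<omega> * X i \<omega> * k v (S (i - 1) \<omega>) / 2\<bar> \<le> \<bar>X i \<omega>\<bar> ^ 3 / v"
      using ul[of "S i \<omega>" "S (i - 1) \<omega>"] unfolding s by (simp add: power2_eq_square)
    with ut[of "S (i - 1) \<omega>"] show ?thesis unfolding Q_def by linarith
  qed
  have A: "\<bar>expectation (\<lambda>\<omega>. u v (S i \<omega>)) - expectation (\<lambda>\<omega>. u (v + h) (S (i - 1) \<omega>)) - (Eg - h / 2 * Ek)\<bar> \<le> V ^ 3 * D / v + h\<^sup>2 / v"
  proof -
    have "expectation (\<lambda>\<omega>. u v (S i \<omega>)) - expectation (\<lambda>\<omega>. u (v + h) (S (i - 1) \<omega>)) - (Eg - h / 2 * Ek)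
      = expectation (\<lambda>\<omega>. u v (S i \<omega>) - u (v + h) (S (i - 1) \<omega>) - Q \<omega>)"
      unfolding eQ[symmetric] using iu1 iQ by simp
    moreover have "\<bar>expectation (\<lambda>\<omega>. u v (S i \<omega>) - u (v + h) (S (i - 1) \<omega>) - Q \<omega>)\<bar> \<le> expectation (\<lambda>\<omega>. \<bar>u v (S i \<omega>) - u (v + h) (S (i - 1) \<omega>) - Q \<omega>\<bar>)"
      by (rule integral_abs_bound)
    moreover have "expectation (\<lambda>\<omega>. \<bar>u v (S i \<omega>) - u (v + h) (S (i - 1) \<omega>) - Q \<omega>\<bar>) \<le> expectation (\<lambda>\<omega>. \<bar>X i \<omega>\<bar> ^ 3 / v + h\<^sup>2 / v)"
      using iu1 iQ X_abs(5)[OF i] pt by (intro integral_mono) auto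
    moreover have "expectation (\<lambda>\<omega>. \<bar>X i \<omega>\<bar> ^ 3 / v + h\<^sup>2 / v) = expectation (\<lambda>\<omega>. \<bar>X i \<omega>\<bar> ^ 3) / v + h\<^sup>2 / v"
      using X_abs(5)[OF i] by (simp add: prob_space)
    moreover have "expectation (\<lambda>\<omega>. \<bar>X i \<omega>\<bar> ^ 3) / v \<le> V ^ 3 * D / v"
      using X_abs(6)[OF i] v by (intro divide_right_mono) auto
    ultimately show ?thesis by linarith
  qed
  have B: "\<bar>Eg - Bi / 2 * Ek\<bar> \<le> 5 * V ^ 3 * D\<^sup>2 * Z / v"
    unfolding Eg_def Bi_def Ek_def by (rule st(3)) measurable
  have "\<bar>Ek\<bar> \<le> 1"
  proof -
    have "\<bar>Ek\<bar> \<le> expectation (\<lambda>\<omega>. \<bar>k v (S (i - 1) \<omega>)\<bar>)" unfolding Ek_def by (rule integral_abs_bound)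
    also have "\<dots> \<le> expectation (\<lambda>\<omega>. 1)" using ik k1 by (intro integral_mono) auto
    finally show ?thesis by (simp add: prob_space)
  qed
  then have "\<bar>Bi - h\<bar> * \<bar>Ek\<bar> \<le> \<bar>Bi - h\<bar> * 1" by (rule mult_left_mono) simp
  then have C: "\<bar>Bi / 2 * Ek - h / 2 * Ek\<bar> \<le> \<bar>Bi - h\<bar>" by (simp add: abs_mult[symmetric] left_diff_distrib)
  show ?thesis unfolding Bi_def[symmetric] using A B C by (simp add: add_divide_distrib) 
qed

text \<open>\<open>F i\<close> interpolates between an explicit value, at the zero sum with the
  whole variance ahead, and almost the expectation wanted. \<open>v i\<close> is the variance still
  to come plus 1. The extra 1 keeps the smoothing away from the kink of the absolute value and
  changes the ends only by constants, 2 at \<open>N\<close> and 1 at 0.\<close>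

theorem lindeberg_abs_moment:
  assumes N: "N \<ge> 1" and a0: "a0 > 0" "\<And>i. i \<in> {1..N} \<Longrightarrow> a0 \<le> \<bar>a i\<bar>" and \<kappa>: "\<kappa>2 > 0"
  shows "\<bar>expectation (\<lambda>\<omega>. \<bar>S N \<omega>\<bar>) - sqrt (2 / pi) * sqrt (\<kappa>2 * (\<Sum>i=1..N. (a i)\<^sup>2))\<bar>
    \<le> lindeberg_const a0 V * (1 + tv N + ln (real N))"
proof -
  obtain u g k :: "real \<Rightarrow> real \<Rightarrow> real" where um:
    "\<And>v. v \<ge> 1 \<Longrightarrow> u v \<in> borel_measurable borel"
    "\<And>v. v \<ge> 1 \<Longrightarrow> g v \<in> borel_measurable borel"
    "\<And>v. v \<ge> 1 \<Longrightarrow> k v \<in> borel_measurable borel"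
    and u0: "\<And>v x. v \<ge> 1 \<Longrightarrow> \<bar>u v x - u v 0\<bar> \<le> \<bar>x\<bar>" and ug:
    "\<And>v x. v \<ge> 1 \<Longrightarrow> \<bar>g v x\<bar> \<le> 1"
    "\<And>v. v \<ge> 1 \<Longrightarrow> g v 0 = 0"
    "\<And>v x. v \<ge> 1 \<Longrightarrow> \<bar>k v x\<bar> \<le> 1"
    "\<And>v x y. v \<ge> 1 \<Longrightarrow> \<bar>k v y - k v x\<bar> \<le> \<bar>y - x\<bar> / v"
    "\<And>v x y. v \<ge> 1 \<Longrightarrow> \<bar>g v y - g v x - (y - x) * k v x\<bar> \<le> (y - x)\<^sup>2 / v"
    "\<And>v x y. v \<ge> 1 \<Longrightarrow> \<bar>u v y - u v x - (y - x) * g v x - (y - x)\<^sup>2 / 2 * k v x\<bar> \<le> \<bar>y - x\<bar> ^ 3 / v"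
    and ut: "\<And>v h x. v \<ge> 1 \<Longrightarrow> h \<ge> 0 \<Longrightarrow> \<bar>u (v + h) x - u v x - h / 2 * k v x\<bar> \<le> h\<^sup>2 / v"
    and u1: "\<And>x. \<bar>u 1 x - \<bar>x\<bar>\<bar> \<le> 2"
    and uz: "\<And>v. v \<ge> 1 \<Longrightarrow> u v 0 = sqrt (2 / pi) * sqrt v"
    using heat_kernel_bounds by blast
  define v where "v i = 1 + \<kappa>2 * (\<Sum>j\<in>{i<..N}. (a j)\<^sup>2)" for i
  define F where "F i = expectation (\<lambda>\<omega>. u (v i) (S i \<omega>))" for i
  define h where "h i = \<kappa>2 * (a i)\<^sup>2" for i
  define b where "b i = \<bar>a i * a i * \<gamma> 0 + 2 * (\<Sum>j=1..<i. a i * a j * \<gamma> (i - j)) - h i\<bar>" for i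
  define B1 where "B1 = V ^ 3 * D + 5 * V ^ 3 * D\<^sup>2 * Z + \<kappa>2\<^sup>2 * V ^ 4"
  define c where "c = min 1 (\<kappa>2 * a0\<^sup>2)"
  have c: "c > 0" using a0 \<kappa> by (simp add: c_def)
  have B1: "B1 \<ge> 0" unfolding B1_def using V_ge_1 D_nonneg Z_nonneg by simp
  have tvn: "tv N \<ge> 0" unfolding tv_def by (intro sum_nonneg) auto
  have lnn: "ln (real N) \<ge> 0" using N by simp
  have v1: "v i \<ge> 1" for i unfolding v_def using \<kappa> by (simp add: sum_nonneg)
  have h0: "h i \<ge> 0" for i unfolding h_def using \<kappa> by simp
  have vh: "v (i - 1) = v i + h i" if "i \<in> {1..N}" for i
  proof -
    have "{i - 1<..N} = insert i {i<..N}" using that by auto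
    then show ?thesis by (simp add: v_def h_def algebra_simps)
  qed
  \<comment> \<open>The lower bound on the weights makes the remaining variance grow linearly
    backwards from \<open>N\<close>, so the sum of \<open>1 / v i\<close> is controlled by a
    harmonic number. With \<open>Suc N\<close> instead of \<open>N\<close> the last step has
    denominator 1.\<close>
  have vlow: "c * real (Suc N - i) \<le> v i" if "i \<in> {1..N}" for i
  proof -
    have "c * real (Suc N - i) = c + c * real (N - i)" using that by (simp add: Suc_diff_le algebra_simps)
    also have "\<dots> \<le> 1 + (\<kappa>2 * a0\<^sup>2) * real (N - i)" by (intro add_mono mult_right_mono) (auto simp: c_def)
    also have "(\<kappa>2 * a0\<^sup>2) * real (N - i) = \<kappa>2 * (\<Sum>j\<in>{i<..N}. a0\<^sup>2)" by simp
    also have "1 + \<kappa>2 * (\<Sum>j\<in>{i<..N}. a0\<^sup>2) \<le> v i" unfolding v_def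
    proof (intro add_left_mono mult_left_mono sum_mono)
      fix j assume "j \<in> {i<..N}"
      then have "a0 \<le> \<bar>a j\<bar>" using a0(2)[of j] that by auto
      then have "a0\<^sup>2 \<le> \<bar>a j\<bar>\<^sup>2" using a0 by (intro power_mono) auto
      then show "a0\<^sup>2 \<le> (a j)\<^sup>2" by simp
    qed (use \<kappa> in auto)
    finally show ?thesis .
  qed
  have step: "\<bar>F i - F (i - 1)\<bar> \<le> B1 / c * (1 / real (Suc N - i)) + b i" if i: "i \<in> {1..N}" for i
  proof -
    have i1: "i \<ge> 1" using i by simp
    have "\<bar>F i - F (i - 1)\<bar> \<le> (V ^ 3 * D + 5 * V ^ 3 * D\<^sup>2 * Z + (h i)\<^sup>2) / v i + b i"
      unfolding F_def vh[OF i] b_def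
      by (rule lindeberg_step[of i "v i" "h i" u g k, OF i1 v1 h0]) (use um u0 ug ut v1[of i] h0[of i] in auto)
    also have "(V ^ 3 * D + 5 * V ^ 3 * D\<^sup>2 * Z + (h i)\<^sup>2) / v i \<le> B1 / v i"
    proof -
      have "(h i)\<^sup>2 = \<kappa>2\<^sup>2 * \<bar>a i\<bar> ^ 4" by (simp add: h_def power_mult_distrib power_even_abs flip: power_mult)
      also have "\<dots> \<le> \<kappa>2\<^sup>2 * V ^ 4" using a_le by (intro mult_left_mono power_mono) auto
      finally show ?thesis using v1[of i] by (intro divide_right_mono) (auto simp: B1_def)
    qed
    also have "B1 / v i \<le> B1 / (c * real (Suc N - i))"
      using vlow[OF i] B1 c i by (intro divide_left_mono mult_pos_pos) (auto intro: order_less_le_trans[OF _ v1])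
    finally show ?thesis by simp
  qed
  have harm: "(\<Sum>i=1..N. 1 / real (Suc N - i)) \<le> 1 + ln (real N)"
  proof -
    have "(\<Sum>i=1..N. 1 / real (Suc N - i)) = harm N"
      unfolding harm_def by (rule sum.reindex_bij_witness[of _ "\<lambda>m. Suc N - m" "\<lambda>i. Suc N - i"]) (auto simp: inverse_eq_divide)
    then show ?thesis using harm_le_ln[OF N] by simp
  qed
  have "F N - F 0 = (\<Sum>i=1..N. F i - F (i - 1))"
    using sum_telescope_pred[of "Suc N" F] by (simp add: atLeastLessThanSuc_atLeastAtMost)
  then have "\<bar>F N - F 0\<bar> \<le> (\<Sum>i=1..N. \<bar>F i - F (i - 1)\<bar>)" by simp
  also have "\<dots> \<le> (\<Sum>i=1..N. B1 / c * (1 / real (Suc N - i)) + b i)" by (intro sum_mono step)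
  also have "\<dots> = B1 / c * (\<Sum>i=1..N. 1 / real (Suc N - i)) + (\<Sum>i=1..N. b i)"
    by (simp add: sum.distrib sum_distrib_left)
  also have "\<dots> \<le> B1 / c * (1 + ln (real N)) + 2 * V\<^sup>2 * D * Z * (1 + tv N)"
    using harm B1 c variance_increment_sum[of N] unfolding b_def h_def by (intro add_mono mult_left_mono) auto
  finally have F: "\<bar>F N - F 0\<bar> \<le> B1 / c * (1 + ln (real N)) + 2 * V\<^sup>2 * D * Z * (1 + tv N)" .
  have iS: "integrable M (\<lambda>\<omega>. \<bar>S N \<omega>\<bar>)"
  proof -
    have "integrable M (S N)" unfolding S_def[abs_def] using X_abs(1) by (intro Bochner_Integration.integrable_sum) auto
    then show ?thesis by simp
  qed
  have vN: "v N = 1" by (simp add: v_def)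
  have FN: "\<bar>F N - expectation (\<lambda>\<omega>. \<bar>S N \<omega>\<bar>)\<bar> \<le> 2"
  proof -
    have [measurable]: "u 1 \<in> borel_measurable borel" by (rule um) simp
    have iu: "integrable M (\<lambda>\<omega>. u 1 (S N \<omega>))"
    proof (rule integrable_dominated[where g="\<lambda>\<omega>. 2 + \<bar>S N \<omega>\<bar>"])
      show "\<bar>u 1 (S N \<omega>)\<bar> \<le> 2 + \<bar>S N \<omega>\<bar>" for \<omega> using u1[of "S N \<omega>"] by linarith
    qed (use iS in auto)
    have "F N - expectation (\<lambda>\<omega>. \<bar>S N \<omega>\<bar>) = expectation (\<lambda>\<omega>. u 1 (S N \<omega>) - \<bar>S N \<omega>\<bar>)"
      unfolding F_def vN using iu iS by simp
    moreover have "\<bar>expectation (\<lambda>\<omega>. u 1 (S N \<omega>) - \<bar>S N \<omega>\<bar>)\<bar> \<le> expectation (\<lambda>\<omega>. \<bar>u 1 (S N \<omega>) - \<bar>S N \<omega>\<bar>\<bar>)"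
      by (rule integral_abs_bound)
    moreover have "expectation (\<lambda>\<omega>. \<bar>u 1 (S N \<omega>) - \<bar>S N \<omega>\<bar>\<bar>) \<le> expectation (\<lambda>\<omega>. 2)"
      using iu iS u1 by (intro integral_mono) auto
    moreover have "expectation (\<lambda>\<omega>. 2) = (2::real)" by (simp add: prob_space)
    ultimately show ?thesis by linarith
  qed
  define s where "s = \<kappa>2 * (\<Sum>i=1..N. (a i)\<^sup>2)"
  have s0: "s \<ge> 0" unfolding s_def using \<kappa> by (simp add: sum_nonneg)
  have v0: "v 0 = 1 + s"
  proof -
    have "{0<..N} = {1..N}" by auto
    then show ?thesis by (simp add: v_def s_def)
  qed
  have F0: "F 0 = sqrt (2 / pi) * sqrt (1 + s)"
    unfolding F_def S_0 v0 using uz[of "1 + s"] s0 by (simp add: prob_space)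
  have "sqrt (1 + s) \<le> 1 + sqrt s" using sqrt_add_le_add_sqrt[of 1 s] s0 by simp
  moreover have "sqrt s \<le> sqrt (1 + s)" by simp
  moreover have "0 \<le> sqrt (2 / pi)" "sqrt (2 / pi) \<le> 1" using pi_gt3 by auto
  ultimately have "\<bar>sqrt (2 / pi) * (sqrt (1 + s) - sqrt s)\<bar> \<le> 1 * 1"
    unfolding abs_mult by (intro mult_mono) auto
  then have "\<bar>F 0 - sqrt (2 / pi) * sqrt s\<bar> \<le> 1" by (simp add: F0 right_diff_distrib)
  then have "\<bar>expectation (\<lambda>\<omega>. \<bar>S N \<omega>\<bar>) - sqrt (2 / pi) * sqrt s\<bar> \<le> B1 / c * (1 + ln (real N)) + 2 * V\<^sup>2 * D * Z * (1 + tv N) + 3"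
    using F FN by linarith
  also have "\<dots> \<le> B1 / c * (1 + tv N + ln (real N)) + 2 * V\<^sup>2 * D * Z * (1 + tv N + ln (real N)) + 3 * (1 + tv N + ln (real N))"
  proof -
    have 1: "B1 / c * (1 + ln (real N)) \<le> B1 / c * (1 + tv N + ln (real N))"
      using B1 c tvn by (intro mult_left_mono) auto
    have 2: "2 * V\<^sup>2 * D * Z * (1 + tv N) \<le> 2 * V\<^sup>2 * D * Z * (1 + tv N + ln (real N))"
      using lnn D_nonneg Z_nonneg by (intro mult_left_mono) auto
    have 3: "3 \<le> 3 * (1 + tv N + ln (real N))" using tvn lnn by simp
    show ?thesis by (rule add_mono[OF add_mono[OF 1 2] 3])
  qed
  also have "\<dots> = lindeberg_const a0 V * (1 + tv N + ln (real N))"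
    unfolding lindeberg_const_def B1_def[symmetric] c_def[symmetric] by (simp add: algebra_simps)
  finally show ?thesis unfolding s_def .
qed

end

section \<open>Second moments of window sums\<close>

text \<open>Jensen's inequality for the square, read off the nonnegative variance of the
  modulus.\<close>

lemma (in prob_space) expectation_abs_le_sqrt:
  fixes X :: "'a \<Rightarrow> real"
  assumes [measurable]: "X \<in> borel_measurable M" and sq: "integrable M (\<lambda>\<omega>. (X \<omega>)\<^sup>2)"
  shows "integrable M (\<lambda>\<omega>. \<bar>X \<omega>\<bar>)" and "expectation (\<lambda>\<omega>. \<bar>X \<omega>\<bar>) \<le> sqrt (expectation (\<lambda>\<omega>. (X \<omega>)\<^sup>2))"
proof -
  show i: "integrable M (\<lambda>\<omega>. \<bar>X \<omega>\<bar>)"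
  proof (rule integrable_dominated[where g="\<lambda>\<omega>. 1 + (X \<omega>)\<^sup>2"])
    show "\<bar>\<bar>X \<omega>\<bar>\<bar> \<le> 1 + (X \<omega>)\<^sup>2" for \<omega>
    proof -
      have "0 \<le> (\<bar>X \<omega>\<bar> - 1)\<^sup>2" by simp
      then have "2 * \<bar>X \<omega>\<bar> \<le> 1 + (X \<omega>)\<^sup>2" by (simp add: power2_diff)
      then show ?thesis by simp
    qed
  qed (use sq in auto)
  define m where "m = expectation (\<lambda>\<omega>. \<bar>X \<omega>\<bar>)"
  have "0 \<le> expectation (\<lambda>\<omega>. (\<bar>X \<omega>\<bar> - m)\<^sup>2)" by simp
  also have "\<dots> = expectation (\<lambda>\<omega>. (X \<omega>)\<^sup>2 - 2 * m * \<bar>X \<omega>\<bar> + m\<^sup>2)"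
    by (intro Bochner_Integration.integral_cong refl) (simp add: power2_diff algebra_simps)
  also have "\<dots> = expectation (\<lambda>\<omega>. (X \<omega>)\<^sup>2) - 2 * m * m + m\<^sup>2"
    using i sq by (simp add: prob_space m_def)
  finally have "m\<^sup>2 \<le> expectation (\<lambda>\<omega>. (X \<omega>)\<^sup>2)" by (simp add: power2_eq_square)
  then show "expectation (\<lambda>\<omega>. \<bar>X \<omega>\<bar>) \<le> sqrt (expectation (\<lambda>\<omega>. (X \<omega>)\<^sup>2))"
    unfolding m_def[symmetric] by (rule real_le_rsqrt)
qed

text \<open>Each row of the covariance matrix is dominated by \<open>s 0, s 1, ...\<close> from the
  diagonal to the right and by \<open>s 1, s 2, ...\<close> to the left, hence has a row sum of at
  most \<open>2 * suminf s\<close>.\<close>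

lemma (in prob_space) square_sum_le:
  fixes \<zeta> :: "nat \<Rightarrow> 'a \<Rightarrow> real" and w :: "nat \<Rightarrow> real"
  assumes int: "\<And>i j. i \<in> {1..N} \<Longrightarrow> j \<in> {1..N} \<Longrightarrow> integrable M (\<lambda>\<omega>. \<zeta> i \<omega> * \<zeta> j \<omega>)"
    and cov: "\<And>i k. i \<in> {1..N} \<Longrightarrow> i + k \<in> {1..N} \<Longrightarrow> \<bar>expectation (\<lambda>\<omega>. \<zeta> i \<omega> * \<zeta> (i + k) \<omega>)\<bar> \<le> s k"
    and s: "summable s" "\<And>k. s k \<ge> 0" and w: "\<And>i. i \<in> {1..N} \<Longrightarrow> \<bar>w i\<bar> \<le> W"
  shows "integrable M (\<lambda>\<omega>. (\<Sum>i=1..N. w i * \<zeta> i \<omega>)\<^sup>2)"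
    and "expectation (\<lambda>\<omega>. (\<Sum>i=1..N. w i * \<zeta> i \<omega>)\<^sup>2) \<le> W\<^sup>2 * real N * (2 * suminf s)"
proof -
  have eq: "(\<Sum>i=1..N. w i * \<zeta> i \<omega>)\<^sup>2 = (\<Sum>i=1..N. \<Sum>j=1..N. w i * w j * (\<zeta> i \<omega> * \<zeta> j \<omega>))" for \<omega>
    unfolding power2_eq_square sum_product by (intro sum.cong refl) (simp add: mult_ac)
  show "integrable M (\<lambda>\<omega>. (\<Sum>i=1..N. w i * \<zeta> i \<omega>)\<^sup>2)"
    unfolding eq using int by (intro Bochner_Integration.integrable_sum integrable_mult_right) auto
  have S: "(\<Sum>k\<in>A. s k) \<le> suminf s" if "finite A" for A using s that by (intro sum_le_suminf) auto
  define t where "t i j = (if i \<le> j then s (j - i) else s (i - j))" for i j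
  have c: "\<bar>w i * w j * expectation (\<lambda>\<omega>. \<zeta> i \<omega> * \<zeta> j \<omega>)\<bar> \<le> W\<^sup>2 * t i j" if "i \<in> {1..N}" "j \<in> {1..N}" for i j
  proof -
    have "\<bar>expectation (\<lambda>\<omega>. \<zeta> i \<omega> * \<zeta> j \<omega>)\<bar> \<le> t i j"
    proof (cases "i \<le> j")
      case True then show ?thesis using cov[of i "j - i"] that by (simp add: t_def)
    next
      case False
      have "expectation (\<lambda>\<omega>. \<zeta> i \<omega> * \<zeta> j \<omega>) = expectation (\<lambda>\<omega>. \<zeta> j \<omega> * \<zeta> i \<omega>)" by (simp only: mult.commute)
      then show ?thesis using cov[of j "i - j"] that False by (simp add: t_def)
    qed
    moreover have "\<bar>w i\<bar> * \<bar>w j\<bar> \<le> W * W" using w[OF that(1)] w[OF that(2)] by (intro mult_mono) auto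
    ultimately show ?thesis unfolding abs_mult power2_eq_square by - (rule mult_mono, auto)
  qed
  have ti: "(\<Sum>j=1..N. t i j) \<le> 2 * suminf s" if "i \<in> {1..N}" for i
  proof -
    have "{1..N} = {1..<i} \<union> {i..N}" "{1..<i} \<inter> {i..N} = {}" using that by auto
    then have "(\<Sum>j=1..N. t i j) = (\<Sum>j=1..<i. t i j) + (\<Sum>j=i..N. t i j)" by (simp add: sum.union_disjoint)
    also have "(\<Sum>j=1..<i. t i j) = (\<Sum>k=1..<i. s k)"
      by (rule sum.reindex_bij_witness[of _ "\<lambda>k. i - k" "\<lambda>j. i - j"]) (auto simp: t_def)
    also have "(\<Sum>j=i..N. t i j) = (\<Sum>k=0..N - i. s k)"
      by (rule sum.reindex_bij_witness[of _ "\<lambda>k. i + k" "\<lambda>j. j - i"]) (use that in \<open>auto simp: t_def\<close>)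
    finally show ?thesis using S[of "{1..<i}"] S[of "{0..N - i}"] by simp
  qed
  have "expectation (\<lambda>\<omega>. (\<Sum>i=1..N. w i * \<zeta> i \<omega>)\<^sup>2) = (\<Sum>i=1..N. \<Sum>j=1..N. w i * w j * expectation (\<lambda>\<omega>. \<zeta> i \<omega> * \<zeta> j \<omega>))"
  proof -
    have "expectation (\<lambda>\<omega>. \<Sum>i=1..N. \<Sum>j=1..N. w i * w j * (\<zeta> i \<omega> * \<zeta> j \<omega>))
        = (\<Sum>i=1..N. expectation (\<lambda>\<omega>. \<Sum>j=1..N. w i * w j * (\<zeta> i \<omega> * \<zeta> j \<omega>)))"
      using int by (intro Bochner_Integration.integral_sum Bochner_Integration.integrable_sum integrable_mult_right) auto
    also have "\<dots> = (\<Sum>i=1..N. \<Sum>j=1..N. expectation (\<lambda>\<omega>. w i * w j * (\<zeta> i \<omega> * \<zeta> j \<omega>)))"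
      using int by (intro sum.cong refl Bochner_Integration.integral_sum integrable_mult_right) auto
    finally show ?thesis unfolding eq integral_mult_right_zero .
  qed
  also have "\<dots> \<le> (\<Sum>i=1..N. \<Sum>j=1..N. W\<^sup>2 * t i j)"
    using c by (intro sum_mono) (meson abs_le_D1)
  also have "\<dots> = W\<^sup>2 * (\<Sum>i=1..N. \<Sum>j=1..N. t i j)" by (simp only: sum_distrib_left)
  also have "\<dots> \<le> W\<^sup>2 * (\<Sum>i=1..N. 2 * suminf s)" using ti by (intro mult_left_mono sum_mono) auto
  finally show "expectation (\<lambda>\<omega>. (\<Sum>i=1..N. w i * \<zeta> i \<omega>)\<^sup>2) \<le> W\<^sup>2 * real N * (2 * suminf s)" by simp
qed

lemma powr_minus_summable: "b > 1 \<Longrightarrow> summable (\<lambda>k. real k powr (- b))"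
  by (simp add: summable_real_powr_iff)

context mixing_process
begin

text \<open>Second-order bounds for a function \<open>f\<close> of the process need only two moments and a
  covariance decay that is summable; the truncation arguments need them uniformly in \<open>f\<close>.\<close>

lemma functional_square_sum:
  fixes f h :: "real \<Rightarrow> real"
  assumes f [measurable]: "f \<in> borel_measurable borel" and fh: "\<And>y. \<bar>f y\<bar> \<le> h y"
    and h [measurable]: "h \<in> borel_measurable borel"
    and ih: "integrable M (\<lambda>\<omega>. h (Y 1 \<omega>) powr p)" and p: "p > 2" and rate: "\<theta> * (1 - 2 / p) > 1"
    and f0: "expectation (\<lambda>\<omega>. f (Y 1 \<omega>)) = 0"
  defines "s \<equiv> \<lambda>k. \<bar>expectation (\<lambda>\<omega>. f (Y 1 \<omega>) * f (Y (1 + k) \<omega>))\<bar>"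
  shows "summable s"
    and "k \<ge> 1 \<Longrightarrow> s k \<le> 4 * (1 + expectation (\<lambda>\<omega>. h (Y 1 \<omega>) powr p))\<^sup>2 * C * real k powr (- (\<theta> * (1 - 2 / p)))"
    and "(\<And>i. i \<in> {1..N} \<Longrightarrow> \<bar>w i\<bar> \<le> W) \<Longrightarrow> integrable M (\<lambda>\<omega>. (\<Sum>i=1..N. w i * f (Y (r + i) \<omega>))\<^sup>2)"
    and "(\<And>i. i \<in> {1..N} \<Longrightarrow> \<bar>w i\<bar> \<le> W) \<Longrightarrow> expectation (\<lambda>\<omega>. (\<Sum>i=1..N. w i * f (Y (r + i) \<omega>))\<^sup>2) \<le> W\<^sup>2 * real N * (2 * suminf s)"
proof -
  define K where "K = expectation (\<lambda>\<omega>. h (Y 1 \<omega>) powr p)"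
  have 1: "s k \<le> 4 * (1 + K)\<^sup>2 * C * real k powr (- (\<theta> * (1 - 2 / p)))" if "k \<ge> 1" for k
    unfolding s_def by (rule cov_pair(1)[OF f f fh fh h ih _ f0 p _ that]) (simp_all add: K_def)
  then show "k \<ge> 1 \<Longrightarrow> s k \<le> 4 * (1 + expectation (\<lambda>\<omega>. h (Y 1 \<omega>) powr p))\<^sup>2 * C * real k powr (- (\<theta> * (1 - 2 / p)))"
    unfolding K_def .
  show s: "summable s"
  proof (rule summable_comparison_test')
    show "summable (\<lambda>k. 4 * (1 + K)\<^sup>2 * C * real k powr (- (\<theta> * (1 - 2 / p))))"
      by (intro summable_mult powr_minus_summable rate)
    show "norm (s k) \<le> 4 * (1 + K)\<^sup>2 * C * real k powr (- (\<theta> * (1 - 2 / p)))" if "k \<ge> 1" for k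
      using 1[OF that] by (simp add: s_def)
  qed
  have sq: "integrable M (\<lambda>\<omega>. (f (Y i \<omega>))\<^sup>2)" if "i \<ge> 1" for i
  proof -
    have "integrable M (\<lambda>\<omega>. (f (Y 1 \<omega>))\<^sup>2)"
    proof (rule integrable_dominated[where g="\<lambda>\<omega>. 1 + h (Y 1 \<omega>) powr p"])
      show "\<bar>(f (Y 1 \<omega>))\<^sup>2\<bar> \<le> 1 + h (Y 1 \<omega>) powr p" for \<omega>
      proof -
        have h0: "h y \<ge> 0" for y using fh[of y] by linarith
        have "\<bar>f (Y 1 \<omega>)\<bar>\<^sup>2 \<le> (h (Y 1 \<omega>))\<^sup>2" using fh by (intro power_mono) auto
        also have "\<dots> = h (Y 1 \<omega>) powr 2" using h0 by simp
        also have "\<dots> \<le> 1 + (h (Y 1 \<omega>) powr 2) powr (p / 2)" using p by (intro abs_le_one_plus_powr) auto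
        also have "(h (Y 1 \<omega>) powr 2) powr (p / 2) = h (Y 1 \<omega>) powr p" by (simp only: powr_powr) simp
        finally show ?thesis by simp
      qed
    qed (use ih in auto)
    then show ?thesis using stationary_single(2)[of "\<lambda>y. (f y)\<^sup>2", OF _ that] by simp
  qed
  have int: "integrable M (\<lambda>\<omega>. f (Y (r + i) \<omega>) * f (Y (r + j) \<omega>))" if "i \<in> {1..N}" "j \<in> {1..N}" for i j r N
  proof (rule integrable_dominated[where g="\<lambda>\<omega>. (f (Y (r + i) \<omega>))\<^sup>2 + (f (Y (r + j) \<omega>))\<^sup>2"])
    show "\<bar>f (Y (r + i) \<omega>) * f (Y (r + j) \<omega>)\<bar> \<le> (f (Y (r + i) \<omega>))\<^sup>2 + (f (Y (r + j) \<omega>))\<^sup>2" for \<omega>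
    proof -
      let ?x = "\<bar>f (Y (r + i) \<omega>)\<bar>" and ?y = "\<bar>f (Y (r + j) \<omega>)\<bar>"
      have "0 \<le> (?x - ?y)\<^sup>2" by simp
      then have "2 * (?x * ?y) \<le> ?x\<^sup>2 + ?y\<^sup>2" unfolding power2_diff by simp
      moreover have "0 \<le> ?x * ?y" by simp
      ultimately show ?thesis unfolding abs_mult power2_abs by linarith
    qed
  qed (use that sq in auto)
  have cov: "\<bar>expectation (\<lambda>\<omega>. f (Y (r + i) \<omega>) * f (Y (r + (i + k)) \<omega>))\<bar> \<le> s k" if "i \<in> {1..N}" for i k r N
    using stationary_pair(1)[of "\<lambda>x y. f x * f y" "r + i" k] that by (simp add: s_def add.assoc)
  note q = square_sum_le[where \<zeta>="\<lambda>i \<omega>. f (Y (r + i) \<omega>)" and N=N and s=s and w=w and W=W, OF int cov s]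
  show "(\<And>i. i \<in> {1..N} \<Longrightarrow> \<bar>w i\<bar> \<le> W) \<Longrightarrow> integrable M (\<lambda>\<omega>. (\<Sum>i=1..N. w i * f (Y (r + i) \<omega>))\<^sup>2)"
    by (rule q(1)) (auto simp: s_def)
  show "(\<And>i. i \<in> {1..N} \<Longrightarrow> \<bar>w i\<bar> \<le> W) \<Longrightarrow> expectation (\<lambda>\<omega>. (\<Sum>i=1..N. w i * f (Y (r + i) \<omega>))\<^sup>2) \<le> W\<^sup>2 * real N * (2 * suminf s)"
    by (rule q(2)) (auto simp: s_def)
qed

lemma functional_abs_sum:
  fixes f h :: "real \<Rightarrow> real"
  assumes f [measurable]: "f \<in> borel_measurable borel" and fh: "\<And>y. \<bar>f y\<bar> \<le> h y"
    and h: "h \<in> borel_measurable borel"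
    and ih: "integrable M (\<lambda>\<omega>. h (Y 1 \<omega>) powr p)" and p: "p > 2" and rate: "\<theta> * (1 - 2 / p) > 1"
    and f0: "expectation (\<lambda>\<omega>. f (Y 1 \<omega>)) = 0" and w: "\<And>i. i \<in> {1..N} \<Longrightarrow> \<bar>w i\<bar> \<le> W" and W: "W \<ge> 0"
  shows "integrable M (\<lambda>\<omega>. \<bar>\<Sum>i=1..N. w i * f (Y (r + i) \<omega>)\<bar>)"
    and "expectation (\<lambda>\<omega>. \<bar>\<Sum>i=1..N. w i * f (Y (r + i) \<omega>)\<bar>)
      \<le> W * sqrt (real N) * sqrt (2 * (\<Sum>k. \<bar>expectation (\<lambda>\<omega>. f (Y 1 \<omega>) * f (Y (1 + k) \<omega>))\<bar>))"
proof -
  note q = functional_square_sum(3,4)[OF f fh h ih p rate f0 w]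
  have m: "(\<lambda>\<omega>. \<Sum>i=1..N. w i * f (Y (r + i) \<omega>)) \<in> borel_measurable M"
    by (intro borel_measurable_sum) auto
  note e = expectation_abs_le_sqrt[OF m q(1)]
  show "integrable M (\<lambda>\<omega>. \<bar>\<Sum>i=1..N. w i * f (Y (r + i) \<omega>)\<bar>)" by (rule e(1))
  have "expectation (\<lambda>\<omega>. \<bar>\<Sum>i=1..N. w i * f (Y (r + i) \<omega>)\<bar>) \<le> sqrt (expectation (\<lambda>\<omega>. (\<Sum>i=1..N. w i * f (Y (r + i) \<omega>))\<^sup>2))"
    by (rule e(2))
  also have "\<dots> \<le> sqrt (W\<^sup>2 * real N * (2 * (\<Sum>k. \<bar>expectation (\<lambda>\<omega>. f (Y 1 \<omega>) * f (Y (1 + k) \<omega>))\<bar>)))"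
    by (intro real_sqrt_le_mono q(2))
  also have "\<dots> = W * sqrt (real N) * sqrt (2 * (\<Sum>k. \<bar>expectation (\<lambda>\<omega>. f (Y 1 \<omega>) * f (Y (1 + k) \<omega>))\<bar>))"
    using W by (simp add: real_sqrt_mult)
  finally show "expectation (\<lambda>\<omega>. \<bar>\<Sum>i=1..N. w i * f (Y (r + i) \<omega>)\<bar>)
      \<le> W * sqrt (real N) * sqrt (2 * (\<Sum>k. \<bar>expectation (\<lambda>\<omega>. f (Y 1 \<omega>) * f (Y (1 + k) \<omega>))\<bar>))" .
qed

end

section \<open>Truncation\<close>

lemma (in mixing_functional) window_abs_moment:
  assumes N: "N \<ge> 1" and a: "\<And>i. i \<in> {1..N} \<Longrightarrow> a0 \<le> \<bar>a i\<bar> \<and> \<bar>a i\<bar> \<le> V" and a0: "a0 > 0" and V: "V \<ge> 1"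
    and tv: "(\<Sum>i=1..<N. \<bar>a (Suc i) - a i\<bar>) \<le> W" and \<kappa>: "\<kappa>2 > 0"
  shows "\<bar>expectation (\<lambda>\<omega>. \<bar>\<Sum>i=1..N. a i * \<phi> (Y (r + i) \<omega>)\<bar>) - sqrt (2 / pi) * sqrt (\<kappa>2 * (\<Sum>i=1..N. (a i)\<^sup>2))\<bar>
    \<le> lindeberg_const a0 V * (1 + W + ln (real N))"
proof -
  \<comment> \<open>The locale bounds all weights, so they are set to 0 outside the window; the drop
    at the end is not seen by \<open>tv N\<close>, which stops at the increment to
    \<open>N\<close>.\<close>
  define a' where "a' i = (if i \<in> {1..N} then a i else 0)" for i
  interpret W: mixing_window M Y C \<theta> \<phi> p K r a' V
    by unfold_locales (use a V in \<open>auto simp: a'_def\<close>)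
  have S: "W.S N \<omega> = (\<Sum>i=1..N. a i * \<phi> (Y (r + i) \<omega>))" for \<omega>
    unfolding W.S_def W.X_def \<xi>_def by (intro sum.cong refl) (simp add: a'_def)
  have "(\<Sum>i=1..N. (a' i)\<^sup>2) = (\<Sum>i=1..N. (a i)\<^sup>2)" by (intro sum.cong refl) (simp add: a'_def)
  moreover have "W.tv N = (\<Sum>i=1..<N. \<bar>a (Suc i) - a i\<bar>)"
    unfolding W.tv_def by (intro sum.cong refl) (simp add: a'_def)
  moreover have "a0 \<le> \<bar>a' i\<bar>" if "i \<in> {1..N}" for i using a[OF that] that by (simp add: a'_def)
  ultimately have "\<bar>expectation (\<lambda>\<omega>. \<bar>\<Sum>i=1..N. a i * \<phi> (Y (r + i) \<omega>)\<bar>) - sqrt (2 / pi) * sqrt (\<kappa>2 * (\<Sum>i=1..N. (a i)\<^sup>2))\<bar>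
    \<le> lindeberg_const a0 V * (1 + (\<Sum>i=1..<N. \<bar>a (Suc i) - a i\<bar>) + ln (real N))"
    using W.lindeberg_abs_moment[OF N a0 _ \<kappa>] by (simp add: S)
  also have "\<dots> \<le> lindeberg_const a0 V * (1 + W + ln (real N))"
  proof (intro mult_left_mono add_mono tv order_refl)
    have "min 1 (\<kappa>2 * a0\<^sup>2) > 0" using \<kappa> a0 by simp
    then show "lindeberg_const a0 V \<ge> 0"
      unfolding lindeberg_const_def using V D_nonneg Z_nonneg by (intro add_nonneg_nonneg divide_nonneg_pos) auto
  qed
  finally show ?thesis .
qed

text \<open>Clipping keeps both the truncated value and the remainder below
  \<open>\<bar>y\<bar>\<close>. The levels are natural numbers, as dominated convergence runs along
  sequences.\<close>

definition truncate :: "nat \<Rightarrow> real \<Rightarrow> real" where "truncate A y = max (- real A) (min (real A) y)"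

lemma truncate_measurable [measurable]: "truncate A \<in> borel_measurable borel"
  unfolding truncate_def[abs_def] by measurable

lemma truncate_bounds: "\<bar>truncate A y\<bar> \<le> \<bar>y\<bar>" "\<bar>truncate A y\<bar> \<le> real A" "\<bar>y - truncate A y\<bar> \<le> \<bar>y\<bar>"
  by (auto simp: truncate_def)

lemma truncate_tendsto: "(\<lambda>A. truncate A y) \<longlonglongrightarrow> y"
proof (rule tendsto_eventually)
  obtain n where n: "\<bar>y\<bar> \<le> real n" using real_arch_simple by blast
  show "eventually (\<lambda>A. truncate A y = y) sequentially"
    using eventually_ge_at_top[of n] by eventually_elim (use n in \<open>auto simp: truncate_def\<close>)
qed

text \<open>\<open>p\<close> will be \<open>2 + \<delta>\<close>, for which the covariances of the
  process itself are summable. \<open>\<theta> > 6\<close> serves bounded functions, whose decay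
  \<open>\<theta> / 2\<close> at \<open>p = 6\<close> exceeds 2, and the clipped statistics of
  distant blocks.\<close>

locale centered_process = mixing_process +
  fixes p :: real
  assumes p_gt_2: "p > 2" and rate2: "\<theta> * (1 - 2 / p) > 2" and \<theta>_gt_6: "\<theta> > 6"
    and Y_moment: "integrable M (\<lambda>\<omega>. \<bar>Y 1 \<omega>\<bar> powr p)"
    and Y_mean: "expectation (Y 1) = 0" and Y_square: "expectation (\<lambda>\<omega>. (Y 1 \<omega>)\<^sup>2) = 1"
    and lrv_pos: "long_run_variance M Y > 0"
begin

abbreviation lrv :: real where "lrv \<equiv> long_run_variance M Y"

lemma Y1_measurable [measurable]: "Y 1 \<in> borel_measurable M" "Y (Suc 0) \<in> borel_measurable M"
  using Y_measurable[of 1] by simp_all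

lemma Y_int: "integrable M (Y 1)"
  by (rule integrable_powr_less[OF _ Y_moment]) (use p_gt_2 in auto)

lemma Y_square_int: "i \<ge> 1 \<Longrightarrow> integrable M (\<lambda>\<omega>. (Y i \<omega>)\<^sup>2)"
proof -
  assume i: "i \<ge> 1"
  have "integrable M (\<lambda>\<omega>. (Y 1 \<omega>)\<^sup>2)"
    using not_integrable_integral_eq[of M "\<lambda>\<omega>. (Y 1 \<omega>)\<^sup>2"] Y_square by force
  then show ?thesis using stationary_single(2)[of "\<lambda>y. y\<^sup>2", OF _ i] by simp
qed

lemma Y_mean': "i \<ge> 1 \<Longrightarrow> expectation (Y i) = 0"
  using stationary_single(1)[of "\<lambda>y. y" i] Y_mean by simp

lemma lrv_eq: "lrv = 1 + 2 * (\<Sum>k. expectation (\<lambda>\<omega>. Y 1 \<omega> * Y (1 + Suc k) \<omega>))"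
  unfolding long_run_variance_def covariance_def using Y_mean Y_mean' Y_square by simp

text \<open>Uniform in the offset and the weights, since one error has to serve all blocks, which
  differ in position and in the values of \<open>\<sigma>\<close>. The error is measured in units of
  \<open>sqrt N\<close>, the size of the sum.\<close>

definition window_approx :: "nat \<Rightarrow> real \<Rightarrow> real \<Rightarrow> real \<Rightarrow> real \<Rightarrow> bool" where
  "window_approx N a0 V W e \<longleftrightarrow>
    (\<forall>r a. (\<forall>i\<in>{1..N}. a0 \<le> \<bar>a i\<bar> \<and> \<bar>a i\<bar> \<le> V) \<longrightarrow> (\<Sum>i=1..<N. \<bar>a (Suc i) - a i\<bar>) \<le> W \<longrightarrow>
      \<bar>expectation (\<lambda>\<omega>. \<bar>\<Sum>i=1..N. a i * Y (r + i) \<omega>\<bar>) - sqrt (2 / pi) * sqrt lrv * sqrt (\<Sum>i=1..N. (a i)\<^sup>2)\<bar> \<le> e * sqrt (real N))"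

definition square_approx :: "nat \<Rightarrow> real \<Rightarrow> real \<Rightarrow> bool" where
  "square_approx N W e \<longleftrightarrow>
    (\<forall>r w. (\<forall>i\<in>{1..N}. \<bar>w i\<bar> \<le> W) \<longrightarrow> 
      expectation (\<lambda>\<omega>. \<bar>\<Sum>i=1..N. w i * ((Y (r + i) \<omega>)\<^sup>2 - 1)\<bar>) \<le> e * real N)"

lemma window_approx_moments:
  assumes p4: "p4 > 3" "\<theta> * (1 - 3 / p4) > 2" and i4: "integrable M (\<lambda>\<omega>. \<bar>Y 1 \<omega>\<bar> powr p4)"
    and a0: "a0 > 0" and V: "V \<ge> 1"
  shows "\<exists>B. \<forall>N\<ge>1. window_approx N a0 V W (B * (1 + W + ln (real N)) / sqrt (real N))"
proof -
  interpret F: mixing_functional M Y C \<theta> "\<lambda>y. y" p4 "expectation (\<lambda>\<omega>. \<bar>Y 1 \<omega>\<bar> powr p4)"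
    by unfold_locales (use p4 i4 Y_mean in auto)
  have k: "F.\<kappa>2 = lrv"
    unfolding F.\<kappa>2_def lrv_eq F.\<gamma>_def F.\<xi>_def using Y_square by (simp add: power2_eq_square)
  show ?thesis
  proof (intro exI[of _ "F.lindeberg_const a0 V"] allI impI)
    fix N :: nat assume N: "N \<ge> 1"
    show "window_approx N a0 V W (F.lindeberg_const a0 V * (1 + W + ln (real N)) / sqrt (real N))"
      unfolding window_approx_def
    proof (intro allI impI)
      fix r a assume "\<forall>i\<in>{1..N}. a0 \<le> \<bar>a i\<bar> \<and> \<bar>a i\<bar> \<le> V" "(\<Sum>i=1..<N. \<bar>a (Suc i) - a i\<bar>) \<le> W"
      then show "\<bar>expectation (\<lambda>\<omega>. \<bar>\<Sum>i=1..N. a i * Y (r + i) \<omega>\<bar>) - sqrt (2 / pi) * sqrt lrv * sqrt (\<Sum>i=1..N. (a i)\<^sup>2)\<bar>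
        \<le> F.lindeberg_const a0 V * (1 + W + ln (real N)) / sqrt (real N) * sqrt (real N)"
        using F.window_abs_moment[OF N _ a0 V, of a W r] lrv_pos N by (simp add: k real_sqrt_mult mult.assoc)
    qed
  qed
qed

text \<open>A common envelope, for all levels, of \<open>y\<close>, of the centred truncation and of
  the difference of the two; it inherits the moment of order \<open>p\<close>.\<close>

definition \<psi> :: "real \<Rightarrow> real" where "\<psi> y = \<bar>y\<bar> + expectation (\<lambda>\<omega>. \<bar>Y 1 \<omega>\<bar>)"
definition tmean :: "nat \<Rightarrow> real" where "tmean A = expectation (\<lambda>\<omega>. truncate A (Y 1 \<omega>))"
definition trunc :: "nat \<Rightarrow> real \<Rightarrow> real" where "trunc A y = truncate A y - tmean A"

lemma \<psi>_measurable [measurable]: "\<psi> \<in> borel_measurable borel"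
  unfolding \<psi>_def[abs_def] by measurable

lemma trunc_measurable [measurable]: "trunc A \<in> borel_measurable borel"
  unfolding trunc_def[abs_def] by measurable

lemma truncate_int: "integrable M (\<lambda>\<omega>. truncate A (Y 1 \<omega>))"
  by (rule integrable_dominated[where g="\<lambda>\<omega>. \<bar>Y 1 \<omega>\<bar>"]) (use Y_int truncate_bounds in auto)

lemma tmean_tendsto: "tmean \<longlonglongrightarrow> 0"
proof -
  have "(\<lambda>A. expectation (\<lambda>\<omega>. truncate A (Y 1 \<omega>))) \<longlonglongrightarrow> expectation (\<lambda>\<omega>. Y 1 \<omega>)"
    by (rule integral_dominated_convergence[where w="\<lambda>\<omega>. \<bar>Y 1 \<omega>\<bar>"])
       (use Y_int truncate_bounds truncate_tendsto in auto)
  then show ?thesis using Y_mean by (simp add: tmean_def[abs_def])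
qed

lemma tmean_le: "\<bar>tmean A\<bar> \<le> expectation (\<lambda>\<omega>. \<bar>Y 1 \<omega>\<bar>)" "\<bar>y - trunc A y\<bar> \<le> \<psi> y" "\<bar>trunc A y\<bar> \<le> \<psi> y" "\<bar>y\<bar> \<le> \<psi> y"
proof -
  have "\<bar>tmean A\<bar> \<le> expectation (\<lambda>\<omega>. \<bar>truncate A (Y 1 \<omega>)\<bar>)" unfolding tmean_def by (rule integral_abs_bound)
  also have "\<dots> \<le> expectation (\<lambda>\<omega>. \<bar>Y 1 \<omega>\<bar>)"
    using truncate_int Y_int truncate_bounds by (intro integral_mono) auto
  finally show 1: "\<bar>tmean A\<bar> \<le> expectation (\<lambda>\<omega>. \<bar>Y 1 \<omega>\<bar>)" .
  show "\<bar>y - trunc A y\<bar> \<le> \<psi> y" using truncate_bounds(3)[of y A] 1 unfolding \<psi>_def trunc_def by linarith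
  show "\<bar>trunc A y\<bar> \<le> \<psi> y" using truncate_bounds(1)[of A y] 1 unfolding \<psi>_def trunc_def by linarith
  show "\<bar>y\<bar> \<le> \<psi> y" using 1 unfolding \<psi>_def by linarith
qed

lemma trunc_tendsto: "(\<lambda>A. trunc A y) \<longlonglongrightarrow> y"
  unfolding trunc_def using tendsto_diff[OF truncate_tendsto[of y] tmean_tendsto] by simp

lemma trunc_centered: "expectation (\<lambda>\<omega>. trunc A (Y 1 \<omega>)) = 0" "expectation (\<lambda>\<omega>. Y 1 \<omega> - trunc A (Y 1 \<omega>)) = 0"
proof -
  have i: "integrable M (\<lambda>\<omega>. trunc A (Y 1 \<omega>))" unfolding trunc_def using truncate_int by simp
  show "expectation (\<lambda>\<omega>. trunc A (Y 1 \<omega>)) = 0" unfolding trunc_def using truncate_int by (simp add: prob_space tmean_def)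
  then show "expectation (\<lambda>\<omega>. Y 1 \<omega> - trunc A (Y 1 \<omega>)) = 0" using i Y_int Y_mean by simp
qed

lemma \<psi>_moment: "integrable M (\<lambda>\<omega>. \<psi> (Y 1 \<omega>) powr p)"
proof (rule integrable_dominated[where g="\<lambda>\<omega>. 2 powr p * (\<bar>Y 1 \<omega>\<bar> powr p + expectation (\<lambda>\<omega>. \<bar>Y 1 \<omega>\<bar>) powr p)"])
  show "\<bar>\<psi> (Y 1 \<omega>) powr p\<bar> \<le> 2 powr p * (\<bar>Y 1 \<omega>\<bar> powr p + expectation (\<lambda>\<omega>. \<bar>Y 1 \<omega>\<bar>) powr p)" for \<omega>
  proof -
    define m where "m = expectation (\<lambda>\<omega>. \<bar>Y 1 \<omega>\<bar>)"
    have m: "m \<ge> 0" unfolding m_def by simp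
    let ?z = "max \<bar>Y 1 \<omega>\<bar> m"
    have "\<psi> (Y 1 \<omega>) powr p \<le> (2 * ?z) powr p"
      unfolding \<psi>_def m_def[symmetric] using m p_gt_2 by (intro powr_mono2) auto
    also have "\<dots> = 2 powr p * ?z powr p" using m by (simp add: powr_mult)
    also have "?z powr p \<le> \<bar>Y 1 \<omega>\<bar> powr p + m powr p" by (auto simp: max_def)
    finally show ?thesis unfolding m_def by simp
  qed
qed (use Y_moment in auto)

lemma \<psi>_square_int: "i \<ge> 1 \<Longrightarrow> integrable M (\<lambda>\<omega>. (\<psi> (Y i \<omega>))\<^sup>2)"
proof -
  assume i: "i \<ge> 1"
  have "integrable M (\<lambda>\<omega>. 1 + \<psi> (Y 1 \<omega>) powr p)" using \<psi>_moment by simp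
  then have "integrable M (\<lambda>\<omega>. (\<psi> (Y 1 \<omega>))\<^sup>2)"
  proof (rule integrable_dominated[rotated])
    show "\<bar>(\<psi> (Y 1 \<omega>))\<^sup>2\<bar> \<le> 1 + \<psi> (Y 1 \<omega>) powr p" for \<omega>
    proof -
      have h0: "\<psi> y \<ge> 0" for y using tmean_le(4)[of y] by linarith
      have "(\<psi> (Y 1 \<omega>))\<^sup>2 = \<psi> (Y 1 \<omega>) powr 2" using h0 by simp
      also have "\<dots> \<le> 1 + (\<psi> (Y 1 \<omega>) powr 2) powr (p / 2)" using p_gt_2 by (intro abs_le_one_plus_powr) auto
      also have "(\<psi> (Y 1 \<omega>) powr 2) powr (p / 2) = \<psi> (Y 1 \<omega>) powr p" by (simp only: powr_powr) simp
      finally show ?thesis by simp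
    qed
  qed auto
  then show ?thesis using stationary_single(2)[of "\<lambda>y. (\<psi> y)\<^sup>2", OF _ i] by simp
qed

text \<open>The products are dominated by the sum of two squared envelopes, integrable because
  \<open>p > 2\<close>.\<close>

lemma product_tendsto:
  fixes f :: "nat \<Rightarrow> real \<Rightarrow> real"
  assumes [measurable]: "\<And>A. f A \<in> borel_measurable borel" "g \<in> borel_measurable borel"
    and le: "\<And>A y. \<bar>f A y\<bar> \<le> \<psi> y" and lim: "\<And>y. (\<lambda>A. f A y) \<longlonglongrightarrow> g y"
  shows "(\<lambda>A. expectation (\<lambda>\<omega>. f A (Y 1 \<omega>) * f A (Y (1 + k) \<omega>))) \<longlonglongrightarrow> expectation (\<lambda>\<omega>. g (Y 1 \<omega>) * g (Y (1 + k) \<omega>))"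
proof (rule integral_dominated_convergence[where w="\<lambda>\<omega>. (\<psi> (Y 1 \<omega>))\<^sup>2 + (\<psi> (Y (1 + k) \<omega>))\<^sup>2"])
  show "integrable M (\<lambda>\<omega>. (\<psi> (Y 1 \<omega>))\<^sup>2 + (\<psi> (Y (1 + k) \<omega>))\<^sup>2)" using \<psi>_square_int by simp
  show "AE \<omega> in M. (\<lambda>A. f A (Y 1 \<omega>) * f A (Y (1 + k) \<omega>)) \<longlonglongrightarrow> g (Y 1 \<omega>) * g (Y (1 + k) \<omega>)"
    by (intro AE_I2 tendsto_mult lim)
  show "AE \<omega> in M. norm (f A (Y 1 \<omega>) * f A (Y (1 + k) \<omega>)) \<le> (\<psi> (Y 1 \<omega>))\<^sup>2 + (\<psi> (Y (1 + k) \<omega>))\<^sup>2" for A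
  proof (rule AE_I2)
    fix \<omega>
    let ?x = "\<psi> (Y 1 \<omega>)" and ?y = "\<psi> (Y (1 + k) \<omega>)"
    have n: "?x \<ge> 0" "?y \<ge> 0" using tmean_le(4) abs_ge_zero order_trans by blast+
    have "norm (f A (Y 1 \<omega>) * f A (Y (1 + k) \<omega>)) \<le> ?x * ?y"
      unfolding real_norm_def abs_mult using le n by (intro mult_mono) auto
    moreover have "0 \<le> (?x - ?y)\<^sup>2" by simp
    then have "2 * (?x * ?y) \<le> ?x\<^sup>2 + ?y\<^sup>2" unfolding power2_diff by simp
    moreover have "0 \<le> ?x * ?y" using n by simp
    ultimately show "norm (f A (Y 1 \<omega>) * f A (Y (1 + k) \<omega>)) \<le> ?x\<^sup>2 + ?y\<^sup>2" by linarith
  qed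
qed auto

lemma functional_Y:
  assumes "f \<in> borel_measurable borel" "\<And>y. \<bar>f y\<bar> \<le> \<psi> y" "expectation (\<lambda>\<omega>. f (Y 1 \<omega>)) = 0"
  shows "summable (\<lambda>k. \<bar>expectation (\<lambda>\<omega>. f (Y 1 \<omega>) * f (Y (1 + k) \<omega>))\<bar>)"
    and "k \<ge> 1 \<Longrightarrow> \<bar>expectation (\<lambda>\<omega>. f (Y 1 \<omega>) * f (Y (1 + k) \<omega>))\<bar>
      \<le> 4 * (1 + expectation (\<lambda>\<omega>. \<psi> (Y 1 \<omega>) powr p))\<^sup>2 * C * real k powr (- (\<theta> * (1 - 2 / p)))"
    and "(\<And>i. i \<in> {1..N} \<Longrightarrow> \<bar>w i\<bar> \<le> W) \<Longrightarrow> W \<ge> 0 \<Longrightarrow> integrable M (\<lambda>\<omega>. \<bar>\<Sum>i=1..N. w i * f (Y (r + i) \<omega>)\<bar>)"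
    and "(\<And>i. i \<in> {1..N} \<Longrightarrow> \<bar>w i\<bar> \<le> W) \<Longrightarrow> W \<ge> 0 \<Longrightarrow> expectation (\<lambda>\<omega>. \<bar>\<Sum>i=1..N. w i * f (Y (r + i) \<omega>)\<bar>)
      \<le> W * sqrt (real N) * sqrt (2 * (\<Sum>k. \<bar>expectation (\<lambda>\<omega>. f (Y 1 \<omega>) * f (Y (1 + k) \<omega>))\<bar>))"
    and "(\<And>i. i \<in> {1..N} \<Longrightarrow> \<bar>w i\<bar> \<le> W) \<Longrightarrow> integrable M (\<lambda>\<omega>. (\<Sum>i=1..N. w i * f (Y (r + i) \<omega>))\<^sup>2)"
    and "(\<And>i. i \<in> {1..N} \<Longrightarrow> \<bar>w i\<bar> \<le> W) \<Longrightarrow> expectation (\<lambda>\<omega>. (\<Sum>i=1..N. w i * f (Y (r + i) \<omega>))\<^sup>2)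
       \<le> W\<^sup>2 * real N * (2 * (\<Sum>k. \<bar>expectation (\<lambda>\<omega>. f (Y 1 \<omega>) * f (Y (1 + k) \<omega>))\<bar>))"
proof -
  have r: "\<theta> * (1 - 2 / p) > 1" using rate2 by simp
  note s = functional_square_sum[OF assms(1,2) \<psi>_measurable \<psi>_moment p_gt_2 r assms(3)]
  note b = functional_abs_sum[OF assms(1,2) \<psi>_measurable \<psi>_moment p_gt_2 r assms(3)]
  show "summable (\<lambda>k. \<bar>expectation (\<lambda>\<omega>. f (Y 1 \<omega>) * f (Y (1 + k) \<omega>))\<bar>)" by (rule s(1))
  show "k \<ge> 1 \<Longrightarrow> \<bar>expectation (\<lambda>\<omega>. f (Y 1 \<omega>) * f (Y (1 + k) \<omega>))\<bar>
      \<le> 4 * (1 + expectation (\<lambda>\<omega>. \<psi> (Y 1 \<omega>) powr p))\<^sup>2 * C * real k powr (- (\<theta> * (1 - 2 / p)))" by (rule s(2))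
  show "(\<And>i. i \<in> {1..N} \<Longrightarrow> \<bar>w i\<bar> \<le> W) \<Longrightarrow> W \<ge> 0 \<Longrightarrow> integrable M (\<lambda>\<omega>. \<bar>\<Sum>i=1..N. w i * f (Y (r + i) \<omega>)\<bar>)"
    by (rule b(1))
  show "(\<And>i. i \<in> {1..N} \<Longrightarrow> \<bar>w i\<bar> \<le> W) \<Longrightarrow> W \<ge> 0 \<Longrightarrow> expectation (\<lambda>\<omega>. \<bar>\<Sum>i=1..N. w i * f (Y (r + i) \<omega>)\<bar>)
      \<le> W * sqrt (real N) * sqrt (2 * (\<Sum>k. \<bar>expectation (\<lambda>\<omega>. f (Y 1 \<omega>) * f (Y (1 + k) \<omega>))\<bar>))"
    by (rule b(2))
  show "(\<And>i. i \<in> {1..N} \<Longrightarrow> \<bar>w i\<bar> \<le> W) \<Longrightarrow> integrable M (\<lambda>\<omega>. (\<Sum>i=1..N. w i * f (Y (r + i) \<omega>))\<^sup>2)"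
    by (rule s(3))
  show "(\<And>i. i \<in> {1..N} \<Longrightarrow> \<bar>w i\<bar> \<le> W) \<Longrightarrow> expectation (\<lambda>\<omega>. (\<Sum>i=1..N. w i * f (Y (r + i) \<omega>))\<^sup>2)
       \<le> W\<^sup>2 * real N * (2 * (\<Sum>k. \<bar>expectation (\<lambda>\<omega>. f (Y 1 \<omega>) * f (Y (1 + k) \<omega>))\<bar>))"
    by (rule s(4))
qed

text \<open>Dominated convergence for series: the terms converge by \<open>product_tendsto\<close>,
  and the mixing bound is uniform in the truncation level. The absolute sums enter second moment
  bounds, the signed ones the long run variance.\<close>

lemma sum_cov_tendsto:
  fixes f :: "nat \<Rightarrow> real \<Rightarrow> real"
  assumes f: "\<And>A. f A \<in> borel_measurable borel" "g \<in> borel_measurable borel"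
    and le: "\<And>A y. \<bar>f A y\<bar> \<le> \<psi> y" and lim: "\<And>y. (\<lambda>A. f A y) \<longlonglongrightarrow> g y"
    and f0: "\<And>A. expectation (\<lambda>\<omega>. f A (Y 1 \<omega>)) = 0"
  shows "(\<lambda>A. \<Sum>k. \<bar>expectation (\<lambda>\<omega>. f A (Y 1 \<omega>) * f A (Y (1 + k) \<omega>))\<bar>)
      \<longlonglongrightarrow> (\<Sum>k. \<bar>expectation (\<lambda>\<omega>. g (Y 1 \<omega>) * g (Y (1 + k) \<omega>))\<bar>)"
    and "(\<lambda>A. \<Sum>k. expectation (\<lambda>\<omega>. f A (Y 1 \<omega>) * f A (Y (1 + Suc k) \<omega>)))
      \<longlonglongrightarrow> (\<Sum>k. expectation (\<lambda>\<omega>. g (Y 1 \<omega>) * g (Y (1 + Suc k) \<omega>)))"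
proof -
  define b where "b k = 4 * (1 + expectation (\<lambda>\<omega>. \<psi> (Y 1 \<omega>) powr p))\<^sup>2 * C * real k powr (- (\<theta> * (1 - 2 / p)))" for k :: nat
  have sb: "summable b" unfolding b_def using rate2 by (intro summable_mult powr_minus_summable) auto
  have sb': "summable (\<lambda>k. b (Suc k))" using sb by (subst summable_Suc_iff)
  have le': "\<bar>expectation (\<lambda>\<omega>. f A (Y 1 \<omega>) * f A (Y (1 + k) \<omega>))\<bar> \<le> b k" if "k \<ge> 1" for k A
    unfolding b_def using functional_Y(2)[OF f(1) le f0 that] .
  \<comment> \<open>Zero to any power is 0 here, so \<open>b 0\<close> is 0 and cannot dominate lag
    0; domination is claimed from lag 1 on.\<close>
  have ev: "eventually (\<lambda>(k, A). norm \<bar>expectation (\<lambda>\<omega>. f A (Y 1 \<omega>) * f A (Y (1 + k) \<omega>))\<bar> \<le> b k) (sequentially \<times>\<^sub>F sequentially)"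
    using eventually_prodI[OF eventually_ge_at_top[of "1::nat"] always_eventually[of "\<lambda>_. True"]]
    by (rule eventually_mono) (use le' in auto)
  show "(\<lambda>A. \<Sum>k. \<bar>expectation (\<lambda>\<omega>. f A (Y 1 \<omega>) * f A (Y (1 + k) \<omega>))\<bar>)
      \<longlonglongrightarrow> (\<Sum>k. \<bar>expectation (\<lambda>\<omega>. g (Y 1 \<omega>) * g (Y (1 + k) \<omega>))\<bar>)"
    using tannerys_theorem[OF tendsto_rabs[OF product_tendsto[OF f le lim]] ev sb] by simp
  have ev': "eventually (\<lambda>(k, A). norm (expectation (\<lambda>\<omega>. f A (Y 1 \<omega>) * f A (Y (1 + Suc k) \<omega>))) \<le> b (Suc k)) (sequentially \<times>\<^sub>F sequentially)"
  proof (rule always_eventually, rule allI)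
    fix x :: "nat \<times> nat"
    obtain k A where "x = (k, A)" by (cases x)
    then show "case x of (k, A) \<Rightarrow> norm (expectation (\<lambda>\<omega>. f A (Y 1 \<omega>) * f A (Y (1 + Suc k) \<omega>))) \<le> b (Suc k)"
      using le'[of "Suc k" A] by simp
  qed
  show "(\<lambda>A. \<Sum>k. expectation (\<lambda>\<omega>. f A (Y 1 \<omega>) * f A (Y (1 + Suc k) \<omega>)))
      \<longlonglongrightarrow> (\<Sum>k. expectation (\<lambda>\<omega>. g (Y 1 \<omega>) * g (Y (1 + Suc k) \<omega>)))"
    using tannerys_theorem[OF product_tendsto[OF f le lim] ev' sb'] by simp
qed

text \<open>The level \<open>A\<close> is fixed before \<open>N\<close>. In units of
  \<open>sqrt N\<close> the truncation error is bounded uniformly by covariance sums that vanish as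
  \<open>A\<close> grows, and the truncated long run variance approaches \<open>lrv\<close>. To the
  bounded process the Lindeberg estimate applies with a constant depending on \<open>A\<close>,
  harmless for fixed \<open>A\<close> since \<open>ln N / sqrt N\<close> tends to 0; this dependence
  is why no rate survives.\<close>

lemma window_approx_truncation:
  assumes a0: "a0 > 0" and V: "V \<ge> 1" and W: "W \<ge> 0" and \<epsilon>: "\<epsilon> > 0"
  shows "eventually (\<lambda>N. window_approx N a0 V W \<epsilon>) sequentially"
proof -
  define \<zeta> where "\<zeta> A y = y - trunc A y" for A y
  have \<zeta>m [measurable]: "\<zeta> A \<in> borel_measurable borel" for A unfolding \<zeta>_def[abs_def] by measurable
  define s where "s A = (\<Sum>k. \<bar>expectation (\<lambda>\<omega>. \<zeta> A (Y 1 \<omega>) * \<zeta> A (Y (1 + k) \<omega>))\<bar>)" for A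
  have \<zeta>_lim: "(\<lambda>A. \<zeta> A y) \<longlonglongrightarrow> 0" for y
    unfolding \<zeta>_def using tendsto_diff[OF tendsto_const trunc_tendsto[of y], of y] by simp
  have \<zeta>_le: "\<bar>\<zeta> A y\<bar> \<le> \<psi> y" for A y unfolding \<zeta>_def by (rule tmean_le)
  have \<zeta>_0: "expectation (\<lambda>\<omega>. \<zeta> A (Y 1 \<omega>)) = 0" for A unfolding \<zeta>_def by (rule trunc_centered)
  have s_lim: "s \<longlonglongrightarrow> 0"
    using sum_cov_tendsto(1)[of \<zeta> "\<lambda>_. 0", OF \<zeta>m _ \<zeta>_le \<zeta>_lim \<zeta>_0] by (simp add: s_def[abs_def])
  define \<kappa>A where "\<kappa>A A = expectation (\<lambda>\<omega>. trunc A (Y 1 \<omega>) * trunc A (Y (1 + 0) \<omega>)) + 2 * (\<Sum>k. expectation (\<lambda>\<omega>. trunc A (Y 1 \<omega>) * trunc A (Y (1 + Suc k) \<omega>)))" for A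
  have "\<kappa>A \<longlonglongrightarrow> expectation (\<lambda>\<omega>. Y 1 \<omega> * Y (1 + 0) \<omega>) + 2 * (\<Sum>k. expectation (\<lambda>\<omega>. Y 1 \<omega> * Y (1 + Suc k) \<omega>))"
    unfolding \<kappa>A_def
    by (intro tendsto_add tendsto_mult tendsto_const product_tendsto[of trunc "\<lambda>y. y"] sum_cov_tendsto(2)[of trunc "\<lambda>y. y"] trunc_measurable tmean_le trunc_tendsto trunc_centered) auto
  then have \<kappa>_lim: "\<kappa>A \<longlonglongrightarrow> lrv" unfolding lrv_eq using Y_square by (simp add: power2_eq_square)
  have "(\<lambda>A. V * sqrt (2 * s A) + sqrt (2 / pi) * V * \<bar>sqrt (\<kappa>A A) - sqrt lrv\<bar>) \<longlonglongrightarrow> V * sqrt (2 * 0) + sqrt (2 / pi) * V * \<bar>sqrt lrv - sqrt lrv\<bar>"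
    by (intro tendsto_intros s_lim \<kappa>_lim)
  then have "eventually (\<lambda>A. V * sqrt (2 * s A) + sqrt (2 / pi) * V * \<bar>sqrt (\<kappa>A A) - sqrt lrv\<bar> < \<epsilon> / 2) sequentially"
    using \<epsilon> by (intro order_tendstoD(2)) auto
  moreover have "eventually (\<lambda>A. \<kappa>A A > 0) sequentially"
    by (rule order_tendstoD(1)[OF \<kappa>_lim lrv_pos])
  ultimately have "eventually (\<lambda>A. V * sqrt (2 * s A) + sqrt (2 / pi) * V * \<bar>sqrt (\<kappa>A A) - sqrt lrv\<bar> < \<epsilon> / 2 \<and> \<kappa>A A > 0) sequentially"
    by eventually_elim auto
  then obtain A where A: "V * sqrt (2 * s A) + sqrt (2 / pi) * V * \<bar>sqrt (\<kappa>A A) - sqrt lrv\<bar> < \<epsilon> / 2" "\<kappa>A A > 0"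
    by (auto simp: eventually_sequentially)
  have tb: "\<bar>trunc A y\<bar> powr 6 \<le> (real A + \<bar>tmean A\<bar>) powr 6" for y
    using truncate_bounds(2)[of A y] unfolding trunc_def by (intro powr_mono2) auto
  \<comment> \<open>A bounded function has all moments; \<open>p = 6\<close> turns the rate
    condition into \<open>\<theta> / 2 > 2\<close>.\<close>
  interpret F: mixing_functional M Y C \<theta> "trunc A" 6 "expectation (\<lambda>\<omega>. \<bar>trunc A (Y 1 \<omega>)\<bar> powr 6)"
  proof unfold_locales
    show "expectation (\<lambda>\<omega>. trunc A (Y 1 \<omega>)) = 0" by (rule trunc_centered)
    show "integrable M (\<lambda>\<omega>. \<bar>trunc A (Y 1 \<omega>)\<bar> powr 6)"
      by (rule integrable_dominated[where g="\<lambda>_. (real A + \<bar>tmean A\<bar>) powr 6"]) (use tb in auto)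
  qed (use \<theta>_gt_6 in auto)
  have k: "F.\<kappa>2 = \<kappa>A A" unfolding F.\<kappa>2_def \<kappa>A_def F.\<gamma>_def F.\<xi>_def by simp
  define L where "L = F.lindeberg_const a0 V"
  have "((\<lambda>N. L * (1 + W + ln (real N)) / sqrt (real N)) \<longlongrightarrow> 0) sequentially" by real_asymp
  then have "eventually (\<lambda>N. L * (1 + W + ln (real N)) / sqrt (real N) < \<epsilon> / 2) sequentially"
    using \<epsilon> by (intro order_tendstoD(2)) auto
  then show ?thesis using eventually_ge_at_top[of 1]
  proof eventually_elim
    case (elim N)
    have sN: "sqrt (real N) > 0" using elim by simp
    have L: "L * (1 + W + ln (real N)) \<le> \<epsilon> / 2 * sqrt (real N)" using elim sN by (simp add: pos_divide_less_eq)
    show ?case unfolding window_approx_def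
    proof (intro allI impI)
      fix r a assume a: "\<forall>i\<in>{1..N}. a0 \<le> \<bar>a i\<bar> \<and> \<bar>a i\<bar> \<le> V" and tv: "(\<Sum>i=1..<N. \<bar>a (Suc i) - a i\<bar>) \<le> W"
      have av: "\<bar>a i\<bar> \<le> V" if "i \<in> {1..N}" for i using a that by auto
      define q where "q = (\<Sum>i=1..N. (a i)\<^sup>2)"
      have q: "0 \<le> q" "sqrt q \<le> V * sqrt (real N)"
      proof -
        show "0 \<le> q" unfolding q_def by (intro sum_nonneg) auto
        have "q \<le> (\<Sum>i=1..N. V\<^sup>2)" unfolding q_def using av V by (intro sum_mono) (auto simp: abs_le_square_iff[symmetric])
        then have "sqrt q \<le> sqrt (real N * V\<^sup>2)" by (intro real_sqrt_le_mono) simp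
        then show "sqrt q \<le> V * sqrt (real N)" using V by (simp add: real_sqrt_mult mult.commute)
      qed
      define EY where "EY = expectation (\<lambda>\<omega>. \<bar>\<Sum>i=1..N. a i * Y (r + i) \<omega>\<bar>)"
      define ET where "ET = expectation (\<lambda>\<omega>. \<bar>\<Sum>i=1..N. a i * trunc A (Y (r + i) \<omega>)\<bar>)"
      have 1: "\<bar>EY - ET\<bar> \<le> V * sqrt (2 * s A) * sqrt (real N)"
      proof -
        have V0: "V \<ge> 0" using V by simp
        have iY: "integrable M (\<lambda>\<omega>. \<bar>\<Sum>i=1..N. a i * Y (r + i) \<omega>\<bar>)"
          using functional_Y(3)[of "\<lambda>y. y", OF _ tmean_le(4) _ av V0] Y_mean by simp
        have iT: "integrable M (\<lambda>\<omega>. \<bar>\<Sum>i=1..N. a i * trunc A (Y (r + i) \<omega>)\<bar>)"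
          by (rule functional_Y(3)[OF trunc_measurable tmean_le(3) trunc_centered(1) av V0])
        note iZ = functional_Y(3,4)[OF \<zeta>m \<zeta>_le \<zeta>_0 av V0, where r=r]
        have "\<bar>EY - ET\<bar> = \<bar>expectation (\<lambda>\<omega>. \<bar>\<Sum>i=1..N. a i * Y (r + i) \<omega>\<bar> - \<bar>\<Sum>i=1..N. a i * trunc A (Y (r + i) \<omega>)\<bar>)\<bar>"
          unfolding EY_def ET_def using iY iT by simp
        also have "\<dots> \<le> expectation (\<lambda>\<omega>. \<bar>\<bar>\<Sum>i=1..N. a i * Y (r + i) \<omega>\<bar> - \<bar>\<Sum>i=1..N. a i * trunc A (Y (r + i) \<omega>)\<bar>\<bar>)"
          by (rule integral_abs_bound)
        also have "\<dots> \<le> expectation (\<lambda>\<omega>. \<bar>\<Sum>i=1..N. a i * \<zeta> A (Y (r + i) \<omega>)\<bar>)"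
        proof (intro integral_mono)
          show "integrable M (\<lambda>\<omega>. \<bar>\<Sum>i=1..N. a i * \<zeta> A (Y (r + i) \<omega>)\<bar>)" by (rule iZ(1))
          fix \<omega>
          have "(\<Sum>i=1..N. a i * Y (r + i) \<omega>) - (\<Sum>i=1..N. a i * trunc A (Y (r + i) \<omega>)) = (\<Sum>i=1..N. a i * \<zeta> A (Y (r + i) \<omega>))"
            by (simp add: \<zeta>_def sum_subtractf right_diff_distrib)
          then show "\<bar>\<bar>\<Sum>i=1..N. a i * Y (r + i) \<omega>\<bar> - \<bar>\<Sum>i=1..N. a i * trunc A (Y (r + i) \<omega>)\<bar>\<bar> \<le> \<bar>\<Sum>i=1..N. a i * \<zeta> A (Y (r + i) \<omega>)\<bar>"
            using abs_triangle_ineq3[of "\<Sum>i=1..N. a i * Y (r + i) \<omega>" "\<Sum>i=1..N. a i * trunc A (Y (r + i) \<omega>)"] by simp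
        qed (use iY iT in auto)
        also have "\<dots> \<le> V * sqrt (real N) * sqrt (2 * s A)" unfolding s_def by (rule iZ(2))
        finally show ?thesis by (simp add: mult_ac)
      qed
      have 2: "\<bar>ET - sqrt (2 / pi) * sqrt (\<kappa>A A) * sqrt q\<bar> \<le> \<epsilon> / 2 * sqrt (real N)"
      proof -
        have "\<bar>ET - sqrt (2 / pi) * sqrt (\<kappa>A A * q)\<bar> \<le> L * (1 + W + ln (real N))"
          unfolding k[symmetric] ET_def q_def L_def
          by (rule F.window_abs_moment[OF elim(2) _ a0 V tv]) (use a A(2) k in auto)
        then show ?thesis using L by (simp only: real_sqrt_mult mult.assoc)
      qed
      have 3: "\<bar>sqrt (2 / pi) * sqrt (\<kappa>A A) * sqrt q - sqrt (2 / pi) * sqrt lrv * sqrt q\<bar> \<le> sqrt (2 / pi) * V * \<bar>sqrt (\<kappa>A A) - sqrt lrv\<bar> * sqrt (real N)"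
      proof -
        have "\<bar>sqrt (2 / pi) * sqrt (\<kappa>A A) * sqrt q - sqrt (2 / pi) * sqrt lrv * sqrt q\<bar> = \<bar>sqrt (2 / pi) * (sqrt (\<kappa>A A) - sqrt lrv) * sqrt q\<bar>"
          by (simp add: algebra_simps)
        also have "\<dots> = sqrt (2 / pi) * \<bar>sqrt (\<kappa>A A) - sqrt lrv\<bar> * sqrt q" using q by (simp add: abs_mult)
        also have "\<dots> \<le> sqrt (2 / pi) * \<bar>sqrt (\<kappa>A A) - sqrt lrv\<bar> * (V * sqrt (real N))" using q by (intro mult_left_mono) auto
        finally show ?thesis by (simp add: mult_ac)
      qed
      have "\<bar>EY - sqrt (2 / pi) * sqrt lrv * sqrt q\<bar> \<le> (V * sqrt (2 * s A) + sqrt (2 / pi) * V * \<bar>sqrt (\<kappa>A A) - sqrt lrv\<bar>) * sqrt (real N) + \<epsilon> / 2 * sqrt (real N)"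
        using 1 2 3 unfolding distrib_right by linarith
      also have "\<dots> \<le> \<epsilon> / 2 * sqrt (real N) + \<epsilon> / 2 * sqrt (real N)"
        using A(1) sN by (intro add_right_mono mult_right_mono) auto
      finally show "\<bar>expectation (\<lambda>\<omega>. \<bar>\<Sum>i=1..N. a i * Y (r + i) \<omega>\<bar>) - sqrt (2 / pi) * sqrt lrv * sqrt (\<Sum>i=1..N. (a i)\<^sup>2)\<bar> \<le> \<epsilon> * sqrt (real N)"
        unfolding EY_def q_def by simp
    qed
  qed
qed

end

section \<open>Averages of squares\<close>

context centered_process
begin

text \<open>Moments of order \<open>2 * p\<close> of the process are moments of order
  \<open>p\<close> of its square, so the second moment bound for functionals applies to the centred
  square and gives the order \<open>1 / sqrt N\<close>.\<close>

lemma square_approx_moments: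
  assumes i4: "integrable M (\<lambda>\<omega>. \<bar>Y 1 \<omega>\<bar> powr (2 * p))" and W: "W \<ge> 0"
  shows "\<exists>B. \<forall>N\<ge>1. square_approx N W (B / sqrt (real N))"
proof -
  define f where "f y = y\<^sup>2 - 1" for y :: real
  define h where "h y = y\<^sup>2 + 1" for y :: real
  have m [measurable]: "f \<in> borel_measurable borel" "h \<in> borel_measurable borel"
    unfolding f_def[abs_def] h_def[abs_def] by measurable
  have fh: "\<bar>f y\<bar> \<le> h y" for y using zero_le_power2[of y] unfolding f_def h_def abs_le_iff by linarith
  have ih: "integrable M (\<lambda>\<omega>. h (Y 1 \<omega>) powr p)"
  proof (rule integrable_dominated[where g="\<lambda>\<omega>. 2 powr p * (\<bar>Y 1 \<omega>\<bar> powr (2 * p) + 1)"])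
    show "\<bar>h (Y 1 \<omega>) powr p\<bar> \<le> 2 powr p * (\<bar>Y 1 \<omega>\<bar> powr (2 * p) + 1)" for \<omega>
    proof -
      let ?z = "max ((Y 1 \<omega>)\<^sup>2) 1"
      have "h (Y 1 \<omega>) powr p \<le> (2 * ?z) powr p"
        unfolding h_def using p_gt_2 by (intro powr_mono2) auto
      also have "\<dots> = 2 powr p * ?z powr p" by (simp add: powr_mult)
      also have "?z powr p \<le> ((Y 1 \<omega>)\<^sup>2) powr p + 1" by (auto simp: max_def)
      also have "((Y 1 \<omega>)\<^sup>2) powr p = (\<bar>Y 1 \<omega>\<bar> powr 2) powr p" by simp
      also have "\<dots> = \<bar>Y 1 \<omega>\<bar> powr (2 * p)" by (simp only: powr_powr)
      finally show ?thesis by simp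
    qed
  qed (use i4 in auto)
  have f0: "expectation (\<lambda>\<omega>. f (Y 1 \<omega>)) = 0"
    unfolding f_def using Y_square Y_square_int[of 1] by (simp add: prob_space)
  have r: "\<theta> * (1 - 2 / p) > 1" using rate2 by simp
  define S where "S = (\<Sum>k. \<bar>expectation (\<lambda>\<omega>. f (Y 1 \<omega>) * f (Y (1 + k) \<omega>))\<bar>)"
  show ?thesis
  proof (intro exI[of _ "W * sqrt (2 * S)"] allI impI)
    fix N :: nat assume N: "N \<ge> 1"
    show "square_approx N W (W * sqrt (2 * S) / sqrt (real N))"
      unfolding square_approx_def
    proof (intro allI impI)
      fix r' w assume w: "\<forall>i\<in>{1..N}. \<bar>w i\<bar> \<le> W"
      have "expectation (\<lambda>\<omega>. \<bar>\<Sum>i=1..N. w i * f (Y (r' + i) \<omega>)\<bar>) \<le> W * sqrt (real N) * sqrt (2 * S)"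
        unfolding S_def by (rule functional_abs_sum(2)[OF m(1) fh m(2) ih p_gt_2 r f0 _ W]) (use w in auto)
      also have "\<dots> = W * sqrt (2 * S) / sqrt (real N) * real N"
        using N by (simp add: field_simps)
      finally show "expectation (\<lambda>\<omega>. \<bar>\<Sum>i=1..N. w i * ((Y (r' + i) \<omega>)\<^sup>2 - 1)\<bar>) \<le> W * sqrt (2 * S) / sqrt (real N) * real N"
        unfolding f_def .
    qed
  qed
qed

text \<open>Without fourth moments, covariances of squares cannot be used. The square is clipped at
  \<open>A\<close>. The excess is nonnegative, so its mean absolute value is its mean
  \<open>1 - c A\<close>, which is small for one fixed \<open>A\<close> without any estimate of
  dependence; the clipped part is bounded and obeys the second moment bound.\<close>

lemma square_approx_truncation:
  assumes W: "W \<ge> 0" and \<epsilon>: "\<epsilon> > 0"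
  shows "eventually (\<lambda>N. square_approx N W \<epsilon>) sequentially"
proof -
  define t where "t A y = min (y\<^sup>2) (real A)" for A :: nat and y :: real
  have tm [measurable]: "t A \<in> borel_measurable borel" for A unfolding t_def[abs_def] by measurable
  have t: "0 \<le> t A y" "t A y \<le> y\<^sup>2" "t A y \<le> real A" for A y by (auto simp: t_def)
  have it: "integrable M (\<lambda>\<omega>. t A (Y i \<omega>))" if "i \<ge> 1" for A i
    by (rule integrable_dominated[where g="\<lambda>_. real A"]) (use t that in auto)
  define c where "c A = expectation (\<lambda>\<omega>. t A (Y 1 \<omega>))" for A
  have clim: "c \<longlonglongrightarrow> 1"
  proof -
    have "(\<lambda>A. expectation (\<lambda>\<omega>. t A (Y 1 \<omega>))) \<longlonglongrightarrow> expectation (\<lambda>\<omega>. (Y 1 \<omega>)\<^sup>2)"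
    proof (rule integral_dominated_convergence[where w="\<lambda>\<omega>. (Y 1 \<omega>)\<^sup>2"])
      show "AE \<omega> in M. (\<lambda>A. t A (Y 1 \<omega>)) \<longlonglongrightarrow> (Y 1 \<omega>)\<^sup>2"
      proof (rule AE_I2, rule tendsto_eventually)
        fix \<omega>
        obtain n where n: "(Y 1 \<omega>)\<^sup>2 \<le> real n" using real_arch_simple by blast
        show "eventually (\<lambda>A. t A (Y 1 \<omega>) = (Y 1 \<omega>)\<^sup>2) sequentially"
          using eventually_ge_at_top[of n] by eventually_elim (use n in \<open>auto simp: t_def\<close>)
      qed
    qed (use Y_square_int[of 1] t in auto)
    then show ?thesis unfolding Y_square c_def[abs_def] .
  qed
  have c01: "c A \<le> 1" "c A \<ge> 0" for A
  proof -
    have "c A \<le> expectation (\<lambda>\<omega>. (Y 1 \<omega>)\<^sup>2)" unfolding c_def using it[of 1] Y_square_int[of 1] t by (intro integral_mono) auto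
    then show "c A \<le> 1" unfolding Y_square .
    show "c A \<ge> 0" unfolding c_def using t by simp
  qed
  have "(\<lambda>A. W * (2 * (1 - c A))) \<longlonglongrightarrow> W * (2 * (1 - 1))" by (intro tendsto_intros clim)
  then have "eventually (\<lambda>A. W * (2 * (1 - c A)) < \<epsilon> / 2) sequentially" using \<epsilon> by (intro order_tendstoD(2)) auto
  then obtain A where A: "W * (2 * (1 - c A)) < \<epsilon> / 2" by (auto simp: eventually_sequentially)
  define f where "f y = t A y - c A" for y
  have fm [measurable]: "f \<in> borel_measurable borel" unfolding f_def[abs_def] by measurable
  have fb: "\<bar>f y\<bar> \<le> real A + 1" for y using t[of A y] c01[of A] unfolding f_def abs_le_iff by auto
  have f0: "expectation (\<lambda>\<omega>. f (Y 1 \<omega>)) = 0" unfolding f_def using it[of 1] by (simp add: prob_space c_def)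
  define S where "S = (\<Sum>k. \<bar>expectation (\<lambda>\<omega>. f (Y 1 \<omega>) * f (Y (1 + k) \<omega>))\<bar>)"
  have "((\<lambda>N. W * sqrt (2 * S) / sqrt (real N)) \<longlongrightarrow> 0) sequentially" by real_asymp
  then have "eventually (\<lambda>N. W * sqrt (2 * S) / sqrt (real N) < \<epsilon> / 2) sequentially"
    using \<epsilon> by (intro order_tendstoD(2)) auto
  then show ?thesis using eventually_ge_at_top[of 1]
  proof eventually_elim
    case (elim N)
    show ?case unfolding square_approx_def
    proof (intro allI impI)
      fix r w assume w: "\<forall>i\<in>{1..N}. \<bar>w i\<bar> \<le> W"
      have iF: "integrable M (\<lambda>\<omega>. \<bar>\<Sum>i=1..N. w i * f (Y (r + i) \<omega>)\<bar>)" and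
        eF: "expectation (\<lambda>\<omega>. \<bar>\<Sum>i=1..N. w i * f (Y (r + i) \<omega>)\<bar>) \<le> W * sqrt (real N) * sqrt (2 * S)"
        unfolding S_def using functional_abs_sum[OF fm fb, of 6 N w W r] w W f0 \<theta>_gt_6 by auto
      define g where "g y = y\<^sup>2 - t A y" for y
      have g0: "g y \<ge> 0" for y using t by (simp add: g_def)
      have ig: "integrable M (\<lambda>\<omega>. g (Y (r + i) \<omega>))" if "i \<ge> 1" for i
        unfolding g_def using it[of "r + i" A] Y_square_int[of "r + i"] that by simp
      have eg: "expectation (\<lambda>\<omega>. g (Y (r + i) \<omega>)) = 1 - c A" if "i \<ge> 1" for i
      proof -
        have [measurable]: "g \<in> borel_measurable borel" unfolding g_def[abs_def] by measurable
        have "expectation (\<lambda>\<omega>. g (Y (r + i) \<omega>)) = expectation (\<lambda>\<omega>. g (Y 1 \<omega>))"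
          by (rule stationary_single(1)) (use that in auto)
        also have "\<dots> = 1 - c A" unfolding g_def c_def using it[of 1 A] Y_square_int[of 1] Y_square by simp
        finally show ?thesis .
      qed
      have iB: "integrable M (\<lambda>\<omega>. \<bar>\<Sum>i=1..N. w i * f (Y (r + i) \<omega>)\<bar> + (\<Sum>i=1..N. W * (g (Y (r + i) \<omega>) + (1 - c A))))"
        using iF ig by (intro Bochner_Integration.integrable_add Bochner_Integration.integrable_sum integrable_mult_right) auto
      have pt: "\<bar>\<Sum>i=1..N. w i * ((Y (r + i) \<omega>)\<^sup>2 - 1)\<bar> \<le> \<bar>\<Sum>i=1..N. w i * f (Y (r + i) \<omega>)\<bar> + (\<Sum>i=1..N. W * (g (Y (r + i) \<omega>) + (1 - c A)))" for \<omega>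
      proof -
        have "(\<Sum>i=1..N. w i * ((Y (r + i) \<omega>)\<^sup>2 - 1)) = (\<Sum>i=1..N. w i * f (Y (r + i) \<omega>)) + (\<Sum>i=1..N. w i * (g (Y (r + i) \<omega>) - (1 - c A)))"
          unfolding sum.distrib[symmetric] by (intro sum.cong refl) (simp add: f_def g_def algebra_simps)
        moreover have "\<bar>\<Sum>i=1..N. w i * (g (Y (r + i) \<omega>) - (1 - c A))\<bar> \<le> (\<Sum>i=1..N. W * (g (Y (r + i) \<omega>) + (1 - c A)))"
        proof (rule order_trans[OF sum_abs], rule sum_mono)
          fix i assume "i \<in> {1..N}"
          moreover have "\<bar>g (Y (r + i) \<omega>) - (1 - c A)\<bar> \<le> g (Y (r + i) \<omega>) + (1 - c A)"
            using g0[of "Y (r + i) \<omega>"] c01[of A] by (auto simp: abs_le_iff)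
          ultimately show "\<bar>w i * (g (Y (r + i) \<omega>) - (1 - c A))\<bar> \<le> W * (g (Y (r + i) \<omega>) + (1 - c A))"
            unfolding abs_mult using w W by (intro mult_mono) auto
        qed
        ultimately show ?thesis by linarith
      qed
      have "expectation (\<lambda>\<omega>. \<bar>\<Sum>i=1..N. w i * ((Y (r + i) \<omega>)\<^sup>2 - 1)\<bar>)
        \<le> expectation (\<lambda>\<omega>. \<bar>\<Sum>i=1..N. w i * f (Y (r + i) \<omega>)\<bar> + (\<Sum>i=1..N. W * (g (Y (r + i) \<omega>) + (1 - c A))))"
      proof (rule integral_mono[OF _ iB pt])
        show "integrable M (\<lambda>\<omega>. \<bar>\<Sum>i=1..N. w i * ((Y (r + i) \<omega>)\<^sup>2 - 1)\<bar>)"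
          by (rule integrable_dominated[OF _ iB]) (use pt in auto)
      qed
      also have "\<dots> = expectation (\<lambda>\<omega>. \<bar>\<Sum>i=1..N. w i * f (Y (r + i) \<omega>)\<bar>) + expectation (\<lambda>\<omega>. \<Sum>i=1..N. W * (g (Y (r + i) \<omega>) + (1 - c A)))"
        using iF ig by (intro Bochner_Integration.integral_add Bochner_Integration.integrable_sum integrable_mult_right Bochner_Integration.integrable_add) auto
      also have "expectation (\<lambda>\<omega>. \<Sum>i=1..N. W * (g (Y (r + i) \<omega>) + (1 - c A))) = (\<Sum>i=1..N. W * (2 * (1 - c A)))"
      proof -
        have "expectation (\<lambda>\<omega>. \<Sum>i=1..N. W * (g (Y (r + i) \<omega>) + (1 - c A))) = (\<Sum>i=1..N. expectation (\<lambda>\<omega>. W * (g (Y (r + i) \<omega>) + (1 - c A))))"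
          using ig by (intro Bochner_Integration.integral_sum integrable_mult_right Bochner_Integration.integrable_add) auto
        also have "\<dots> = (\<Sum>i=1..N. W * (2 * (1 - c A)))"
        proof (intro sum.cong refl)
          fix i assume "i \<in> {1..N}"
          then show "expectation (\<lambda>\<omega>. W * (g (Y (r + i) \<omega>) + (1 - c A))) = W * (2 * (1 - c A))"
            using ig[of i] eg[of i] by (simp add: prob_space)
        qed
        finally show ?thesis .
      qed
      also have "(\<Sum>i=1..N. W * (2 * (1 - c A))) = (W * (2 * (1 - c A))) * real N" by simp
      also have "\<dots> \<le> \<epsilon> / 2 * real N" using A by (intro mult_right_mono) auto
      finally have "expectation (\<lambda>\<omega>. \<bar>\<Sum>i=1..N. w i * ((Y (r + i) \<omega>)\<^sup>2 - 1)\<bar>) \<le> W * sqrt (real N) * sqrt (2 * S) + \<epsilon> / 2 * real N"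
        using eF by simp
      also have "W * sqrt (real N) * sqrt (2 * S) = (W * sqrt (2 * S) / sqrt (real N)) * real N"
        using elim by (simp add: field_simps)
      also have "\<dots> \<le> \<epsilon> / 2 * real N" using elim by (intro mult_right_mono) auto
      finally show "expectation (\<lambda>\<omega>. \<bar>\<Sum>i=1..N. w i * ((Y (r + i) \<omega>)\<^sup>2 - 1)\<bar>) \<le> \<epsilon> * real N" by simp
    qed
  qed
qed

end

section \<open>Variation along the grid\<close>

text \<open>Stated with a real diameter because \<open>c0\<close> need not be an integer; the counts
  of overlapping, neighbouring and boundary blocks go through it.\<close>

lemma card_le_diameter:
  fixes A :: "nat set"
  assumes fin: "finite A" and d: "\<And>i j. i \<in> A \<Longrightarrow> j \<in> A \<Longrightarrow> i < j \<Longrightarrow> real j - real i \<le> Q" and Q: "Q \<ge> 0"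
  shows "real (card A) \<le> Q + 1"
proof (cases "A = {}")
  case False
  define m where "m = Min A"
  define k where "k = nat \<lfloor>Q\<rfloor>"
  have m: "m \<in> A" unfolding m_def using fin False by simp
  have "A \<subseteq> {m..m + k}"
  proof
    fix j assume j: "j \<in> A"
    have mj: "m \<le> j" unfolding m_def using fin j by simp
    have "real j - real m \<le> Q" using d[OF m j] mj Q by (cases "m = j") auto
    then have "real (j - m) \<le> Q" using mj by simp
    then have "int (j - m) \<le> \<lfloor>Q\<rfloor>" by (simp add: le_floor_iff)
    then show "j \<in> {m..m + k}" using mj by (auto simp: k_def)
  qed
  then have "card A \<le> card {m..m + k}" by (intro card_mono) auto
  then have "real (card A) \<le> real k + 1" by simp
  also have "real k \<le> Q" unfolding k_def using Q by simp
  finally show ?thesis by simp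
qed (use Q in simp)

text \<open>Only grid values enter the estimator, and the first observation sits at
  \<open>1 / n\<close>, so the increment from 0 is left out. The same \<open>V\<close> bounds the
  absolute values and, for all \<open>n\<close> at once, the variation.\<close>

definition grid_variation_le :: "real \<Rightarrow> (real \<Rightarrow> real) \<Rightarrow> bool" where
  "grid_variation_le V f \<longleftrightarrow> (\<forall>x\<in>{0..1}. \<bar>f x\<bar> \<le> V) \<and>
    (\<forall>n. (\<Sum>i=1..<n. \<bar>f (real (Suc i) / real n) - f (real i / real n)\<bar>) \<le> V)"

text \<open>A piecewise constant function takes only finitely many values: away from the jump set
  \<open>J\<close> its value at \<open>x\<close> is determined by the set of jumps to the left of \<open>x\<close>.\<close>

lemma piecewise_constant01_variation:
  assumes "piecewise_constant01 h"
  shows "\<exists>V. grid_variation_le V h"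
proof -
  obtain J where J: "finite J" and h: "\<And>x y. x \<in> {0..1} \<Longrightarrow> y \<in> {0..1} \<Longrightarrow> x \<le> y \<Longrightarrow> {x..y} \<inter> J = {} \<Longrightarrow> h x = h y"
    using assms unfolding piecewise_constant01_def by blast
  define L where "L x = {z \<in> J. z < x}" for x
  have "finite (h ` {0..1})"
  proof -
    define D where "D = {0..1} - J"
    have eqD: "h x = h y" if "x \<in> D" "y \<in> D" "L x = L y" "x \<le> y" for x y
    proof (rule h)
      show "{x..y} \<inter> J = {}"
      proof (rule ccontr)
        assume "{x..y} \<inter> J \<noteq> {}"
        then obtain z where z: "z \<in> J" "x \<le> z" "z \<le> y" by auto
        then have "z \<noteq> y" using that by (auto simp: D_def)
        then have "z \<in> L y" using z by (auto simp: L_def)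
        then have "z < x" unfolding that(3)[symmetric] by (simp add: L_def)
        then show False using z by simp
      qed
    qed (use that in \<open>auto simp: D_def\<close>)
    have "h ` D \<subseteq> (\<lambda>s. h (SOME x. x \<in> D \<and> L x = s)) ` Pow J"
    proof
      fix v assume "v \<in> h ` D"
      then obtain x where x: "x \<in> D" "v = h x" by auto
      define y where "y = (SOME y. y \<in> D \<and> L y = L x)"
      have y: "y \<in> D \<and> L y = L x" unfolding y_def by (rule someI[of _ x]) (use x in auto)
      have "h y = h x"
      proof (cases "x \<le> y")
        case True
        show ?thesis by (rule eqD[symmetric, OF x(1) conjunct1[OF y] conjunct2[OF y, symmetric] True])
      next
        case False
        show ?thesis by (rule eqD[OF conjunct1[OF y] x(1) conjunct2[OF y]]) (use False in simp)
      qed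
      then have "v = (\<lambda>s. h (SOME x. x \<in> D \<and> L x = s)) (L x)" using x(2) unfolding y_def by (simp only:)
      moreover have "L x \<in> Pow J" by (auto simp: L_def)
      ultimately show "v \<in> (\<lambda>s. h (SOME x. x \<in> D \<and> L x = s)) ` Pow J" by (rule image_eqI)
    qed
    then have "finite (h ` D)" using J by (meson finite_Pow_iff finite_imageI finite_subset)
    moreover have "h ` {0..1} \<subseteq> h ` D \<union> h ` J" by (auto simp: D_def)
    ultimately show ?thesis using J by (meson finite_Un finite_imageI finite_subset)
  qed
  \<comment> \<open>Finitely many values give a bound \<open>H\<close>, hence \<open>2 * H\<close>
    for every increment.\<close>
  then obtain H where "\<And>v. v \<in> h ` {0..1} \<Longrightarrow> norm v \<le> H" using finite_imp_bounded[of "h ` {0..1}"] unfolding bounded_iff by blast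
  then have H: "\<bar>h x\<bar> \<le> H" if "x \<in> {0..1}" for x using that by fastforce
  have H0: "H \<ge> 0" using H[of 0] by auto
  have tv: "(\<Sum>i=1..<n. \<bar>h (real (Suc i) / real n) - h (real i / real n)\<bar>) \<le> 2 * H * (real (card J) * 2)" for n :: nat
  proof -
    \<comment> \<open>A jump affects the grid cells that contain it: one, or two if it falls on a
      grid point.\<close>
    define B where "B z = {i \<in> {1..<n}. real i / real n \<le> z \<and> z \<le> real (Suc i) / real n}" for z
    have Bz: "real (card (B z)) \<le> 2" for z
    proof -
      have "real (card (B z)) \<le> 1 + 1"
      proof (rule card_le_diameter)
        fix i j assume ij: "i \<in> B z" "j \<in> B z" "i < j"
        then have "real j / real n \<le> real (Suc i) / real n" unfolding B_def by auto
        then have "real j \<le> real (Suc i)" using ij by (simp add: B_def divide_le_cancel)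
        then show "real j - real i \<le> 1" by simp
      qed (auto simp: B_def)
      then show ?thesis by simp
    qed
    have "(\<Sum>i=1..<n. \<bar>h (real (Suc i) / real n) - h (real i / real n)\<bar>) \<le> (\<Sum>i=1..<n. if i \<in> (\<Union>z\<in>J. B z) then 2 * H else 0)"
    proof (rule sum_mono)
      fix i assume i: "i \<in> {1..<n}"
      have x: "real i / real n \<in> {0..1}" "real (Suc i) / real n \<in> {0..1}" using i by auto
      show "\<bar>h (real (Suc i) / real n) - h (real i / real n)\<bar> \<le> (if i \<in> (\<Union>z\<in>J. B z) then 2 * H else 0)"
      proof (cases "i \<in> (\<Union>z\<in>J. B z)")
        case True
        then show ?thesis using H[OF x(1)] H[OF x(2)] by auto
      next
        case False
        then have "{real i / real n..real (Suc i) / real n} \<inter> J = {}" using i by (auto simp: B_def)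
        then have "h (real i / real n) = h (real (Suc i) / real n)"
          using x by (intro h) (auto simp: divide_right_mono)
        then show ?thesis using False by simp
      qed
    qed
    also have "\<dots> = 2 * H * real (card ({1..<n} \<inter> (\<Union>z\<in>J. B z)))"
    proof -
      have "(\<Sum>i=1..<n. if i \<in> U then 2 * H else 0) = 2 * H * real (card ({1..<n} \<inter> U))" for U
        by (simp add: sum.If_cases)
      then show ?thesis .
    qed
    also have "\<dots> \<le> 2 * H * (real (card J) * 2)"
    proof (rule mult_left_mono)
      have "card ({1..<n} \<inter> (\<Union>z\<in>J. B z)) \<le> card (\<Union>z\<in>J. B z)" using J by (intro card_mono) (auto simp: B_def)
      also have "\<dots> \<le> (\<Sum>z\<in>J. card (B z))" by (rule card_UN_le[OF J])
      finally have "real (card ({1..<n} \<inter> (\<Union>z\<in>J. B z))) \<le> (\<Sum>z\<in>J. real (card (B z)))" by (simp only: of_nat_le_iff of_nat_sum[symmetric])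
      also have "\<dots> \<le> (\<Sum>z\<in>J. 2)" using Bz by (intro sum_mono)
      finally show "real (card ({1..<n} \<inter> (\<Union>z\<in>J. B z))) \<le> real (card J) * 2" by simp
    qed (use H0 in simp)
    finally show ?thesis .
  qed
  have "grid_variation_le (max H (2 * H * (real (card J) * 2))) h"
    unfolding grid_variation_le_def using H tv by (meson max.coboundedI1 max.coboundedI2)
  then show ?thesis by blast
qed

text \<open>The Lipschitz part contributes \<open>n - 1\<close> increments of at most
  \<open>L / n\<close>, so its variation stays below \<open>L\<close> on every grid.\<close>

lemma piecewise_lipschitz01_variation:
  assumes "piecewise_lipschitz01 f"
  shows "\<exists>V. grid_variation_le V f"
proof -
  obtain g h L where L: "L-lipschitz_on {0..1} g" and h: "piecewise_constant01 h" and f: "\<And>x. x \<in> {0..1} \<Longrightarrow> f x = g x + h x"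
    using assms unfolding piecewise_lipschitz01_def by blast
  obtain V where V: "grid_variation_le V h" using piecewise_constant01_variation[OF h] by blast
  have L0: "L \<ge> 0" using L by (rule lipschitz_on_nonneg)
  have g: "\<bar>g x - g y\<bar> \<le> L * \<bar>x - y\<bar>" if "x \<in> {0..1}" "y \<in> {0..1}" for x y
    using lipschitz_onD[OF L that] by (simp add: dist_real_def)
  have "\<bar>f x\<bar> \<le> \<bar>g 0\<bar> + L + V" if "x \<in> {0..1}" for x
  proof -
    have "\<bar>g x - g 0\<bar> \<le> L * \<bar>x - 0\<bar>" using g[of x 0] that by simp
    also have "\<dots> \<le> L * 1" using L0 that by (intro mult_left_mono) auto
    finally have "\<bar>g x\<bar> \<le> \<bar>g 0\<bar> + L" by linarith
    moreover have "\<bar>h x\<bar> \<le> V" using V that by (simp add: grid_variation_le_def)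
    ultimately show ?thesis using f[OF that] by linarith
  qed
  moreover have "(\<Sum>i=1..<n. \<bar>f (real (Suc i) / real n) - f (real i / real n)\<bar>) \<le> \<bar>g 0\<bar> + L + V" for n :: nat
  proof -
    have "(\<Sum>i=1..<n. \<bar>f (real (Suc i) / real n) - f (real i / real n)\<bar>)
      \<le> (\<Sum>i=1..<n. L / real n + \<bar>h (real (Suc i) / real n) - h (real i / real n)\<bar>)"
    proof (rule sum_mono)
      fix i assume i: "i \<in> {1..<n}"
      have x: "real i / real n \<in> {0..1}" "real (Suc i) / real n \<in> {0..1}" using i by auto
      have "\<bar>g (real (Suc i) / real n) - g (real i / real n)\<bar> \<le> L * \<bar>real (Suc i) / real n - real i / real n\<bar>"
        by (rule g[OF x(2,1)])
      also have "real (Suc i) / real n - real i / real n = 1 / real n" by (simp add: diff_divide_distrib[symmetric])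
      finally have "\<bar>g (real (Suc i) / real n) - g (real i / real n)\<bar> \<le> L / real n" by simp
      then show "\<bar>f (real (Suc i) / real n) - f (real i / real n)\<bar> \<le> L / real n + \<bar>h (real (Suc i) / real n) - h (real i / real n)\<bar>"
        using f[OF x(1)] f[OF x(2)] by linarith
    qed
    also have "\<dots> = real (n - 1) * (L / real n) + (\<Sum>i=1..<n. \<bar>h (real (Suc i) / real n) - h (real i / real n)\<bar>)"
      by (simp add: sum.distrib)
    also have "\<dots> \<le> L + V"
    proof (rule add_mono)
      have "real (n - 1) / real n \<le> 1" by (cases "n = 0") auto
      then have "real (n - 1) / real n * L \<le> 1 * L" using L0 by (rule mult_right_mono)
      then show "real (n - 1) * (L / real n) \<le> L" by simp
      show "(\<Sum>i=1..<n. \<bar>h (real (Suc i) / real n) - h (real i / real n)\<bar>) \<le> V" using V by (simp add: grid_variation_le_def)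
    qed
    finally show ?thesis by simp
  qed
  ultimately show ?thesis unfolding grid_variation_le_def by blast
qed

lemma grid_variation_diff_le:
  fixes x :: "nat \<Rightarrow> real"
  assumes "i \<le> j" shows "\<bar>x j - x i\<bar> \<le> (\<Sum>t=i..<j. \<bar>x (Suc t) - x t\<bar>)"
proof -
  have "x j - x i = (\<Sum>t=i..<j. x (Suc t) - x t)" using assms by (simp add: sum_Suc_diff')
  then show ?thesis by (simp add: sum_abs)
qed

section \<open>Local standard deviations\<close>

lemma sum_blocks:
  fixes f :: "nat \<Rightarrow> real"
  shows "(\<Sum>j=1..b. \<Sum>i\<in>block l j. f i) = (\<Sum>i=1..b * l. f i)"
proof (induction b)
  case (Suc b)
  have "{1..Suc b * l} = {1..b * l} \<union> block l (Suc b)" "{1..b * l} \<inter> block l (Suc b) = {}"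
    by (auto simp: block_def)
  then have "(\<Sum>i=1..Suc b * l. f i) = (\<Sum>i=1..b * l. f i) + (\<Sum>i\<in>block l (Suc b). f i)"
    by (simp add: sum.union_disjoint block_def)
  then show ?case using Suc by simp
qed simp

lemma sum_shift_interval:
  fixes f :: "nat \<Rightarrow> real"
  shows "(\<Sum>i\<in>{r + 1..r + N}. f i) = (\<Sum>i=1..N. f (r + i))"
  by (rule sum.reindex_bij_witness[of _ "\<lambda>i. r + i" "\<lambda>i. i - r"]) auto

lemma sum_block:
  fixes f :: "nat \<Rightarrow> real"
  assumes "j \<ge> 1" shows "(\<Sum>i\<in>block l j. f i) = (\<Sum>i=1..l. f ((j - 1) * l + i))"
proof -
  have "j * l = (j - 1) * l + l" using assms by (cases j) auto
  then show ?thesis unfolding block_def using sum_shift_interval[of f "(j - 1) * l" l] by simp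
qed

lemma card_block: "j \<ge> 1 \<Longrightarrow> card (block l j) = l"
  unfolding block_def by (cases j) auto

text \<open>The local standard deviation is a seminorm of the data: a scaled Euclidean norm after
  centring. A mean function therefore perturbs it by at most the local standard deviation of its own
  grid values.\<close>

lemma sqrt_local_variance:
  "sqrt (local_variance l x j) = L2_set (\<lambda>i. x i - local_mean l x j) (block l j) / sqrt (real l)"
  unfolding local_variance_def L2_set_def by (simp add: real_sqrt_divide)

lemma sqrt_local_variance_add:
  "sqrt (local_variance l (\<lambda>i. x i + y i) j) \<le> sqrt (local_variance l x j) + sqrt (local_variance l y j)"
proof -
  have "local_mean l (\<lambda>i. x i + y i) j = local_mean l x j + local_mean l y j"
    unfolding local_mean_def by (simp add: sum.distrib distrib_left)
  then have "L2_set (\<lambda>i. x i + y i - local_mean l (\<lambda>i. x i + y i) j) (block l j)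
    = L2_set (\<lambda>i. (x i - local_mean l x j) + (y i - local_mean l y j)) (block l j)"
    by (intro arg_cong2[where f=L2_set] ext refl) simp
  also have "\<dots> \<le> L2_set (\<lambda>i. x i - local_mean l x j) (block l j) + L2_set (\<lambda>i. y i - local_mean l y j) (block l j)"
    by (rule L2_set_triangle_ineq)
  finally show ?thesis unfolding sqrt_local_variance add_divide_distrib[symmetric] by (rule divide_right_mono) simp
qed

lemma local_variance_uminus: "local_variance l (\<lambda>i. - x i) j = local_variance l x j"
proof -
  have "local_mean l (\<lambda>i. - x i) j = - local_mean l x j" unfolding local_mean_def by (simp add: sum_negf)
  then have "(- x i - local_mean l (\<lambda>i. - x i) j)\<^sup>2 = (x i - local_mean l x j)\<^sup>2" for i
    by (simp add: power2_commute)
  then show ?thesis unfolding local_variance_def by simp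
qed

lemma sqrt_local_variance_diff:
  "\<bar>sqrt (local_variance l (\<lambda>i. x i + y i) j) - sqrt (local_variance l y j)\<bar> \<le> sqrt (local_variance l x j)"
  using sqrt_local_variance_add[of l x y j] sqrt_local_variance_add[of l "\<lambda>i. x i + y i" "\<lambda>i. - x i" j]
  by (simp add: local_variance_uminus)

lemma local_variance_expand:
  assumes "l \<ge> 1" "j \<ge> 1"
  shows "local_variance l x j = 1 / real l * (\<Sum>i\<in>block l j. (x i)\<^sup>2) - (local_mean l x j)\<^sup>2"
proof -
  define m where "m = local_mean l x j"
  have m: "(\<Sum>i\<in>block l j. x i) = real l * m" using assms by (simp add: m_def local_mean_def)
  have "(\<Sum>i\<in>block l j. (x i - m)\<^sup>2) = (\<Sum>i\<in>block l j. (x i)\<^sup>2 - 2 * m * x i + m\<^sup>2)"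
    by (intro sum.cong refl) (simp add: power2_diff)
  also have "\<dots> = (\<Sum>i\<in>block l j. (x i)\<^sup>2) - 2 * m * (real l * m) + real l * m\<^sup>2"
    unfolding m[symmetric] using assms by (simp add: sum.distrib sum_subtractf sum_distrib_left card_block)
  finally have "(\<Sum>i\<in>block l j. (x i - m)\<^sup>2) = (\<Sum>i\<in>block l j. (x i)\<^sup>2) - real l * m\<^sup>2"
    by (simp add: power2_eq_square)
  then show ?thesis unfolding local_variance_def m_def[symmetric] using assms by (simp add: right_diff_distrib)
qed

text \<open>Increments across block borders are left out, so different blocks use disjoint parts of
  the grid and the oscillations add up to at most the total variation.\<close>

definition osc :: "nat \<Rightarrow> (nat \<Rightarrow> real) \<Rightarrow> nat \<Rightarrow> real" where
  "osc l x j = (\<Sum>t=(j - 1) * l + 1..<j * l. \<bar>x (Suc t) - x t\<bar>)"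

lemma osc_nonneg: "osc l x j \<ge> 0"
  unfolding osc_def by (intro sum_nonneg) auto

lemma diff_le_osc:
  assumes "i \<in> block l j" "k \<in> block l j" shows "\<bar>x i - x k\<bar> \<le> osc l x j"
proof -
  have *: "\<bar>x k - x i\<bar> \<le> osc l x j" if "i \<in> block l j" "k \<in> block l j" "i \<le> k" for i k
  proof -
    have "\<bar>x k - x i\<bar> \<le> (\<Sum>t=i..<k. \<bar>x (Suc t) - x t\<bar>)" by (rule grid_variation_diff_le[OF that(3)])
    also have "\<dots> \<le> osc l x j" unfolding osc_def using that by (intro sum_mono2) (auto simp: block_def)
    finally show ?thesis .
  qed
  show ?thesis using *[of i k] *[of k i] assms by (cases "i \<le> k") (auto simp: abs_minus_commute)
qed

lemma diff_mean_le_osc: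
  assumes i: "i \<in> block l j" and lj: "l \<ge> 1" "j \<ge> 1" shows "\<bar>x i - local_mean l x j\<bar> \<le> osc l x j"
proof -
  have "x i - local_mean l x j = 1 / real l * (\<Sum>k\<in>block l j. x i - x k)"
    unfolding local_mean_def using lj by (simp add: sum_subtractf card_block right_diff_distrib)
  also have "\<bar>\<dots>\<bar> \<le> 1 / real l * (\<Sum>k\<in>block l j. osc l x j)"
    unfolding abs_mult using diff_le_osc[OF i] by (intro mult_mono order_trans[OF sum_abs] sum_mono) (auto intro: sum_nonneg)
  also have "\<dots> = osc l x j" using lj by (simp add: card_block)
  finally show ?thesis .
qed

lemma L2_set_le_bound:
  assumes "finite A" "\<And>i. i \<in> A \<Longrightarrow> \<bar>f i\<bar> \<le> c" "c \<ge> 0" shows "L2_set f A \<le> c * sqrt (real (card A))"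
proof -
  have "(\<Sum>i\<in>A. (f i)\<^sup>2) \<le> (\<Sum>i\<in>A. c\<^sup>2)" using assms by (intro sum_mono) (metis abs_ge_zero power2_abs power_mono)
  then have "L2_set f A \<le> sqrt (real (card A) * c\<^sup>2)" unfolding L2_set_def by (intro real_sqrt_le_mono) simp
  then show ?thesis using assms by (simp add: real_sqrt_mult mult.commute)
qed

lemma sqrt_local_variance_le_osc:
  assumes lj: "l \<ge> 1" "j \<ge> 1" shows "sqrt (local_variance l x j) \<le> osc l x j"
proof -
  have "L2_set (\<lambda>i. x i - local_mean l x j) (block l j) \<le> osc l x j * sqrt (real l)"
    using L2_set_le_bound[of "block l j" "\<lambda>i. x i - local_mean l x j" "osc l x j"] diff_mean_le_osc[OF _ lj] osc_nonneg lj
    by (simp add: card_block) (simp add: block_def)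
  then show ?thesis unfolding sqrt_local_variance using lj by (simp add: pos_divide_le_eq)
qed

text \<open>The local variance estimates the quadratic mean of \<open>\<sigma>\<close> on a block,
  whereas the Riemann sum contains the arithmetic mean. The triangle inequality against the constant
  function bounds the difference by the oscillation; the modulus appears because it is the norm of a
  constant.\<close>

lemma root_mean_square_near_mean:
  assumes lj: "l \<ge> 1" "j \<ge> 1"
  shows "\<bar>sqrt (1 / real l * (\<Sum>i\<in>block l j. (x i)\<^sup>2)) - \<bar>local_mean l x j\<bar>\<bar> \<le> osc l x j"
proof -
  define m where "m = local_mean l x j"
  have c: "L2_set (\<lambda>i. m) (block l j) = \<bar>m\<bar> * sqrt (real l)"
    unfolding L2_set_def using lj by (simp add: card_block real_sqrt_mult mult.commute)
  have d: "L2_set (\<lambda>i. x i - m) (block l j) \<le> osc l x j * sqrt (real l)"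
    using sqrt_local_variance_le_osc[OF lj, of x] lj unfolding sqrt_local_variance m_def[symmetric] by (simp add: pos_divide_le_eq)
  have d': "L2_set (\<lambda>i. m - x i) (block l j) \<le> osc l x j * sqrt (real l)"
    using d by (simp add: L2_set_def power2_commute)
  have s: "sqrt (1 / real l * (\<Sum>i\<in>block l j. (x i)\<^sup>2)) = L2_set x (block l j) / sqrt (real l)"
    unfolding L2_set_def by (simp add: real_sqrt_divide)
  have "L2_set x (block l j) \<le> L2_set (\<lambda>i. x i - m) (block l j) + L2_set (\<lambda>i. m) (block l j)"
    using L2_set_triangle_ineq[of "\<lambda>i. x i - m" "\<lambda>i. m" "block l j"] by simp
  moreover have "L2_set (\<lambda>i. m) (block l j) \<le> L2_set (\<lambda>i. m - x i) (block l j) + L2_set x (block l j)"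
    using L2_set_triangle_ineq[of "\<lambda>i. m - x i" x "block l j"] by simp
  ultimately have "\<bar>L2_set x (block l j) - \<bar>m\<bar> * sqrt (real l)\<bar> \<le> osc l x j * sqrt (real l)"
    using d d' c by linarith
  then have "\<bar>L2_set x (block l j) - \<bar>m\<bar> * sqrt (real l)\<bar> / sqrt (real l) \<le> osc l x j"
    using lj by (simp add: pos_divide_le_eq)
  moreover have "L2_set x (block l j) / sqrt (real l) - \<bar>m\<bar> = (L2_set x (block l j) - \<bar>m\<bar> * sqrt (real l)) / sqrt (real l)"
    using lj by (simp add: diff_divide_distrib)
  ultimately show ?thesis unfolding s m_def[symmetric] by (simp add: abs_divide)
qed

text \<open>Only \<open>s\<close> has to stay away from 0; the random quantity \<open>a\<close> may
  vanish.\<close>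

lemma abs_sqrt_diff_le:
  assumes "a \<ge> 0" "s \<ge> s0" "s0 > (0::real)" shows "\<bar>sqrt a - s\<bar> \<le> \<bar>a - s\<^sup>2\<bar> / s0"
proof -
  have "a - s\<^sup>2 = (sqrt a - s) * (sqrt a + s)" using assms by (simp add: algebra_simps power2_eq_square)
  then have "\<bar>a - s\<^sup>2\<bar> = \<bar>sqrt a - s\<bar> * (sqrt a + s)" using assms by (simp add: abs_mult)
  also have "\<dots> \<ge> \<bar>sqrt a - s\<bar> * s0"
  proof (rule mult_left_mono)
    show "s0 \<le> sqrt a + s" using assms(2) real_sqrt_ge_zero[OF assms(1)] by linarith
  qed simp
  finally show ?thesis using assms by (simp add: pos_le_divide_eq)
qed

lemma sum_osc_le:
  assumes "(\<Sum>i=1..<b * l. \<bar>x (Suc i) - x i\<bar>) \<le> V"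
  shows "(\<Sum>j=1..b. osc l x j) \<le> V"
proof -
  \<comment> \<open>Cut off at \<open>b * l\<close>, where the successor would leave the
    grid.\<close>
  define g where "g t = (if t < b * l then \<bar>x (Suc t) - x t\<bar> else 0)" for t
  have "(\<Sum>j=1..b. osc l x j) \<le> (\<Sum>j=1..b. \<Sum>t\<in>block l j. g t)"
  proof (rule sum_mono)
    fix j assume j: "j \<in> {1..b}"
    have jb: "j * l \<le> b * l" using j by (intro mult_le_mono1) simp
    have "osc l x j = (\<Sum>t=(j - 1) * l + 1..<j * l. g t)"
      unfolding osc_def by (intro sum.cong refl) (auto simp: g_def dest: less_le_trans[OF _ jb])
    also have "\<dots> \<le> (\<Sum>t\<in>block l j. g t)" by (intro sum_mono2) (auto simp: block_def g_def)
    finally show "osc l x j \<le> (\<Sum>t\<in>block l j. g t)" .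
  qed
  also have "\<dots> = (\<Sum>t=1..b * l. g t)" by (rule sum_blocks)
  also have "\<dots> = (\<Sum>t=1..<b * l. \<bar>x (Suc t) - x t\<bar>)"
    by (rule sum.mono_neutral_cong_right) (auto simp: g_def)
  finally show ?thesis using assms by simp
qed

section \<open>The denominator: averaged local standard deviations\<close>

locale blocks = centered_process +
  fixes \<mu> \<sigma> :: "real \<Rightarrow> real" and \<sigma>0 V :: real and n l b :: nat
  assumes n: "n = b * l" and l: "l \<ge> 1" and b: "b \<ge> 1"
    and \<sigma>0: "\<sigma>0 > 0" and \<sigma>_ge: "\<forall>x\<in>{0..1}. \<sigma> x \<ge> \<sigma>0"
    and var: "grid_variation_le V \<mu>" "grid_variation_le V \<sigma>" and V: "V \<ge> 1"
begin

definition sg :: "nat \<Rightarrow> real" where "sg i = \<sigma> (real i / real n)"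
definition mu :: "nat \<Rightarrow> real" where "mu i = \<mu> (real i / real n)"
definition z :: "'a \<Rightarrow> nat \<Rightarrow> real" where "z \<omega> i = sg i * Y i \<omega>"
definition A :: real where "A = 1 / real b * (\<Sum>j=1..b. local_mean l sg j)"
definition S2 :: real where "S2 = (\<Sum>k. \<bar>expectation (\<lambda>\<omega>. Y 1 \<omega> * Y (1 + k) \<omega>)\<bar>)"

lemma observation_eq: "observation \<mu> \<sigma> Y n \<omega> = (\<lambda>i. mu i + z \<omega> i)"
  by (auto simp: observation_def mu_def sg_def z_def)

lemma unit: "i \<le> n \<Longrightarrow> real i / real n \<in> {0..1}" by (cases "n = 0") auto

lemma sg_bounds: "i \<le> n \<Longrightarrow> \<sigma>0 \<le> sg i" "i \<le> n \<Longrightarrow> \<bar>sg i\<bar> \<le> V" "i \<le> n \<Longrightarrow> \<bar>mu i\<bar> \<le> V"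
  using \<sigma>_ge var unit[of i] by (auto simp: sg_def mu_def grid_variation_le_def simp del: atLeastAtMost_iff)

lemma tv: "(\<Sum>i=1..<n. \<bar>sg (Suc i) - sg i\<bar>) \<le> V" "(\<Sum>i=1..<n. \<bar>mu (Suc i) - mu i\<bar>) \<le> V"
  using var by (auto simp: sg_def mu_def grid_variation_le_def)

lemma block_le: "j \<in> {1..b} \<Longrightarrow> i \<in> block l j \<Longrightarrow> 1 \<le> i \<and> i \<le> n"
proof -
  assume ji: "j \<in> {1..b}" "i \<in> block l j"
  have "i \<le> j * l" using ji by (simp add: block_def)
  moreover have "j * l \<le> b * l" using ji by (intro mult_le_mono1) simp
  ultimately have "i \<le> n" unfolding n by (rule le_trans)
  then show ?thesis using ji by (simp add: block_def)
qed

lemma real_n: "real n = real b * real l"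
  by (metis n of_nat_mult)

text \<open>The average of the block means does not depend on the blocking. The locale is used with
  both block lengths of one sample, and this gives numerator and denominator the same
  centre.\<close>

lemma A_alt: "A = 1 / real n * (\<Sum>i=1..n. sg i)"
proof -
  have "(\<Sum>j=1..b. local_mean l sg j) = 1 / real l * (\<Sum>i=1..n. sg i)"
    unfolding local_mean_def sum_distrib_left[symmetric] sum_blocks n[symmetric] ..
  then show ?thesis unfolding A_def real_n by simp
qed

lemma A_ge: "A \<ge> \<sigma>0"
proof -
  have "real n * \<sigma>0 \<le> (\<Sum>i=1..n. sg i)" using sum_mono[of "{1..n}" "\<lambda>_. \<sigma>0" sg] sg_bounds(1) by simp
  moreover have "real n > 0" using n l b by simp
  ultimately show ?thesis unfolding A_alt by (simp add: field_simps)
qed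

lemma S2_nonneg: "S2 \<ge> 0"
  unfolding S2_def using functional_Y(1)[of "\<lambda>y. y", OF _ tmean_le(4)] Y_mean by (intro suminf_nonneg) auto

lemma z_measurable [measurable]: "i \<ge> 1 \<Longrightarrow> (\<lambda>\<omega>. z \<omega> i) \<in> borel_measurable M"
  unfolding z_def by measurable

lemma weighted_square:
  assumes "\<And>i. i \<in> {1..N} \<Longrightarrow> \<bar>w i\<bar> \<le> W"
  shows "integrable M (\<lambda>\<omega>. (\<Sum>i=1..N. w i * Y (r + i) \<omega>)\<^sup>2)"
    "expectation (\<lambda>\<omega>. (\<Sum>i=1..N. w i * Y (r + i) \<omega>)\<^sup>2) \<le> W\<^sup>2 * real N * (2 * S2)"
  using functional_Y(5,6)[of "\<lambda>y. y", OF _ tmean_le(4), of N w W r] assms Y_mean by (simp_all add: S2_def)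

definition sd_mean :: "'a \<Rightarrow> real" where
  "sd_mean \<omega> = 1 / real b * (\<Sum>j=1..b. sqrt (local_variance l (observation \<mu> \<sigma> Y n \<omega>) j))"

lemma sd_mean_measurable [measurable]: "sd_mean \<in> borel_measurable M"
proof -
  have "(\<lambda>\<omega>. mu i + z \<omega> i) \<in> borel_measurable M" if "i \<in> block l j" for i j
    using that z_measurable[of i] by (auto simp: block_def)
  then show ?thesis
    unfolding sd_mean_def[abs_def] observation_eq local_variance_def local_mean_def
    by (intro borel_measurable_times borel_measurable_sum borel_measurable_const borel_measurable_sqrt borel_measurable_power borel_measurable_diff) auto
qed

text \<open>Three comparisons: the mean function is removed by the seminorm property; the standard
  deviation of the pure noise is compared with the quadratic mean of \<open>\<sigma>\<close> through
  the variances, at the price of dividing by \<open>\<sigma>0\<close>; the quadratic mean is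
  replaced by the arithmetic one. The last summand in the bracket is the squared local mean of the
  noise.\<close>

lemma local_sd_error:
  assumes j: "j \<in> {1..b}"
  shows "\<bar>sqrt (local_variance l (observation \<mu> \<sigma> Y n \<omega>) j) - local_mean l sg j\<bar> \<le> osc l mu j + osc l sg j
    + (\<bar>\<Sum>i=1..l. (sg ((j - 1) * l + i))\<^sup>2 * ((Y ((j - 1) * l + i) \<omega>)\<^sup>2 - 1)\<bar> / real l
       + (\<Sum>i=1..l. sg ((j - 1) * l + i) * Y ((j - 1) * l + i) \<omega>)\<^sup>2 / (real l)\<^sup>2) / \<sigma>0"
proof -
  have j1: "j \<ge> 1" using j by simp
  define s where "s = sqrt (1 / real l * (\<Sum>i\<in>block l j. (sg i)\<^sup>2))"
  have s2: "s\<^sup>2 = 1 / real l * (\<Sum>i\<in>block l j. (sg i)\<^sup>2)" unfolding s_def by (simp add: sum_nonneg)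
  have s0: "s \<ge> \<sigma>0"
  proof -
    have "(\<Sum>i\<in>block l j. \<sigma>0\<^sup>2) \<le> (\<Sum>i\<in>block l j. (sg i)\<^sup>2)"
      using sg_bounds(1) block_le[OF j] \<sigma>0 by (intro sum_mono power_mono) auto
    then have "\<sigma>0\<^sup>2 \<le> 1 / real l * (\<Sum>i\<in>block l j. (sg i)\<^sup>2)" using l j1 by (simp add: card_block field_simps)
    then show ?thesis unfolding s_def by (rule real_le_rsqrt)
  qed
  have m0: "local_mean l sg j \<ge> 0"
    unfolding local_mean_def using sg_bounds(1) block_le[OF j] \<sigma>0 by (intro mult_nonneg_nonneg sum_nonneg) (auto intro: order_trans less_imp_le)
  have 1: "\<bar>sqrt (local_variance l (observation \<mu> \<sigma> Y n \<omega>) j) - sqrt (local_variance l (z \<omega>) j)\<bar> \<le> osc l mu j"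
    unfolding observation_eq using sqrt_local_variance_diff[of l mu "z \<omega>" j] sqrt_local_variance_le_osc[OF l j1, of mu] by linarith
  have 2: "\<bar>sqrt (local_variance l (z \<omega>) j) - s\<bar> \<le> \<bar>local_variance l (z \<omega>) j - s\<^sup>2\<bar> / \<sigma>0"
    by (rule abs_sqrt_diff_le[OF _ s0 \<sigma>0]) (simp add: local_variance_def sum_nonneg)
  have 3: "\<bar>s - local_mean l sg j\<bar> \<le> osc l sg j"
    using root_mean_square_near_mean[OF l j1, of sg] m0 by (simp add: s_def)
  have "local_variance l (z \<omega>) j - s\<^sup>2 = (\<Sum>i\<in>block l j. (sg i)\<^sup>2 * ((Y i \<omega>)\<^sup>2 - 1)) / real l - (\<Sum>i\<in>block l j. sg i * Y i \<omega>)\<^sup>2 / (real l)\<^sup>2"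
    unfolding local_variance_expand[OF l j1] s2 local_mean_def z_def
    by (simp add: power_mult_distrib right_diff_distrib sum_subtractf diff_divide_distrib power_divide)
  then have "\<bar>local_variance l (z \<omega>) j - s\<^sup>2\<bar> \<le> \<bar>\<Sum>i\<in>block l j. (sg i)\<^sup>2 * ((Y i \<omega>)\<^sup>2 - 1)\<bar> / real l + (\<Sum>i\<in>block l j. sg i * Y i \<omega>)\<^sup>2 / (real l)\<^sup>2"
    using abs_triangle_ineq4[of "(\<Sum>i\<in>block l j. (sg i)\<^sup>2 * ((Y i \<omega>)\<^sup>2 - 1)) / real l" "(\<Sum>i\<in>block l j. sg i * Y i \<omega>)\<^sup>2 / (real l)\<^sup>2"] by simp
  then have "\<bar>local_variance l (z \<omega>) j - s\<^sup>2\<bar> / \<sigma>0 \<le> (\<bar>\<Sum>i\<in>block l j. (sg i)\<^sup>2 * ((Y i \<omega>)\<^sup>2 - 1)\<bar> / real l + (\<Sum>i\<in>block l j. sg i * Y i \<omega>)\<^sup>2 / (real l)\<^sup>2) / \<sigma>0"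
    using \<sigma>0 by (intro divide_right_mono) auto
  then show ?thesis using 1 2 3 unfolding sum_block[OF j1] by linarith
qed

text \<open>The oscillations are summed over the blocks before dividing by \<open>b\<close>, so
  jumps cost only a multiple of \<open>V / b\<close>. The squared local means are of order
  \<open>1 / l\<close> by the second moment bound.\<close>

lemma sd_mean_error:
  assumes sq: "square_approx l (V\<^sup>2) e"
  shows "integrable M (\<lambda>\<omega>. \<bar>sd_mean \<omega> - A\<bar>)"
    and "expectation (\<lambda>\<omega>. \<bar>sd_mean \<omega> - A\<bar>) \<le> 2 * V / real b + (e + 2 * V\<^sup>2 * S2 / real l) / \<sigma>0"
proof -
  define P where "P j \<omega> = \<bar>\<Sum>i=1..l. (sg ((j - 1) * l + i))\<^sup>2 * ((Y ((j - 1) * l + i) \<omega>)\<^sup>2 - 1)\<bar>" for j \<omega>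
  define Q where "Q j \<omega> = (\<Sum>i=1..l. sg ((j - 1) * l + i) * Y ((j - 1) * l + i) \<omega>)\<^sup>2" for j \<omega>
  define G where "G j \<omega> = osc l mu j + osc l sg j + (P j \<omega> / real l + Q j \<omega> / (real l)\<^sup>2) / \<sigma>0" for j \<omega>
  have ind: "(j - 1) * l + i \<le> n" if "j \<in> {1..b}" "i \<in> {1..l}" for i j
  proof -
    have "(j - 1) * l + i \<in> block l j" using that by (cases j) (auto simp: block_def)
    then show ?thesis using block_le[OF that(1)] by simp
  qed
  have iP: "integrable M (P j)" if j: "j \<in> {1..b}" for j
    unfolding P_def[abs_def] using Y_square_int
    by (intro integrable_abs Bochner_Integration.integrable_sum integrable_mult_right Bochner_Integration.integrable_diff) auto
  have eP: "expectation (P j) \<le> e * real l" if j: "j \<in> {1..b}" for j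
  proof -
    have "\<bar>(sg ((j - 1) * l + i))\<^sup>2\<bar> \<le> V\<^sup>2" if "i \<in> {1..l}" for i
      using sg_bounds(2)[OF ind[OF j that]] V by (simp add: abs_le_square_iff[symmetric])
    then have "\<forall>i\<in>{1..l}. \<bar>(sg ((j - 1) * l + i))\<^sup>2\<bar> \<le> V\<^sup>2" by (intro ballI)
    from mp[OF spec[OF spec[OF sq[unfolded square_approx_def], of "(j - 1) * l"], of "\<lambda>i. (sg ((j - 1) * l + i))\<^sup>2"] this]
    show ?thesis unfolding P_def[abs_def] .
  qed
  have sgb: "\<bar>sg ((j - 1) * l + i)\<bar> \<le> V" if "j \<in> {1..b}" "i \<in> {1..l}" for i j
    by (rule sg_bounds(2)[OF ind[OF that]])
  have Q: "integrable M (Q j)" "expectation (Q j) \<le> V\<^sup>2 * real l * (2 * S2)" if j: "j \<in> {1..b}" for j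
    unfolding Q_def[abs_def] by (rule weighted_square[OF sgb[OF j]], assumption)+
  have iG: "integrable M (G j)" if j: "j \<in> {1..b}" for j
    unfolding G_def[abs_def] using iP[OF j] Q(1)[OF j] by simp
  have eG: "expectation (G j) \<le> osc l mu j + osc l sg j + (e + 2 * V\<^sup>2 * S2 / real l) / \<sigma>0" if j: "j \<in> {1..b}" for j
  proof -
    have "expectation (G j) = osc l mu j + osc l sg j + (expectation (P j) / real l + expectation (Q j) / (real l)\<^sup>2) / \<sigma>0"
      unfolding G_def[abs_def] using iP[OF j] Q(1)[OF j] by (simp add: prob_space)
    moreover have "expectation (P j) / real l \<le> e" using eP[OF j] l by (simp add: pos_divide_le_eq)
    moreover have "expectation (Q j) / (real l)\<^sup>2 \<le> 2 * V\<^sup>2 * S2 / real l"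
      using Q(2)[OF j] l by (simp add: field_simps power2_eq_square)
    ultimately show ?thesis using \<sigma>0 by (simp add: divide_right_mono add_mono)
  qed
  have pt: "\<bar>sd_mean \<omega> - A\<bar> \<le> 1 / real b * (\<Sum>j=1..b. G j \<omega>)" for \<omega>
  proof -
    have "sd_mean \<omega> - A = 1 / real b * (\<Sum>j=1..b. sqrt (local_variance l (observation \<mu> \<sigma> Y n \<omega>) j) - local_mean l sg j)"
      unfolding sd_mean_def A_def by (simp only: sum_subtractf right_diff_distrib)
    also have "\<bar>\<dots>\<bar> \<le> 1 / real b * (\<Sum>j=1..b. \<bar>sqrt (local_variance l (observation \<mu> \<sigma> Y n \<omega>) j) - local_mean l sg j\<bar>)"
      unfolding abs_mult by (simp add: divide_right_mono sum_abs)
    also have "\<dots> \<le> 1 / real b * (\<Sum>j=1..b. G j \<omega>)"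
      using local_sd_error unfolding G_def P_def Q_def by (intro mult_left_mono sum_mono) auto
    finally show ?thesis .
  qed
  have iB: "integrable M (\<lambda>\<omega>. 1 / real b * (\<Sum>j=1..b. G j \<omega>))"
    using iG by (intro integrable_mult_right Bochner_Integration.integrable_sum) auto
  show i: "integrable M (\<lambda>\<omega>. \<bar>sd_mean \<omega> - A\<bar>)"
    by (rule integrable_dominated[OF _ iB]) (use pt in auto)
  have "expectation (\<lambda>\<omega>. \<bar>sd_mean \<omega> - A\<bar>) \<le> expectation (\<lambda>\<omega>. 1 / real b * (\<Sum>j=1..b. G j \<omega>))"
    by (rule integral_mono[OF i iB pt])
  also have "\<dots> = 1 / real b * (\<Sum>j=1..b. expectation (G j))"
    unfolding integral_mult_right_zero using iG by (subst Bochner_Integration.integral_sum) auto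
  also have "\<dots> \<le> 1 / real b * (\<Sum>j=1..b. osc l mu j + osc l sg j + (e + 2 * V\<^sup>2 * S2 / real l) / \<sigma>0)"
    using eG by (intro mult_left_mono sum_mono) auto
  also have "\<dots> = 1 / real b * ((\<Sum>j=1..b. osc l mu j) + (\<Sum>j=1..b. osc l sg j)) + (e + 2 * V\<^sup>2 * S2 / real l) / \<sigma>0"
    using b by (simp add: sum.distrib distrib_left)
  also have "\<dots> \<le> 1 / real b * (V + V) + (e + 2 * V\<^sup>2 * S2 / real l) / \<sigma>0"
    using sum_osc_le[of mu b l V, folded n] sum_osc_le[of sg b l V, folded n] tv by (intro add_right_mono mult_left_mono add_mono) auto
  finally show "expectation (\<lambda>\<omega>. \<bar>sd_mean \<omega> - A\<bar>) \<le> 2 * V / real b + (e + 2 * V\<^sup>2 * S2 / real l) / \<sigma>0" by simp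
qed

end

section \<open>The long run variance estimator\<close>

text \<open>\<open>c0\<close> need not be an integer, but \<open>c0 * l\<close> is a natural number
  \<open>m\<close>; all index sets are then described by \<open>m\<close> without real
  arithmetic.\<close>

locale long_blocks = blocks +
  fixes c0 :: real and m :: nat
  assumes m: "real m = c0 * real l" and c0: "1 \<le> c0" "c0 < real b"
begin

definition wt :: "nat \<Rightarrow> real" where "wt j = surrounding_weight n c0 l j"
definition sur :: "nat \<Rightarrow> nat set" where "sur j = surrounding n c0 l j"
text \<open>Each summand of the estimator is the modulus of a linear contrast of the data; this is
  the coefficient vector of the contrast on the whole sample.\<close>

definition cf :: "nat \<Rightarrow> nat \<Rightarrow> real" where
  "cf j i = (if i \<in> block l j then 1 else 0) - wt j * (if i \<in> sur j then 1 else 0)"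
definition interior :: "nat \<Rightarrow> bool" where "interior j \<longleftrightarrow> m \<le> (j - 1) * l \<and> j * l + m \<le> n"
text \<open>Natural subtraction cuts the window at the left end of the sample, as \<open>min\<close>
  does at the right end.\<close>

definition st :: "nat \<Rightarrow> nat" where "st j = (j - 1) * l - m"
definition en :: "nat \<Rightarrow> nat" where "en j = min n (j * l + m)"
definition T :: "nat \<Rightarrow> 'a \<Rightarrow> real" where "T j \<omega> = (\<Sum>i=1..n. cf j i * z \<omega> i)"
definition oscW :: "(nat \<Rightarrow> real) \<Rightarrow> nat \<Rightarrow> real" where
  "oscW x j = (\<Sum>t=st j + 1..<en j. \<bar>x (Suc t) - x t\<bar>)"

lemma l_le_m: "l \<le> m"
proof -
  have "1 * real l \<le> c0 * real l" using c0 by (intro mult_right_mono) auto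
  then show ?thesis unfolding m[symmetric] by simp
qed

lemma jl: "j \<ge> 1 \<Longrightarrow> j * l = (j - 1) * l + l"
  by (cases j) auto

lemma jl_le: "j \<in> {1..b} \<Longrightarrow> j * l \<le> n"
  unfolding n by (intro mult_le_mono1) simp

text \<open>Writing \<open>i + m\<close> on one side instead of subtracting \<open>m\<close> on the
  other keeps the cut at the left end free of case distinctions.\<close>

lemma sur_iff:
  assumes j: "j \<ge> 1"
  shows "i \<in> sur j \<longleftrightarrow> 1 \<le> i \<and> i \<le> n \<and> ((j - 1) * l < i + m \<and> i \<le> (j - 1) * l \<or> j * l < i \<and> i \<le> j * l + m)"
proof -
  have r: "(real j - 1) * real l = real ((j - 1) * l)" using j by (simp add: of_nat_diff)
  have 1: "(real j - 1 - c0) * real l + 1 \<le> real i \<longleftrightarrow> (j - 1) * l < i + m"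
  proof -
    have "(real j - 1 - c0) * real l = real ((j - 1) * l) - real m" unfolding r[symmetric] m by (simp add: algebra_simps)
    then have "(real j - 1 - c0) * real l + 1 \<le> real i \<longleftrightarrow> real ((j - 1) * l + 1) \<le> real (i + m)"
      unfolding of_nat_add of_nat_1 by linarith
    also have "\<dots> \<longleftrightarrow> (j - 1) * l < i + m" unfolding of_nat_le_iff by linarith
    finally show ?thesis .
  qed
  have 2: "real i \<le> (real j - 1) * real l \<longleftrightarrow> i \<le> (j - 1) * l" unfolding r of_nat_le_iff ..
  have 3: "real j * real l + 1 \<le> real i \<longleftrightarrow> j * l < i"
  proof -
    have "real j * real l + 1 \<le> real i \<longleftrightarrow> real (j * l + 1) \<le> real i" by (simp add: add.commute)
    then show ?thesis unfolding of_nat_le_iff by linarith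
  qed
  have 4: "real i \<le> (real j + c0) * real l \<longleftrightarrow> i \<le> j * l + m"
  proof -
    have "(real j + c0) * real l = real (j * l + m)" using m by (simp add: algebra_simps)
    then show ?thesis by (simp only: of_nat_le_iff)
  qed
  show ?thesis unfolding sur_def surrounding_def using 1 2 3 4 by auto
qed

lemma interior_iff:
  assumes "j \<ge> 1"
  shows "interior j \<longleftrightarrow> 0 \<le> (real j - 1 - c0) * real l \<and> (real j + c0) * real l \<le> real n"
proof -
  have r: "(real j - 1) * real l = real ((j - 1) * l)" using assms by (simp add: of_nat_diff)
  have "(real j - 1 - c0) * real l = real ((j - 1) * l) - real m" unfolding r[symmetric] m by (simp add: algebra_simps)
  then have 1: "0 \<le> (real j - 1 - c0) * real l \<longleftrightarrow> m \<le> (j - 1) * l" by (simp del: of_nat_mult)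
  have "(real j + c0) * real l = real (j * l + m)" using m by (simp add: algebra_simps)
  then have 2: "(real j + c0) * real l \<le> real n \<longleftrightarrow> j * l + m \<le> n" by (simp only: of_nat_le_iff)
  show ?thesis unfolding interior_def 1 2 ..
qed

lemma finite_sur: "finite (sur j)"
  unfolding sur_def surrounding_def by auto

lemma block_sur_disjoint: "j \<ge> 1 \<Longrightarrow> block l j \<inter> sur j = {}"
  using sur_iff[of j] jl[of j] by (auto simp: block_def)

text \<open>Since \<open>1 \<le> c0 < b\<close> there are at least two blocks, so at least one
  complete neighbouring block is observed. This keeps the boundary weight at most 1 and its
  denominator positive.\<close>

lemma card_sur_ge:
  assumes j: "j \<in> {1..b}" shows "l \<le> card (sur j)"
proof -
  have j1: "j \<ge> 1" using j by simp
  have b1: "b > 1" using c0 by linarith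
  show ?thesis
  proof (cases "j = 1")
    case True
    have "2 * l \<le> b * l" using b1 by (intro mult_le_mono1) simp
    then have "j * l + l \<le> n" unfolding True n by linarith
    then have "{j * l + 1..j * l + l} \<subseteq> sur j"
      unfolding subset_iff atLeastAtMost_iff sur_iff[OF j1] using l_le_m by (intro allI impI conjI disjI2; linarith)
    from card_mono[OF finite_sur this] show ?thesis by simp
  next
    case False
    then have "1 * l \<le> (j - 1) * l" using j by (intro mult_le_mono1) auto
    then have ll: "l \<le> (j - 1) * l" by simp
    have "(j - 1) * l \<le> n" using jl_le[OF j] jl[OF j1] by linarith
    then have "{(j - 1) * l - l + 1..(j - 1) * l} \<subseteq> sur j"
      unfolding subset_iff atLeastAtMost_iff sur_iff[OF j1] using l_le_m ll l by (intro allI impI conjI disjI1; linarith)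
    from card_mono[OF finite_sur this] show ?thesis using ll by simp
  qed
qed

lemma card_sur_interior:
  assumes j: "j \<in> {1..b}" and i: "interior j" shows "card (sur j) = 2 * m"
proof -
  have j1: "j \<ge> 1" using j by simp
  have aux: "(1 \<le> i \<and> i \<le> n \<and> (p < i + m \<and> i \<le> p \<or> q < i \<and> i \<le> q + m)) \<longleftrightarrow> (p - m + 1 \<le> i \<and> i \<le> p \<or> q + 1 \<le> i \<and> i \<le> q + m)"
    if "m \<le> p" "q + m \<le> n" "p \<le> q" for i p q n m :: nat
    using that by auto
  have pq: "m \<le> (j - 1) * l" "j * l + m \<le> n" "(j - 1) * l \<le> j * l"
    using i jl[OF j1] unfolding interior_def by auto
  have "sur j = {(j - 1) * l - m + 1..(j - 1) * l} \<union> {j * l + 1..j * l + m}"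
    unfolding set_eq_iff Un_iff atLeastAtMost_iff sur_iff[OF j1] using aux[OF pq] by blast
  moreover have "{(j - 1) * l - m + 1..(j - 1) * l} \<inter> {j * l + 1..j * l + m} = {}"
  proof (rule Int_emptyI)
    fix x assume "x \<in> {(j - 1) * l - m + 1..(j - 1) * l}" "x \<in> {j * l + 1..j * l + m}"
    then show False using pq(3) unfolding atLeastAtMost_iff by linarith
  qed
  ultimately have "card (sur j) = card {(j - 1) * l - m + 1..(j - 1) * l} + card {j * l + 1..j * l + m}"
    by (simp only: card_Un_disjoint finite_atLeastAtMost)
  then show ?thesis using pq(1) by simp
qed

text \<open>In the interior and at the boundary the weight times the number of surrounding indices
  is \<open>l\<close>. Hence the coefficients of the contrast sum to zero and constants are
  annihilated.\<close>

lemma wt: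
  assumes j: "j \<in> {1..b}"
  shows "0 \<le> wt j" "wt j \<le> 1" "wt j * real (card (sur j)) = real l" "interior j \<Longrightarrow> wt j = 1 / (2 * c0)"
proof -
  have j1: "j \<ge> 1" using j by simp
  have w: "wt j = (if interior j then 1 / (2 * c0) else real l / real (card (sur j)))"
    unfolding wt_def surrounding_weight_def interior_iff[OF j1] sur_def ..
  have cs: "real l \<le> real (card (sur j))" "real (card (sur j)) > 0" using card_sur_ge[OF j] l by auto
  show "interior j \<Longrightarrow> wt j = 1 / (2 * c0)" by (simp add: w)
  show "0 \<le> wt j" "wt j \<le> 1" unfolding w using c0 cs by auto
  show "wt j * real (card (sur j)) = real l"
    using card_sur_interior[OF j] cs c0 by (auto simp: w m)
qed

lemma cf_abs: "j \<in> {1..b} \<Longrightarrow> \<bar>cf j i\<bar> \<le> 1"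
  using wt(1,2)[of j] by (auto simp: cf_def)

lemma sum_cf:
  assumes j: "j \<in> {1..b}"
  shows "(\<Sum>i=1..n. cf j i * x i) = (\<Sum>i\<in>block l j. x i) - wt j * (\<Sum>i\<in>sur j. x i)"
proof -
  have s: "(\<Sum>i=1..n. (if i \<in> B then 1 else 0) * x i) = (\<Sum>i\<in>B. x i)" if "B \<subseteq> {1..n}" for B
  proof -
    have "(\<Sum>i=1..n. (if i \<in> B then 1 else 0) * x i) = (\<Sum>i=1..n. if i \<in> B then x i else 0)"
      by (intro sum.cong refl) auto
    also have "\<dots> = (\<Sum>i\<in>{1..n} \<inter> B. x i)" by (simp add: sum.inter_restrict)
    finally show ?thesis using that by (simp add: Int_absorb1)
  qed
  have B: "block l j \<subseteq> {1..n}" using block_le[OF j] by auto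
  have S: "sur j \<subseteq> {1..n}" using sur_iff[of j] j by auto
  have "(\<Sum>i=1..n. cf j i * x i) = (\<Sum>i=1..n. (if i \<in> block l j then 1 else 0) * x i) - wt j * (\<Sum>i=1..n. (if i \<in> sur j then 1 else 0) * x i)"
    unfolding cf_def sum_distrib_left sum_subtractf[symmetric] by (intro sum.cong refl) (simp add: algebra_simps)
  then show ?thesis by (simp only: s[OF B] s[OF S])
qed

lemma kappa_hat_X_eq:
  "kappa_hat_X n c0 l b x = sqrt (2 * c0 / (1 + 2 * c0)) * sqrt (pi / 2) * (1 / real b * (\<Sum>j=1..b. \<bar>\<Sum>i=1..n. cf j i * x i\<bar> / sqrt (real l)))"
proof -
  have "(\<Sum>j=1..b. 1 / sqrt (real l) * \<bar>(\<Sum>i\<in>block l j. x i) - surrounding_weight n c0 l j * (\<Sum>i\<in>surrounding n c0 l j. x i)\<bar>)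
      = (\<Sum>j=1..b. \<bar>\<Sum>i=1..n. cf j i * x i\<bar> / sqrt (real l))"
  proof (rule sum.cong[OF refl])
    fix j assume "j \<in> {1..b}"
    then show "1 / sqrt (real l) * \<bar>(\<Sum>i\<in>block l j. x i) - surrounding_weight n c0 l j * (\<Sum>i\<in>surrounding n c0 l j. x i)\<bar>
      = \<bar>\<Sum>i=1..n. cf j i * x i\<bar> / sqrt (real l)"
      unfolding sum_cf[OF \<open>j \<in> {1..b}\<close>] wt_def sur_def by simp
  qed
  then show ?thesis unfolding kappa_hat_X_def by simp
qed

lemma st_le_en: "j \<in> {1..b} \<Longrightarrow> st j + l \<le> en j" and en_le: "en j \<le> n" and window_length: "j \<in> {1..b} \<Longrightarrow> en j \<le> st j + (l + 2 * m)"
  and interior_window: "j \<in> {1..b} \<Longrightarrow> interior j \<Longrightarrow> en j = st j + (l + 2 * m)"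
  using jl_le[of j] jl[of j] unfolding st_def en_def interior_def by auto

lemma block_window: "j \<in> {1..b} \<Longrightarrow> i \<in> block l j \<Longrightarrow> i \<in> {st j + 1..en j}"
  using block_le[of j i] unfolding st_def en_def block_def by auto

lemma sur_window: "j \<in> {1..b} \<Longrightarrow> i \<in> sur j \<Longrightarrow> i \<in> {st j + 1..en j}"
  using sur_iff[of j i] jl[of j] unfolding st_def en_def by auto

lemma cf_outside: "j \<in> {1..b} \<Longrightarrow> i \<notin> {st j + 1..en j} \<Longrightarrow> cf j i = 0"
  using block_window[of j i] sur_window[of j i] unfolding cf_def by auto

lemma sum_window:
  assumes j: "j \<in> {1..b}"
  shows "(\<Sum>i=1..n. cf j i * x i) = (\<Sum>i=st j + 1..en j. cf j i * x i)"
    and "(\<Sum>i=1..n. cf j i * x i) = (\<Sum>i=1..en j - st j. cf j (st j + i) * x (st j + i))"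
proof -
  show 1: "(\<Sum>i=1..n. cf j i * x i) = (\<Sum>i=st j + 1..en j. cf j i * x i)"
    by (rule sum.mono_neutral_right) (use en_le[of j] cf_outside[OF j] in auto)
  have "st j + (en j - st j) = en j" using st_le_en[OF j] by simp
  then show "(\<Sum>i=1..n. cf j i * x i) = (\<Sum>i=1..en j - st j. cf j (st j + i) * x (st j + i))"
    unfolding 1 using sum_shift_interval[of "\<lambda>i. cf j i * x i" "st j" "en j - st j"] by simp
qed

lemma diff_le_oscW:
  assumes "i \<in> {st j + 1..en j}" "k \<in> {st j + 1..en j}" shows "\<bar>x i - x k\<bar> \<le> oscW x j"
proof -
  have *: "\<bar>x k - x i\<bar> \<le> oscW x j" if "i \<in> {st j + 1..en j}" "k \<in> {st j + 1..en j}" "i \<le> k" for i k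
  proof -
    have "\<bar>x k - x i\<bar> \<le> (\<Sum>t=i..<k. \<bar>x (Suc t) - x t\<bar>)" by (rule grid_variation_diff_le[OF that(3)])
    also have "\<dots> \<le> oscW x j" unfolding oscW_def using that by (intro sum_mono2) auto
    finally show ?thesis .
  qed
  show ?thesis using *[of i k] *[of k i] assms by (cases "i \<le> k") (auto simp: abs_minus_commute)
qed

lemma oscW_nonneg: "oscW x j \<ge> 0"
  unfolding oscW_def by (intro sum_nonneg) auto

text \<open>Windows overlap, but two windows containing a common increment belong to blocks at most
  \<open>2 * c0 + 1\<close> apart. So the total variation is counted at most
  \<open>2 * c0 + 2\<close> times.\<close>

lemma sum_oscW_le:
  assumes V': "(\<Sum>i=1..<n. \<bar>x (Suc i) - x i\<bar>) \<le> V"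
  shows "(\<Sum>j=1..b. oscW x j) \<le> (2 * c0 + 2) * V"
proof -
  let ?g = "\<lambda>t. \<bar>x (Suc t) - x t\<bar>"
  define R where "R t = {j \<in> {1..b}. t \<in> {st j + 1..<en j}}" for t
  have R: "real (card (R t)) \<le> 2 * c0 + 2" for t
  proof -
    have "real (card (R t)) \<le> (2 * c0 + 1) + 1"
    proof (rule card_le_diameter)
      fix i j assume ij: "i \<in> R t" "j \<in> R t" "i < j"
      have "(j - 1) * l < t + m" "t < i * l + m" using ij unfolding R_def st_def en_def by auto
      then have "(j - 1) * l < i * l + 2 * m" by linarith
      then have "real ((j - 1) * l) < real (i * l + 2 * m)" by (simp only: of_nat_less_iff)
      then have "(real j - 1) * real l < (real i + 2 * c0) * real l"
        using ij m by (simp add: of_nat_diff algebra_simps)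
      then have "real j - 1 < real i + 2 * c0" using l by (simp add: mult_less_cancel_right)
      then show "real j - real i \<le> 2 * c0 + 1" by linarith
    qed (use c0 in \<open>auto simp: R_def\<close>)
    then show ?thesis by simp
  qed
  have "(\<Sum>j=1..b. oscW x j) = (\<Sum>j=1..b. \<Sum>t=1..<n. if t \<in> {st j + 1..<en j} then ?g t else 0)"
  proof (rule sum.cong[OF refl])
    fix j assume "j \<in> {1..b}"
    have "oscW x j = (\<Sum>t\<in>{1..<n} \<inter> {st j + 1..<en j}. ?g t)"
      unfolding oscW_def using en_le[of j] by (intro sum.cong) auto
    then show "oscW x j = (\<Sum>t=1..<n. if t \<in> {st j + 1..<en j} then ?g t else 0)"
      by (simp only: sum.inter_restrict[OF finite_atLeastLessThan])
  qed
  also have "\<dots> = (\<Sum>t=1..<n. \<Sum>j=1..b. if t \<in> {st j + 1..<en j} then ?g t else 0)" by (rule sum.swap)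
  also have "\<dots> = (\<Sum>t=1..<n. real (card (R t)) * ?g t)"
  proof (rule sum.cong[OF refl])
    fix t
    have "(\<Sum>j=1..b. if t \<in> {st j + 1..<en j} then ?g t else 0) = (\<Sum>j\<in>R t. ?g t)"
      unfolding R_def by (rule sum.inter_filter[symmetric]) simp
    then show "(\<Sum>j=1..b. if t \<in> {st j + 1..<en j} then ?g t else 0) = real (card (R t)) * ?g t" by simp
  qed
  also have "\<dots> \<le> (\<Sum>t=1..<n. (2 * c0 + 2) * ?g t)" by (intro sum_mono mult_right_mono R) auto
  also have "\<dots> = (2 * c0 + 2) * (\<Sum>t=1..<n. ?g t)" by (simp only: sum_distrib_left)
  also have "\<dots> \<le> (2 * c0 + 2) * V" using V' c0 by (intro mult_left_mono) auto
  finally show ?thesis .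
qed

lemma mean_part_const:
  assumes j: "j \<in> {1..b}" and "\<And>i. i \<in> {1..n} \<Longrightarrow> mu i = c"
  shows "(\<Sum>i=1..n. cf j i * mu i) = 0"
proof -
  have "(\<Sum>i=1..n. cf j i * mu i) = (\<Sum>i=1..n. cf j i * c)" using assms(2) by (intro sum.cong) auto
  also have "\<dots> = real l * c - wt j * (real (card (sur j)) * c)"
    unfolding sum_cf[OF j] using j by (simp add: card_block)
  also have "\<dots> = (real l - wt j * real (card (sur j))) * c" by (simp add: algebra_simps)
  finally show ?thesis using wt(3)[OF j] by simp
qed

text \<open>As constants are annihilated, the mean may be centred at its first value in the window;
  block and surroundings each carry total weight \<open>l\<close>.\<close>

lemma mean_part_le:
  assumes j: "j \<in> {1..b}"
  shows "\<bar>\<Sum>i=1..n. cf j i * mu i\<bar> \<le> 2 * real l * oscW mu j"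
proof -
  define c where "c = mu (st j + 1)"
  have o: "\<bar>mu i - c\<bar> \<le> oscW mu j" if "i \<in> {st j + 1..en j}" for i
    unfolding c_def using st_le_en[OF j] l that by (intro diff_le_oscW) auto
  have z: "(\<Sum>i=1..n. cf j i * c) = 0"
    unfolding sum_cf[OF j] using j wt(3)[OF j] by (simp add: card_block mult.assoc[symmetric])
  have "(\<Sum>i=1..n. cf j i * mu i) = (\<Sum>i=1..n. cf j i * (mu i - c))"
    using z by (simp add: right_diff_distrib sum_subtractf)
  also have "\<dots> = (\<Sum>i\<in>block l j. mu i - c) - wt j * (\<Sum>i\<in>sur j. mu i - c)" by (rule sum_cf[OF j])
  also have "\<bar>\<dots>\<bar> \<le> (\<Sum>i\<in>block l j. oscW mu j) + wt j * (\<Sum>i\<in>sur j. oscW mu j)"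
  proof -
    have "\<bar>\<Sum>i\<in>block l j. mu i - c\<bar> \<le> (\<Sum>i\<in>block l j. oscW mu j)"
      using o block_window[OF j] by (intro order_trans[OF sum_abs] sum_mono) auto
    moreover have "\<bar>wt j * (\<Sum>i\<in>sur j. mu i - c)\<bar> \<le> wt j * (\<Sum>i\<in>sur j. oscW mu j)"
      unfolding abs_mult using o sur_window[OF j] wt(1)[OF j] by (intro mult_mono order_trans[OF sum_abs] sum_mono) auto
    ultimately show ?thesis by linarith
  qed
  also have "\<dots> = real l * oscW mu j + (wt j * real (card (sur j))) * oscW mu j" using j by (simp add: card_block mult.assoc)
  also have "\<dots> = 2 * real l * oscW mu j" unfolding wt(3)[OF j] by simp
  finally show ?thesis .
qed

text \<open>A window has at most \<open>(1 + 2 * c0) * l\<close> points and coefficients of modulus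
  at most \<open>V\<close>; after normalisation by \<open>l\<close> the second moments are bounded
  by a constant free of \<open>n\<close>.\<close>

definition C2 :: real where "C2 = V\<^sup>2 * (1 + 2 * c0) * (2 * S2)"

lemma C2_nonneg: "C2 \<ge> 0"
  unfolding C2_def using S2_nonneg c0 by simp

definition Zs :: "nat \<Rightarrow> 'a \<Rightarrow> real" where "Zs j \<omega> = \<bar>T j \<omega>\<bar> / sqrt (real l)"

lemma coef_le: "j \<in> {1..b} \<Longrightarrow> i \<le> n \<Longrightarrow> \<bar>cf j i * sg i\<bar> \<le> V"
  using mult_mono[of "\<bar>cf j i\<bar>" 1 "\<bar>sg i\<bar>" V] cf_abs[of j i] sg_bounds(2)[of i] by (simp add: abs_mult)

lemma T_window: "j \<in> {1..b} \<Longrightarrow> T j \<omega> = (\<Sum>i=1..en j - st j. cf j (st j + i) * sg (st j + i) * Y (st j + i) \<omega>)"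
  unfolding T_def sum_window(2) z_def by (simp add: mult.assoc)

lemma Zs_square:
  assumes j: "j \<in> {1..b}"
  shows "integrable M (\<lambda>\<omega>. (Zs j \<omega>)\<^sup>2)" "expectation (\<lambda>\<omega>. (Zs j \<omega>)\<^sup>2) \<le> C2"
proof -
  have w: "\<bar>cf j (st j + i) * sg (st j + i)\<bar> \<le> V" if "i \<in> {1..en j - st j}" for i
    using coef_le[OF j, of "st j + i"] that en_le[of j] by auto
  note q = weighted_square[of "en j - st j" "\<lambda>i. cf j (st j + i) * sg (st j + i)" V "st j", OF w]
  have e: "(Zs j \<omega>)\<^sup>2 = (T j \<omega>)\<^sup>2 / real l" for \<omega> unfolding Zs_def by (simp add: power_divide)
  show "integrable M (\<lambda>\<omega>. (Zs j \<omega>)\<^sup>2)" unfolding e T_window[OF j] using q(1) by simp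
  have "expectation (\<lambda>\<omega>. (Zs j \<omega>)\<^sup>2) \<le> V\<^sup>2 * real (en j - st j) * (2 * S2) / real l"
    unfolding e T_window[OF j] using q(2) by (simp add: divide_right_mono)
  also have "\<dots> \<le> V\<^sup>2 * (real l + 2 * real m) * (2 * S2) / real l"
    using window_length[OF j] S2_nonneg by (intro divide_right_mono mult_right_mono mult_left_mono) auto
  also have "\<dots> = C2" unfolding C2_def m using l by (simp add: field_simps)
  finally show "expectation (\<lambda>\<omega>. (Zs j \<omega>)\<^sup>2) \<le> C2" .
qed

lemma T_gen:
  assumes j: "j \<in> {1..b}" and I: "{st j + 1..en j} \<subseteq> I"
  shows "T j \<in> borel_measurable (gen I)"
  unfolding T_def[abs_def] sum_window(1)[OF j] z_def
  by (intro borel_measurable_sum borel_measurable_times borel_measurable_const Y_gen) (use I in auto)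

lemma Zs_gen: "j \<in> {1..b} \<Longrightarrow> {st j + 1..en j} \<subseteq> I \<Longrightarrow> Zs j \<in> borel_measurable (gen I)"
  unfolding Zs_def[abs_def] using T_gen[of j I] by measurable

lemma Zs_measurable [measurable]: "j \<in> {1..b} \<Longrightarrow> Zs j \<in> borel_measurable M"
  by (rule gen_measurable[OF _ Zs_gen[of j "{1..}"]]) auto

lemma Zs_nonneg: "Zs j \<omega> \<ge> 0"
  unfolding Zs_def by simp

lemma Zs_mean:
  assumes j: "j \<in> {1..b}"
  shows "integrable M (Zs j)" "0 \<le> expectation (Zs j)" "expectation (Zs j) \<le> sqrt C2"
proof -
  have a: "\<bar>Zs j \<omega>\<bar> = Zs j \<omega>" for \<omega> using Zs_nonneg by simp
  note e = expectation_abs_le_sqrt[OF Zs_measurable[OF j] Zs_square(1)[OF j], unfolded a]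
  show "integrable M (Zs j)" using e(1) .
  show "0 \<le> expectation (Zs j)" using Zs_nonneg by simp
  show "expectation (Zs j) \<le> sqrt C2" using order_trans[OF e(2) real_sqrt_le_mono[OF Zs_square(2)[OF j]]] .
qed

text \<open>A window reaches \<open>m\<close> indices beyond its block, so blocks at distance
  \<open>2 * c0 + 2\<close> leave a gap of at least \<open>l\<close>. The exponent 6 is a convenient
  value below \<open>\<theta>\<close>: with clipping level \<open>l\<close> the bound is still of
  order \<open>l powr -4\<close>.\<close>

lemma covariance_far:
  assumes i: "i \<in> {1..b}" and j: "j \<in> {1..b}" and far: "real i + 2 * c0 + 2 \<le> real j" and B: "B > 0"
  shows "\<bar>expectation (\<lambda>\<omega>. min (Zs i \<omega>) B * min (Zs j \<omega>) B) - expectation (\<lambda>\<omega>. min (Zs i \<omega>) B) * expectation (\<lambda>\<omega>. min (Zs j \<omega>) B)\<bar>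
    \<le> 4 * B\<^sup>2 * C * real l powr - 6"
proof -
  have ge: "i * l + m + l \<le> st j"
  proof -
    have "(real i + 2 * c0 + 1) * real l \<le> (real j - 1) * real l" using far by (intro mult_right_mono) auto
    then have "real (i * l + 2 * m + l) \<le> real ((j - 1) * l)" using m j by (simp add: of_nat_diff algebra_simps)
    then have "i * l + 2 * m + l \<le> (j - 1) * l" by (simp only: of_nat_le_iff)
    then show ?thesis unfolding st_def by linarith
  qed
  have m1: "i * l + m \<ge> 1" using l_le_m l by linarith
  have "en i \<le> i * l + m" by (simp add: en_def)
  then have U: "Zs i \<in> borel_measurable (gen {1..i * l + m})" by (intro Zs_gen[OF i]) auto
  have W: "Zs j \<in> borel_measurable (gen {i * l + m + l..})" using ge by (intro Zs_gen[OF j]) auto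
  have b: "\<bar>min (Zs k \<omega>) B\<bar> \<le> B" for k \<omega> using Zs_nonneg[of k \<omega>] B by (auto simp: min_def)
  have "\<bar>expectation (\<lambda>\<omega>. min (Zs i \<omega>) B * min (Zs j \<omega>) B) - expectation (\<lambda>\<omega>. min (Zs i \<omega>) B) * expectation (\<lambda>\<omega>. min (Zs j \<omega>) B)\<bar>
    \<le> 4 * B * B * (C * real l powr (- \<theta>))"
    by (rule cov_gap_bounded[OF _ _ m1 l b b B B]) (use U W in measurable)
  also have "\<dots> \<le> 4 * B * B * (C * real l powr - 6)"
    using B C_ge_1 \<theta>_gt_6 l by (intro mult_left_mono powr_mono) auto
  finally show ?thesis by (simp add: power2_eq_square mult.assoc)
qed

text \<open>Only second moments of the normalised contrasts are bounded, and Davydov's inequality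
  with \<open>p = r = 2\<close> gives no decay, so the contrasts are clipped at \<open>B\<close>.
  After clipping, distant blocks are nearly uncorrelated and each block has boundedly many near
  ones, whence a variance of order \<open>1 / b\<close>. The excess over \<open>B\<close> is at most
  the square divided by \<open>B\<close>.\<close>

lemma fluctuation:
  assumes B: "B > 0"
  shows "integrable M (\<lambda>\<omega>. \<bar>1 / real b * (\<Sum>j=1..b. Zs j \<omega> - expectation (Zs j))\<bar>)"
    and "expectation (\<lambda>\<omega>. \<bar>1 / real b * (\<Sum>j=1..b. Zs j \<omega> - expectation (Zs j))\<bar>)
      \<le> 2 * C2 / B + sqrt ((4 * c0 + 5) * (2 * C2) / real b + 4 * B\<^sup>2 * C * real l powr - 6)"
proof -
  define U where "U j \<omega> = min (Zs j \<omega>) B" for j \<omega>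
  have Um [measurable]: "U j \<in> borel_measurable M" if "j \<in> {1..b}" for j
    unfolding U_def[abs_def] using Zs_measurable[OF that] by measurable
  have U0: "0 \<le> U j \<omega>" "U j \<omega> \<le> B" "U j \<omega> \<le> Zs j \<omega>" for j \<omega> using Zs_nonneg[of j \<omega>] B by (auto simp: U_def)
  have iU: "integrable M (U j)" if "j \<in> {1..b}" for j
    by (rule integrable_dominated[where g="\<lambda>_. B"]) (use U0 Um[OF that] in auto)
  have iUU: "integrable M (\<lambda>\<omega>. U i \<omega> * U j \<omega>)" if "i \<in> {1..b}" "j \<in> {1..b}" for i j
  proof (rule integrable_dominated[where g="\<lambda>_. B * B"])
    show "\<bar>U i \<omega> * U j \<omega>\<bar> \<le> B * B" for \<omega> unfolding abs_mult using U0 B by (intro mult_mono) auto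
  qed (use Um[OF that(1)] Um[OF that(2)] in auto)
  define cv where "cv i j = expectation (\<lambda>\<omega>. U i \<omega> * U j \<omega>) - expectation (U i) * expectation (U j)" for i j
  have U2: "expectation (U j) \<le> sqrt C2" "0 \<le> expectation (U j)" if "j \<in> {1..b}" for j
  proof -
    have "expectation (U j) \<le> expectation (Zs j)" using iU[OF that] Zs_mean(1)[OF that] U0 by (intro integral_mono) auto
    then show "expectation (U j) \<le> sqrt C2" using Zs_mean(3)[OF that] by linarith
    show "0 \<le> expectation (U j)" using U0 by simp
  qed
  \<comment> \<open>Near blocks get only the trivial bound from second moments, which does not
    involve \<open>B\<close>.\<close>
  have near: "\<bar>cv i j\<bar> \<le> 2 * C2" if ij: "i \<in> {1..b}" "j \<in> {1..b}" for i j
  proof -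
    have "0 \<le> expectation (\<lambda>\<omega>. U i \<omega> * U j \<omega>)" using U0 by simp
    moreover have "expectation (\<lambda>\<omega>. U i \<omega> * U j \<omega>) \<le> expectation (\<lambda>\<omega>. ((Zs i \<omega>)\<^sup>2 + (Zs j \<omega>)\<^sup>2) / 2)"
    proof (rule integral_mono)
      show "U i \<omega> * U j \<omega> \<le> ((Zs i \<omega>)\<^sup>2 + (Zs j \<omega>)\<^sup>2) / 2" for \<omega>
      proof -
        have "U i \<omega> * U j \<omega> \<le> Zs i \<omega> * Zs j \<omega>" using U0 Zs_nonneg by (intro mult_mono) auto
        moreover have "0 \<le> (Zs i \<omega> - Zs j \<omega>)\<^sup>2" by simp
        then have "Zs i \<omega> * Zs j \<omega> \<le> ((Zs i \<omega>)\<^sup>2 + (Zs j \<omega>)\<^sup>2) / 2" by (simp add: power2_diff)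
        ultimately show ?thesis by (rule order_trans)
      qed
    qed (use iUU[OF ij] Zs_square(1)[OF ij(1)] Zs_square(1)[OF ij(2)] in auto)
    moreover have "expectation (\<lambda>\<omega>. ((Zs i \<omega>)\<^sup>2 + (Zs j \<omega>)\<^sup>2) / 2) \<le> C2"
      using Zs_square[OF ij(1)] Zs_square[OF ij(2)] by simp
    moreover have "expectation (U i) * expectation (U j) \<le> sqrt C2 * sqrt C2"
      using U2[OF ij(1)] U2[OF ij(2)] C2_nonneg by (intro mult_mono) auto
    moreover have "0 \<le> expectation (U i) * expectation (U j)" using U2[OF ij(1)] U2[OF ij(2)] by simp
    ultimately show ?thesis unfolding cv_def abs_le_iff using C2_nonneg by simp
  qed
  define q where "q = 4 * B\<^sup>2 * C * real l powr - 6"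
  have q0: "q \<ge> 0" unfolding q_def using C_ge_1 by simp
  have cv: "\<bar>cv i j\<bar> \<le> (if \<bar>real i - real j\<bar> < 2 * c0 + 2 then 2 * C2 else 0) + q" if ij: "i \<in> {1..b}" "j \<in> {1..b}" for i j
  proof (cases "\<bar>real i - real j\<bar> < 2 * c0 + 2")
    case True then show ?thesis using near[OF ij] q0 by simp
  next
    case False
    then consider "real i + 2 * c0 + 2 \<le> real j" | "real j + 2 * c0 + 2 \<le> real i" by linarith
    then have "\<bar>cv i j\<bar> \<le> q"
    proof cases
      case 1
      show ?thesis unfolding cv_def U_def[abs_def] q_def by (rule covariance_far[OF ij 1 B])
    next
      case 2
      have "cv i j = cv j i" unfolding cv_def by (simp only: mult.commute)
      show ?thesis unfolding \<open>cv i j = cv j i\<close> unfolding cv_def U_def[abs_def] q_def by (rule covariance_far[OF ij(2,1) 2 B])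
    qed
    then show ?thesis using False by simp
  qed
  define G where "G \<omega> = (\<Sum>j=1..b. U j \<omega> - expectation (U j))" for \<omega>
  have Gsq: "(G \<omega>)\<^sup>2 = (\<Sum>i=1..b. \<Sum>j=1..b. (U i \<omega> - expectation (U i)) * (U j \<omega> - expectation (U j)))" for \<omega>
    unfolding G_def power2_eq_square sum_product ..
  have iD: "integrable M (\<lambda>\<omega>. (U i \<omega> - expectation (U i)) * (U j \<omega> - expectation (U j)))"
    and eD: "expectation (\<lambda>\<omega>. (U i \<omega> - expectation (U i)) * (U j \<omega> - expectation (U j))) = cv i j" if ij: "i \<in> {1..b}" "j \<in> {1..b}" for i j
  proof -
    have e: "(U i \<omega> - expectation (U i)) * (U j \<omega> - expectation (U j))
      = U i \<omega> * U j \<omega> - expectation (U i) * U j \<omega> - expectation (U j) * U i \<omega> + expectation (U i) * expectation (U j)" for \<omega>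
      by (simp add: algebra_simps)
    show "integrable M (\<lambda>\<omega>. (U i \<omega> - expectation (U i)) * (U j \<omega> - expectation (U j)))"
      unfolding e using iUU[OF ij] iU[OF ij(1)] iU[OF ij(2)] by simp
    show "expectation (\<lambda>\<omega>. (U i \<omega> - expectation (U i)) * (U j \<omega> - expectation (U j))) = cv i j"
      unfolding e cv_def using iUU[OF ij] iU[OF ij(1)] iU[OF ij(2)] by (simp add: prob_space)
  qed
  have iG2: "integrable M (\<lambda>\<omega>. (G \<omega>)\<^sup>2)" unfolding Gsq using iD by (intro Bochner_Integration.integrable_sum) auto
  have "expectation (\<lambda>\<omega>. (G \<omega>)\<^sup>2) = (\<Sum>i=1..b. expectation (\<lambda>\<omega>. \<Sum>j=1..b. (U i \<omega> - expectation (U i)) * (U j \<omega> - expectation (U j))))"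
    unfolding Gsq using iD by (intro Bochner_Integration.integral_sum Bochner_Integration.integrable_sum) auto
  also have "\<dots> = (\<Sum>i=1..b. \<Sum>j=1..b. cv i j)"
  proof (rule sum.cong[OF refl])
    fix i assume i: "i \<in> {1..b}"
    have "expectation (\<lambda>\<omega>. \<Sum>j=1..b. (U i \<omega> - expectation (U i)) * (U j \<omega> - expectation (U j)))
      = (\<Sum>j=1..b. expectation (\<lambda>\<omega>. (U i \<omega> - expectation (U i)) * (U j \<omega> - expectation (U j))))"
      using iD i by (intro Bochner_Integration.integral_sum) auto
    also have "\<dots> = (\<Sum>j=1..b. cv i j)" using eD i by (intro sum.cong refl) auto
    finally show "expectation (\<lambda>\<omega>. \<Sum>j=1..b. (U i \<omega> - expectation (U i)) * (U j \<omega> - expectation (U j))) = (\<Sum>j=1..b. cv i j)" .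
  qed
  also have "\<dots> \<le> (\<Sum>i=1..b. \<Sum>j=1..b. (if \<bar>real i - real j\<bar> < 2 * c0 + 2 then 2 * C2 else 0) + q)"
    using cv by (intro sum_mono) (meson abs_le_D1)
  also have "\<dots> \<le> (\<Sum>i=1..b. (4 * c0 + 5) * (2 * C2) + real b * q)"
  proof (rule sum_mono)
    fix i
    \<comment> \<open>The near indices have diameter below \<open>4 * c0 + 4\<close>, which gives
      the count \<open>4 * c0 + 5\<close>.\<close>
    define R where "R = {j \<in> {1..b}. \<bar>real i - real j\<bar> < 2 * c0 + 2}"
    have "real (card R) \<le> (4 * c0 + 4) + 1"
      by (rule card_le_diameter) (use c0 in \<open>auto simp: R_def\<close>)
    then have R: "real (card R) \<le> 4 * c0 + 5" by simp
    have "(\<Sum>j=1..b. if \<bar>real i - real j\<bar> < 2 * c0 + 2 then 2 * C2 else 0) = (\<Sum>j\<in>R. 2 * C2)"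
      unfolding R_def by (rule sum.inter_filter[symmetric]) simp
    also have "\<dots> \<le> (4 * c0 + 5) * (2 * C2)" using R C2_nonneg by (simp add: mult_right_mono)
    finally show "(\<Sum>j=1..b. (if \<bar>real i - real j\<bar> < 2 * c0 + 2 then 2 * C2 else 0) + q) \<le> (4 * c0 + 5) * (2 * C2) + real b * q"
      by (simp add: sum.distrib)
  qed
  finally have EG2: "expectation (\<lambda>\<omega>. (G \<omega>)\<^sup>2) \<le> real b * ((4 * c0 + 5) * (2 * C2) + real b * q)" by simp
  have Gm: "G \<in> borel_measurable M"
    unfolding G_def[abs_def] using Um by (intro borel_measurable_sum borel_measurable_diff) auto
  note eG = expectation_abs_le_sqrt[OF Gm iG2]
  have EG: "1 / real b * expectation (\<lambda>\<omega>. \<bar>G \<omega>\<bar>) \<le> sqrt ((4 * c0 + 5) * (2 * C2) / real b + q)"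
  proof -
    have "1 / real b * expectation (\<lambda>\<omega>. \<bar>G \<omega>\<bar>) \<le> 1 / real b * sqrt (real b * ((4 * c0 + 5) * (2 * C2) + real b * q))"
      using order_trans[OF eG(2) real_sqrt_le_mono[OF EG2]] by (intro mult_left_mono) auto
    also have "\<dots> = sqrt ((1 / real b)\<^sup>2 * (real b * ((4 * c0 + 5) * (2 * C2) + real b * q)))"
      by (simp add: real_sqrt_mult)
    also have "(1 / real b)\<^sup>2 * (real b * ((4 * c0 + 5) * (2 * C2) + real b * q)) = (4 * c0 + 5) * (2 * C2) / real b + q"
      using b by (simp add: field_simps power2_eq_square)
    finally show ?thesis .
  qed
  \<comment> \<open>The excess of \<open>Zs j\<close> over the clipped value and the mean of this
    excess, each estimated by the square over \<open>B\<close>.\<close>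
  define d where "d j \<omega> = (Zs j \<omega>)\<^sup>2 / B + C2 / B" for j \<omega>
  have pw: "\<bar>(Zs j \<omega> - expectation (Zs j)) - (U j \<omega> - expectation (U j))\<bar> \<le> d j \<omega>" if j: "j \<in> {1..b}" for j \<omega>
  proof -
    have zu: "0 \<le> Zs j \<omega> - U j \<omega>" "Zs j \<omega> - U j \<omega> \<le> (Zs j \<omega>)\<^sup>2 / B" for \<omega>
    proof -
      show "0 \<le> Zs j \<omega> - U j \<omega>" using U0 by simp
      show "Zs j \<omega> - U j \<omega> \<le> (Zs j \<omega>)\<^sup>2 / B"
      proof (cases "Zs j \<omega> \<le> B")
        case True then show ?thesis using B by (simp add: U_def)
      next
        case False
        then have "Zs j \<omega> * B \<le> Zs j \<omega> * Zs j \<omega>" using Zs_nonneg by (intro mult_left_mono) auto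
        then have "Zs j \<omega> \<le> (Zs j \<omega>)\<^sup>2 / B" using B by (simp add: pos_le_divide_eq power2_eq_square)
        then show ?thesis using U0[of j \<omega>] by linarith
      qed
    qed
    have "expectation (Zs j) - expectation (U j) = expectation (\<lambda>\<omega>. Zs j \<omega> - U j \<omega>)"
      using iU[OF j] Zs_mean(1)[OF j] by simp
    moreover have "0 \<le> expectation (\<lambda>\<omega>. Zs j \<omega> - U j \<omega>)" using zu by simp
    moreover have "expectation (\<lambda>\<omega>. Zs j \<omega> - U j \<omega>) \<le> expectation (\<lambda>\<omega>. (Zs j \<omega>)\<^sup>2 / B)"
      using iU[OF j] Zs_mean(1)[OF j] Zs_square(1)[OF j] zu by (intro integral_mono) auto
    moreover have "expectation (\<lambda>\<omega>. (Zs j \<omega>)\<^sup>2 / B) \<le> C2 / B"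
      using Zs_square(2)[OF j] B by (simp add: divide_right_mono)
    ultimately show ?thesis using zu[of \<omega>] unfolding d_def abs_le_iff by linarith
  qed
  have iBd: "integrable M (\<lambda>\<omega>. 1 / real b * \<bar>G \<omega>\<bar> + 1 / real b * (\<Sum>j=1..b. d j \<omega>))"
    unfolding d_def using eG(1) Zs_square(1)
    by (intro Bochner_Integration.integrable_add integrable_mult_right Bochner_Integration.integrable_sum integrable_divide) auto
  have pt: "\<bar>1 / real b * (\<Sum>j=1..b. Zs j \<omega> - expectation (Zs j))\<bar> \<le> 1 / real b * \<bar>G \<omega>\<bar> + 1 / real b * (\<Sum>j=1..b. d j \<omega>)" for \<omega>
  proof -
    have "\<bar>(\<Sum>j=1..b. Zs j \<omega> - expectation (Zs j)) - G \<omega>\<bar> \<le> (\<Sum>j=1..b. d j \<omega>)"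
      unfolding G_def sum_subtractf[symmetric] using pw by (intro order_trans[OF sum_abs] sum_mono) (simp add: sum_subtractf)
    then have "\<bar>\<Sum>j=1..b. Zs j \<omega> - expectation (Zs j)\<bar> \<le> \<bar>G \<omega>\<bar> + (\<Sum>j=1..b. d j \<omega>)" by linarith
    then have "1 / real b * \<bar>\<Sum>j=1..b. Zs j \<omega> - expectation (Zs j)\<bar> \<le> 1 / real b * (\<bar>G \<omega>\<bar> + (\<Sum>j=1..b. d j \<omega>))"
      by (intro mult_left_mono) auto
    then show ?thesis unfolding abs_mult by (simp only: distrib_left) simp
  qed
  show i: "integrable M (\<lambda>\<omega>. \<bar>1 / real b * (\<Sum>j=1..b. Zs j \<omega> - expectation (Zs j))\<bar>)"
  proof (rule integrable_dominated[OF _ iBd])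
    show "(\<lambda>\<omega>. \<bar>1 / real b * (\<Sum>j=1..b. Zs j \<omega> - expectation (Zs j))\<bar>) \<in> borel_measurable M"
      using Zs_measurable by (intro borel_measurable_abs borel_measurable_times borel_measurable_sum borel_measurable_diff) auto
  qed (use pt in auto)
  have "expectation (\<lambda>\<omega>. \<bar>1 / real b * (\<Sum>j=1..b. Zs j \<omega> - expectation (Zs j))\<bar>) \<le> expectation (\<lambda>\<omega>. 1 / real b * \<bar>G \<omega>\<bar> + 1 / real b * (\<Sum>j=1..b. d j \<omega>))"
    by (rule integral_mono[OF i iBd pt])
  also have "\<dots> = 1 / real b * expectation (\<lambda>\<omega>. \<bar>G \<omega>\<bar>) + 1 / real b * expectation (\<lambda>\<omega>. \<Sum>j=1..b. d j \<omega>)"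
    unfolding d_def using eG(1) Zs_square(1)
    by (subst Bochner_Integration.integral_add)
       (auto intro!: Bochner_Integration.integrable_add integrable_mult_right Bochner_Integration.integrable_sum integrable_divide)
  also have "\<dots> \<le> 1 / real b * expectation (\<lambda>\<omega>. \<bar>G \<omega>\<bar>) + 1 / real b * (\<Sum>j=1..b. C2 / B + C2 / B)"
  proof (intro add_left_mono mult_left_mono)
    have "expectation (\<lambda>\<omega>. \<Sum>j=1..b. d j \<omega>) = (\<Sum>j=1..b. expectation (\<lambda>\<omega>. (Zs j \<omega>)\<^sup>2) / B + C2 / B)"
      unfolding d_def using Zs_square(1) by (subst Bochner_Integration.integral_sum) (auto simp: prob_space)
    also have "\<dots> \<le> (\<Sum>j=1..b. C2 / B + C2 / B)"
      using Zs_square(2) B by (intro sum_mono add_right_mono divide_right_mono) auto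
    finally show "expectation (\<lambda>\<omega>. \<Sum>j=1..b. d j \<omega>) \<le> (\<Sum>j=1..b. C2 / B + C2 / B)" .
  qed simp
  also have "1 / real b * (\<Sum>j=1..b. C2 / B + C2 / B) = 2 * C2 / B" using b by (simp add: field_simps)
  finally show "expectation (\<lambda>\<omega>. \<bar>1 / real b * (\<Sum>j=1..b. Zs j \<omega> - expectation (Zs j))\<bar>)
      \<le> 2 * C2 / B + sqrt ((4 * c0 + 5) * (2 * C2) / real b + 4 * B\<^sup>2 * C * real l powr - 6)"
    using EG unfolding q_def by linarith
qed

end

section \<open>The numerator: mean absolute contrasts\<close>

context long_blocks
begin

definition Kc :: real where "Kc = sqrt (2 * c0 / (1 + 2 * c0)) * sqrt (pi / 2)"
definition kX :: "'a \<Rightarrow> real" where "kX \<omega> = kappa_hat_X n c0 l b (observation \<mu> \<sigma> Y n \<omega>)"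

text \<open>The factor in the estimator undoes two constants: \<open>sqrt (2 / pi)\<close> is the
  mean modulus of a standard normal variable, and \<open>(1 + 2 * c0) / (2 * c0)\<close> is the sum
  of squares of the coefficients of an interior contrast, divided by \<open>l\<close>.\<close>

lemma Kc: "0 \<le> Kc" "Kc \<le> 2" "Kc * (sqrt (2 / pi) * sqrt ((1 + 2 * c0) / (2 * c0))) = 1"
proof -
  show "0 \<le> Kc" unfolding Kc_def using c0 by simp
  have "2 * c0 / (1 + 2 * c0) \<le> 1" using c0 by simp
  then have "sqrt (2 * c0 / (1 + 2 * c0)) \<le> 1" by simp
  moreover have "sqrt (pi / 2) \<le> 2" using pi_less_4 by (intro real_le_lsqrt) auto
  ultimately have "Kc \<le> 1 * 2" unfolding Kc_def using c0 by (intro mult_mono) auto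
  then show "Kc \<le> 2" by simp
  have "Kc * (sqrt (2 / pi) * sqrt ((1 + 2 * c0) / (2 * c0))) = sqrt ((2 * c0 / (1 + 2 * c0) * (pi / 2)) * (2 / pi * ((1 + 2 * c0) / (2 * c0))))"
    unfolding Kc_def by (simp only: real_sqrt_mult)
  also have "(2 * c0 / (1 + 2 * c0) * (pi / 2)) * (2 / pi * ((1 + 2 * c0) / (2 * c0))) = 1"
  proof -
    have "x / y * (z / 2) * (2 / z * (y / x)) = 1" if "x \<noteq> 0" "y \<noteq> 0" "z \<noteq> 0" for x y z :: real
      using that by (simp add: field_simps)
    then show ?thesis using c0 by simp
  qed
  finally show "Kc * (sqrt (2 / pi) * sqrt ((1 + 2 * c0) / (2 * c0))) = 1" by simp
qed

lemma cf_interior: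
  assumes j: "j \<in> {1..b}" and int: "interior j" and i: "i \<in> {st j + 1..en j}"
  shows "cf j i = (if (j - 1) * l < i \<and> i \<le> j * l then 1 else - 1 / (2 * c0))"
proof -
  have j1: "j \<ge> 1" using j by simp
  have en: "en j = j * l + m" using int unfolding en_def interior_def by simp
  have ile: "(j - 1) * l - m < i" "i \<le> j * l + m" "i \<le> n" "1 \<le> i" using i en en_le[of j] unfolding st_def by auto
  show ?thesis
  proof (cases "(j - 1) * l < i \<and> i \<le> j * l")
    case True
    then have "i \<in> block l j" by (simp add: block_def)
    moreover from this have "i \<notin> sur j" using block_sur_disjoint[OF j1] by auto
    ultimately show ?thesis using True by (simp add: cf_def)
  next
    case False
    then have nb: "i \<notin> block l j" by (auto simp: block_def)
    have "i \<in> sur j" unfolding sur_iff[OF j1] using False ile by auto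
    then show ?thesis using nb False wt(4)[OF j int] by (auto simp: cf_def)
  qed
qed

lemma diff_mean_le_oscW:
  assumes j: "j \<in> {1..b}" and i: "i \<in> {st j + 1..en j}"
  shows "\<bar>x i - local_mean l x j\<bar> \<le> oscW x j"
proof -
  have "x i - local_mean l x j = 1 / real l * (\<Sum>k\<in>block l j. x i - x k)"
    unfolding local_mean_def using j l by (simp add: sum_subtractf card_block right_diff_distrib)
  also have "\<bar>\<dots>\<bar> \<le> 1 / real l * (\<Sum>k\<in>block l j. oscW x j)"
    unfolding abs_mult using diff_le_oscW[OF i] block_window[OF j] oscW_nonneg
    by (intro mult_mono order_trans[OF sum_abs] sum_mono) (auto intro: sum_nonneg)
  also have "\<dots> = oscW x j" using j l by (simp add: card_block)
  finally show ?thesis .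
qed

text \<open>The window estimate yields the Euclidean norm of the weights \<open>cf j * sg\<close>.
  Comparing it with the norm of \<open>cf j\<close> times the block mean of \<open>\<sigma>\<close>
  costs the oscillation on the window, by the triangle inequality, so jumps of
  \<open>\<sigma>\<close> need no separate treatment.\<close>

lemma interior_abs_moment:
  assumes j: "j \<in> {1..b}" and int: "interior j"
    and wa: "window_approx (l + 2 * m) (\<sigma>0 / (2 * c0)) V (5 * V) e"
  shows "\<bar>expectation (Zs j) - sqrt (2 / pi) * sqrt lrv * (local_mean l sg j * sqrt ((1 + 2 * c0) / (2 * c0)))\<bar>
    \<le> sqrt (1 + 2 * c0) * (e + sqrt lrv * oscW sg j)"
proof -
  define N where "N = l + 2 * m"
  define s where "s = st j"
  define a where "a i = cf j (s + i) * sg (s + i)" for i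
  have en: "en j = s + N" using interior_window[OF j int] by (simp add: s_def N_def)
  have win: "s + i \<in> {st j + 1..en j}" "s + i \<le> n" if "i \<in> {1..N}" for i
    using that en en_le[of j] by (auto simp: s_def)
  have lN: "real N = (1 + 2 * c0) * real l" unfolding N_def using m by (simp add: algebra_simps)
  have T: "T j \<omega> = (\<Sum>i=1..N. a i * Y (s + i) \<omega>)" for \<omega>
    unfolding T_window[OF j] a_def s_def[symmetric] en by simp
  \<comment> \<open>The coefficient is 1 on the block and \<open>- 1 / (2 * c0)\<close> around it;
    both have modulus at least \<open>1 / (2 * c0)\<close>, whence the lower bound
    \<open>\<sigma>0 / (2 * c0)\<close> for the weights.\<close>
  have cfa: "\<bar>cf j (s + i)\<bar> \<ge> 1 / (2 * c0)" if "i \<in> {1..N}" for i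
    unfolding cf_interior[OF j int win(1)[OF that]] using c0 by simp
  have a1: "\<forall>i\<in>{1..N}. \<sigma>0 / (2 * c0) \<le> \<bar>a i\<bar> \<and> \<bar>a i\<bar> \<le> V"
  proof
    fix i assume i: "i \<in> {1..N}"
    have "1 / (2 * c0) * \<sigma>0 \<le> \<bar>cf j (s + i)\<bar> * \<bar>sg (s + i)\<bar>"
      using cfa[OF i] sg_bounds(1)[OF win(2)[OF i]] \<sigma>0 c0 by (intro mult_mono) auto
    then have "\<sigma>0 / (2 * c0) \<le> \<bar>a i\<bar>" by (simp add: a_def abs_mult)
    then show "\<sigma>0 / (2 * c0) \<le> \<bar>a i\<bar> \<and> \<bar>a i\<bar> \<le> V" using coef_le[OF j win(2)[OF i]] by (simp add: a_def)
  qed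
  \<comment> \<open>\<open>V\<close> from the variation of \<open>\<sigma>\<close>, and
    \<open>2 * V\<close> at each of the two block ends, where the coefficient jumps by at most
    2.\<close>
  have a2: "(\<Sum>i=1..<N. \<bar>a (Suc i) - a i\<bar>) \<le> 5 * V"
  proof -
    define e1 where "e1 i = (if i = (j - 1) * l - s then 2 * V else 0)" for i :: nat
    define e2 where "e2 i = (if i = j * l - s then 2 * V else 0)" for i :: nat
    have each: "\<bar>a (Suc i) - a i\<bar> \<le> \<bar>sg (Suc (s + i)) - sg (s + i)\<bar> + (e1 i + e2 i)" if i: "i \<in> {1..<N}" for i
    proof -
      have i': "i \<in> {1..N}" "Suc i \<in> {1..N}" using i by auto
      have d: "\<bar>cf j (s + Suc i) - cf j (s + i)\<bar> * V \<le> e1 i + e2 i"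
      proof (cases "s + i = (j - 1) * l \<or> s + i = j * l")
        case True
        have "\<bar>cf j (s + Suc i) - cf j (s + i)\<bar> \<le> 2" using cf_abs[OF j, of "s + Suc i"] cf_abs[OF j, of "s + i"] by linarith
        then have "\<bar>cf j (s + Suc i) - cf j (s + i)\<bar> * V \<le> 2 * V" using V by (intro mult_right_mono) auto
        moreover have "2 * V \<le> e1 i + e2 i" using True V by (auto simp: e1_def e2_def)
        ultimately show ?thesis by linarith
      next
        case False
        then have "((j - 1) * l < s + Suc i \<and> s + Suc i \<le> j * l) \<longleftrightarrow> ((j - 1) * l < s + i \<and> s + i \<le> j * l)" by auto
        then have "cf j (s + Suc i) = cf j (s + i)"
          unfolding cf_interior[OF j int win(1)[OF i'(1)]] cf_interior[OF j int win(1)[OF i'(2)]] by simp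
        then show ?thesis using V by (simp add: e1_def e2_def)
      qed
      have "a (Suc i) - a i = cf j (s + Suc i) * (sg (Suc (s + i)) - sg (s + i)) + (cf j (s + Suc i) - cf j (s + i)) * sg (s + i)"
        by (simp add: a_def algebra_simps)
      also have "\<bar>\<dots>\<bar> \<le> \<bar>cf j (s + Suc i)\<bar> * \<bar>sg (Suc (s + i)) - sg (s + i)\<bar> + \<bar>cf j (s + Suc i) - cf j (s + i)\<bar> * \<bar>sg (s + i)\<bar>"
        unfolding abs_mult[symmetric] by (rule abs_triangle_ineq)
      also have "\<dots> \<le> 1 * \<bar>sg (Suc (s + i)) - sg (s + i)\<bar> + \<bar>cf j (s + Suc i) - cf j (s + i)\<bar> * V"
        using cf_abs[OF j] sg_bounds(2)[OF win(2)[OF i'(1)]] by (intro add_mono mult_right_mono mult_left_mono) auto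
      finally have le: "\<bar>a (Suc i) - a i\<bar> \<le> 1 * \<bar>sg (Suc (s + i)) - sg (s + i)\<bar> + \<bar>cf j (s + Suc i) - cf j (s + i)\<bar> * V" .
      show ?thesis by (rule order_trans[OF le]) (use d in simp)
    qed
    have "(\<Sum>i=1..<N. \<bar>sg (Suc (s + i)) - sg (s + i)\<bar>) \<le> V"
    proof -
      have "(\<Sum>i=1..<N. \<bar>sg (Suc (s + i)) - sg (s + i)\<bar>) = (\<Sum>t\<in>(+) s ` {1..<N}. \<bar>sg (Suc t) - sg t\<bar>)"
        by (subst sum.reindex) auto
      also have "\<dots> \<le> (\<Sum>t=1..<n. \<bar>sg (Suc t) - sg t\<bar>)" using en en_le[of j] by (intro sum_mono2) auto
      finally show ?thesis using tv(1) by linarith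
    qed
    moreover have "(\<Sum>i=1..<N. e1 i) \<le> 2 * V" "(\<Sum>i=1..<N. e2 i) \<le> 2 * V"
      unfolding e1_def e2_def using V by (simp_all add: sum.delta)
    moreover have "(\<Sum>i=1..<N. \<bar>a (Suc i) - a i\<bar>) \<le> (\<Sum>i=1..<N. \<bar>sg (Suc (s + i)) - sg (s + i)\<bar>) + ((\<Sum>i=1..<N. e1 i) + (\<Sum>i=1..<N. e2 i))"
      unfolding sum.distrib[symmetric] by (rule sum_mono) (rule each)
    ultimately show ?thesis by linarith
  qed
  define q where "q = (\<Sum>i=1..N. (a i)\<^sup>2)"
  have main: "\<bar>expectation (\<lambda>\<omega>. \<bar>T j \<omega>\<bar>) - sqrt (2 / pi) * sqrt lrv * sqrt q\<bar> \<le> e * sqrt (real N)"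
    unfolding T q_def by (rule mp[OF mp[OF spec[OF spec[OF wa[unfolded window_approx_def N_def[symmetric]]]] a1] a2])
  define mn where "mn = local_mean l sg j"
  have mn0: "mn \<ge> 0"
    unfolding mn_def local_mean_def using sg_bounds(1) block_le[OF j] \<sigma>0 by (intro mult_nonneg_nonneg sum_nonneg) (auto intro: order_trans less_imp_le)
  define c where "c i = cf j (s + i)" for i
  \<comment> \<open>Applying the contrast to its own coefficients gives \<open>l\<close> from the
    block and \<open>wt j * l\<close> from the surroundings.\<close>
  have c2: "(\<Sum>i=1..N. (c i)\<^sup>2) = real l * ((1 + 2 * c0) / (2 * c0))"
  proof -
    have "(\<Sum>i=1..N. (c i)\<^sup>2) = (\<Sum>i=1..n. cf j i * cf j i)"
      unfolding sum_window(2)[OF j] s_def[symmetric] en by (simp add: c_def power2_eq_square)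
    also have "\<dots> = (\<Sum>i\<in>block l j. cf j i) - wt j * (\<Sum>i\<in>sur j. cf j i)" by (rule sum_cf[OF j])
    also have "(\<Sum>i\<in>block l j. cf j i) = (\<Sum>i\<in>block l j. 1)"
      using block_sur_disjoint[of j] j by (intro sum.cong refl) (auto simp: cf_def)
    also have "(\<Sum>i\<in>sur j. cf j i) = (\<Sum>i\<in>sur j. - wt j)"
      using block_sur_disjoint[of j] j by (intro sum.cong refl) (auto simp: cf_def)
    finally have "(\<Sum>i=1..N. (c i)\<^sup>2) = real l + wt j * (wt j * real (card (sur j)))" using j by (simp add: card_block mult_ac)
    also have "\<dots> = real l + wt j * real l" unfolding wt(3)[OF j] ..
    also have "\<dots> = real l * ((1 + 2 * c0) / (2 * c0))" unfolding wt(4)[OF j int] using c0 by (simp add: field_simps)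
    finally show ?thesis .
  qed
  have La: "L2_set a {1..N} = sqrt q" by (simp add: L2_set_def q_def)
  have Lc: "L2_set (\<lambda>i. mn * c i) {1..N} = mn * (sqrt (real l) * sqrt ((1 + 2 * c0) / (2 * c0)))"
  proof -
    have "(\<Sum>i=1..N. (mn * c i)\<^sup>2) = mn\<^sup>2 * (real l * ((1 + 2 * c0) / (2 * c0)))"
      unfolding power_mult_distrib sum_distrib_left[symmetric] c2 ..
    then show ?thesis unfolding L2_set_def using mn0 by (simp only: real_sqrt_mult real_sqrt_abs abs_of_nonneg)
  qed
  have db: "\<bar>a i - mn * c i\<bar> \<le> oscW sg j" if "i \<in> {1..N}" for i
  proof -
    have "a i - mn * c i = c i * (sg (s + i) - mn)" by (simp add: a_def c_def algebra_simps)
    also have "\<bar>\<dots>\<bar> \<le> 1 * oscW sg j"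
      unfolding abs_mult mn_def using cf_abs[OF j] diff_mean_le_oscW[OF j win(1)[OF that]] by (intro mult_mono) (auto simp: c_def)
    finally show ?thesis by simp
  qed
  have Ld: "L2_set (\<lambda>i. a i - mn * c i) {1..N} \<le> oscW sg j * sqrt (real N)" "L2_set (\<lambda>i. mn * c i - a i) {1..N} \<le> oscW sg j * sqrt (real N)"
    using L2_set_le_bound[of "{1..N}" "\<lambda>i. a i - mn * c i" "oscW sg j"] L2_set_le_bound[of "{1..N}" "\<lambda>i. mn * c i - a i" "oscW sg j"]
      db oscW_nonneg by (auto simp: abs_minus_commute)
  have "\<bar>L2_set a {1..N} - L2_set (\<lambda>i. mn * c i) {1..N}\<bar> \<le> oscW sg j * sqrt (real N)"
    using L2_set_triangle_ineq[of "\<lambda>i. a i - mn * c i" "\<lambda>i. mn * c i" "{1..N}"]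
      L2_set_triangle_ineq[of "\<lambda>i. mn * c i - a i" a "{1..N}"] Ld by simp
  then have dq: "\<bar>sqrt q - mn * (sqrt (real l) * sqrt ((1 + 2 * c0) / (2 * c0)))\<bar> \<le> oscW sg j * sqrt (real N)"
    unfolding La Lc .
  define k where "k = sqrt (2 / pi) * sqrt lrv"
  have k: "0 \<le> k" "k \<le> sqrt lrv"
  proof -
    have "sqrt (2 / pi) \<le> 1" using pi_gt3 by simp
    then show "k \<le> sqrt lrv" unfolding k_def using lrv_pos by (intro mult_left_le_one_le) auto
    show "0 \<le> k" unfolding k_def using lrv_pos by simp
  qed
  have "\<bar>k * (sqrt q - mn * (sqrt (real l) * sqrt ((1 + 2 * c0) / (2 * c0))))\<bar> \<le> sqrt lrv * (oscW sg j * sqrt (real N))"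
    unfolding abs_mult using dq k oscW_nonneg lrv_pos by (intro mult_mono) auto
  then have "\<bar>k * sqrt q - k * (mn * (sqrt (real l) * sqrt ((1 + 2 * c0) / (2 * c0))))\<bar> \<le> sqrt lrv * (oscW sg j * sqrt (real N))"
    by (simp only: right_diff_distrib)
  with main have tot: "\<bar>expectation (\<lambda>\<omega>. \<bar>T j \<omega>\<bar>) - k * (mn * (sqrt (real l) * sqrt ((1 + 2 * c0) / (2 * c0))))\<bar> \<le> e * sqrt (real N) + sqrt lrv * (oscW sg j * sqrt (real N))"
    unfolding k_def[symmetric] by linarith
  have sl: "sqrt (real l) > 0" using l by simp
  have eZ: "expectation (Zs j) = expectation (\<lambda>\<omega>. \<bar>T j \<omega>\<bar>) / sqrt (real l)" unfolding Zs_def[abs_def] by simp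
  have "expectation (Zs j) - k * (mn * sqrt ((1 + 2 * c0) / (2 * c0))) = (expectation (\<lambda>\<omega>. \<bar>T j \<omega>\<bar>) - k * (mn * (sqrt (real l) * sqrt ((1 + 2 * c0) / (2 * c0))))) / sqrt (real l)"
    unfolding eZ diff_divide_distrib using sl by simp
  then have "\<bar>expectation (Zs j) - k * (mn * sqrt ((1 + 2 * c0) / (2 * c0)))\<bar> = \<bar>expectation (\<lambda>\<omega>. \<bar>T j \<omega>\<bar>) - k * (mn * (sqrt (real l) * sqrt ((1 + 2 * c0) / (2 * c0))))\<bar> / sqrt (real l)"
    using sl by (simp only: abs_divide abs_of_pos)
  also have "\<dots> \<le> (e * sqrt (real N) + sqrt lrv * (oscW sg j * sqrt (real N))) / sqrt (real l)"
    using tot sl by (intro divide_right_mono) auto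
  also have "\<dots> = sqrt (1 + 2 * c0) * (e + sqrt lrv * oscW sg j)"
    unfolding lN real_sqrt_mult using sl by (simp add: field_simps)
  finally show ?thesis unfolding k_def mn_def .
qed

lemma card_boundary: "real (card {j \<in> {1..b}. \<not> interior j}) \<le> 2 * c0 + 2"
proof -
  define R1 where "R1 = {j \<in> {1..b}. real j < c0 + 1}"
  define R2 where "R2 = {j \<in> {1..b}. real b < real j + c0}"
  have "{j \<in> {1..b}. \<not> interior j} \<subseteq> R1 \<union> R2"
  proof
    fix j assume "j \<in> {j \<in> {1..b}. \<not> interior j}"
    then have j: "j \<in> {1..b}" "\<not> interior j" by auto
    have "(real j - 1 - c0) * real l < 0 \<or> real n < (real j + c0) * real l"
      using j interior_iff[of j] by auto
    then show "j \<in> R1 \<union> R2"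
    proof
      assume "(real j - 1 - c0) * real l < 0"
      then have "real j - 1 - c0 < 0" using l by (simp add: mult_less_0_iff)
      then show ?thesis using j by (simp add: R1_def)
    next
      assume "real n < (real j + c0) * real l"
      then have "real b < real j + c0" unfolding real_n using l by (simp add: mult_less_cancel_right)
      then show ?thesis using j by (simp add: R2_def)
    qed
  qed
  then have "card {j \<in> {1..b}. \<not> interior j} \<le> card (R1 \<union> R2)" by (intro card_mono) (auto simp: R1_def R2_def)
  also have "\<dots> \<le> card R1 + card R2" by (rule card_Un_le)
  finally have "real (card {j \<in> {1..b}. \<not> interior j}) \<le> real (card R1) + real (card R2)" by linarith
  moreover have "real (card R1) \<le> c0 + 1"
    by (rule card_le_diameter) (use c0 in \<open>auto simp: R1_def\<close>)
  moreover have "real (card R2) \<le> c0 + 1"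
    by (rule card_le_diameter) (use c0 in \<open>auto simp: R2_def\<close>)
  ultimately show ?thesis by linarith
qed

text \<open>Interior blocks use the Gaussian comparison, whose oscillation terms sum to a multiple
  of \<open>V\<close>. Boundary contrasts can have a different variance factor; there are boundedly
  many of them, so a crude bound costs only order \<open>1 / b\<close>.\<close>

lemma bias:
  assumes wa: "window_approx (l + 2 * m) (\<sigma>0 / (2 * c0)) V (5 * V) e" and e: "e \<ge> 0"
  shows "\<bar>Kc * (1 / real b * (\<Sum>j=1..b. expectation (Zs j))) - sqrt lrv * A\<bar>
    \<le> 2 * sqrt (1 + 2 * c0) * (e + sqrt lrv * ((2 * c0 + 2) * V) / real b) + (2 * c0 + 2) * (2 * sqrt C2 + sqrt lrv * V) / real b"
proof -
  define R where "R = {j \<in> {1..b}. \<not> interior j}"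
  define G where "G = 2 * sqrt C2 + sqrt lrv * V"
  have G: "G \<ge> 0" unfolding G_def using C2_nonneg lrv_pos V by simp
  have each: "\<bar>Kc * expectation (Zs j) - sqrt lrv * local_mean l sg j\<bar>
    \<le> 2 * sqrt (1 + 2 * c0) * (e + sqrt lrv * oscW sg j) + (if \<not> interior j then G else 0)" if j: "j \<in> {1..b}" for j
  proof (cases "interior j")
    case True
    define t where "t = sqrt (2 / pi) * sqrt lrv * (local_mean l sg j * sqrt ((1 + 2 * c0) / (2 * c0)))"
    have "Kc * t = sqrt lrv * local_mean l sg j * (Kc * (sqrt (2 / pi) * sqrt ((1 + 2 * c0) / (2 * c0))))"
      unfolding t_def by (simp only: mult_ac)
    then have "Kc * t = sqrt lrv * local_mean l sg j" unfolding Kc(3) by simp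
    then have "Kc * expectation (Zs j) - sqrt lrv * local_mean l sg j = Kc * (expectation (Zs j) - t)"
      by (simp add: right_diff_distrib)
    also have "\<bar>\<dots>\<bar> \<le> 2 * (sqrt (1 + 2 * c0) * (e + sqrt lrv * oscW sg j))"
      unfolding abs_mult t_def using Kc interior_abs_moment[OF j True wa] by (intro mult_mono) auto
    finally show ?thesis using True by simp
  next
    case False
    have "local_mean l sg j \<ge> 0"
      unfolding local_mean_def using sg_bounds(1) block_le[OF j] \<sigma>0 by (intro mult_nonneg_nonneg sum_nonneg) (auto intro: order_trans less_imp_le)
    moreover have "local_mean l sg j \<le> V"
    proof -
      have "(\<Sum>i\<in>block l j. sg i) \<le> (\<Sum>i\<in>block l j. V)"
        using sg_bounds(2) block_le[OF j] by (intro sum_mono) (meson abs_le_D1)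
      then show ?thesis unfolding local_mean_def using j l by (simp add: card_block field_simps)
    qed
    ultimately have 1: "0 \<le> sqrt lrv * local_mean l sg j" "sqrt lrv * local_mean l sg j \<le> sqrt lrv * V"
      using lrv_pos by (auto intro: mult_left_mono)
    have "Kc * expectation (Zs j) \<le> 2 * sqrt C2" using Kc Zs_mean[OF j] by (intro mult_mono) auto
    moreover have "0 \<le> Kc * expectation (Zs j)" using Kc Zs_mean[OF j] by simp
    moreover have "0 \<le> 2 * sqrt (1 + 2 * c0) * (e + sqrt lrv * oscW sg j)"
      using e lrv_pos oscW_nonneg c0 by (intro mult_nonneg_nonneg add_nonneg_nonneg) auto
    moreover have "0 \<le> sqrt lrv * V" using lrv_pos V by simp
    moreover have "0 \<le> sqrt C2" using C2_nonneg by simp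
    ultimately show ?thesis using False 1 unfolding G_def abs_le_iff by simp
  qed
  define Q where "Q = (\<Sum>j=1..b. 2 * sqrt (1 + 2 * c0) * (e + sqrt lrv * oscW sg j) + (if \<not> interior j then G else 0))"
  have eq: "Kc * (1 / real b * (\<Sum>j=1..b. expectation (Zs j))) - sqrt lrv * A = 1 / real b * (\<Sum>j=1..b. Kc * expectation (Zs j) - sqrt lrv * local_mean l sg j)"
    unfolding A_def sum_subtractf sum_distrib_left[symmetric] right_diff_distrib by (simp only: mult.left_commute)
  have le1: "\<bar>Kc * (1 / real b * (\<Sum>j=1..b. expectation (Zs j))) - sqrt lrv * A\<bar> \<le> 1 / real b * Q"
    unfolding eq abs_mult Q_def using each by (intro mult_mono order_trans[OF sum_abs] sum_mono) auto
  have Qe: "Q = 2 * sqrt (1 + 2 * c0) * (real b * e + sqrt lrv * (\<Sum>j=1..b. oscW sg j)) + real (card R) * G"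
  proof -
    have "(\<Sum>j=1..b. if \<not> interior j then G else 0) = (\<Sum>j\<in>R. G)"
      unfolding R_def by (rule sum.inter_filter[symmetric]) simp
    then show ?thesis unfolding Q_def by (simp add: sum.distrib sum_distrib_left[symmetric])
  qed
  have Ql: "Q \<le> 2 * sqrt (1 + 2 * c0) * (real b * e + sqrt lrv * ((2 * c0 + 2) * V)) + (2 * c0 + 2) * G"
    unfolding Qe using sum_oscW_le[OF tv(1)] card_boundary lrv_pos c0 G unfolding R_def
    by (intro add_mono mult_left_mono mult_right_mono order_refl) auto
  have le2: "1 / real b * Q \<le> 1 / real b * (2 * sqrt (1 + 2 * c0) * (real b * e + sqrt lrv * ((2 * c0 + 2) * V)) + (2 * c0 + 2) * G)"
    using Ql by (intro mult_left_mono) auto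
  have "1 / real b * (2 * sqrt (1 + 2 * c0) * (real b * e + sqrt lrv * ((2 * c0 + 2) * V)) + (2 * c0 + 2) * G)
    = 2 * sqrt (1 + 2 * c0) * (e + sqrt lrv * ((2 * c0 + 2) * V) / real b) + (2 * c0 + 2) * G / real b"
    using b by (simp add: field_simps)
  then show ?thesis using order_trans[OF le1 le2] unfolding G_def by simp
qed

text \<open>\<open>U\<close> switches the contribution of the mean function: 1 in general, 0 for a
  constant mean, which the contrasts annihilate. In general a contrast of the mean is at most
  \<open>2 * l * oscW mu j\<close>; dividing by \<open>sqrt l\<close>, summing and averaging gives
  the order \<open>sqrt l / b\<close>.\<close>

lemma numerator_error:
  assumes wa: "window_approx (l + 2 * m) (\<sigma>0 / (2 * c0)) V (5 * V) e" and e: "e \<ge> 0" and B: "B > 0"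
    and U: "U \<ge> 0" "\<And>j. j \<in> {1..b} \<Longrightarrow> \<bar>\<Sum>i=1..n. cf j i * mu i\<bar> \<le> U * (2 * real l * oscW mu j)"
  shows "integrable M (\<lambda>\<omega>. \<bar>kX \<omega> - sqrt lrv * A\<bar>)"
    and "expectation (\<lambda>\<omega>. \<bar>kX \<omega> - sqrt lrv * A\<bar>) \<le> U * (4 * ((2 * c0 + 2) * V)) * (sqrt (real l) / real b)
      + 2 * (2 * C2 / B + sqrt ((4 * c0 + 5) * (2 * C2) / real b + 4 * B\<^sup>2 * C * real l powr - 6))
      + (2 * sqrt (1 + 2 * c0) * (e + sqrt lrv * ((2 * c0 + 2) * V) / real b) + (2 * c0 + 2) * (2 * sqrt C2 + sqrt lrv * V) / real b)"
proof -
  define F where "F \<omega> = \<bar>1 / real b * (\<Sum>j=1..b. Zs j \<omega> - expectation (Zs j))\<bar>" for \<omega>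
  define c1 where "c1 = U * (4 * ((2 * c0 + 2) * V)) * (sqrt (real l) / real b)"
  define c2 where "c2 = 2 * sqrt (1 + 2 * c0) * (e + sqrt lrv * ((2 * c0 + 2) * V) / real b) + (2 * c0 + 2) * (2 * sqrt C2 + sqrt lrv * V) / real b"
  define Mj where "Mj j = (\<Sum>i=1..n. cf j i * mu i)" for j
  have sl: "sqrt (real l) > 0" using l by simp
  have obs: "(\<Sum>i=1..n. cf j i * observation \<mu> \<sigma> Y n \<omega> i) = Mj j + T j \<omega>" for j \<omega>
    unfolding observation_eq Mj_def T_def by (simp add: sum.distrib distrib_left)
  have kX: "kX \<omega> = Kc * (1 / real b * (\<Sum>j=1..b. \<bar>Mj j + T j \<omega>\<bar> / sqrt (real l)))" for \<omega>
    unfolding kX_def kappa_hat_X_eq obs Kc_def ..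
  have p1: "\<bar>kX \<omega> - Kc * (1 / real b * (\<Sum>j=1..b. Zs j \<omega>))\<bar> \<le> c1" for \<omega>
  proof -
    have "kX \<omega> - Kc * (1 / real b * (\<Sum>j=1..b. Zs j \<omega>)) = Kc * (1 / real b * (\<Sum>j=1..b. \<bar>Mj j + T j \<omega>\<bar> / sqrt (real l) - Zs j \<omega>))"
      unfolding kX by (simp only: sum_subtractf right_diff_distrib)
    also have "\<bar>\<dots>\<bar> \<le> 2 * (1 / real b * (\<Sum>j=1..b. U * 2 * sqrt (real l) * oscW mu j))"
    proof -
      have s: "\<bar>\<Sum>j=1..b. \<bar>Mj j + T j \<omega>\<bar> / sqrt (real l) - Zs j \<omega>\<bar> \<le> (\<Sum>j=1..b. U * 2 * sqrt (real l) * oscW mu j)"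
      proof (rule order_trans[OF sum_abs], rule sum_mono)
        fix j assume j: "j \<in> {1..b}"
        have "\<bar>\<bar>Mj j + T j \<omega>\<bar> / sqrt (real l) - Zs j \<omega>\<bar> = \<bar>\<bar>Mj j + T j \<omega>\<bar> - \<bar>T j \<omega>\<bar>\<bar> / sqrt (real l)"
          unfolding Zs_def diff_divide_distrib[symmetric] using sl by (simp only: abs_divide abs_of_pos)
        also have "\<dots> \<le> \<bar>Mj j\<bar> / sqrt (real l)" using sl by (intro divide_right_mono) auto
        also have "\<dots> \<le> U * (2 * real l * oscW mu j) / sqrt (real l)"
          using U(2)[OF j] sl unfolding Mj_def by (intro divide_right_mono) auto
        also have "\<dots> = U * 2 * (real l / sqrt (real l)) * oscW mu j" by simp
        also have "real l / sqrt (real l) = sqrt (real l)" by (rule real_div_sqrt) simp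
        finally show "\<bar>\<bar>Mj j + T j \<omega>\<bar> / sqrt (real l) - Zs j \<omega>\<bar> \<le> U * 2 * sqrt (real l) * oscW mu j" .
      qed
      show ?thesis unfolding abs_mult using Kc s by (intro mult_mono) auto
    qed
    also have "\<dots> = 4 * U * sqrt (real l) / real b * (\<Sum>j=1..b. oscW mu j)"
      by (simp add: sum_distrib_left[symmetric])
    also have "\<dots> \<le> 4 * U * sqrt (real l) / real b * ((2 * c0 + 2) * V)"
      using sum_oscW_le[OF tv(2)] U(1) by (intro mult_left_mono) auto
    finally show ?thesis unfolding c1_def by (simp add: mult_ac)
  qed
  have p2: "\<bar>Kc * (1 / real b * (\<Sum>j=1..b. Zs j \<omega>)) - Kc * (1 / real b * (\<Sum>j=1..b. expectation (Zs j)))\<bar> \<le> 2 * F \<omega>" for \<omega>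
  proof -
    have "Kc * (1 / real b * (\<Sum>j=1..b. Zs j \<omega>)) - Kc * (1 / real b * (\<Sum>j=1..b. expectation (Zs j))) = Kc * (1 / real b * (\<Sum>j=1..b. Zs j \<omega> - expectation (Zs j)))"
      by (simp only: sum_subtractf right_diff_distrib)
    also have "\<bar>\<dots>\<bar> \<le> 2 * F \<omega>" unfolding F_def abs_mult[of Kc] using Kc by (intro mult_right_mono) auto
    finally show ?thesis .
  qed
  have pt: "\<bar>kX \<omega> - sqrt lrv * A\<bar> \<le> c1 + 2 * F \<omega> + c2" for \<omega>
    using p1[of \<omega>] p2[of \<omega>] bias[OF wa e] unfolding c2_def by linarith
  note f = fluctuation[OF B, folded F_def]
  have iB: "integrable M (\<lambda>\<omega>. c1 + 2 * F \<omega> + c2)" using f(1) by simp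
  have m: "kX \<in> borel_measurable M"
  proof -
    have "T j \<in> borel_measurable M" if "j \<in> {1..b}" for j
      by (rule gen_measurable[OF _ T_gen[OF that, of "{1..}"]]) auto
    then show ?thesis unfolding kX[abs_def]
      by (intro borel_measurable_times borel_measurable_const borel_measurable_sum borel_measurable_divide borel_measurable_abs borel_measurable_add) auto
  qed
  show i: "integrable M (\<lambda>\<omega>. \<bar>kX \<omega> - sqrt lrv * A\<bar>)"
    by (rule integrable_dominated[OF _ iB]) (use m pt in auto)
  have "expectation (\<lambda>\<omega>. \<bar>kX \<omega> - sqrt lrv * A\<bar>) \<le> expectation (\<lambda>\<omega>. c1 + 2 * F \<omega> + c2)"
    by (rule integral_mono[OF i iB pt])
  also have "\<dots> = c1 + 2 * expectation F + c2" using f(1) by (simp add: prob_space)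
  also have "\<dots> \<le> c1 + 2 * (2 * C2 / B + sqrt ((4 * c0 + 5) * (2 * C2) / real b + 4 * B\<^sup>2 * C * real l powr - 6)) + c2"
    using f(2) by simp
  finally show "expectation (\<lambda>\<omega>. \<bar>kX \<omega> - sqrt lrv * A\<bar>) \<le> U * (4 * ((2 * c0 + 2) * V)) * (sqrt (real l) / real b)
      + 2 * (2 * C2 / B + sqrt ((4 * c0 + 5) * (2 * C2) / real b + 4 * B\<^sup>2 * C * real l powr - 6))
      + (2 * sqrt (1 + 2 * c0) * (e + sqrt lrv * ((2 * c0 + 2) * V) / real b) + (2 * c0 + 2) * (2 * sqrt C2 + sqrt lrv * V) / real b)"
    unfolding c1_def c2_def .
qed

lemma kX_measurable [measurable]: "kX \<in> borel_measurable M"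
proof -
  have "(\<lambda>\<omega>. observation \<mu> \<sigma> Y n \<omega> i) \<in> borel_measurable M" if "i \<ge> 1" for i
    unfolding observation_eq using z_measurable[OF that] by measurable
  then show ?thesis unfolding kX_def[abs_def] kappa_hat_X_eq
    by (intro borel_measurable_times borel_measurable_const borel_measurable_sum borel_measurable_divide borel_measurable_abs) auto
qed

end

section \<open>Consistency\<close>

text \<open>What holds eventually for every fixed error holds eventually along one null sequence.
  Truncation, which gives no rate, then enters the same convergence argument as the explicit
  rates.\<close>

lemma diagonal_rate:
  fixes P :: "nat \<Rightarrow> real \<Rightarrow> bool"
  assumes P: "\<And>\<epsilon>. \<epsilon> > 0 \<Longrightarrow> eventually (\<lambda>N. P N \<epsilon>) sequentially"
  obtains e where "e \<longlonglongrightarrow> 0" "\<And>N. e N \<ge> (0::real)" "eventually (\<lambda>N. P N (e N)) sequentially"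
proof -
  \<comment> \<open>The best accuracy \<open>1 / (k + 1)\<close> available at \<open>N\<close> is
    taken, and it is attained because the maximum belongs to the set. The restriction
    \<open>k \<le> N\<close> keeps the set finite; from some \<open>N\<close> on it contains 0, so
    the value of \<open>Max\<close> on the empty set does not matter.\<close>
  define K where "K N = {k. k \<le> N \<and> P N (1 / (real k + 1))}" for N
  define e where "e N = 1 / (real (Max (K N)) + 1)" for N
  have fin: "finite (K N)" for N unfolding K_def by (rule finite_subset[of _ "{..N}"]) auto
  have Kk: "eventually (\<lambda>N. k \<in> K N) sequentially" for k
    using P[of "1 / (real k + 1)"] eventually_ge_at_top[of k] by (simp add: K_def eventually_conj_iff)
  have "eventually (\<lambda>N. P N (e N)) sequentially"
    using Kk[of 0]
  proof eventually_elim
    case (elim N)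
    have "Max (K N) \<in> K N" by (rule Max_in[OF fin]) (use elim in auto)
    then show ?case by (simp add: K_def e_def)
  qed
  moreover have "e \<longlonglongrightarrow> 0"
  proof (rule LIMSEQ_I)
    fix r :: real assume r: "r > 0"
    obtain k :: nat where k: "1 / (real k + 1) < r"
      using reals_Archimedean[OF r] by (auto simp: inverse_eq_divide add.commute)
    obtain N0 where N0: "\<And>N. N \<ge> N0 \<Longrightarrow> k \<in> K N" using Kk[of k] by (auto simp: eventually_sequentially)
    have "norm (e N - 0) < r" if "N \<ge> N0" for N
    proof -
      have "k \<le> Max (K N)" by (rule Max_ge[OF fin N0[OF that]])
      then have "e N \<le> 1 / (real k + 1)" unfolding e_def by (intro divide_left_mono) auto
      moreover have "e N \<ge> 0" by (simp add: e_def)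
      ultimately show ?thesis using k by simp
    qed
    then show "\<exists>no. \<forall>N\<ge>no. norm (e N - 0) < r" by blast
  qed
  ultimately show ?thesis using that[of e] by (simp add: e_def)
qed

text \<open>The error of the quotient is \<open>(num - \<kappa> * A) - \<kappa> * (den - A)\<close>
  over \<open>den\<close>. Unless \<open>den\<close> deviates from \<open>A\<close> by
  \<open>\<sigma>0 / 2\<close>, it is at least \<open>\<sigma>0 / 2\<close>; the rest is Markov's
  inequality. The scale \<open>R\<close> affects only the first event, so the deviation of the
  denominator from its lower bound needs no rate.\<close>

lemma (in prob_space) ratio_prob_le:
  fixes num den :: "'a \<Rightarrow> real"
  assumes [measurable]: "num \<in> borel_measurable M" "den \<in> borel_measurable M"
    and i1: "integrable M (\<lambda>\<omega>. \<bar>num \<omega> - \<kappa> * A\<bar>)" and e1: "expectation (\<lambda>\<omega>. \<bar>num \<omega> - \<kappa> * A\<bar>) \<le> E1"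
    and i2: "integrable M (\<lambda>\<omega>. \<bar>den \<omega> - A\<bar>)" and e2: "expectation (\<lambda>\<omega>. \<bar>den \<omega> - A\<bar>) \<le> E2"
    and A: "A \<ge> \<sigma>0" "\<sigma>0 > 0" and \<kappa>: "\<kappa> \<ge> 0" and R: "R > 0" and \<epsilon>: "\<epsilon> > 0"
  shows "prob {\<omega> \<in> space M. \<bar>R * (num \<omega> / den \<omega> - \<kappa>) - 0\<bar> > \<epsilon>} \<le> 2 / (\<sigma>0 * \<epsilon>) * (R * E1 + \<kappa> * (R * E2)) + 2 / \<sigma>0 * E2"
proof -
  define H where "H \<omega> = \<bar>num \<omega> - \<kappa> * A\<bar> + \<kappa> * \<bar>den \<omega> - A\<bar>" for \<omega>
  define c where "c = \<sigma>0 * \<epsilon> / (2 * R)"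
  have c: "c > 0" unfolding c_def using A R \<epsilon> by simp
  have iH: "integrable M H" unfolding H_def[abs_def] using i1 i2 by simp
  have [measurable]: "H \<in> borel_measurable M" unfolding H_def[abs_def] by measurable
  have H0: "H \<omega> \<ge> 0" for \<omega> unfolding H_def using \<kappa> by simp
  have eH: "expectation H \<le> E1 + \<kappa> * E2"
  proof -
    have "expectation H = expectation (\<lambda>\<omega>. \<bar>num \<omega> - \<kappa> * A\<bar>) + \<kappa> * expectation (\<lambda>\<omega>. \<bar>den \<omega> - A\<bar>)"
      unfolding H_def[abs_def] using i1 i2 by simp
    then show ?thesis using e1 mult_left_mono[OF e2 \<kappa>] by linarith
  qed
  let ?S1 = "{\<omega> \<in> space M. H \<omega> \<ge> c}" and ?S2 = "{\<omega> \<in> space M. \<bar>den \<omega> - A\<bar> \<ge> \<sigma>0 / 2}"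
  have sub: "{\<omega> \<in> space M. \<bar>R * (num \<omega> / den \<omega> - \<kappa>) - 0\<bar> > \<epsilon>} \<subseteq> ?S1 \<union> ?S2"
  proof
    fix \<omega> assume "\<omega> \<in> {\<omega> \<in> space M. \<bar>R * (num \<omega> / den \<omega> - \<kappa>) - 0\<bar> > \<epsilon>}"
    then have w: "\<omega> \<in> space M" "\<bar>R * (num \<omega> / den \<omega> - \<kappa>)\<bar> > \<epsilon>" by auto
    show "\<omega> \<in> ?S1 \<union> ?S2"
    proof (cases "\<bar>den \<omega> - A\<bar> \<ge> \<sigma>0 / 2")
      case False
      then have d: "den \<omega> > \<sigma>0 / 2" using A by (auto simp: abs_if split: if_splits)
      then have d0: "den \<omega> > 0" using A by linarith
      have "\<bar>num \<omega> / den \<omega> - \<kappa>\<bar> = \<bar>(num \<omega> - \<kappa> * A) - \<kappa> * (den \<omega> - A)\<bar> / den \<omega>"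
        using d0 by (simp add: abs_divide[symmetric] field_simps)
      also have "\<dots> \<le> H \<omega> / den \<omega>"
        unfolding H_def using d0 \<kappa> abs_triangle_ineq4[of "num \<omega> - \<kappa> * A" "\<kappa> * (den \<omega> - A)"] by (intro divide_right_mono) (auto simp: abs_mult)
      also have "\<dots> \<le> H \<omega> / (\<sigma>0 / 2)" using d A H0 by (intro divide_left_mono) auto
      finally have "R * \<bar>num \<omega> / den \<omega> - \<kappa>\<bar> \<le> R * (H \<omega> / (\<sigma>0 / 2))" using R by (intro mult_left_mono) auto
      moreover have "R * \<bar>num \<omega> / den \<omega> - \<kappa>\<bar> > \<epsilon>" using w R by (simp add: abs_mult)
      ultimately have "\<epsilon> < R * (H \<omega> / (\<sigma>0 / 2))" by linarith
      then have "c \<le> H \<omega>" unfolding c_def using A R by (simp add: field_simps)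
      then show ?thesis using w by simp
    qed (use w in simp)
  qed
  have p1: "prob ?S1 \<le> (E1 + \<kappa> * E2) / c"
  proof -
    have "prob ?S1 \<le> expectation H / c"
      by (rule integral_Markov_inequality_measure[OF iH sets.empty_sets _ c]) (simp add: H0)
    also have "\<dots> \<le> (E1 + \<kappa> * E2) / c" using eH c by (intro divide_right_mono) auto
    finally show ?thesis .
  qed
  have p2: "prob ?S2 \<le> E2 / (\<sigma>0 / 2)"
  proof -
    have "prob ?S2 \<le> expectation (\<lambda>\<omega>. \<bar>den \<omega> - A\<bar>) / (\<sigma>0 / 2)"
      by (rule integral_Markov_inequality_measure[OF i2 sets.empty_sets]) (use A in auto)
    also have "\<dots> \<le> E2 / (\<sigma>0 / 2)" using e2 A by (intro divide_right_mono) auto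
    finally show ?thesis .
  qed
  have "prob {\<omega> \<in> space M. \<bar>R * (num \<omega> / den \<omega> - \<kappa>) - 0\<bar> > \<epsilon>} \<le> prob (?S1 \<union> ?S2)"
    by (rule finite_measure_mono[OF sub]) measurable
  also have "\<dots> \<le> prob ?S1 + prob ?S2" by (rule measure_Un_le) measurable
  also have "\<dots> \<le> (E1 + \<kappa> * E2) / c + E2 / (\<sigma>0 / 2)" by (rule add_mono[OF p1 p2])
  also have "\<dots> = 2 / (\<sigma>0 * \<epsilon>) * (R * E1 + \<kappa> * (R * E2)) + 2 / \<sigma>0 * E2"
    unfolding c_def using A R \<epsilon> by (simp add: field_simps)
  finally show ?thesis .
qed

section \<open>Limits along admissible sample sizes\<close>

lemma admissibleD:
  assumes "n \<in> admissible s q c0"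
  shows "n \<ge> 1" "real (npow n s) = real n powr s" "real (npow n (1 - s)) = real n powr (1 - s)"
    "real (npow n q) = real n powr q" "real (npow n (1 - q)) = real n powr (1 - q)"
    "n = npow n (1 - s) * npow n s" "n = npow n (1 - q) * npow n q"
    "npow n s \<ge> 1" "npow n (1 - s) \<ge> 1" "npow n q \<ge> 1" "npow n (1 - q) \<ge> 1"
    "c0 < real (npow n (1 - q))"
proof -
  have n: "n \<ge> 1" using assms by (simp add: admissible_def)
  have e: "real (npow n a) = real n powr a" if "real n powr a \<in> \<nat>" for a
    using that unfolding npow_def by (elim Nats_cases) simp
  have p: "real n powr (1 - a) * real n powr a = real n" for a using n by (simp add: powr_add[symmetric])
  have ge: "npow n a \<ge> 1" if "real n powr a \<in> \<nat>" for a
  proof -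
    have "real n powr a > 0" using n by simp
    then have "real (npow n a) > 0" unfolding e[OF that] .
    then show ?thesis by simp
  qed
  show "n \<ge> 1" by (rule n)
  have N: "real n powr s \<in> \<nat>" "real n powr (1 - s) \<in> \<nat>" "real n powr q \<in> \<nat>" "real n powr (1 - q) \<in> \<nat>"
    using assms by (auto simp: admissible_def)
  show 1: "real (npow n s) = real n powr s" "real (npow n (1 - s)) = real n powr (1 - s)"
    "real (npow n q) = real n powr q" "real (npow n (1 - q)) = real n powr (1 - q)"
    by (rule e[OF N(1)] e[OF N(2)] e[OF N(3)] e[OF N(4)])+
  have "real n = real (npow n (1 - s) * npow n s)" unfolding of_nat_mult 1 p ..
  then show "n = npow n (1 - s) * npow n s" by (simp only: of_nat_eq_iff)
  have "real n = real (npow n (1 - q) * npow n q)" unfolding of_nat_mult 1 p ..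
  then show "n = npow n (1 - q) * npow n q" by (simp only: of_nat_eq_iff)
  show "npow n s \<ge> 1" "npow n (1 - s) \<ge> 1" "npow n q \<ge> 1" "npow n (1 - q) \<ge> 1"
    by (rule ge[OF N(1)] ge[OF N(2)] ge[OF N(3)] ge[OF N(4)])+
  show "c0 < real (npow n (1 - q))" unfolding 1 using assms by (simp add: admissible_def)
qed

text \<open>The number of observations in an interior window; the floor is exact on admissible
  sample sizes.\<close>

definition window_size :: "real \<Rightarrow> real \<Rightarrow> nat \<Rightarrow> nat" where
  "window_size q c0 n = npow n q + 2 * nat \<lfloor>c0 * real n powr q\<rfloor>"

lemma admissible_window:
  assumes "n \<in> admissible s q c0" "c0 \<ge> 1"
  shows "real (nat \<lfloor>c0 * real n powr q\<rfloor>) = c0 * real (npow n q)" "real (window_size q c0 n) = (1 + 2 * c0) * real n powr q"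
proof -
  have "c0 * real n powr q \<in> \<nat>" using assms by (simp add: admissible_def)
  then have *: "real (nat \<lfloor>c0 * real n powr q\<rfloor>) = c0 * real n powr q" by (elim Nats_cases) simp
  then show "real (nat \<lfloor>c0 * real n powr q\<rfloor>) = c0 * real (npow n q)" using admissibleD(4)[OF assms(1)] by simp
  show "real (window_size q c0 n) = (1 + 2 * c0) * real n powr q"
    unfolding window_size_def using * admissibleD(4)[OF assms(1)] by (simp add: algebra_simps)
qed

text \<open>Limits are computed for real powers along all \<open>n\<close>; the rounded quantities
  agree with them on the admissible set, which is all that the filter sees.\<close>

lemma admissible_tendsto:
  fixes f g :: "nat \<Rightarrow> real"
  assumes "(g \<longlongrightarrow> L) sequentially" "\<And>n. n \<in> admissible s q c0 \<Longrightarrow> f n = g n"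
  shows "(f \<longlongrightarrow> L) (admissible_at_top s q c0)"
proof -
  have "(g \<longlongrightarrow> L) (admissible_at_top s q c0)" by (rule tendsto_mono[OF inf_le1 assms(1)])
  moreover have "eventually (\<lambda>n. g n = f n) (admissible_at_top s q c0)"
    using assms(2) by (simp add: eventually_inf_principal)
  ultimately show ?thesis by (rule Lim_transform_eventually)
qed

text \<open>The clipping level is \<open>B = l\<close>: clipping then costs order
  \<open>1 / l\<close>, and the mixing term is at most of order \<open>1 / l\<close> after the root.
  Everything of order \<open>1 / b\<close> is absorbed into \<open>sqrt (1 / b)\<close>.\<close>

lemma (in long_blocks) numerator_error':
  assumes wa: "window_approx (l + 2 * m) (\<sigma>0 / (2 * c0)) V (5 * V) e" and e: "e \<ge> 0"
    and U: "U \<ge> 0" "\<And>j. j \<in> {1..b} \<Longrightarrow> \<bar>\<Sum>i=1..n. cf j i * mu i\<bar> \<le> U * (2 * real l * oscW mu j)"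
  shows "expectation (\<lambda>\<omega>. \<bar>kX \<omega> - sqrt lrv * A\<bar>) \<le> 2 * sqrt (1 + 2 * c0) * e
    + 4 * ((2 * c0 + 2) * V) * (U * (sqrt (real l) / real b)) + (4 * C2 + 4 * sqrt C) * (1 / real l)
    + (2 * sqrt ((4 * c0 + 5) * (2 * C2)) + 2 * sqrt (1 + 2 * c0) * (sqrt lrv * ((2 * c0 + 2) * V)) + (2 * c0 + 2) * (2 * sqrt C2 + sqrt lrv * V)) * sqrt (1 / real b)"
proof -
  have l0: "real l > 0" "real l \<ge> 1" and b1: "real b \<ge> 1" using l b by auto
  have ib: "1 / real b \<le> sqrt (1 / real b)"
  proof (rule real_le_rsqrt)
    have "(1 / real b) * (1 / real b) \<le> 1 * (1 / real b)" using b1 by (intro mult_right_mono) auto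
    then show "(1 / real b)\<^sup>2 \<le> 1 / real b" by (simp add: power2_eq_square)
  qed
  have s: "sqrt ((4 * c0 + 5) * (2 * C2) / real b + 4 * (real l)\<^sup>2 * C * real l powr - 6)
      \<le> sqrt ((4 * c0 + 5) * (2 * C2)) * sqrt (1 / real b) + 2 * sqrt C * (1 / real l)"
  proof -
    have p: "(real l)\<^sup>2 * real l powr - 6 \<le> (1 / real l)\<^sup>2"
    proof -
      have "(real l)\<^sup>2 * real l powr - 6 = real l powr 2 * real l powr - 6" using l0 by simp
      also have "\<dots> = real l powr - 4" by (simp only: powr_add[symmetric]) simp
      also have "\<dots> \<le> real l powr - 2" using l0 by (intro powr_mono) auto
      also have "\<dots> = (1 / real l)\<^sup>2" using l0 by (simp add: powr_minus_divide power_one_over)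
      finally show ?thesis .
    qed
    have "sqrt ((4 * c0 + 5) * (2 * C2) / real b + 4 * (real l)\<^sup>2 * C * real l powr - 6)
      \<le> sqrt ((4 * c0 + 5) * (2 * C2) / real b) + sqrt (4 * (real l)\<^sup>2 * C * real l powr - 6)"
      using c0 C2_nonneg C_ge_1 by (intro sqrt_add_le_add_sqrt) auto
    also have "sqrt ((4 * c0 + 5) * (2 * C2) / real b) = sqrt ((4 * c0 + 5) * (2 * C2)) * sqrt (1 / real b)"
      by (simp only: real_sqrt_mult[symmetric]) simp
    also have "sqrt (4 * (real l)\<^sup>2 * C * real l powr - 6) \<le> sqrt (4 * C * (1 / real l)\<^sup>2)"
      using mult_left_mono[OF p, of "4 * C"] C_ge_1 by (intro real_sqrt_le_mono) (simp add: mult_ac)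
    also have "\<dots> = 2 * sqrt C * (1 / real l)" using l0 by (simp add: real_sqrt_mult real_sqrt_divide)
    finally show ?thesis by simp
  qed
  have g: "0 \<le> 2 * sqrt (1 + 2 * c0) * (sqrt lrv * ((2 * c0 + 2) * V))" "0 \<le> (2 * c0 + 2) * (2 * sqrt C2 + sqrt lrv * V)"
    using c0 lrv_pos V C2_nonneg by auto
  have "expectation (\<lambda>\<omega>. \<bar>kX \<omega> - sqrt lrv * A\<bar>) \<le> U * (4 * ((2 * c0 + 2) * V)) * (sqrt (real l) / real b)
      + 2 * (2 * C2 / real l + sqrt ((4 * c0 + 5) * (2 * C2) / real b + 4 * (real l)\<^sup>2 * C * real l powr - 6))
      + (2 * sqrt (1 + 2 * c0) * (e + sqrt lrv * ((2 * c0 + 2) * V) / real b) + (2 * c0 + 2) * (2 * sqrt C2 + sqrt lrv * V) / real b)"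
    by (rule numerator_error(2)[OF wa e l0(1) U])
  also have "\<dots> = 2 * sqrt (1 + 2 * c0) * e + 4 * ((2 * c0 + 2) * V) * (U * (sqrt (real l) / real b)) + 4 * C2 * (1 / real l)
      + 2 * sqrt ((4 * c0 + 5) * (2 * C2) / real b + 4 * (real l)\<^sup>2 * C * real l powr - 6)
      + (2 * sqrt (1 + 2 * c0) * (sqrt lrv * ((2 * c0 + 2) * V)) * (1 / real b) + (2 * c0 + 2) * (2 * sqrt C2 + sqrt lrv * V) * (1 / real b))"
    by (simp add: algebra_simps add_divide_distrib)
  also have "\<dots> \<le> 2 * sqrt (1 + 2 * c0) * e + 4 * ((2 * c0 + 2) * V) * (U * (sqrt (real l) / real b)) + 4 * C2 * (1 / real l)
      + 2 * (sqrt ((4 * c0 + 5) * (2 * C2)) * sqrt (1 / real b) + 2 * sqrt C * (1 / real l))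
      + (2 * sqrt (1 + 2 * c0) * (sqrt lrv * ((2 * c0 + 2) * V)) * sqrt (1 / real b) + (2 * c0 + 2) * (2 * sqrt C2 + sqrt lrv * V) * sqrt (1 / real b))"
    using s by (intro add_mono mult_left_mono order_refl ib g) auto
  also have "\<dots> = 2 * sqrt (1 + 2 * c0) * e
    + 4 * ((2 * c0 + 2) * V) * (U * (sqrt (real l) / real b)) + (4 * C2 + 4 * sqrt C) * (1 / real l)
    + (2 * sqrt ((4 * c0 + 5) * (2 * C2)) + 2 * sqrt (1 + 2 * c0) * (sqrt lrv * ((2 * c0 + 2) * V)) + (2 * c0 + 2) * (2 * sqrt C2 + sqrt lrv * V)) * sqrt (1 / real b)"
    by (simp only: distrib_right distrib_left)
  finally show ?thesis .
qed

context centered_process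
begin

text \<open>The constants are quantified before the sample size, the errors and the scale, so that
  the bound can be sent to its limit term by term. The locales are interpreted inside the proof
  because the block lengths depend on \<open>n\<close>.\<close>

lemma estimator_tail:
  assumes \<sigma>0: "\<sigma>0 > 0" "\<forall>x\<in>{0..1}. \<sigma> x \<ge> \<sigma>0" and var: "grid_variation_le V \<mu>" "grid_variation_le V \<sigma>" and V: "V \<ge> 1"
    and c0: "c0 \<ge> 1" and U: "U = 1 \<or> U = 0 \<and> (\<exists>a. \<forall>x\<in>{0..1}. \<mu> x = a)"
  shows "\<exists>a1 a2 a3 a4 a5. \<forall>n e e' R \<epsilon>. n \<in> admissible s q c0 \<longrightarrow> e \<ge> 0 \<longrightarrow>
    window_approx (window_size q c0 n) (\<sigma>0 / (2 * c0)) V (5 * V) e \<longrightarrow> square_approx (npow n s) (V\<^sup>2) e' \<longrightarrow> R > 0 \<longrightarrow> \<epsilon> > 0 \<longrightarrow>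
    prob {\<omega> \<in> space M. \<bar>R * (kappa_hat s q c0 n (observation \<mu> \<sigma> Y n \<omega>) - sqrt lrv) - 0\<bar> > \<epsilon>} \<le>
      2 / (\<sigma>0 * \<epsilon>) * (R * (a1 * e + a2 * (U * (sqrt (real n powr q) / real n powr (1 - q))) + a3 * (1 / real n powr q) + a4 * sqrt (1 / real n powr (1 - q)))
        + sqrt lrv * (R * (2 * V * (1 / real n powr (1 - s)) + 1 / \<sigma>0 * e' + a5 * (1 / real n powr s))))
      + 2 / \<sigma>0 * (2 * V * (1 / real n powr (1 - s)) + 1 / \<sigma>0 * e' + a5 * (1 / real n powr s))"
proof -
  define S where "S = (\<Sum>k. \<bar>expectation (\<lambda>\<omega>. Y 1 \<omega> * Y (1 + k) \<omega>)\<bar>)"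
  have lrv_sqrt: "0 \<le> sqrt lrv" using lrv_pos by (rule real_sqrt_ge_zero[OF less_imp_le])
  \<comment> \<open>The value of the locale constant \<open>C2\<close>, written out so as to be
    visibly free of \<open>n\<close>.\<close>
  define D2 where "D2 = V\<^sup>2 * (1 + 2 * c0) * (2 * S)"
  show ?thesis
  proof (intro exI allI impI)
    fix n :: nat and e e' R \<epsilon> :: real
    assume n: "n \<in> admissible s q c0" and e: "e \<ge> 0" and wa: "window_approx (window_size q c0 n) (\<sigma>0 / (2 * c0)) V (5 * V) e"
      and sa: "square_approx (npow n s) (V\<^sup>2) e'" and R: "R > 0" and \<epsilon>: "\<epsilon> > 0"
    note ad = admissibleD[OF n]
    define m where "m = nat \<lfloor>c0 * real n powr q\<rfloor>"
    interpret L: long_blocks M Y C \<theta> p \<mu> \<sigma> \<sigma>0 V n "npow n q" "npow n (1 - q)" c0 m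
      by unfold_locales (use ad \<sigma>0 var V c0 admissible_window(1)[OF n c0] in \<open>auto simp: m_def\<close>)
    interpret B: blocks M Y C \<theta> p \<mu> \<sigma> \<sigma>0 V n "npow n s" "npow n (1 - s)"
      by unfold_locales (use ad \<sigma>0 var V in auto)
    have C2: "L.C2 = D2" unfolding L.C2_def L.S2_def D2_def S_def ..
    have AB: "B.A = L.A" unfolding B.A_alt L.A_alt B.sg_def L.sg_def ..
    have U0: "U \<ge> 0" using U by auto
    have Um: "\<bar>\<Sum>i=1..n. L.cf j i * L.mu i\<bar> \<le> U * (2 * real (npow n q) * L.oscW L.mu j)" if j: "j \<in> {1..npow n (1 - q)}" for j
      using U
    proof
      assume "U = 1" then show ?thesis using L.mean_part_le[OF j] by simp
    next
      assume "U = 0 \<and> (\<exists>a. \<forall>x\<in>{0..1}. \<mu> x = a)"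
      then obtain a where U: "U = 0" and a: "\<And>x. x \<in> {0..1} \<Longrightarrow> \<mu> x = a" by blast
      have "L.mu i = a" if "i \<in> {1..n}" for i unfolding L.mu_def by (rule a) (use L.unit[of i] that in auto)
      from L.mean_part_const[OF j this] show ?thesis using U by simp
    qed
    have wa': "window_approx (npow n q + 2 * m) (\<sigma>0 / (2 * c0)) V (5 * V) e" using wa by (simp add: window_size_def m_def)
    have lpos: "real (npow n q) > 0" using ad by simp
    note ni = L.numerator_error(1)[OF wa' e lpos U0 Um]
    note ne = L.numerator_error'[OF wa' e U0 Um, unfolded C2 ad(4,5)]
    note di = B.sd_mean_error[OF sa]
    have de: "expectation (\<lambda>\<omega>. \<bar>B.sd_mean \<omega> - L.A\<bar>) \<le> 2 * V * (1 / real n powr (1 - s)) + 1 / \<sigma>0 * e' + (2 * V\<^sup>2 * S / \<sigma>0) * (1 / real n powr s)"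
      using di(2) unfolding AB ad(2,3) B.S2_def S_def[symmetric] by (simp add: add_divide_distrib mult_ac)
    have dm: "B.sd_mean \<in> borel_measurable M"
      by (rule B.sd_mean_measurable)
    have kh: "kappa_hat s q c0 n (observation \<mu> \<sigma> Y n \<omega>) = L.kX \<omega> / B.sd_mean \<omega>" for \<omega>
      unfolding kappa_hat_def L.kX_def B.sd_mean_def ..
    show "prob {\<omega> \<in> space M. \<bar>R * (kappa_hat s q c0 n (observation \<mu> \<sigma> Y n \<omega>) - sqrt lrv) - 0\<bar> > \<epsilon>} \<le>
      2 / (\<sigma>0 * \<epsilon>) * (R * (2 * sqrt (1 + 2 * c0) * e + 4 * ((2 * c0 + 2) * V) * (U * (sqrt (real n powr q) / real n powr (1 - q))) + (4 * D2 + 4 * sqrt C) * (1 / real n powr q)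
          + (2 * sqrt ((4 * c0 + 5) * (2 * D2)) + 2 * sqrt (1 + 2 * c0) * (sqrt lrv * ((2 * c0 + 2) * V)) + (2 * c0 + 2) * (2 * sqrt D2 + sqrt lrv * V)) * sqrt (1 / real n powr (1 - q)))
        + sqrt lrv * (R * (2 * V * (1 / real n powr (1 - s)) + 1 / \<sigma>0 * e' + (2 * V\<^sup>2 * S / \<sigma>0) * (1 / real n powr s))))
      + 2 / \<sigma>0 * (2 * V * (1 / real n powr (1 - s)) + 1 / \<sigma>0 * e' + (2 * V\<^sup>2 * S / \<sigma>0) * (1 / real n powr s))"
      unfolding kh
      by (rule ratio_prob_le[OF L.kX_measurable dm ni ne di(1)[unfolded AB] de L.A_ge \<sigma>0(1) lrv_sqrt R \<epsilon>])
  qed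
qed

text \<open>Both claims reduce to these seven limits: one with the scale \<open>sqrt b_n\<close> and
  explicit errors, the other with scale 1 and null sequences chosen diagonally.\<close>

lemma estimator_consistent:
  fixes R e1 e2 :: "nat \<Rightarrow> real"
  assumes \<sigma>0: "\<sigma>0 > 0" "\<forall>x\<in>{0..1}. \<sigma> x \<ge> \<sigma>0" and var: "grid_variation_le V \<mu>" "grid_variation_le V \<sigma>" and V: "V \<ge> 1"
    and c0: "c0 \<ge> 1" and U: "U = 1 \<or> U = 0 \<and> (\<exists>a. \<forall>x\<in>{0..1}. \<mu> x = a)" and s: "0 < s" "s < 1" and q: "0 < q"
    and R: "\<And>n. n \<ge> 1 \<Longrightarrow> R n > 0"
    and e1: "\<And>N. e1 N \<ge> 0" "eventually (\<lambda>N. window_approx N (\<sigma>0 / (2 * c0)) V (5 * V) (e1 N)) sequentially"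
    and e2: "eventually (\<lambda>N. square_approx N (V\<^sup>2) (e2 N)) sequentially" "e2 \<longlonglongrightarrow> 0"
    and lim: "((\<lambda>n. R n * e1 (window_size q c0 n)) \<longlongrightarrow> 0) (admissible_at_top s q c0)"
      "((\<lambda>n. R n * (U * (sqrt (real n powr q) / real n powr (1 - q)))) \<longlongrightarrow> 0) (admissible_at_top s q c0)"
      "((\<lambda>n. R n * (1 / real n powr q)) \<longlongrightarrow> 0) (admissible_at_top s q c0)"
      "((\<lambda>n. R n * sqrt (1 / real n powr (1 - q))) \<longlongrightarrow> 0) (admissible_at_top s q c0)"
      "((\<lambda>n. R n * (1 / real n powr (1 - s))) \<longlongrightarrow> 0) (admissible_at_top s q c0)"
      "((\<lambda>n. R n * e2 (npow n s)) \<longlongrightarrow> 0) (admissible_at_top s q c0)"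
      "((\<lambda>n. R n * (1 / real n powr s)) \<longlongrightarrow> 0) (admissible_at_top s q c0)"
  shows "tendsto_in_prob M (\<lambda>n \<omega>. R n * (kappa_hat s q c0 n (observation \<mu> \<sigma> Y n \<omega>) - sqrt lrv)) 0 (admissible_at_top s q c0)"
  unfolding tendsto_in_prob_def
proof (intro allI impI)
  fix \<epsilon> :: real assume \<epsilon>: "\<epsilon> > 0"
  let ?F = "admissible_at_top s q c0"
  obtain a1 a2 a3 a4 a5 where B: "\<forall>n e e' R \<epsilon>. n \<in> admissible s q c0 \<longrightarrow> e \<ge> 0 \<longrightarrow>
    window_approx (window_size q c0 n) (\<sigma>0 / (2 * c0)) V (5 * V) e \<longrightarrow> square_approx (npow n s) (V\<^sup>2) e' \<longrightarrow> R > 0 \<longrightarrow> \<epsilon> > 0 \<longrightarrow>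
    prob {\<omega> \<in> space M. \<bar>R * (kappa_hat s q c0 n (observation \<mu> \<sigma> Y n \<omega>) - sqrt lrv) - 0\<bar> > \<epsilon>} \<le>
      2 / (\<sigma>0 * \<epsilon>) * (R * (a1 * e + a2 * (U * (sqrt (real n powr q) / real n powr (1 - q))) + a3 * (1 / real n powr q) + a4 * sqrt (1 / real n powr (1 - q)))
        + sqrt lrv * (R * (2 * V * (1 / real n powr (1 - s)) + 1 / \<sigma>0 * e' + a5 * (1 / real n powr s))))
      + 2 / \<sigma>0 * (2 * V * (1 / real n powr (1 - s)) + 1 / \<sigma>0 * e' + a5 * (1 / real n powr s))"
    using estimator_tail[OF \<sigma>0 var V c0 U, of s q] by (elim exE) (rule that)
  note bound = B[rule_format]
  have adm: "eventually (\<lambda>n. n \<in> admissible s q c0) ?F"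
    by (simp add: eventually_inf_principal)
  have pw: "((\<lambda>n. 1 / real n powr a) \<longlongrightarrow> 0) sequentially" "filterlim (\<lambda>n. real n powr a) at_top sequentially" if "a > 0" for a
    using that by real_asymp+
  \<comment> \<open>Window and block lengths tend to infinity along the filter, which turns eventual
    statements in the length into eventual statements in the sample size.\<close>
  have wsz: "filterlim (window_size q c0) sequentially ?F"
    unfolding filterlim_sequentially_iff_filterlim_real
  proof -
    have "filterlim (\<lambda>n. (1 + 2 * c0) * real n powr q) at_top sequentially"
      using c0 pw(2)[OF q] by (intro filterlim_tendsto_pos_mult_at_top[OF tendsto_const]) auto
    then have "filterlim (\<lambda>n. (1 + 2 * c0) * real n powr q) at_top ?F" by (rule filterlim_mono) simp_all
    moreover have "eventually (\<lambda>n. (1 + 2 * c0) * real n powr q = real (window_size q c0 n)) ?F"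
      using adm by eventually_elim (simp add: admissible_window(2)[OF _ c0])
    ultimately show "filterlim (\<lambda>n. real (window_size q c0 n)) at_top ?F" using filterlim_cong[OF refl refl] by fast
  qed
  have ssz: "filterlim (\<lambda>n. npow n s) sequentially ?F"
    unfolding filterlim_sequentially_iff_filterlim_real
  proof -
    have "filterlim (\<lambda>n. real n powr s) at_top ?F" using pw(2)[OF s(1)] by (rule filterlim_mono) simp_all
    moreover have "eventually (\<lambda>n. real n powr s = real (npow n s)) ?F"
      using adm by eventually_elim (simp add: admissibleD(2))
    ultimately show "filterlim (\<lambda>n. real (npow n s)) at_top ?F" using filterlim_cong[OF refl refl] by fast
  qed
  have ev1: "eventually (\<lambda>n. window_approx (window_size q c0 n) (\<sigma>0 / (2 * c0)) V (5 * V) (e1 (window_size q c0 n))) ?F"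
    by (rule eventually_compose_filterlim[OF e1(2) wsz])
  have ev2: "eventually (\<lambda>n. square_approx (npow n s) (V\<^sup>2) (e2 (npow n s))) ?F"
    by (rule eventually_compose_filterlim[OF e2(1) ssz])
  have l2: "((\<lambda>n. e2 (npow n s)) \<longlongrightarrow> 0) ?F" by (rule filterlim_compose[OF e2(2) ssz])
  have l3: "((\<lambda>n. 1 / real n powr (1 - s)) \<longlongrightarrow> 0) ?F" "((\<lambda>n. 1 / real n powr s) \<longlongrightarrow> 0) ?F"
    using pw(1)[of "1 - s"] pw(1)[of s] s by (auto intro: tendsto_mono[OF inf_le1])
  define G where "G n = 2 / (\<sigma>0 * \<epsilon>) * ((a1 * (R n * e1 (window_size q c0 n)) + a2 * (R n * (U * (sqrt (real n powr q) / real n powr (1 - q)))) + a3 * (R n * (1 / real n powr q)) + a4 * (R n * sqrt (1 / real n powr (1 - q))))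
        + sqrt lrv * (2 * V * (R n * (1 / real n powr (1 - s))) + 1 / \<sigma>0 * (R n * e2 (npow n s)) + a5 * (R n * (1 / real n powr s))))
      + 2 / \<sigma>0 * (2 * V * (1 / real n powr (1 - s)) + 1 / \<sigma>0 * e2 (npow n s) + a5 * (1 / real n powr s))" for n
  have "(G \<longlongrightarrow> 2 / (\<sigma>0 * \<epsilon>) * ((a1 * 0 + a2 * 0 + a3 * 0 + a4 * 0) + sqrt lrv * (2 * V * 0 + 1 / \<sigma>0 * 0 + a5 * 0)) + 2 / \<sigma>0 * (2 * V * 0 + 1 / \<sigma>0 * 0 + a5 * 0)) ?F"
    unfolding G_def by (intro tendsto_add tendsto_mult tendsto_const lim l2 l3)
  then have G: "(G \<longlongrightarrow> 0) ?F" by simp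
  show "((\<lambda>n. prob {\<omega> \<in> space M. \<epsilon> < \<bar>R n * (kappa_hat s q c0 n (observation \<mu> \<sigma> Y n \<omega>) - sqrt lrv) - 0\<bar>}) \<longlongrightarrow> 0) ?F"
  proof (rule tendsto_sandwich[OF _ _ tendsto_const G])
    show "eventually (\<lambda>n. 0 \<le> prob {\<omega> \<in> space M. \<epsilon> < \<bar>R n * (kappa_hat s q c0 n (observation \<mu> \<sigma> Y n \<omega>) - sqrt lrv) - 0\<bar>}) ?F" by simp
    show "eventually (\<lambda>n. prob {\<omega> \<in> space M. \<epsilon> < \<bar>R n * (kappa_hat s q c0 n (observation \<mu> \<sigma> Y n \<omega>) - sqrt lrv) - 0\<bar>} \<le> G n) ?F"
      using ev1 ev2 adm
    proof eventually_elim
      case (elim n)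
      have R': "R n > 0" by (rule R[OF admissibleD(1)[OF elim(3)]])
      show ?case
        by (rule order_trans[OF bound[OF elim(3) e1(1) elim(1,2) R' \<epsilon>]]) (simp only: G_def distrib_left mult.left_commute order_refl)
    qed
  qed
qed

end

section \<open>Choice of the parameters\<close>

lemma grid_variation_le_mono: "grid_variation_le V f \<Longrightarrow> V \<le> W \<Longrightarrow> grid_variation_le W f"
  unfolding grid_variation_le_def by (meson order_trans)

lemma (in centered_process) window_approx_mono:
  "window_approx N a0 V W e \<Longrightarrow> e \<le> e' \<Longrightarrow> window_approx N a0 V W e'"
  unfolding window_approx_def by (meson mult_right_mono order_trans real_sqrt_ge_zero of_nat_0_le_iff)

theorem proposition2p7:
  fixes M :: "'a measure" and Y :: "nat \<Rightarrow> 'a \<Rightarrow> real"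
    and \<mu> \<sigma> :: "real \<Rightarrow> real"
    and \<sigma>0 s q c0 \<delta> \<rho> C :: real
  assumes "prob_space M"
    and "strictly_stationary M Y"
    and "integrable M (Y 1)" and "prob_space.expectation M (Y 1) = 0"
    and "integrable M (\<lambda>\<omega>. (Y 1 \<omega>)\<^sup>2)" and "prob_space.variance M (Y 1) = 1"
    and "(\<lambda>k. alpha_mix M Y k) \<longlonglongrightarrow> 0"
    and "long_run_variance M Y > 0"
    and "cadlag01 \<mu>"
    and "cadlag01 \<sigma>" and "piecewise_lipschitz01 \<sigma>"
    and "\<sigma>0 > 0" and "\<forall>x\<in>{0..1}. \<sigma> x \<ge> \<sigma>0"
    and "1/2 < s" and "s < 1" and "0 < q" and "q < 1" and "1 \<le> c0"
    and "0 < \<delta>" and "\<delta> \<le> 1"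
    and "\<rho> > max ((\<delta>\<^sup>2 + 4 * \<delta>) / (2 + 2 * \<delta>)) 1"
    and "integrable M (\<lambda>\<omega>. \<bar>Y 1 \<omega>\<bar> powr (2 + \<delta>))"
    and "\<forall>k\<ge>1. alpha_mix M Y k \<le> C * real k powr (- \<rho> * (2 + \<delta>) * (1 + \<delta>) / \<delta>\<^sup>2)"
  shows
    "((\<exists>a. \<forall>x\<in>{0..1}. \<mu> x = a) \<and>
      integrable M (\<lambda>\<omega>. \<bar>Y 1 \<omega>\<bar> powr (4 + 2 * \<delta>)) \<and>
      q < s \<and>
      q > (1 - s) * max (1 / \<delta> * ((\<rho> + 1) / (\<rho> - 1)))
                        (1 + \<delta>\<^sup>2 / (\<rho> * (1 + \<delta>) * (2 + \<delta>)))
      \<longrightarrow> tendsto_in_prob M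
            (\<lambda>n \<omega>. sqrt (real (npow n (1 - s))) *
                    (kappa_hat s q c0 n (observation \<mu> \<sigma> Y n \<omega>) - sqrt (long_run_variance M Y)))
            0 (admissible_at_top s q c0)) \<and>
     (piecewise_lipschitz01 \<mu> \<and>
      q < 2/3 \<and>
      (integrable M (\<lambda>\<omega>. \<bar>Y 1 \<omega>\<bar> powr (4 + 2 * \<delta>)) \<or>
       \<rho> > \<delta> * (8 + \<delta>) / ((2 + \<delta>) * (1 + \<delta>)))
      \<longrightarrow> tendsto_in_prob M
            (\<lambda>n \<omega>. kappa_hat s q c0 n (observation \<mu> \<sigma> Y n \<omega>) - sqrt (long_run_variance M Y))
            0 (admissible_at_top s q c0))"
proof -
  define \<theta> where "\<theta> = \<rho> * (2 + \<delta>) * (1 + \<delta>) / \<delta>\<^sup>2"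
  have \<delta>: "0 < \<delta>" "\<delta> \<le> 1" and \<rho>: "\<rho> > 1" using assms(19-21) by auto
  have d2: "\<delta>\<^sup>2 \<le> \<delta>" "\<delta>\<^sup>2 > 0" using \<delta> by (simp_all add: power2_eq_square mult_left_le)
  \<comment> \<open>Termwise \<open>2 + 3 * \<delta> + \<delta>\<^sup>2 \<ge> 6 *
    \<delta>\<^sup>2\<close> as \<open>\<delta> \<le> 1\<close>, and \<open>\<rho> > 1\<close> makes
    the inequality strict.\<close>
  have \<theta>6: "\<theta> > 6"
  proof -
    have "6 * \<delta>\<^sup>2 \<le> (2 + \<delta>) * (1 + \<delta>)" using \<delta> d2 by (simp add: algebra_simps power2_eq_square)
    moreover have "(2 + \<delta>) * (1 + \<delta>) * 1 < (2 + \<delta>) * (1 + \<delta>) * \<rho>" using \<delta> \<rho> by (intro mult_strict_left_mono) auto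
    ultimately have "6 * \<delta>\<^sup>2 < \<rho> * (2 + \<delta>) * (1 + \<delta>)" by (simp add: mult_ac)
    then show ?thesis unfolding \<theta>_def using d2 by (simp add: pos_less_divide_eq)
  qed
  \<comment> \<open>With \<open>p = 2 + \<delta>\<close> the exponent of the covariance decay
    becomes \<open>\<rho> * ((1 + \<delta>) / \<delta>)\<close>, which exceeds 2 for
    \<open>\<delta> \<le> 1\<close>.\<close>
  have \<theta>2: "\<theta> * (1 - 2 / (2 + \<delta>)) > 2"
  proof -
    have "\<theta> * (1 - 2 / (2 + \<delta>)) = \<rho> * ((1 + \<delta>) / \<delta>)"
    proof -
      have "1 - 2 / (2 + \<delta>) = \<delta> / (2 + \<delta>)" using \<delta> by (simp add: field_simps)
      moreover have "2 + \<delta> \<noteq> 0" "\<delta> \<noteq> 0" using \<delta> by auto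
      ultimately show ?thesis unfolding \<theta>_def by (simp add: power2_eq_square)
    qed
    moreover have "(1 + \<delta>) / \<delta> \<ge> 2" using \<delta> by (simp add: pos_le_divide_eq)
    then have "\<rho> * ((1 + \<delta>) / \<delta>) \<ge> \<rho> * 2" using \<rho> by (intro mult_left_mono) auto
    ultimately show ?thesis using \<rho> by linarith
  qed
  \<comment> \<open>Three factors of order \<open>4 + 2 * \<delta>\<close>: the exponent becomes
    \<open>\<rho> * ((1 + \<delta>) * (1 + 2 * \<delta>) / (2 * \<delta>\<^sup>2))\<close>.\<close>
  have \<theta>3: "\<theta> * (1 - 3 / (4 + 2 * \<delta>)) > 2"
  proof -
    have e: "1 - 3 / (4 + 2 * \<delta>) = (1 + 2 * \<delta>) / (2 * (2 + \<delta>))" using \<delta> by (simp add: field_simps)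
    have g: "\<rho> * x * (1 + \<delta>) / \<delta>\<^sup>2 * ((1 + 2 * \<delta>) / (2 * x)) = \<rho> * ((1 + \<delta>) * (1 + 2 * \<delta>) / (2 * \<delta>\<^sup>2))" if "x > 0" for x
      using that by simp
    have "\<theta> * (1 - 3 / (4 + 2 * \<delta>)) = \<rho> * ((1 + \<delta>) * (1 + 2 * \<delta>) / (2 * \<delta>\<^sup>2))"
      unfolding \<theta>_def e by (rule g) (use \<delta> in simp)
    moreover have "(1 + \<delta>) * (1 + 2 * \<delta>) / (2 * \<delta>\<^sup>2) \<ge> 2"
      using \<delta> d2 by (simp add: pos_le_divide_eq algebra_simps power2_eq_square)
    then have "\<rho> * ((1 + \<delta>) * (1 + 2 * \<delta>) / (2 * \<delta>\<^sup>2)) \<ge> \<rho> * 2" using \<rho> by (intro mult_left_mono) auto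
    ultimately show ?thesis using \<rho> by linarith
  qed
  interpret P0: prob_space M by fact
  \<comment> \<open>\<open>max C 1\<close> meets the lower bound on the constant that the locale
    asks for.\<close>
  interpret P: centered_process M Y "max C 1" \<theta> "2 + \<delta>"
  proof unfold_locales
    fix k :: nat assume k: "k \<ge> 1"
    have "alpha_mix M Y k \<le> C * real k powr (- \<theta>)" using assms(23) k by (simp add: \<theta>_def)
    also have "\<dots> \<le> max C 1 * real k powr (- \<theta>)" by (intro mult_right_mono) auto
    finally show "alpha_mix M Y k \<le> max C 1 * real k powr (- \<theta>)" .
  next
    show "P0.expectation (\<lambda>\<omega>. (Y 1 \<omega>)\<^sup>2) = 1" using assms(4,6) by simp
  qed (use assms \<theta>6 \<theta>2 \<delta> in auto)
  obtain V\<sigma> where V\<sigma>: "grid_variation_le V\<sigma> \<sigma>" using piecewise_lipschitz01_variation[OF assms(11)] by blast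
  have ws: "1 - s > 0" "s > 0" using assms by auto
  have a0: "\<sigma>0 / (2 * c0) > 0" using assms by simp
  show ?thesis
  proof (intro conjI impI; elim conjE exE)
    fix a assume const: "\<forall>x\<in>{0..1}. \<mu> x = a" and i4: "integrable M (\<lambda>\<omega>. \<bar>Y 1 \<omega>\<bar> powr (4 + 2 * \<delta>))" and qs: "q < s"
      and qb: "q > (1 - s) * max (1 / \<delta> * ((\<rho> + 1) / (\<rho> - 1))) (1 + \<delta>\<^sup>2 / (\<rho> * (1 + \<delta>) * (2 + \<delta>)))"
    \<comment> \<open>The second argument of the maximum is at least 1. The consequence
      \<open>q > 1 - s\<close> makes \<open>sqrt b_n\<close> times the logarithmic window error
      vanish.\<close>
    have q1: "q > 1 - s"
    proof -
      have "1 \<le> 1 + \<delta>\<^sup>2 / (\<rho> * (1 + \<delta>) * (2 + \<delta>))" using \<rho> \<delta> by simp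
      then have "(1 - s) * 1 \<le> (1 - s) * max (1 / \<delta> * ((\<rho> + 1) / (\<rho> - 1))) (1 + \<delta>\<^sup>2 / (\<rho> * (1 + \<delta>) * (2 + \<delta>)))"
        using ws by (intro mult_left_mono) auto
      from le_less_trans[OF this qb] show ?thesis by simp
    qed
    define V where "V = max (max V\<sigma> \<bar>a\<bar>) 1"
    have V: "V \<ge> 1" "grid_variation_le V \<sigma>" using grid_variation_le_mono[OF V\<sigma>] by (auto simp: V_def)
    have V\<mu>: "grid_variation_le V \<mu>"
      unfolding grid_variation_le_def
    proof (intro conjI ballI allI)
      fix x assume "x \<in> {0..1::real}" then show "\<bar>\<mu> x\<bar> \<le> V" using const by (simp add: V_def)
    next
      fix n :: nat
      have "(\<Sum>i=1..<n. \<bar>\<mu> (real (Suc i) / real n) - \<mu> (real i / real n)\<bar>) = (\<Sum>i=1..<n. 0)"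
      proof (intro sum.cong refl)
        fix i assume i: "i \<in> {1..<n}"
        then have "real (Suc i) / real n \<in> {0..1}" "real i / real n \<in> {0..1}" by auto
        then show "\<bar>\<mu> (real (Suc i) / real n) - \<mu> (real i / real n)\<bar> = 0" using const by (metis abs_zero diff_self)
      qed
      then show "(\<Sum>i=1..<n. \<bar>\<mu> (real (Suc i) / real n) - \<mu> (real i / real n)\<bar>) \<le> V" using V by simp
    qed
    have p4: "4 + 2 * \<delta> > 3" using \<delta> by simp
    have p22: "4 + 2 * \<delta> = 2 * (2 + \<delta>)" by simp
    obtain B1 where B1: "\<And>N. N \<ge> 1 \<Longrightarrow> P.window_approx N (\<sigma>0 / (2 * c0)) V (5 * V) (B1 * (1 + 5 * V + ln (real N)) / sqrt (real N))"
      using P.window_approx_moments[OF p4 \<theta>3 i4 a0 V(1)] by blast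
    obtain B2 where B2: "\<And>N. N \<ge> 1 \<Longrightarrow> P.square_approx N (V\<^sup>2) (B2 / sqrt (real N))"
      using P.square_approx_moments[OF i4[unfolded p22], of "V\<^sup>2"] by auto
    \<comment> \<open>The modulus supplies the nonnegativity that
      \<open>estimator_consistent\<close> asks for, since the sign of \<open>B1\<close> is not known
      here.\<close>
    define e1 where "e1 N = \<bar>B1 * (1 + 5 * V + ln (real N)) / sqrt (real N)\<bar>" for N
    define e2 where "e2 N = B2 / sqrt (real N)" for N
    have qs': "1 - s < q" "q < s" "0 < q" "q < 1" "s < 1" "1/2 < s" using q1 qs assms by auto
    have half: "sqrt (1 / real n powr t) = 1 / real n powr (t / 2)" for n t
      by (simp add: real_sqrt_divide powr_half_sqrt[symmetric] powr_powr)
    have root: "sqrt (real (npow n (1 - s))) = real n powr ((1 - s) / 2)" if "n \<in> admissible s q c0" for n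
      using admissibleD(3)[OF that] by (simp add: powr_half_sqrt[symmetric] powr_powr)
    have R0: "sqrt (real (npow n (1 - s))) > 0" if "n \<ge> 1" for n
    proof -
      have "real n powr (1 - s) \<ge> 1" using that ws by (intro ge_one_powr_ge_zero) auto
      then show ?thesis by (simp add: npow_def)
    qed
    have pw: "((\<lambda>n. real n powr a) \<longlongrightarrow> 0) sequentially" if "a < 0" for a
      using that by real_asymp
    show "tendsto_in_prob M (\<lambda>n \<omega>. sqrt (real (npow n (1 - s))) * (kappa_hat s q c0 n (observation \<mu> \<sigma> Y n \<omega>) - sqrt (long_run_variance M Y))) 0 (admissible_at_top s q c0)"
    proof (rule P.estimator_consistent[where ?e1.0=e1 and ?e2.0=e2 and U=0 and V=V, OF assms(12,13) V\<mu> V(2,1) assms(18) _ ws(2) assms(15,16) R0])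
      show "(0::real) = 1 \<or> (0::real) = 0 \<and> (\<exists>a. \<forall>x\<in>{0..1}. \<mu> x = a)" using const by blast
      show "e1 N \<ge> 0" for N by (simp add: e1_def)
      show "eventually (\<lambda>N. P.window_approx N (\<sigma>0 / (2 * c0)) V (5 * V) (e1 N)) sequentially"
        using eventually_ge_at_top[of 1]
        by eventually_elim (rule P.window_approx_mono[OF B1], assumption, simp only: e1_def abs_ge_self)
      show "eventually (\<lambda>N. P.square_approx N (V\<^sup>2) (e2 N)) sequentially"
        using eventually_ge_at_top[of 1] by eventually_elim (simp add: e2_def B2)
      show "e2 \<longlonglongrightarrow> 0" unfolding e2_def by real_asymp
      show "((\<lambda>n. sqrt (real (npow n (1 - s))) * e1 (window_size q c0 n)) \<longlongrightarrow> 0) (admissible_at_top s q c0)"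
      proof (rule admissible_tendsto)
        define K where "K = 1 + 5 * V + ln (1 + 2 * c0)"
        have k0: "1 + 2 * c0 > 0" using assms by simp
        have "((\<lambda>n. real n powr ((1 - s) / 2 - q / 2)) \<longlongrightarrow> 0) sequentially" by (rule pw) (use qs' in simp)
        moreover have "((\<lambda>n. ln (real n) * real n powr ((1 - s) / 2 - q / 2)) \<longlongrightarrow> 0) sequentially"
        proof -
          \<comment> \<open>Half of the margin in \<open>q > 1 - s\<close>; being positive, it lets
            the power beat the logarithm of the window length.\<close>
          define t where "t = (q - (1 - s)) / 2"
          have t: "t > 0" using qs' by (simp add: t_def)
          have "((\<lambda>n. ln (real n) / real n powr t) \<longlongrightarrow> 0) sequentially" using lim_ln_over_power[OF t] by simp
          moreover have "ln (real n) / real n powr t = ln (real n) * real n powr ((1 - s) / 2 - q / 2)" for n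
          proof -
            have "(1 - s) / 2 - q / 2 = - t" by (simp add: t_def field_simps)
            then show ?thesis by (simp add: powr_minus_divide)
          qed
          ultimately show ?thesis by simp
        qed
        ultimately have "((\<lambda>n. \<bar>B1 / sqrt (1 + 2 * c0) * (K * real n powr ((1 - s) / 2 - q / 2) + q * (ln (real n) * real n powr ((1 - s) / 2 - q / 2)))\<bar>) \<longlongrightarrow> \<bar>B1 / sqrt (1 + 2 * c0) * (K * 0 + q * 0)\<bar>) sequentially"
          by (intro tendsto_intros)
        then show "((\<lambda>n. \<bar>B1 / sqrt (1 + 2 * c0) * (K * real n powr ((1 - s) / 2 - q / 2) + q * (ln (real n) * real n powr ((1 - s) / 2 - q / 2)))\<bar>) \<longlongrightarrow> 0) sequentially"
          by simp
        fix n assume n: "n \<in> admissible s q c0"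
        have n1: "real n > 0" using admissibleD(1)[OF n] by simp
        have w: "real (window_size q c0 n) = (1 + 2 * c0) * real n powr q" by (rule admissible_window(2)[OF n assms(18)])
        have lw: "ln (real (window_size q c0 n)) = ln (1 + 2 * c0) + q * ln (real n)"
          unfolding w using k0 n1 by (simp add: ln_mult ln_powr)
        have sw: "sqrt (real (window_size q c0 n)) = sqrt (1 + 2 * c0) * real n powr (q / 2)"
          unfolding w by (simp add: real_sqrt_mult powr_half_sqrt[symmetric] powr_powr)
        have "sqrt (real (npow n (1 - s))) * e1 (window_size q c0 n) = \<bar>real n powr ((1 - s) / 2) * (B1 * (1 + 5 * V + ln (real (window_size q c0 n))) / sqrt (real (window_size q c0 n)))\<bar>"
          unfolding root[OF n] e1_def by (simp add: abs_mult)
        also have "real n powr ((1 - s) / 2) * (B1 * (1 + 5 * V + ln (real (window_size q c0 n))) / sqrt (real (window_size q c0 n)))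
          = B1 / sqrt (1 + 2 * c0) * ((K + q * ln (real n)) * (real n powr ((1 - s) / 2) / real n powr (q / 2)))"
          unfolding lw sw K_def by (simp add: add.assoc)
        also have "real n powr ((1 - s) / 2) / real n powr (q / 2) = real n powr ((1 - s) / 2 - q / 2)"
          by (simp add: powr_diff)
        finally show "sqrt (real (npow n (1 - s))) * e1 (window_size q c0 n) = \<bar>B1 / sqrt (1 + 2 * c0) * (K * real n powr ((1 - s) / 2 - q / 2) + q * (ln (real n) * real n powr ((1 - s) / 2 - q / 2)))\<bar>"
          by (simp only: distrib_right mult.assoc)
      qed
      show "((\<lambda>n. sqrt (real (npow n (1 - s))) * (0 * (sqrt (real n powr q) / real n powr (1 - q)))) \<longlongrightarrow> 0) (admissible_at_top s q c0)" by simp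
      show "((\<lambda>n. sqrt (real (npow n (1 - s))) * (1 / real n powr q)) \<longlongrightarrow> 0) (admissible_at_top s q c0)"
        by (rule admissible_tendsto[OF pw[of "(1 - s) / 2 - q"]]) (use qs' in \<open>simp_all add: root powr_diff\<close>)
      \<comment> \<open>The fluctuation over the long blocks: the exponent is
        \<open>(q - s) / 2\<close>, negative by \<open>q < s\<close>.\<close>
      show "((\<lambda>n. sqrt (real (npow n (1 - s))) * sqrt (1 / real n powr (1 - q))) \<longlongrightarrow> 0) (admissible_at_top s q c0)"
        by (rule admissible_tendsto[OF pw[of "(1 - s) / 2 - (1 - q) / 2"]])
           (use qs' in \<open>simp_all only: root half powr_diff[of _ "(1 - s) / 2" "(1 - q) / 2"]\<close>, auto)
      show "((\<lambda>n. sqrt (real (npow n (1 - s))) * (1 / real n powr (1 - s))) \<longlongrightarrow> 0) (admissible_at_top s q c0)"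
        by (rule admissible_tendsto[OF pw[of "(1 - s) / 2 - (1 - s)"]]) (use qs' in \<open>simp_all only: root powr_diff\<close>, auto)
      show "((\<lambda>n. sqrt (real (npow n (1 - s))) * (1 / real n powr s)) \<longlongrightarrow> 0) (admissible_at_top s q c0)"
        by (rule admissible_tendsto[OF pw[of "(1 - s) / 2 - s"]]) (use qs' in \<open>simp_all only: root powr_diff\<close>, auto)
      \<comment> \<open>The averages of squares in the short blocks: the exponent is
        \<open>(1 - 2 * s) / 2\<close>, negative by \<open>s > 1/2\<close>.\<close>
      show "((\<lambda>n. sqrt (real (npow n (1 - s))) * e2 (npow n s)) \<longlongrightarrow> 0) (admissible_at_top s q c0)"
      proof (rule admissible_tendsto)
        show "((\<lambda>n. B2 * real n powr ((1 - s) / 2 - s / 2)) \<longlongrightarrow> 0) sequentially"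
          by (rule tendsto_mult_right_zero[OF pw]) (use qs' in simp)
        fix n assume n: "n \<in> admissible s q c0"
        show "sqrt (real (npow n (1 - s))) * e2 (npow n s) = B2 * real n powr ((1 - s) / 2 - s / 2)"
          unfolding root[OF n] e2_def admissibleD(2)[OF n] powr_diff by (simp add: powr_half_sqrt[symmetric] powr_powr)
      qed
    qed
  next
    assume pl: "piecewise_lipschitz01 \<mu>" and q23: "q < 2 / 3"
    obtain V\<mu> where V\<mu>: "grid_variation_le V\<mu> \<mu>" using piecewise_lipschitz01_variation[OF pl] by blast
    define V where "V = max (max V\<sigma> V\<mu>) 1"
    have V: "V \<ge> 1" "grid_variation_le V \<sigma>" "grid_variation_le V \<mu>"
      using grid_variation_le_mono[OF V\<sigma>] grid_variation_le_mono[OF V\<mu>] by (auto simp: V_def)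
    obtain e1 where e1: "e1 \<longlonglongrightarrow> 0" "\<And>N. e1 N \<ge> 0" "eventually (\<lambda>N. P.window_approx N (\<sigma>0 / (2 * c0)) V (5 * V) (e1 N)) sequentially"
      using diagonal_rate[of "\<lambda>N. P.window_approx N (\<sigma>0 / (2 * c0)) V (5 * V)"] P.window_approx_truncation[OF a0 V(1)] V(1) by auto
    obtain e2 where e2: "e2 \<longlonglongrightarrow> 0" "\<And>N. e2 N \<ge> 0" "eventually (\<lambda>N. P.square_approx N (V\<^sup>2) (e2 N)) sequentially"
      using diagonal_rate[of "\<lambda>N. P.square_approx N (V\<^sup>2)"] P.square_approx_truncation[of "V\<^sup>2"] by auto
    have pw: "((\<lambda>n. real n powr a) \<longlongrightarrow> 0) sequentially" if "a < 0" for a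
      using that by real_asymp
    have fl: "filterlim f sequentially (admissible_at_top s q c0)"
      if "\<And>n. n \<in> admissible s q c0 \<Longrightarrow> real (f n) = c * real n powr t" "c > 0" "t > 0" for f :: "nat \<Rightarrow> nat" and c t
    proof -
      have "filterlim (\<lambda>n. real n powr t) at_top sequentially" using that by real_asymp
      then have "filterlim (\<lambda>n. c * real n powr t) at_top sequentially"
        using that by (intro filterlim_tendsto_pos_mult_at_top[OF tendsto_const]) auto
      then have "filterlim (\<lambda>n. c * real n powr t) at_top (admissible_at_top s q c0)" by (rule filterlim_mono) simp_all
      moreover have "eventually (\<lambda>n. c * real n powr t = real (f n)) (admissible_at_top s q c0)"
        using that by (simp add: eventually_inf_principal)
      ultimately have "filterlim (\<lambda>n. real (f n)) at_top (admissible_at_top s q c0)" using filterlim_cong[OF refl refl] by fast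
      then show ?thesis unfolding filterlim_sequentially_iff_filterlim_real .
    qed
    have "tendsto_in_prob M (\<lambda>n \<omega>. 1 * (kappa_hat s q c0 n (observation \<mu> \<sigma> Y n \<omega>) - sqrt (long_run_variance M Y))) 0 (admissible_at_top s q c0)"
    proof (rule P.estimator_consistent[where ?e1.0=e1 and ?e2.0=e2 and U=1 and V=V and R="\<lambda>_. 1", OF assms(12,13) V(3,2,1) assms(18) _ ws(2) assms(15,16) _ e1(2,3) e2(3,1)])
      show "((\<lambda>n. 1 * e1 (window_size q c0 n)) \<longlongrightarrow> 0) (admissible_at_top s q c0)"
        unfolding mult_1 by (rule filterlim_compose[OF e1(1) fl[OF admissible_window(2)]]) (use assms in auto)
      show "((\<lambda>n. 1 * e2 (npow n s)) \<longlongrightarrow> 0) (admissible_at_top s q c0)"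
        unfolding mult_1 by (rule filterlim_compose[OF e2(1) fl[of _ 1 s]]) (use assms in \<open>auto simp: admissibleD(2)\<close>)
      \<comment> \<open>The contribution of the mean function: the exponent is
        \<open>3 * q / 2 - 1\<close>, negative exactly for \<open>q < 2/3\<close>.\<close>
      show "((\<lambda>n. 1 * (1 * (sqrt (real n powr q) / real n powr (1 - q)))) \<longlongrightarrow> 0) (admissible_at_top s q c0)"
        by (rule admissible_tendsto[OF pw[of "q / 2 - (1 - q)"]])
           (use q23 in \<open>simp_all only: powr_diff\<close>, auto simp: powr_half_sqrt[symmetric] powr_powr)
      show "((\<lambda>n. 1 * (1 / real n powr q)) \<longlongrightarrow> 0) (admissible_at_top s q c0)"
        by (rule admissible_tendsto[OF pw[of "- q"]]) (use assms in \<open>auto simp: powr_minus_divide\<close>)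
      show "((\<lambda>n. 1 * sqrt (1 / real n powr (1 - q))) \<longlongrightarrow> 0) (admissible_at_top s q c0)"
        by (rule admissible_tendsto[OF pw[of "- ((1 - q) / 2)"]])
           (use assms in \<open>simp_all only: powr_minus_divide\<close>, auto simp: real_sqrt_divide powr_half_sqrt[symmetric] powr_powr)
      show "((\<lambda>n. 1 * (1 / real n powr (1 - s))) \<longlongrightarrow> 0) (admissible_at_top s q c0)"
        by (rule admissible_tendsto[OF pw[of "- (1 - s)"]]) (use ws in linarith, simp only: powr_minus_divide mult_1)
      show "((\<lambda>n. 1 * (1 / real n powr s)) \<longlongrightarrow> 0) (admissible_at_top s q c0)"
        by (rule admissible_tendsto[OF pw[of "- s"]]) (use assms in \<open>auto simp: powr_minus_divide\<close>)
    qed auto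
    then show "tendsto_in_prob M (\<lambda>n \<omega>. kappa_hat s q c0 n (observation \<mu> \<sigma> Y n \<omega>) - sqrt (long_run_variance M Y)) 0 (admissible_at_top s q c0)"
      by simp
  qed
qed

end
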